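(* Let $\mathsf h$ be an arbitrary complex number, let $N\ge3$, and let $\mathcal U_{\mathsf h}(sl(N))$ be the Jordanian quantum algebra defined in the context, with generators $E_i,F_i,H_i$ ($1\le i\le N-1$). Then $\mathcal U_{\mathsf h}(sl(N))$ admits the following coalgebra structure (coproduct $\Delta$, antipode $S$, counit $\epsilon$): $$\Delta(E_i)=E_i\otimes1+T^{(\delta_{i1}+\delta_{i,N-1})}\otimes E_i,$$ $$\Delta(F_i)=F_i\otimes1+T^{-(\delta_{i1}+\delta_{i,N-1})}\otimes F_i+T(H_1+\cdots+H_{N-1})\otimes T^{-1}[F_i,T],$$ $$\Delta(H_i)=H_i\otimes1+1\otimes H_i-\tfrac{\delta_{i1}+\delta_{i,N-1}}{2}(1-T^{-2})\otimes(H_1+\cdots+H_{N-1}),$$ $$S(E_i)=-T^{-(\delta_{i1}+\delta_{i,N-1})}E_i,$$ $$S(F_i)=-T^{(\delta_{i1}+\delta_{i,N-1})}F_i+T^2(H_1+\cdots+H_{N-1})T^{-2}[F_i,T],$$ $$S(H_i)=-H_i+\tfrac{\delta_{i1}+\delta_{i,N-1}}{2}(1-T^2)(H_1+\cdots+H_{N-1}),$$ $$\epsilon(E_i)=\epsilon(F_i)=\epsilon(H_i)=0.$$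
   Context: Here $[a,b]=ab-ba$, $(\mathrm{ad}\,a)(b)=[a,b]$, $\delta$ is the Kronecker symbol, and $(a_{ij})_{1\le i,j\le N-1}$ is the Cartan matrix of $sl(N)$ ($a_{ii}=2$, $a_{i,i\pm1}=-1$, $a_{ij}=0$ for $|i-j|>1$). Write $\theta_i=\delta_{i1}+\delta_{i,N-1}$. The Jordanian quantum algebra $\mathcal U_{\mathsf h}(sl(N))$ is the algebra over $\mathbb C$ with generators $E_i,F_i,H_i$, $1\le i\le N-1$, and the relations $$[H_i,H_j]=0,\qquad [H_i,E_j]=a_{ij}E_j,$$ $$[H_i,F_j]=-a_{ij}F_j+\theta_iT^{-1}[F_j,T](H_1+\cdots+H_{N-1}),$$ $$[T^{-\theta_i}E_i,F_j]=\delta_{ij}\Bigl(T^{-\theta_i}H_i+\tfrac{\theta_i}{2}(T-T^{-1})(H_1+\cdots+H_{N-1})\Bigr),$$ $$[E_i,E_j]=0,\qquad [T^{\theta_i}F_i,T^{\theta_j}F_j]=0\qquad(|i-j|>1),$$ $$(\mathrm{ad}\,E_i)^{1-a_{ij}}(E_j)=0,\qquad (\mathrm{ad}\,T^{\theta_i}F_i)^{1-a_{ij}}(T^{\theta_j}F_j)=0\qquad(i\ne j),$$ where $T^{\pm1}=\bigl(1+2\mathsf h[E_1,[E_2,\cdots,[E_{N-2},E_{N-1}]\cdots]]\bigr)^{\pm1/2}$. A particular nonlinear realization in terms of the classical Chevalley generators $e_i,f_i,h_i$ of $sl(N)$, with $e_{1N}=[e_1,[e_2,\cdots,[e_{N-2},e_{N-1}]\cdots]]$,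 is $$T^{\pm1}=\pm\mathsf he_{1N}+\sqrt{1+\mathsf h^2e_{1N}^2},\qquad E_i=T^{\theta_i/2}e_i,$$ $$F_i=T^{-\theta_i/2}\bigl(f_i+\tfrac{\mathsf h}{2}T[f_i,e_{1N}](h_1+\cdots+h_{N-1})\bigr),\qquad H_i=h_i-\tfrac{\theta_i\mathsf h}{2}e_{1N}T^{-1}(h_1+\cdots+h_{N-1}).$$ *)

theory Defs
  imports "HOL-Algebra.Algebra" "HOL-Algebra.Algebraic_Closure_Type" Complex_Main
begin

section \<open>Complete filtered algebras over the complex numbers\<close>

text \<open>
  The elements \<open>T\<close> and its inverse are binomial series in an iterated commutator \<open>X\<close> of generators,
  and \<open>h\<close> is a number, not a formal parameter.  So the algebra in question is not a quotient of the
  free algebra but of a completion of it in which powers of \<open>X\<close> tend to zero.  We complete with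
  respect to the principal grading (\<open>E\<close>, \<open>H\<close>, \<open>F\<close> have degree 1, 0, -1): elements are formal series
  \<open>x\<^sub>d + x\<^sub>d\<^sub>+\<^sub>1 + \<dots>\<close>, bounded below, whose homogeneous components are ordinary (finite) elements.

  The completion of the monoid algebra of \<open>M\<close> with respect to a degree homomorphism from \<open>M\<close> to the
  integers.  The finiteness condition forces the degrees in the support to be bounded below
  and makes the sum in the product finite.
\<close>

type_synonym 'm series = "'m \<Rightarrow> complex"

definition series_ring :: "'m monoid \<Rightarrow> ('m \<Rightarrow> int) \<Rightarrow> 'm series ring" where
  "series_ring M dgr = \<lparr>
     carrier = {f. (\<forall>w. f w \<noteq> 0 \<longrightarrow> w \<in> carrier M) \<and> (\<forall>d. finite {w. f w \<noteq> 0 \<and> dgr w \<le> d})},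
     monoid.mult = (\<lambda>f g w. \<Sum>(u, v) \<in> {(u, v). u \<in> carrier M \<and> v \<in> carrier M \<and>
                       f u \<noteq> 0 \<and> g v \<noteq> 0 \<and> u \<otimes>\<^bsub>M\<^esub> v = w}. f u * g v),
     one = (\<lambda>w. if w = \<one>\<^bsub>M\<^esub> then 1 else 0),
     ring.zero = (\<lambda>w. 0),
     add = (\<lambda>f g w. f w + g w)\<rparr>"

definition sc :: "complex \<Rightarrow> 'm series \<Rightarrow> 'm series" where
  "sc c f = (\<lambda>w. c * f w)"

definition deg_ge :: "'m monoid \<Rightarrow> ('m \<Rightarrow> int) \<Rightarrow> int \<Rightarrow> 'm series set" where
  "deg_ge M dgr n = {f \<in> carrier (series_ring M dgr). \<forall>w. f w \<noteq> 0 \<longrightarrow> n \<le> dgr w}"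

definition closed_set :: "'m monoid \<Rightarrow> ('m \<Rightarrow> int) \<Rightarrow> 'm series set \<Rightarrow> bool" where
  "closed_set M dgr J \<longleftrightarrow>
     (\<forall>f \<in> carrier (series_ring M dgr).
        (\<forall>n. \<exists>g\<in>J. f \<ominus>\<^bsub>series_ring M dgr\<^esub> g \<in> deg_ge M dgr n) \<longrightarrow> f \<in> J)"

definition closed_ideal_gen :: "'m monoid \<Rightarrow> ('m \<Rightarrow> int) \<Rightarrow> 'm series set \<Rightarrow> 'm series set" where
  "closed_ideal_gen M dgr S =
     \<Inter>{J. ideal J (series_ring M dgr) \<and> closed_set M dgr J \<and> S \<subseteq> J}"

text \<open>
  An algebra is given as a quotient of such a completed monoid algebra by a closed two-sided ideal;
  it is complete and Hausdorff for the quotient filtration \<open>fil\<close>.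
\<close>

record 'm calg =
  mon :: "'m monoid"
  dgr :: "'m \<Rightarrow> int"
  rel_ideal :: "'m series set"

definition cover :: "'m calg \<Rightarrow> 'm series ring" where
  "cover P = series_ring (mon P) (dgr P)"

definition alg :: "'m calg \<Rightarrow> 'm series set ring" where
  "alg P = cover P Quot rel_ideal P"

definition cls :: "'m calg \<Rightarrow> 'm series \<Rightarrow> 'm series set" where
  "cls P f = rel_ideal P +>\<^bsub>cover P\<^esub> f"

definition scalar :: "'m calg \<Rightarrow> complex \<Rightarrow> 'm series set" where
  "scalar P c = cls P (sc c \<one>\<^bsub>cover P\<^esub>)"

definition smul :: "'m calg \<Rightarrow> complex \<Rightarrow> 'm series set \<Rightarrow> 'm series set" where
  "smul P c x = scalar P c \<otimes>\<^bsub>alg P\<^esub> x"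

definition fil :: "'m calg \<Rightarrow> int \<Rightarrow> 'm series set set" where
  "fil P n = cls P ` deg_ge (mon P) (dgr P) n"

subsection \<open>Completed tensor products\<close>

text \<open>
  The product monoid, graded by total degree, gives the completed tensor product of the two
  completed monoid algebras; dividing by the closed ideal generated by the two given ideals gives
  that of the quotients.
\<close>

definition tprod :: "'m series \<Rightarrow> 'n series \<Rightarrow> ('m \<times> 'n) series" where
  "tprod f g = (\<lambda>(u, v). f u * g v)"

definition ctensor :: "'m calg \<Rightarrow> 'n calg \<Rightarrow> ('m \<times> 'n) calg" (infixr \<open>\<boxtimes>\<close> 75) where
  "P \<boxtimes> Q =
     (let M = mon P \<times>\<times> mon Q; d = (\<lambda>(u, v). dgr P u + dgr Q v) in
      \<lparr>mon = M, dgr = d,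
       rel_ideal = closed_ideal_gen M d
         ((\<lambda>f. tprod f \<one>\<^bsub>cover Q\<^esub>) ` rel_ideal P \<union> (\<lambda>g. tprod \<one>\<^bsub>cover P\<^esub> g) ` rel_ideal Q)\<rparr>)"

definition tens ::
  "'m calg \<Rightarrow> 'n calg \<Rightarrow> 'm series set \<Rightarrow> 'n series set \<Rightarrow> ('m \<times> 'n) series set" where
  "tens P Q x y = (\<Union>f\<in>x. \<Union>g\<in>y. cls (P \<boxtimes> Q) (tprod f g))"

definition filtered_linear ::
  "'m calg \<Rightarrow> 'n calg \<Rightarrow> ('m series set \<Rightarrow> 'n series set) \<Rightarrow> bool" where
  "filtered_linear P Q k \<longleftrightarrow>
     k \<in> carrier (alg P) \<rightarrow> carrier (alg Q) \<and>
     (\<forall>x\<in>carrier (alg P). \<forall>y\<in>carrier (alg P). k (x \<oplus>\<^bsub>alg P\<^esub> y) = k x \<oplus>\<^bsub>alg Q\<^esub> k y) \<and>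
     (\<forall>c. \<forall>x\<in>carrier (alg P). k (smul P c x) = smul Q c (k x)) \<and>
     (\<forall>n. k ` fil P n \<subseteq> fil Q n)"

text \<open>
  A filtered linear map is continuous, hence determined by its values on the \<open>tens P Q x y\<close>, whose
  span is dense.  So there is at most one \<open>k\<close> (on the carrier) as follows, namely the linear map on
  the completed tensor product induced by the bilinear map \<open>\<beta>\<close>.
\<close>

definition induced ::
  "'m calg \<Rightarrow> 'n calg \<Rightarrow> 'p calg \<Rightarrow> ('m series set \<Rightarrow> 'n series set \<Rightarrow> 'p series set)
     \<Rightarrow> (('m \<times> 'n) series set \<Rightarrow> 'p series set) \<Rightarrow> bool" where
  "induced P Q R \<beta> k \<longleftrightarrow> filtered_linear (P \<boxtimes> Q) R k \<and>
     (\<forall>x\<in>carrier (alg P). \<forall>y\<in>carrier (alg Q). k (tens P Q x y) = \<beta> x y)"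

subsection \<open>Hopf algebras\<close>

definition coassociative ::
  "'m calg \<Rightarrow> ('m series set \<Rightarrow> ('m \<times> 'm) series set) \<Rightarrow> bool" where
  "coassociative P \<Delta> \<longleftrightarrow>
     (\<exists>\<Delta>_id id_\<Delta> assoc.
        induced P P ((P \<boxtimes> P) \<boxtimes> P) (\<lambda>x y. tens (P \<boxtimes> P) P (\<Delta> x) y) \<Delta>_id \<and>
        induced P P (P \<boxtimes> (P \<boxtimes> P)) (\<lambda>x y. tens P (P \<boxtimes> P) x (\<Delta> y)) id_\<Delta> \<and>
        filtered_linear ((P \<boxtimes> P) \<boxtimes> P) (P \<boxtimes> (P \<boxtimes> P)) assoc \<and>
        (\<forall>x\<in>carrier (alg P). \<forall>y\<in>carrier (alg P). \<forall>z\<in>carrier (alg P).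
           assoc (tens (P \<boxtimes> P) P (tens P P x y) z) = tens P (P \<boxtimes> P) x (tens P P y z)) \<and>
        (\<forall>x\<in>carrier (alg P). assoc (\<Delta>_id (\<Delta> x)) = id_\<Delta> (\<Delta> x)))"

definition counital ::
  "'m calg \<Rightarrow> ('m series set \<Rightarrow> ('m \<times> 'm) series set) \<Rightarrow> ('m series set \<Rightarrow> complex) \<Rightarrow> bool" where
  "counital P \<Delta> \<epsilon> \<longleftrightarrow>
     (\<exists>\<epsilon>_id id_\<epsilon>.
        induced P P P (\<lambda>x y. smul P (\<epsilon> x) y) \<epsilon>_id \<and>
        induced P P P (\<lambda>x y. smul P (\<epsilon> y) x) id_\<epsilon> \<and>
        (\<forall>x\<in>carrier (alg P). \<epsilon>_id (\<Delta> x) = x \<and> id_\<epsilon> (\<Delta> x) = x))"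

definition antipodal ::
  "'m calg \<Rightarrow> ('m series set \<Rightarrow> ('m \<times> 'm) series set) \<Rightarrow> ('m series set \<Rightarrow> complex)
     \<Rightarrow> ('m series set \<Rightarrow> 'm series set) \<Rightarrow> bool" where
  "antipodal P \<Delta> \<epsilon> S \<longleftrightarrow>
     (\<exists>m_S_id m_id_S.
        induced P P P (\<lambda>x y. S x \<otimes>\<^bsub>alg P\<^esub> y) m_S_id \<and>
        induced P P P (\<lambda>x y. x \<otimes>\<^bsub>alg P\<^esub> S y) m_id_S \<and>
        (\<forall>x\<in>carrier (alg P). m_S_id (\<Delta> x) = scalar P (\<epsilon> x) \<and> m_id_S (\<Delta> x) = scalar P (\<epsilon> x)))"

text \<open>
  The ground field sits in degree 0, so for the counit preserving the filtration means vanishing on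
  \<open>fil P 1\<close>.
\<close>

definition hopf_structure ::
  "'m calg \<Rightarrow> ('m series set \<Rightarrow> ('m \<times> 'm) series set) \<Rightarrow> ('m series set \<Rightarrow> 'm series set)
     \<Rightarrow> ('m series set \<Rightarrow> complex) \<Rightarrow> bool" where
  "hopf_structure P \<Delta> S \<epsilon> \<longleftrightarrow>
     \<Delta> \<in> ring_hom (alg P) (alg (P \<boxtimes> P)) \<and> filtered_linear P (P \<boxtimes> P) \<Delta> \<and>
     \<epsilon> \<in> ring_hom (alg P) ring_of_type_algebra \<and> (\<forall>c. \<epsilon> (scalar P c) = c) \<and>
     (\<forall>x \<in> fil P 1. \<epsilon> x = 0) \<and>
     filtered_linear P P S \<and> S \<one>\<^bsub>alg P\<^esub> = \<one>\<^bsub>alg P\<^esub> \<and>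
     (\<forall>x\<in>carrier (alg P). \<forall>y\<in>carrier (alg P). S (x \<otimes>\<^bsub>alg P\<^esub> y) = S y \<otimes>\<^bsub>alg P\<^esub> S x) \<and>
     coassociative P \<Delta> \<and> counital P \<Delta> \<epsilon> \<and> antipodal P \<Delta> \<epsilon> S"


section \<open>The Jordanian quantum algebra of sl(N)\<close>

definition lie :: "('a, 'b) ring_scheme \<Rightarrow> 'a \<Rightarrow> 'a \<Rightarrow> 'a" (\<open>\<lbrakk>_,/ _\<rbrakk>\<index>\<close>) where
  "\<lbrakk>x, y\<rbrakk>\<^bsub>R\<^esub> = x \<otimes>\<^bsub>R\<^esub> y \<ominus>\<^bsub>R\<^esub> y \<otimes>\<^bsub>R\<^esub> x"

definition cartan :: "nat \<Rightarrow> nat \<Rightarrow> int" where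
  "cartan i j = (if i = j then 2 else if i = Suc j \<or> j = Suc i then -1 else 0)"

definition theta :: "nat \<Rightarrow> nat \<Rightarrow> nat" where
  "theta N i = of_bool (i = 1) + of_bool (i = N - 1)"

text \<open>
  The defining relations, as elements left-hand side minus right-hand side, for arbitrary elements
  \<open>E\<close>, \<open>F\<close>, \<open>H\<close>, \<open>T\<close>, \<open>T'\<close> of a ring with an action \<open>s\<close> of the scalars; \<open>T'\<close> plays the role of the
  inverse of \<open>T\<close>.
\<close>

locale jordanian_data =
  fixes R :: "('a, 'b) ring_scheme" (structure)
    and s :: "complex \<Rightarrow> 'a \<Rightarrow> 'a"
    and N :: nat
    and E F H :: "nat \<Rightarrow> 'a"
    and T T' :: 'a
begin

definition H_sum :: 'a where
  "H_sum = (\<Oplus>k\<in>{1..N - 1}. H k)"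

definition TF :: "nat \<Rightarrow> 'a" where
  "TF i = T [^] theta N i \<otimes> F i"

definition relators :: "'a set" where
  "relators =
    (\<Union>i\<in>{1..N - 1}. \<Union>j\<in>{1..N - 1}.
      {\<lbrakk>H i, H j\<rbrakk>,
       \<lbrakk>H i, E j\<rbrakk> \<ominus> s (of_int (cartan i j)) (E j),
       \<lbrakk>H i, F j\<rbrakk> \<ominus> (s (- of_int (cartan i j)) (F j)
                      \<oplus> s (of_nat (theta N i)) (T' \<otimes> \<lbrakk>F j, T\<rbrakk> \<otimes> H_sum)),
       \<lbrakk>T' [^] theta N i \<otimes> E i, F j\<rbrakk> \<ominus>
         s (of_bool (i = j))
           (T' [^] theta N i \<otimes> H i \<oplus> s (of_nat (theta N i) / 2) ((T \<ominus> T') \<otimes> H_sum))} \<union>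
      (if \<bar>int i - int j\<bar> > 1 then {\<lbrakk>E i, E j\<rbrakk>, \<lbrakk>TF i, TF j\<rbrakk>} else {}) \<union>
      (if i \<noteq> j then
         {((\<lambda>x. \<lbrakk>E i, x\<rbrakk>) ^^ nat (1 - cartan i j)) (E j),
          ((\<lambda>x. \<lbrakk>TF i, x\<rbrakk>) ^^ nat (1 - cartan i j)) (TF j)}
       else {}))"

end

datatype letter = GE nat | GF nat | GH nat

fun letter_deg :: "letter \<Rightarrow> int" where
  "letter_deg (GE i) = 1"
| "letter_deg (GF i) = -1"
| "letter_deg (GH i) = 0"

definition word_deg :: "letter list \<Rightarrow> int" where
  "word_deg w = (\<Sum>g\<leftarrow>w. letter_deg g)"

definition word_monoid :: "nat \<Rightarrow> letter list monoid" where
  "word_monoid N =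
     \<lparr>carrier = lists (\<Union>i\<in>{1..N - 1}. {GE i, GF i, GH i}), monoid.mult = (@), one = []\<rparr>"

definition free_alg :: "nat \<Rightarrow> letter list series ring" where
  "free_alg N = series_ring (word_monoid N) word_deg"

definition letter_series :: "letter \<Rightarrow> letter list series" where
  "letter_series g = (\<lambda>w. if w = [g] then 1 else 0)"

definition X_series :: "nat \<Rightarrow> letter list series" where
  "X_series N = foldr (lie (free_alg N)) (map (\<lambda>i. letter_series (GE i)) [1..<N - 1])
                  (letter_series (GE (N - 1)))"

text \<open>
  The binomial series of \<open>(1 + 2hX)\<^bsup>a\<^esup>\<close>.  As \<open>X\<close> is homogeneous of word length \<open>N - 1 \<ge> 1\<close>, the
  coefficient of a word \<open>w\<close> in the \<open>k\<close>-th power of \<open>X\<close> vanishes for \<open>k > length w\<close>.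
\<close>

definition T_series :: "nat \<Rightarrow> complex \<Rightarrow> complex \<Rightarrow> letter list series" where
  "T_series N h a =
     (\<lambda>w. \<Sum>k\<le>length w. (a gchoose k) * (2 * h) ^ k * (X_series N [^]\<^bsub>free_alg N\<^esub> k) w)"

definition jordanian :: "nat \<Rightarrow> complex \<Rightarrow> letter list calg" where
  "jordanian N h =
     \<lparr>mon = word_monoid N, dgr = word_deg,
      rel_ideal = closed_ideal_gen (word_monoid N) word_deg
        (jordanian_data.relators (free_alg N) sc N
           (\<lambda>i. letter_series (GE i)) (\<lambda>i. letter_series (GF i)) (\<lambda>i. letter_series (GH i))
           (T_series N h (1/2)) (T_series N h (-1/2)))\<rparr>"

end

(*
  Two commuting representations of the Jordanian relations on one algebra combine, by the formulas
  for the coproduct, into a third one, and one representation gives, by the formulas for the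
  antipode, a representation on the opposite algebra.  Both computations concern elements of an
  arbitrary ring: in terms of G_i = T^-1 [F_i, T], which vanishes for 1 < i < N - 1, one has
  [H_i, T] = theta_i (T - T^-1)/2, so F_i, H_i and the sum of all H_k commute with T up to explicit
  terms.  The Serre relations between T^theta_i F_i + s G-terms are polynomials in s which vanish
  at small integers s because conjugation by T shifts s by one; hence all their coefficients
  vanish.

  A map on the completed algebra is determined by its values on words.  That the image of T is the
  prescribed element y follows from uniqueness of square roots: both have square 1 + 2hX, commute,
  and are 1 modulo elements of positive degree.  The Hopf axioms then need to be checked only on
  the generators: coassociativity and the counit law compare algebra homomorphisms, and the elements
  z with m(S x id)(z) scalar are closed under multiplication by values of the coproduct because
  m(S x id)(z (c x d)) = S(c) m(S x id)(z) d.
*)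

theory Submission
  imports Defs
begin

section \<open>Commutators and the Jordanian relations\<close>

text \<open>The long computations need a ring without carrier conditions. They are done in a type
  class and transferred through one ring that has every algebra on the given type as a factor. What
  survives of it is that \<open>T\<close> is invertible, that its square is 1 + 2hX for the nested
  commutator X, and that whatever commutes with X commutes with \<open>T\<close>. The last property
  does the work of a functional calculus: [H_i, T] commutes with X, hence with \<open>T\<close>, and
  is found by bracketing the square. That [F_k, T] commutes with \<open>T\<close> is not among the
  relations either; it is extracted from the nested form of T^-2 X, in which F_k meets only one
  factor. For T (x) T this commutation property is not established, so the relations for the
  coproduct are derived without it, and that T is sent to T (x) T has to come from the filtration.
  Behind the antipode is the fact that the elements F_k - G_k (H_1 + ... + H_{N-1}) satisfy,
  together with the E_i and H_i, the undeformed relations of sl(N).\<close>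

definition br :: "'a::ring \<Rightarrow> 'a \<Rightarrow> 'a" where
  "br x y = x * y - y * x"

lemma br_add_left: "br (x + y) z = br x z + br y z"
  and br_add_right: "br z (x + y) = br z x + br z y"
  and br_diff_left: "br (x - y) z = br x z - br y z"
  and br_diff_right: "br z (x - y) = br z x - br z y"
  and br_minus_left: "br (- x) z = - br x z"
  and br_minus_right: "br z (- x) = - br z x"
  and br_zero_left [simp]: "br 0 z = 0"
  and br_zero_right [simp]: "br z 0 = 0"
  and br_self [simp]: "br z z = 0"
  and br_mult_right: "br z (x * y) = br z x * y + x * br z y"
  and br_mult_left: "br (x * y) z = x * br y z + br x z * y"
  by (simp_all add: br_def algebra_simps)

lemma br_one [simp]: "br (1::'a::ring_1) z = 0" "br z (1::'a::ring_1) = 0"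
  by (simp_all add: br_def)

lemma br_commute: "br x y = - br y x"
  by (simp add: br_def)

lemma br_eq_0_iff: "br x y = 0 \<longleftrightarrow> x * y = y * x"
  by (simp add: br_def)

lemma br_eq_0_sym: "br x y = 0 \<Longrightarrow> br y x = 0"
  by (simp add: br_def)

lemma br_jacobi: "br z (br x y) = br (br z x) y + br x (br z y)"
  by (simp add: br_def algebra_simps)

lemma br_jacobi_left: "br (br x y) z = br x (br y z) - br y (br x z)"
  by (simp add: br_def algebra_simps)

lemma br_br_left: "br z y = 0 \<Longrightarrow> br z (br x y) = br (br z x) y"
  and br_br_right: "br z x = 0 \<Longrightarrow> br z (br x y) = br x (br z y)"
  by (simp_all add: br_jacobi[of z x y])

lemma br_power_0: "br z (x::'a::ring_1) = 0 \<Longrightarrow> br z (x ^ k) = 0"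
  by (simp add: br_eq_0_iff power_commuting_commutes)

lemma br_mult_0: "br z x = 0 \<Longrightarrow> br z y = 0 \<Longrightarrow> br z (x * y) = 0"
  by (simp add: br_mult_right)

lemma br_of_nat [simp]: "br z (of_nat k :: 'a::ring_1) = 0"
  by (simp add: br_eq_0_iff mult_of_nat_commute)

lemma br_of_int [simp]: "br z (of_int k :: 'a::ring_1) = 0"
  by (simp add: br_eq_0_iff mult_of_int_commute)

lemma br_sum_left: "br (sum f A) z = (\<Sum>i\<in>A. br (f i) z)"
  by (simp add: br_def sum_distrib_left sum_distrib_right sum_subtractf)

lemma br_sum_right: "br z (sum f A) = (\<Sum>i\<in>A. br z (f i))"
  by (simp add: br_def sum_distrib_left sum_distrib_right sum_subtractf)

subsection \<open>Iterated brackets\<close>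

definition rnest :: "(nat \<Rightarrow> 'a::ring) \<Rightarrow> nat \<Rightarrow> nat \<Rightarrow> 'a" where
  "rnest x n k = foldr br (map x [k..<n]) (x n)"

text \<open>The left-nested bracket [..[[x_1, x_2], x_3].., x_k]. The value at 0 is a dummy that
  makes the recursion total; the uses have k at least 1.\<close>

fun lnest :: "(nat \<Rightarrow> 'a::ring) \<Rightarrow> nat \<Rightarrow> 'a" where
  "lnest x 0 = x 1"
| "lnest x (Suc k) = (if k = 0 then x 1 else br (lnest x k) (x (Suc k)))"

lemma lnest_1 [simp]: "lnest x (Suc 0) = x 1"
  by simp

lemma lnest_Suc: "1 \<le> k \<Longrightarrow> lnest x (Suc k) = br (lnest x k) (x (Suc k))"
  by simp

declare lnest.simps(2) [simp del]

lemma rnest_self [simp]: "rnest x n n = x n"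
  by (simp add: rnest_def)

lemma rnest_step: "k < n \<Longrightarrow> rnest x n k = br (x k) (rnest x n (Suc k))"
  by (simp add: rnest_def upt_conv_Cons)

lemma br_rnest_0:
  assumes "k \<le> n" and "\<And>m. k \<le> m \<Longrightarrow> m \<le> n \<Longrightarrow> br z (x m) = 0"
  shows "br z (rnest x n k) = 0"
  using assms
proof (induction k rule: inc_induct)
  case (step k)
  have "br z (x k) = 0" "br z (rnest x n (Suc k)) = 0"
    using step by auto
  then show ?case
    using step.hyps by (simp add: rnest_step br_jacobi)
qed simp

lemma br_lnest_0:
  assumes "1 \<le> k" and "\<And>m. 1 \<le> m \<Longrightarrow> m \<le> k \<Longrightarrow> br z (x m) = 0"
  shows "br z (lnest x k) = 0"
  using assms
proof (induction k rule: dec_induct)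
  case (step k)
  then show ?case
    by (simp add: lnest_Suc br_jacobi)
qed simp

text \<open>ad z is a derivation of the bracket, so weights add along the nest; integers are central
  in the ring and pass through every bracket.\<close>

lemma br_rnest_weight:
  fixes x :: "nat \<Rightarrow> 'a::ring_1"
  assumes "k \<le> n" and "\<And>m. k \<le> m \<Longrightarrow> m \<le> n \<Longrightarrow> br z (x m) = of_int (c m) * x m"
  shows "br z (rnest x n k) = of_int (\<Sum>m = k..n. c m) * rnest x n k"
  using assms
proof (induction k rule: inc_induct)
  case (step k)
  let ?r = "rnest x n (Suc k)" and ?s = "\<Sum>m = Suc k..n. c m"
  have 1: "br z (x k) = of_int (c k) * x k" "br z ?r = of_int ?s * ?r"
    using step by auto
  have 2: "(\<Sum>m = k..n. c m) = c k + ?s"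
    using step.hyps by (simp add: sum.atLeast_Suc_atMost)
  have "br z (br (x k) ?r) = br (of_int (c k) * x k) ?r + br (x k) (of_int ?s * ?r)"
    by (simp only: br_jacobi 1)
  also have "\<dots> = of_int (c k) * br (x k) ?r + of_int ?s * br (x k) ?r"
    by (simp add: br_mult_left br_mult_right br_eq_0_sym[OF br_of_int] del: of_int_sum)
  finally show ?case
    using step.hyps by (simp add: rnest_step 2 distrib_right)
qed simp

text \<open>As v commutes with every x_m, each power of v can leave the bracket it stands in. This
  compares the nest of the V^theta E_m with the nest of the E_m.\<close>

lemma rnest_scale:
  fixes x :: "nat \<Rightarrow> 'a::ring_1"
  assumes "k \<le> n" and "\<And>m. k \<le> m \<Longrightarrow> m \<le> n \<Longrightarrow> br v (x m) = 0"
  shows "rnest (\<lambda>m. v ^ e m * x m) n k = v ^ (\<Sum>m = k..n. e m) * rnest x n k"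
  using assms
proof (induction k rule: inc_induct)
  case (step k)
  let ?r = "rnest x n (Suc k)" and ?s = "\<Sum>m = Suc k..n. e m"
  have 2: "(\<Sum>m = k..n. e m) = e k + ?s"
    using step.hyps by (simp add: sum.atLeast_Suc_atMost)
  have c: "br v (x k) = 0" "br v ?r = 0"
    using step by (auto intro!: br_rnest_0)
  have c': "br (x k) (v ^ p) = 0" "br (v ^ p) ?r = 0" "br (v ^ q) (v ^ p) = 0" for p q
    using c by (blast intro: br_power_0 br_eq_0_sym br_self)+
  have c'': "v ^ ?s * (v ^ e k * y) = v ^ e k * (v ^ ?s * y)" for y
    by (metis add.commute mult.assoc power_add)
  have "rnest (\<lambda>m. v ^ e m * x m) n k = br (v ^ e k * x k) (v ^ ?s * ?r)"
    using step by (simp add: rnest_step)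
  also have "\<dots> = v ^ e k * v ^ ?s * br (x k) ?r"
    using c' by (simp add: br_mult_left br_mult_right mult.assoc c'')
  finally show ?case
    using step.hyps by (simp add: rnest_step 2 power_add mult.assoc)
qed simp

section \<open>Serre relations of type A and the highest root vector\<close>

locale serre_family =
  fixes x :: "nat \<Rightarrow> 'a::ring_1" and n :: nat
  assumes no_2_torsion: "\<And>y::'a. y + y = 0 \<Longrightarrow> y = 0"
    and far: "\<And>i k. \<lbrakk>1 \<le> i; Suc i < k; k \<le> n\<rbrakk> \<Longrightarrow> br (x i) (x k) = 0"
    and near: "\<And>i. \<lbrakk>1 \<le> i; i < n\<rbrakk> \<Longrightarrow> br (x i) (br (x i) (x (Suc i))) = 0"
      "\<And>i. \<lbrakk>1 \<le> i; i < n\<rbrakk> \<Longrightarrow> br (x (Suc i)) (br (x (Suc i)) (x i)) = 0"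
begin

lemma lnest_rnest_0: "\<lbrakk>1 \<le> k; Suc k < m; m \<le> n\<rbrakk> \<Longrightarrow> br (lnest x k) (rnest x n m) = 0"
proof (rule br_rnest_0)
  fix l assume "1 \<le> k" "Suc k < m" "m \<le> n" "m \<le> l" "l \<le> n"
  then have "br (x l) (lnest x k) = 0"
    by (intro br_lnest_0 br_eq_0_sym[OF far]) auto
  then show "br (lnest x k) (x l) = 0"
    by (rule br_eq_0_sym)
qed simp

text \<open>The left part of length k commutes with everything from index k + 2 on, so by the Jacobi
  identity x_{k+1} can be moved from the right nest into the left one.\<close>

lemma rnest_split:
  assumes "1 \<le> k" "k < n"
  shows "rnest x n 1 = br (lnest x k) (rnest x n (Suc k))"
  using assms
proof (induction k rule: dec_induct)
  case base
  then show ?case by (simp add: rnest_step)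
next
  case (step k)
  have "br (lnest x k) (rnest x n (Suc (Suc k))) = 0"
    using step by (intro lnest_rnest_0) auto
  then show ?case
    using step by (simp add: rnest_step[of "Suc k"] lnest_Suc br_jacobi)
qed

lemma rnest_eq_lnest:
  assumes "2 \<le> n"
  shows "rnest x n 1 = lnest x n"
proof -
  obtain k where k: "n = Suc k" "1 \<le> k"
    using assms by (cases n) auto
  then show ?thesis
    using rnest_split[of k] by (simp add: lnest_Suc)
qed

text \<open>The highest root plus a simple root is not a root. At an interior node i the nest is [a,
  [x_i, b]], with a built from the left of i, b from the right, [a, b] = 0, and ad x_i applied twice
  kills both a and b. A factor 2 has to be cancelled there, whence \<open>no_2_torsion\<close>; at
  the two ends the Serre relations apply directly.\<close>

lemma highest_root_central:
  assumes n: "2 \<le> n" and i: "1 \<le> i" "i \<le> n"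
  shows "br (x i) (rnest x n 1) = 0"
proof -
  have right: "br (x i) (br (x i) (rnest x n (Suc i))) = 0" if "i < n"
  proof (cases "Suc i = n")
    case True
    then have "rnest x n (Suc i) = x (Suc i)"
      by simp
    then show ?thesis using near(1)[of i] i that by simp
  next
    case False
    have 0: "br (x i) (rnest x n (Suc (Suc i))) = 0"
      using i False that by (intro br_rnest_0 far) auto
    show ?thesis
      using False that near(1)[of i] i br_br_left[OF 0] by (simp add: rnest_step)
  qed
  have left: "br (x i) (br (x i) (lnest x k)) = 0" if ik: "i = Suc k" "1 \<le> k" for k
  proof (cases "k = 1")
    case True
    then have "lnest x k = x 1" "i = Suc 1"
      using ik by auto
    then show ?thesis using near(2)[of 1] i ik by simp
  next
    case False
    then obtain l where l: "k = Suc l" "1 \<le> l" using ik by (cases k) auto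
    have 0: "br (x i) (lnest x l) = 0"
      using i l that by (intro br_lnest_0 br_eq_0_sym[OF far]) auto
    show ?thesis
      using l ik near(2)[of k] i br_br_right[OF 0] by (simp add: lnest_Suc)
  qed
  obtain k where k: "i = Suc k"
    using i by (cases i) auto
  consider "i = 1" | "1 \<le> k" "i < n" | "1 \<le> k" "i = n"
    using i k by linarith
  then show ?thesis
  proof cases
    case 1
    then show ?thesis using right n by (simp add: rnest_step)
  next
    case 2
    let ?a = "lnest x k" and ?b = "rnest x n (Suc i)"
    have ab: "br ?a ?b = 0"
      using 2 k by (intro lnest_rnest_0) auto
    \<comment> \<open>By Leibniz, ad x_i applied twice to [a, b] = 0 leaves twice the mixed term
      [[x_i, a], [x_i, b]], which is also what ad x_i makes of the whole nest.\<close>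
    have "0 = br (x i) (br (x i) (br ?a ?b))"
      by (simp add: ab)
    also have "\<dots> = br (x i) (br (br (x i) ?a) ?b) + br (x i) (br ?a (br (x i) ?b))"
      by (simp add: br_jacobi[of "x i" ?a ?b] br_add_right)
    also have "br (x i) (br (br (x i) ?a) ?b) = br (br (x i) ?a) (br (x i) ?b)"
      using left[of k] k 2 by (intro br_br_right) auto
    also have "br (x i) (br ?a (br (x i) ?b)) = br (br (x i) ?a) (br (x i) ?b)"
      using right k 2 by (intro br_br_left) auto
    finally have "br (br (x i) ?a) (br (x i) ?b) = 0"
      using no_2_torsion by metis
    moreover have "rnest x n 1 = br ?a (br (x i) ?b)"
      using rnest_split[of k] k 2 by (simp add: rnest_step)
    moreover have "br (x i) (br ?a (br (x i) ?b)) = br (br (x i) ?a) (br (x i) ?b)"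
      using right k 2 by (intro br_br_left) auto
    ultimately show ?thesis
      by simp
  next
    case 3
    have "rnest x n 1 = lnest x (Suc k)"
      using rnest_eq_lnest n k 3 by metis
    also have "\<dots> = - br (x i) (lnest x k)"
      using k 3 by (simp add: lnest_Suc br_commute[of "lnest x k"])
    finally have "br (x i) (rnest x n 1) = - br (x i) (br (x i) (lnest x k))"
      by (simp only: br_minus_right)
    then show ?thesis using left[of k] k 3 by (simp del: One_nat_def)
  qed
qed

end

declare One_nat_def [simp del] of_int_sum [simp del] of_nat_sum [simp del]

section \<open>Cartan matrix sums and the Jordanian relations in a ring\<close>

lemma theta_le_1: "N \<ge> 3 \<Longrightarrow> theta N i = 0 \<or> theta N i = 1"
  by (auto simp: theta_def)

lemma of_int_left_commute: "x * (of_int c * y) = of_int c * (x * y)"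
  and of_nat_left_commute: "x * (of_nat k * y) = of_nat k * (x * y)"
  for x y :: "'a::ring_1"
  by (metis mult.assoc mult_of_int_commute, metis mult.assoc mult_of_nat_commute)

text \<open>The sum pairs the coroot of node i with the highest root, the sum of all simple roots:
  the entries 2, -1, -1 cancel except at the two ends, where one neighbour is missing.\<close>

lemma cartan_sum:
  assumes "N \<ge> 3" "1 \<le> i" "i \<le> N - 1"
  shows "(\<Sum>m = 1..N - 1. cartan i m) = int (theta N i)"
proof -
  \<comment> \<open>For i = 1 the last indicator asks for m = 0, which lies outside the range and so
    drops out.\<close>
  have "(\<Sum>m = 1..N - 1. cartan i m) =
      (\<Sum>m = 1..N - 1. (if m = i then 2 else 0) + (if m = Suc i then -1 else 0) + (if m = i - 1 then -1 else 0))"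
    using assms by (intro sum.cong) (auto simp: cartan_def)
  also have "\<dots> = 2 + (if i < N - 1 then -1 else 0) + (if 1 < i then -1 else 0)"
    using assms by (simp add: sum.distrib) auto
  finally show ?thesis
    using assms by (auto simp: theta_def)
qed

lemma cartan_sym: "cartan i k = cartan k i"
  by (auto simp: cartan_def)

lemma cartan_sum':
  "N \<ge> 3 \<Longrightarrow> 1 \<le> k \<Longrightarrow> k \<le> N - 1 \<Longrightarrow> (\<Sum>m = 1..N - 1. cartan m k) = int (theta N k)"
  using cartan_sum[of N k] by (simp add: cartan_sym[of _ k])

lemma theta_sum: "N \<ge> 3 \<Longrightarrow> (\<Sum>m = 1..N - 1. theta N m) = 2"
proof -
  assume N: "N \<ge> 3"
  have "(\<Sum>m = 1..N - 1. theta N m) = (\<Sum>m = 1..N - 1. (if m = 1 then 1 else 0) + (if m = N - 1 then 1 else 0))"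
    by (intro sum.cong) (auto simp: theta_def)
  also have "\<dots> = 2" using N by (simp add: sum.distrib)
  finally show ?thesis .
qed

text \<open>The relations by themselves, with \<open>V\<close> in the role of the inverse of
  \<open>T\<close> and \<open>j\<close> embedding the complex numbers into the centre. They are
  separated from \<open>jordan_rep\<close> since the condition \<open>commutant\<close> of the
  latter is not shown for the images under the coproduct.\<close>

locale jordan_rels =
  fixes j :: "complex \<Rightarrow> 'a::ring_1" and N :: nat and E F H :: "nat \<Rightarrow> 'a" and T V :: 'a
  assumes N: "N \<ge> 3"
    and j_add: "j (c + d) = j c + j d" and j_mult: "j (c * d) = j c * j d" and j_one: "j 1 = 1"
    and j_central: "br (j c) x = 0"
    and HH: "\<lbrakk>i \<in> {1..N-1}; k \<in> {1..N-1}\<rbrakk> \<Longrightarrow> br (H i) (H k) = 0"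
    and HE: "\<lbrakk>i \<in> {1..N-1}; k \<in> {1..N-1}\<rbrakk> \<Longrightarrow> br (H i) (E k) = of_int (cartan i k) * E k"
    and HF: "\<lbrakk>i \<in> {1..N-1}; k \<in> {1..N-1}\<rbrakk> \<Longrightarrow> br (H i) (F k) =
      - (of_int (cartan i k) * F k) + of_nat (theta N i) * (V * br (F k) T * sum H {1..N-1})"
    and EF: "\<lbrakk>i \<in> {1..N-1}; k \<in> {1..N-1}\<rbrakk> \<Longrightarrow> br (V ^ theta N i * E i) (F k) =
      (if i = k then V ^ theta N i * H i
         + of_nat (theta N i) * (j (1/2) * ((T - V) * sum H {1..N-1})) else 0)"
    and EE: "\<lbrakk>i \<in> {1..N-1}; k \<in> {1..N-1}; i \<noteq> k; cartan i k = 0\<rbrakk> \<Longrightarrow> br (E i) (E k) = 0"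
    and KK: "\<lbrakk>i \<in> {1..N-1}; k \<in> {1..N-1}; i \<noteq> k; cartan i k = 0\<rbrakk> \<Longrightarrow>
      br (T ^ theta N i * F i) (T ^ theta N k * F k) = 0"
    and EEE: "\<lbrakk>i \<in> {1..N-1}; k \<in> {1..N-1}; cartan i k = -1\<rbrakk> \<Longrightarrow> br (E i) (br (E i) (E k)) = 0"
    and KKK: "\<lbrakk>i \<in> {1..N-1}; k \<in> {1..N-1}; cartan i k = -1\<rbrakk> \<Longrightarrow>
      br (T ^ theta N i * F i) (br (T ^ theta N i * F i) (T ^ theta N k * F k)) = 0"

text \<open>The parameter \<open>h\<close> occurs in no relation, only in the square of
  \<open>T\<close>. The condition \<open>commutant\<close> stands for the fact that \<open>T\<close>
  is a limit of polynomials in X.\<close>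

locale jordan_rep = jordan_rels +
  fixes h :: complex
  assumes TV [simp]: "T * V = 1" and VT [simp]: "V * T = 1"
    and T_square: "T * T = 1 + j (2 * h) * rnest E (N-1) 1"
    and commutant: "br z (rnest E (N-1) 1) = 0 \<Longrightarrow> br z T = 0"
begin

abbreviation "Idx \<equiv> {1..N-1}"
abbreviation "th \<equiv> theta N"
abbreviation "Xe \<equiv> rnest E (N-1) 1"
abbreviation "c2 \<equiv> j (1/2)"
definition "Hs = sum H Idx"
definition "D = c2 * (T - V)"
definition "G k = V * br (F k) T"
text \<open>With \<open>a\<close> and \<open>K\<close> the mixed relation becomes [a_i, K_k] = 0 for
  distinct i, k and [a_i, K_i] = \<open>Ht i\<close>. The Serre relations of the E_i carry over to
  the a_i, because V commutes with every E_i.\<close>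

definition "a i = V ^ th i * E i"
definition "K i = T ^ th i * F i"
definition "Ht i = H i + of_nat (th i) * (T * D * Hs)"

lemma TV' [simp]: "T * (V * x) = x" "V * (T * x) = x"
  by (simp_all flip: mult.assoc)

lemma T_cancel: "T * x = T * y \<Longrightarrow> x = y"
  by (metis TV'(2))

lemma c2: "c2 + c2 = 1"
  using j_add[of "1/2" "1/2"] by (simp add: j_one)

lemma c2_mult: "c2 * x + c2 * x = x"
  using c2 by (simp flip: distrib_right)

lemma no_2_torsion: "y + y = 0 \<Longrightarrow> y = (0::'a)"
  by (metis c2_mult distrib_left mult_zero_right)

lemma halve: "x + x = y + y \<Longrightarrow> x = (y::'a)"
  using no_2_torsion[of "x - y"] by (simp add: algebra_simps)

lemma j_commute: "x * j c = j c * x"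
  using j_central[of c x] by (simp add: br_def)

lemma j_commute': "x * (j c * y) = j c * (x * y)"
  using j_commute by (metis mult.assoc)

lemma j_central': "br x (j c) = 0"
  using j_central br_eq_0_sym by blast

lemma theta_01: "th i = 0 \<or> th i = 1"
  using theta_le_1 N by blast

lemma br_V: assumes "br z T = 0" shows "br z V = 0"
proof -
  have "z * V = V * (T * z) * V" by (simp add: mult.assoc)
  also have "\<dots> = V * (z * T) * V" using assms by (simp add: br_def)
  also have "\<dots> = V * z" by (simp add: mult.assoc)
  finally show ?thesis by (simp add: br_def)
qed

lemma br_D: "br z T = 0 \<Longrightarrow> br z D = 0"
  by (simp add: D_def br_mult_right br_V j_central' br_diff_right)

lemma DD: "D + D = T - V"
  by (simp add: D_def c2_mult)

lemma serre_E: "serre_family E (N-1)"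
proof
  fix i assume "1 \<le> i" "i < N - 1"
  then show "br (E i) (br (E i) (E (Suc i))) = 0" "br (E (Suc i)) (br (E (Suc i)) (E i)) = 0"
    using EEE[of i "Suc i"] EEE[of "Suc i" i] by (auto simp: cartan_def)
next
  fix i k assume "1 \<le> i" "Suc i < k" "k \<le> N - 1"
  then show "br (E i) (E k) = 0"
    using EE[of i k] by (auto simp: cartan_def)
qed (rule no_2_torsion)

lemma EX: "i \<in> Idx \<Longrightarrow> br (E i) Xe = 0"
  using serre_family.highest_root_central[OF serre_E] N by auto

lemma XT: "br Xe T = 0"
  by (rule commutant) simp

lemma ET: "i \<in> Idx \<Longrightarrow> br (E i) T = 0"
  by (rule commutant) (rule EX)

lemma TE: "i \<in> Idx \<Longrightarrow> br T (E i) = 0"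
  using ET br_eq_0_sym by blast

lemma VE: "i \<in> Idx \<Longrightarrow> br V (E i) = 0"
  using ET br_V br_eq_0_sym by blast

lemma HX: "i \<in> Idx \<Longrightarrow> br (H i) Xe = of_nat (th i) * Xe"
  using br_rnest_weight[of 1 "N-1" "H i" E "cartan i"] HE N cartan_sum[of N i] by auto

lemma HT: assumes i: "i \<in> Idx" shows "br (H i) T = of_nat (th i) * D"
proof -
  let ?Y = "br (H i) T"
  have "br ?Y Xe = br (H i) (br T Xe) - br T (br (H i) Xe)"
    by (rule br_jacobi_left)
  also have "\<dots> = 0"
    using XT by (simp add: HX[OF i] br_mult_right br_eq_0_sym)
  finally have YT: "br ?Y T = 0"
    by (rule commutant)
  then have YT': "?Y * T = T * ?Y"
    by (simp add: br_eq_0_iff)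
  have "T * ?Y + T * ?Y = br (H i) (T * T)"
    by (simp only: br_mult_right YT')
  also have "\<dots> = j (2 * h) * (of_nat (th i) * Xe)"
    by (simp add: T_square br_add_right br_mult_right j_central' HX[OF i])
  also have "\<dots> = of_nat (th i) * (T * T - 1)"
    by (simp add: T_square flip: mult.assoc) (simp add: j_commute)
  finally have "V * (T * ?Y + T * ?Y) = V * (of_nat (th i) * (T * T - 1))"
    by simp
  then have "?Y + ?Y = of_nat (th i) * (V * (T * T - 1))"
    by (metis distrib_left TV'(2) mult.assoc mult_of_nat_commute)
  also have "\<dots> = of_nat (th i) * D + of_nat (th i) * D"
    by (simp add: DD algebra_simps flip: distrib_left)
  finally show ?thesis
    by (rule halve)
qed

lemma HsE: "k \<in> Idx \<Longrightarrow> br Hs (E k) = of_nat (th k) * E k"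
  using cartan_sum'[of N k] N
  by (simp add: Hs_def br_sum_left HE flip: sum_distrib_right of_int_sum)

lemma HsT: "br Hs T = T - V"
proof -
  have "br Hs T = of_nat (\<Sum>i\<in>Idx. th i) * D"
    by (simp add: Hs_def br_sum_left HT sum_distrib_right of_nat_sum)
  also have "\<dots> = T - V"
    by (simp add: theta_sum N mult_2 DD)
  finally show ?thesis .
qed

lemma HHs: "i \<in> Idx \<Longrightarrow> br (H i) Hs = 0"
  by (simp add: Hs_def br_sum_right HH)

lemma V_pow_br:
  assumes "br V x = 0" "br V y = 0"
  shows "br (V ^ p * x) (V ^ q * y) = V ^ (p + q) * br x y"
proof -
  have 1: "br (V ^ p) y = 0" "br x (V ^ q) = 0" "br (V ^ p) (V ^ q) = 0"
    using assms by (meson br_eq_0_sym br_power_0 br_self)+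
  have "br (V ^ p * x) (V ^ q * y) = V ^ p * V ^ q * br x y"
    using 1 by (simp add: br_mult_left br_mult_right mult.assoc)
      (metis add.commute mult.assoc power_add)
  then show ?thesis by (simp add: power_add)
qed

lemma Va: "i \<in> Idx \<Longrightarrow> br V (a i) = 0" and Ta: "i \<in> Idx \<Longrightarrow> br T (a i) = 0"
  unfolding a_def using VE TE br_V[of T] br_self[of V]
  by (auto intro!: br_mult_0 br_power_0 intro: br_eq_0_sym[OF br_V])

lemma br_V_0: "br V x = 0 \<Longrightarrow> br V y = 0 \<Longrightarrow> br V (br x y) = 0"
  by (simp add: br_jacobi)

lemma serre_a: "serre_family a (N-1)"
proof
  fix i assume i: "1 \<le> i" "i < N - 1"
  have *: "br V (E i) = 0" "br V (E (Suc i)) = 0"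
    using i by (auto intro!: VE)
  then show "br (a i) (br (a i) (a (Suc i))) = 0" "br (a (Suc i)) (br (a (Suc i)) (a i)) = 0"
    using i EEE[of i "Suc i"] EEE[of "Suc i" i]
    by (auto simp: a_def V_pow_br br_V_0 cartan_def)
next
  fix i k assume ik: "1 \<le> i" "Suc i < k" "k \<le> N - 1"
  have "br V (E i) = 0" "br V (E k) = 0"
    using ik by (auto intro!: VE)
  then show "br (a i) (a k) = 0"
    using ik EE[of i k] by (auto simp: a_def V_pow_br cartan_def)
qed (rule no_2_torsion)

abbreviation "Xa \<equiv> rnest a (N-1) 1"

lemma Xa: "Xa = V * V * Xe"
proof -
  have "Xa = V ^ (\<Sum>m = 1..N-1. th m) * Xe"
    unfolding a_def using N by (intro rnest_scale VE) auto
  then show ?thesis by (simp add: theta_sum N power2_eq_square)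
qed

lemma X_Xa: "Xe = T * T * Xa"
  by (simp add: Xa mult.assoc)

text \<open>Multiply T^2 = 1 + 2hX by V^2: the inverse V depends on \<open>Xa\<close> = V^2 X as T
  depends on X, with h replaced by -h.\<close>

lemma VV: "V * V = 1 - j (2 * h) * Xa"
proof -
  have "1 = V * (V * (T * T))" by simp
  also have "\<dots> = V * V + j (2 * h) * (V * V * Xe)"
    by (simp add: T_square algebra_simps j_commute')
  finally show ?thesis unfolding Xa by (metis add_diff_cancel_right')
qed

lemma EF_a: "\<lbrakk>i \<in> Idx; k \<in> Idx\<rbrakk> \<Longrightarrow> br (a i) (F k) = (if i = k then V ^ th i * Ht i else 0)"
  using EF[of i k] theta_01[of i]
  by (auto simp: a_def Ht_def Hs_def D_def algebra_simps)

lemma Fa_0: "\<lbrakk>i \<in> Idx; k \<in> Idx; i \<noteq> k\<rbrakk> \<Longrightarrow> br (F k) (a i) = 0"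
  using EF_a[of i k] br_eq_0_sym by auto

lemma HtT: "i \<in> Idx \<Longrightarrow> br (Ht i) T = of_nat (th i) * (T * T * D)"
proof -
  assume i: "i \<in> Idx"
  have D0: "br D T = 0" using br_D[of T] br_eq_0_sym by auto
  then have "br (Ht i) T = of_nat (th i) * D + of_nat (th i) * (T * D * (T - V))"
    by (simp add: Ht_def br_add_left br_mult_left HT[OF i] HsT br_eq_0_sym[OF br_of_nat])
  also have "T * D * (T - V) = T * T * D - D"
    using D0 br_V[OF D0] by (simp add: br_def algebra_simps)
  finally show ?thesis by (simp add: algebra_simps)
qed

text \<open>[T, V^theta Ht_k] is a polynomial in T and V, hence commutes with R; the Jacobi identity
  does the rest.\<close>

lemma c_R:
  assumes k: "k \<in> Idx" and R: "br T R = 0"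
  shows "br T (br (V ^ th k * Ht k) R) = 0"
proof -
  have RT: "br R T = 0" using R br_eq_0_sym by blast
  have "br T (V ^ th k * Ht k) = - (V ^ th k * (of_nat (th k) * (T * T * D)))"
    using HtT[OF k] br_power_0[of T V] br_V[of T] by (simp add: br_mult_right br_commute[of T "Ht k"])
  moreover have "br R (V ^ th k * (of_nat (th k) * (T * T * D))) = 0"
    using RT br_V[OF RT] br_D[OF RT] by (simp add: br_mult_0 br_power_0)
  ultimately show ?thesis
    using R by (simp add: br_jacobi[of T "V ^ th k * Ht k" R] br_minus_left br_eq_0_sym)
qed

lemma Ta_rnest: "1 \<le> k \<Longrightarrow> k \<le> N-1 \<Longrightarrow> br T (rnest a (N-1) k) = 0"
  by (rule br_rnest_0) (auto intro!: Ta)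

lemma Ta_lnest: "1 \<le> k \<Longrightarrow> k \<le> N-1 \<Longrightarrow> br T (lnest a k) = 0"
  by (rule br_lnest_0) (auto intro!: Ta)

text \<open>Inside \<open>Xa\<close> = [L, [a_k, R]] the element F_k meets only a_k and turns it
  into -H_k. As R is an eigenvector of ad H_k, the result is a multiple of [L, R] = 0.\<close>

lemma FXa_interior:
  assumes k: "k \<in> Idx" "th k = 0"
  shows "br (F k) Xa = 0"
proof -
  have k': "1 < k" "k < N-1"
    using k by (auto simp: theta_def split: if_splits)
  let ?L = "lnest a (k - 1)" and ?R = "rnest a (N-1) (Suc k)"
  have "Xa = br ?L (rnest a (N-1) k)"
    using serre_family.rnest_split[OF serre_a, of "k - 1"] k' by simp
  then have Xe: "Xa = br ?L (br (a k) ?R)"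
    using k' by (simp add: rnest_step)
  have FL: "br (F k) ?L = 0" and FR: "br (F k) ?R = 0"
    using k' k by (auto intro!: br_lnest_0 br_rnest_0 Fa_0)
  have Fk: "br (F k) (a k) = - H k"
    using EF_a[of k k] k br_commute[of "F k"] by (simp add: Ht_def)
  have HV: "br (H k) V = 0"
    using HT[OF k(1)] k by (intro br_V) simp
  have "br (H k) (a m) = of_int (cartan k m) * a m" if "m \<in> Idx" for m
    using HV HE[OF k(1) that] by (simp add: a_def br_mult_right br_power_0 of_int_left_commute)
  then have "br (H k) ?R = of_int (\<Sum>m = Suc k..N-1. cartan k m) * ?R"
    using k k' by (intro br_rnest_weight) auto
  moreover have "br ?L ?R = 0"
    using serre_family.lnest_rnest_0[OF serre_a, of "k-1" "Suc k"] k' by auto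
  ultimately show ?thesis
    by (simp add: Xe br_jacobi[of "F k" ?L] FL br_jacobi[of "F k" "a k"] FR Fk br_minus_left br_minus_right
        br_mult_right del: of_int_sum)
qed

text \<open>At an end node one side of a_k is empty, and [F_k, Xa] is up to sign the bracket of
  V^theta Ht_k with the nest of the remaining a_m. That nest commutes with T, so \<open>c_R\<close>
  applies.\<close>

lemma FXa_T:
  assumes k: "k \<in> Idx"
  shows "br T (br (F k) Xa) = 0"
proof -
  have Fk: "br (F k) (a k) = - (V ^ th k * Ht k)"
    using EF_a[of k k] k br_commute[of "F k"] by simp
  consider "th k = 0" | "k = 1" | "k = N-1"
    by (auto simp: theta_def split: if_splits)
  then show ?thesis
  proof cases
    case 1
    then show ?thesis using FXa_interior k by simp
  next
    case 2
    let ?R = "rnest a (N-1) 2"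
    have Xe: "Xa = br (a k) ?R"
      using 2 N by (simp add: rnest_step numeral_2_eq_2)
    have "br (F k) ?R = 0"
      using 2 k N by (intro br_rnest_0 Fa_0) auto
    then have "br (F k) Xa = - br (V ^ th k * Ht k) ?R"
      by (simp add: Xe br_jacobi[of "F k" "a k"] Fk br_minus_left)
    then show ?thesis
      using c_R[OF k Ta_rnest[of 2]] N by (simp add: br_minus_right)
  next
    case 3
    let ?L = "lnest a (N-2)"
    have N2: "Suc (N-2) = N-1" using N by simp
    have "Xa = lnest a (Suc (N-2))"
      using serre_family.rnest_eq_lnest[OF serre_a] N N2 by simp
    then have Xe: "Xa = br ?L (a k)"
      using 3 N N2 lnest_Suc[of "N-2" a] by simp
    have "br (F k) ?L = 0"
      using 3 k N by (intro br_lnest_0 Fa_0) auto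
    then have "br (F k) Xa = br (V ^ th k * Ht k) ?L"
      by (simp add: Xe br_jacobi[of "F k" ?L] Fk br_minus_right br_commute[of ?L "V ^ th k * Ht k"])
    then show ?thesis
      using c_R[OF k Ta_lnest[of "N-2"]] N by simp
  qed
qed

lemma FVV: "br (F k) (V * V) = - (j (2 * h) * br (F k) Xa)"
  by (simp add: VV br_diff_right br_mult_right j_central')

lemma FTT: "br (F k) (T * T) = - (T * T * br (F k) (V * V) * (T * T))"
proof -
  have "0 = br (F k) (T * T * (V * V))"
    by (simp add: mult.assoc)
  also have "\<dots> = br (F k) (T * T) * (V * V) + T * T * br (F k) (V * V)"
    by (rule br_mult_right)
  finally have "br (F k) (T * T) * (V * V) = - (T * T * br (F k) (V * V))"
    by (metis eq_neg_iff_add_eq_0)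
  then have "br (F k) (T * T) * (V * V) * (T * T) = - (T * T * br (F k) (V * V)) * (T * T)"
    by simp
  then show ?thesis by (simp add: mult.assoc)
qed

text \<open>Carries the knowledge of [F_k, Xa] over to X = T^2 Xa. The bracket with T^2 is expressed
  through V^2 = 1 - 2h Xa, so that only [F_k, Xa], Xa, T and scalars are left on the right.\<close>

lemma FX: "br (F k) Xe = T * T * (br (F k) Xa + j (2 * h) * br (F k) Xa * (T * T) * Xa)"
  unfolding X_Xa br_mult_right[of "F k" "T * T"] FTT FVV by (simp add: algebra_simps)

lemma T_Xa: "br T Xa = 0"
  using N by (intro Ta_rnest) auto

text \<open>By Jacobi [[F_k, T], X] is [F_k, [T, X]] minus [T, [F_k, X]]. Both vanish, and
  \<open>commutant\<close> passes from X to T.\<close>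

lemma FTT_0: "k \<in> Idx \<Longrightarrow> br (br (F k) T) T = 0"
proof (rule commutant)
  assume k: "k \<in> Idx"
  have "br T (br (F k) Xe) = 0"
    unfolding FX using FXa_T[OF k] T_Xa
    by (intro br_mult_0) (auto simp: br_add_right br_mult_0 j_central')
  then show "br (br (F k) T) Xe = 0"
    using XT by (simp add: br_jacobi_left br_eq_0_sym[OF XT])
qed

lemma GT: "k \<in> Idx \<Longrightarrow> br (G k) T = 0"
  using FTT_0 br_V[of T] by (simp add: G_def br_mult_left br_eq_0_sym)

lemma G_0: "k \<in> Idx \<Longrightarrow> th k = 0 \<Longrightarrow> G k = 0"
proof -
  assume k: "k \<in> Idx" "th k = 0"
  then have "br (F k) Xe = 0" by (simp add: FX FXa_interior)
  then have "br (F k) T = 0" by (rule commutant)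
  then show ?thesis by (simp add: G_def)
qed

lemma FT: "br (F k) T = T * G k"
  by (simp add: G_def)

lemma GV: "k \<in> Idx \<Longrightarrow> br (G k) V = 0"
  by (rule br_V) (rule GT)

lemma FV: "k \<in> Idx \<Longrightarrow> br (F k) V = - (V * G k)"
proof -
  assume k: "k \<in> Idx"
  have "0 = br (F k) (T * V)" by simp
  also have "\<dots> = T * G k * V + T * br (F k) V"
    unfolding br_mult_right FT by simp
  finally have "T * br (F k) V = - (T * G k * V)" by (metis eq_neg_iff_add_eq_0 add.commute)
  then have "V * (T * br (F k) V) = V * (- (T * G k * V))" by simp
  then show ?thesis using GV[OF k] by (simp add: br_eq_0_iff mult.assoc)
qed

lemma HF': "\<lbrakk>i \<in> Idx; k \<in> Idx\<rbrakk> \<Longrightarrow> br (H i) (F k) =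
      - (of_int (cartan i k) * F k) + of_nat (th i) * (G k * Hs)"
  using HF[of i k] by (simp add: G_def Hs_def)

lemma HsF: assumes k: "k \<in> Idx" shows "br Hs (F k) = - (of_nat (th k) * F k) + G k * Hs + G k * Hs"
proof -
  have "br Hs (F k) = - (of_int (\<Sum>i\<in>Idx. cartan i k) * F k) + of_nat (\<Sum>i\<in>Idx. th i) * (G k * Hs)"
    unfolding of_int_sum of_nat_sum sum_distrib_right
    using HF'[OF _ k] by (simp add: br_sum_left[of H Idx, folded Hs_def] sum.distrib sum_negf sum_subtractf)
  then show ?thesis
    using k by (simp add: theta_sum N cartan_sum' mult_2 del: of_int_sum of_nat_sum)
qed

text \<open>[H_i, T G_k] = [H_i, [F_k, T]] is evaluated with Leibniz on one side and Jacobi on the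
  other. The theta_i-terms, which come from [H_i, F_k] and from [H_i, T], add up to T G_k and shift
  the weight -a_ik by theta_i.\<close>

lemma HG: assumes "i \<in> Idx" "k \<in> Idx"
  shows "br (H i) (G k) = of_int (int (th i) - cartan i k) * G k"
proof (rule T_cancel)
  let ?t = "of_nat (th i) :: 'a" and ?c = "of_int (cartan i k) :: 'a"
  have tc: "x * ?t = ?t * x" "x * ?c = ?c * x" "x * (?t * y) = ?t * (x * y)" "x * (?c * y) = ?c * (x * y)" for x y
    by (simp_all add: mult_of_nat_commute mult_of_int_commute) (metis mult.assoc mult_of_nat_commute mult_of_int_commute)+
  have GTV: "G k * T = T * G k" "G k * V = V * G k"
    using GT GV assms by (simp_all add: br_eq_0_iff)
  have "br (H i) (T * G k) = br (H i) (br (F k) T)"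
    by (simp add: FT)
  also have "\<dots> = br (br (H i) (F k)) T + br (F k) (br (H i) T)"
    by (rule br_jacobi)
  also have "br (br (H i) (F k)) T = - (?c * (T * G k)) + ?t * (G k * (T - V))"
    using GT[OF assms(2)]
    by (simp add: HF'[OF assms] br_diff_left br_add_left br_minus_left br_mult_left FT HsT br_eq_0_sym[OF br_of_int] br_eq_0_sym[OF br_of_nat])
  also have "br (F k) (br (H i) T) = ?t * (c2 * (T * G k + V * G k))"
    using HT[OF assms(1)] FV[OF assms(2)] by (simp add: br_mult_right D_def j_central' br_diff_right FT)
  also have "br (H i) (T * G k) = ?t * (D * G k) + T * br (H i) (G k)"
    by (simp add: br_mult_right HT[OF assms(1)] mult.assoc)
  finally have "T * br (H i) (G k) = - (?c * (T * G k)) + ?t * (G k * (T - V) + c2 * (T * G k + V * G k) - D * G k)"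
    by (simp add: algebra_simps)
  also have "G k * (T - V) + c2 * (T * G k + V * G k) - D * G k = G k * (T - V) + (c2 * (V * G k) + c2 * (V * G k))"
    by (simp add: D_def algebra_simps)
  also have "\<dots> = T * G k"
    unfolding c2_mult by (simp add: GTV algebra_simps)
  finally show "T * br (H i) (G k) = T * (of_int (int (th i) - cartan i k) * G k)"
    by (simp add: algebra_simps tc)
qed

text \<open>The weights of \<open>HG\<close> add up to 2 - theta_k, which is 1 wherever G_k does not
  vanish.\<close>

lemma HsG: assumes k: "k \<in> Idx" shows "br Hs (G k) = G k"
proof -
  have "br Hs (G k) = of_int (int (\<Sum>i\<in>Idx. th i) - (\<Sum>i\<in>Idx. cartan i k)) * G k"
    unfolding Hs_def br_sum_left of_nat_sum sum_subtractf[symmetric] of_int_sum sum_distrib_right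
    using k by (intro sum.cong) (auto simp: HG simp del: of_int_diff)
  also have "\<dots> = of_int (2 - int (th k)) * G k"
    using k by (simp only: theta_sum N cartan_sum') (auto simp: cartan_sum' N)
  finally show ?thesis
    using theta_01[of k] G_0[OF k] by auto
qed

lemma aK: assumes "i \<in> Idx" "k \<in> Idx" shows "br (a i) (K k) = (if i = k then Ht i else 0)"
proof -
  have "br (a i) (K k) = T ^ th k * br (a i) (F k)"
    using br_power_0[of "a i" T] br_eq_0_sym[OF Ta] assms by (simp add: K_def br_mult_right)
  moreover have "T ^ th k * (V ^ th k * x) = x" for x
    using theta_01[of k] by auto
  ultimately show ?thesis
    using assms by (auto simp: EF_a)
qed

text \<open>E_i commutes with T, so bracketing [F_k, T] with E_i only involves [E_i, F_k]. The cases
  theta_i = 0 and 1 are treated apart because the mixed relation is given for V^theta E_i.\<close>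

lemma EG: assumes "i \<in> Idx" "k \<in> Idx"
  shows "br (E i) (G k) = (if i = k then of_nat (th i) * (T * D) else 0)"
proof (rule T_cancel)
  have "T * br (E i) (G k) = br (E i) (br (F k) T)"
    unfolding FT by (simp add: br_mult_right ET[OF assms(1)])
  also have "\<dots> = br (br (E i) (F k)) T"
    by (simp add: br_jacobi[of "E i" "F k" T] ET[OF assms(1)])
  finally have *: "T * br (E i) (G k) = br (br (E i) (F k)) T" .
  have E: "E i = T ^ th i * a i"
    using theta_01[of i] by (auto simp: a_def)
  have "br (br (E i) (F k)) T = (if i = k then of_nat (th i) * (T * T * D) else 0)"
  proof (cases "th i = 0")
    case True
    then show ?thesis
      using HtT[OF assms(1)] EF_a[OF assms] by (auto simp: E)
  next
    case False
    then have th: "th i = 1" using theta_01[of i] by auto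
    have "br (E i) (F k) = T * br (a i) (F k) + br T (F k) * a i"
      by (simp add: E th br_mult_left)
    also have "\<dots> = (if i = k then Ht i else 0) - T * G k * a i"
      using EF_a[OF assms] th by (auto simp: br_commute[of T "F k"] FT)
    finally show ?thesis
      using GT[OF assms(2)] br_eq_0_sym[OF Ta[OF assms(1)]] HtT[OF assms(1)]
      by (auto simp: br_diff_left br_mult_left)
  qed
  then show "T * br (E i) (G k) = T * (if i = k then of_nat (th i) * (T * D) else 0)"
    using * by (simp add: mult.assoc of_nat_left_commute)
qed

end

section \<open>Polynomial Serre relations and the undeformed generators\<close>

context jordan_rep
begin

definition "g k = T * G k"
text \<open>Up to sign the antipode of \<open>Hs\<close>. Under ad \<open>Hts\<close> the a_i and
  K_i have the plain weights theta_i and -theta_i, whereas ad \<open>Hs\<close> produces further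
  factors and terms.\<close>

definition "Hts = T * T * Hs"
text \<open>An undeformed generator: with the E_i and H_i the f_k satisfy the relations of sl(N)
  itself, by \<open>Ef\<close>, \<open>Htf\<close>, \<open>ff\<close> and
  \<open>fff\<close>.\<close>

definition "f k = F k - G k * Hs"

lemma no_3_torsion: assumes "y + y + y = (0::'a)" shows "y = 0"
proof -
  have "j (1/3) + j (1/3) + j (1/3) = 1"
    by (simp add: j_one flip: j_add)
  then have "y = (j (1/3) + j (1/3) + j (1/3)) * y" by simp
  also have "\<dots> = j (1/3) * (y + y + y)" by (simp add: algebra_simps)
  finally show ?thesis using assms by simp
qed

lemma G_T: "k \<in> Idx \<Longrightarrow> G k * T = T * G k" and G_V: "k \<in> Idx \<Longrightarrow> G k * V = V * G k"
  using GT GV by (simp_all add: br_eq_0_iff)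

lemma gT: "k \<in> Idx \<Longrightarrow> br (g k) T = 0"
  using GT by (simp add: g_def br_mult_left)

lemma KT: "k \<in> Idx \<Longrightarrow> br (K k) T = T * g k"
  using theta_01[of k] G_0[of k] by (auto simp: K_def br_mult_left FT g_def br_power_0)

lemma HtsK: "k \<in> Idx \<Longrightarrow> br Hts (K k) = - (of_nat (th k) * K k)"
proof -
  assume k: "k \<in> Idx"
  consider "th k = 0" | "th k = 1" using theta_01[of k] by auto
  then show ?thesis
  proof cases
    case 1
    then have "br T (F k) = 0"
      using FT[of k] G_0[OF k] by (simp add: br_eq_0_sym)
    then show ?thesis
      using 1 HsF[OF k] G_0[OF k] by (simp add: Hts_def K_def br_mult_left)
  next
    case 2
    have TF: "br T (F k) = - (T * G k)"
      by (simp add: br_commute[of T] FT)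
    have 3: "br Hs (T * F k) = - (V * F k) + T * (G k * Hs) + T * (G k * Hs)"
      unfolding br_mult_right HsT HsF[OF k] using 2 by (simp add: algebra_simps)
    have 4: "br (T * T) (T * F k) = - (T * (T * (T * G k))) - (T * (T * (T * G k)))"
      using G_T[OF k] by (simp add: br_mult_right br_mult_left TF mult.assoc algebra_simps)
    have "br (T * T * Hs) (T * F k) = - (T * F k)"
      unfolding br_mult_left[of "T * T" Hs] 3 4 by (simp add: algebra_simps)
    then show ?thesis
      using 2 by (simp add: Hts_def K_def)
  qed
qed

lemma VKT: "k \<in> Idx \<Longrightarrow> V * K k * T = K k + g k"
  using KT[of k] by (simp add: br_def algebra_simps)

lemma VgT: "k \<in> Idx \<Longrightarrow> V * g k * T = g k"
  using gT[of k] by (simp add: br_def algebra_simps)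

lemma conj_br: "V * br x y * T = br (V * x * T) (V * y * T)"
  by (simp add: br_def algebra_simps)

lemma conj_br': "T * br x y * V = br (T * x * V) (T * y * V)"
  by (simp add: br_def algebra_simps)

lemma TgV: "k \<in> Idx \<Longrightarrow> T * g k * V = g k"
  using br_V[OF gT, of k] by (simp add: br_def algebra_simps)

lemma TKV: "k \<in> Idx \<Longrightarrow> T * K k * V = K k - g k"
proof -
  assume k: "k \<in> Idx"
  have "T * (K k + g k) * V = K k"
    by (simp add: VKT[OF k, symmetric] mult.assoc)
  then show ?thesis using TgV[OF k] by (simp add: algebra_simps)
qed

lemma bilinear_expand:
  fixes s :: 'a
  assumes "br s x = 0" "br s x' = 0" "br s y = 0" "br s y' = 0"
  shows "br (x + s * x') (y + s * y') = br x y + s * (br x y' + br x' y) + s * s * br x' y'"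
proof -
  have c: "x * (s * z) = s * (x * z)" "x' * (s * z) = s * (x' * z)"
    "y * (s * z) = s * (y * z)" "y' * (s * z) = s * (y' * z)" for z
    using assms by (simp_all add: br_def flip: mult.assoc)
  show ?thesis by (simp add: br_def algebra_simps c)
qed

lemma trilinear_expand:
  fixes s :: 'a
  assumes s: "br s x = 0" "br s x' = 0" "br s y = 0" "br s y' = 0"
  shows "br (x + s * x') (br (x + s * x') (y + s * y')) = br x (br x y)
    + s * (br x' (br x y) + br x (br x' y) + br x (br x y'))
    + s * s * (br x (br x' y') + br x' (br x y') + br x' (br x' y))
    + s * s * s * br x' (br x' y')"
proof -
  have c: "x * (s * z) = s * (x * z)" "x' * (s * z) = s * (x' * z)"
    "y * (s * z) = s * (y * z)" "y' * (s * z) = s * (y' * z)" for z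
    using assms by (simp_all add: br_def flip: mult.assoc)
  show ?thesis by (simp add: br_def algebra_simps c)
qed

text \<open>The bracket of K_i + s g_i with K_k + s g_k is quadratic in s with constant term 0. Its
  values at s = 1 and s = -1 vanish, and their sum is twice the leading coefficient.\<close>

lemma KK_coeffs:
  assumes ik: "i \<in> Idx" "k \<in> Idx" "i \<noteq> k" "cartan i k = 0"
  shows "br (K i) (g k) + br (g i) (K k) = 0" "br (g i) (g k) = 0"
proof -
  have 0: "br (K i) (K k) = 0"
    using KK[OF ik] by (simp add: K_def)
  let ?c1 = "br (K i) (g k) + br (g i) (K k)" and ?c2 = "br (g i) (g k)"
  have "0 = br (K i + 1 * g i) (K k + 1 * g k)"
    using conj_br[of "K i" "K k"] 0 by (simp add: VKT[OF ik(1)] VKT[OF ik(2)])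
  then have 1: "?c1 + ?c2 = 0"
    using 0 by (subst (asm) bilinear_expand) auto
  have "0 = br (K i + (- 1) * g i) (K k + (- 1) * g k)"
    using conj_br'[of "K i" "K k"] 0 by (simp add: TKV[OF ik(1)] TKV[OF ik(2)])
  then have 2: "- ?c1 + ?c2 = 0"
    using 0 by (subst (asm) bilinear_expand) (auto simp: br_minus_left)
  have "?c2 + ?c2 = (?c1 + ?c2) + (- ?c1 + ?c2)" by simp
  then have "?c2 + ?c2 = 0" using 1 2 by simp
  then show c2: "?c2 = 0" by (rule no_2_torsion)
  show "?c1 = 0" using 1 c2 by simp
qed

text \<open>The linear system for x s + y s^2 + z s^3 vanishing at s = 1, -1 and 2. Elimination
  produces 2y and 6z, which is where the absence of 2- and 3-torsion enters.\<close>

lemma cubic_coeffs: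
  fixes x y z :: 'a
  assumes 1: "x + y + z = 0" and 2: "- x + y - z = 0" and 3: "2 * x + 2 * 2 * y + 2 * 2 * 2 * z = 0"
  shows "x = 0" "y = 0" "z = 0"
proof -
  have "y + y = (x + y + z) + (- x + y - z)" by (simp add: algebra_simps)
  then have "y + y = 0" by (simp only: 1 2) simp
  then show y: "y = 0" by (rule no_2_torsion)
  have x: "x = - z" using 1 y by (simp add: eq_neg_iff_add_eq_0)
  have 8: "2 * 2 * 2 * z = z + z + z + z + z + z + z + z"
  proof -
    have "2 * 2 * 2 * z = (1 + 1 + 1 + 1 + 1 + 1 + 1 + (1::'a)) * z" by simp
    also have "\<dots> = z + z + z + z + z + z + z + z" by (simp only: distrib_right mult_1_left)
    finally show ?thesis .
  qed
  have "(z + z + z) + (z + z + z) = 2 * x + 2 * 2 * y + 2 * 2 * 2 * z"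
    unfolding x y 8 unfolding mult_2 mult_zero_right
    by (simp only: add.assoc minus_add_cancel add_0_left add_0_right)
  then have "z + z + z = 0"
    unfolding 3 by (rule no_2_torsion)
  then show z: "z = 0" by (rule no_3_torsion)
  show "x = 0" using x z by simp
qed

lemma KKK_coeffs:
  assumes ik: "i \<in> Idx" "k \<in> Idx" "cartan i k = -1"
  shows "br (K i) (br (K i) (K k)) = 0"
    "br (g i) (br (K i) (K k)) + br (K i) (br (g i) (K k)) + br (K i) (br (K i) (g k)) = 0"
    "br (K i) (br (g i) (g k)) + br (g i) (br (K i) (g k)) + br (g i) (br (g i) (K k)) = 0"
    "br (g i) (br (g i) (g k)) = 0"
proof -
  show 0: "br (K i) (br (K i) (K k)) = 0"
    using KKK[OF ik] by (simp add: K_def)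
  let ?c1 = "br (g i) (br (K i) (K k)) + br (K i) (br (g i) (K k)) + br (K i) (br (K i) (g k))"
  let ?c2 = "br (K i) (br (g i) (g k)) + br (g i) (br (K i) (g k)) + br (g i) (br (g i) (K k))"
  let ?c3 = "br (g i) (br (g i) (g k))"
  have p: "s * ?c1 + s * s * ?c2 + s * s * s * ?c3 = 0"
    if "br (K i + s * g i) (br (K i + s * g i) (K k + s * g k)) = 0" "\<And>x. br s x = 0" for s
    using that(1) unfolding trilinear_expand[OF that(2) that(2) that(2) that(2)] 0 by simp
  \<comment> \<open>Conjugating by T once and twice gives s = 1 and s = 2, and conjugating by the
    inverse gives s = -1: three values for three unknown coefficients.\<close>
  have m1: "br (K i + g i) (br (K i + g i) (K k + g k)) = 0"
    using arg_cong[OF 0, of "\<lambda>x. V * x * T"] by (simp add: conj_br VKT[OF ik(1)] VKT[OF ik(2)])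
  have 3: "V * (K l + g l) * T = K l + 2 * g l" if "l \<in> Idx" for l
    using VKT[OF that] VgT[OF that] by (simp add: algebra_simps mult_2)
  have m2: "br (K i + 2 * g i) (br (K i + 2 * g i) (K k + 2 * g k)) = 0"
    using arg_cong[OF m1, of "\<lambda>x. V * x * T"] by (simp add: conj_br 3[OF ik(1)] 3[OF ik(2)])
  have mm: "br (K i - g i) (br (K i - g i) (K k - g k)) = 0"
    using arg_cong[OF 0, of "\<lambda>x. T * x * V"] by (simp add: conj_br' TKV[OF ik(1)] TKV[OF ik(2)])
  have 1: "?c1 + ?c2 + ?c3 = 0"
    using p[of 1] m1 by simp
  have 2: "- ?c1 + ?c2 - ?c3 = 0"
    using p[of "-1"] mm by (simp add: br_minus_left)
  have "br 2 x = 0" for x :: 'a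
    using br_eq_0_sym[OF br_of_nat[of x 2]] by simp
  then have 3: "2 * ?c1 + 2 * 2 * ?c2 + 2 * 2 * 2 * ?c3 = 0"
    using p[of 2] m2 by simp
  show "?c1 = 0" "?c2 = 0" "?c3 = 0"
    using cubic_coeffs[OF 1 2 3] by simp_all
qed

lemma Hs_weight_pow: "br Hs (V ^ m) = - (of_nat m * (V ^ m * (1 - V * V)))"
proof (induction m)
  case (Suc m)
  have "0 = br Hs (V * T)" by simp
  also have "\<dots> = br Hs V * T + V * (T - V)" by (simp only: br_mult_right HsT)
  finally have "br Hs V * T * V = - (V * (T - V)) * V" by (metis eq_neg_iff_add_eq_0)
  then have HsV: "br Hs V = - (V * (1 - V * V))"
    by (simp add: algebra_simps)
  have "V ^ m * V = V * V ^ m" by (simp add: power_commutes)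
  then have 1: "V ^ m * (V * x) = V * (V ^ m * x)" for x by (metis mult.assoc)
  show ?case
    by (simp add: br_mult_right HsV Suc algebra_simps of_nat_left_commute power_commutes 1)
qed simp

lemma KV_pow: assumes k: "k \<in> Idx" shows "br (K k) (V ^ m) = - (of_nat m * (V ^ m * g k))"
proof (induction m)
  case (Suc m)
  have "0 = br (K k) (V * T)" by simp
  also have "\<dots> = br (K k) V * T + V * (T * g k)" by (simp only: br_mult_right KT[OF k])
  finally have "br (K k) V * T * V = - g k * V" by (metis eq_neg_iff_add_eq_0 TV'(2))
  moreover have gV: "g k * V = V * g k" using br_V[OF gT[OF k]] by (simp add: br_def)
  ultimately have KV: "br (K k) V = - (V * g k)"
    by (simp add: mult.assoc)
  have 2: "g k * (V ^ m) = V ^ m * g k" using br_power_0[OF br_V[OF gT[OF k]], of m] by (simp add: br_def)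
  have 1: "V ^ m * (V * x) = V * (V ^ m * x)" for x by (metis mult.assoc power_commutes)
  show ?case
    by (simp add: br_mult_right KV Suc algebra_simps of_nat_left_commute 1 2)
qed simp

lemma f_eq: "k \<in> Idx \<Longrightarrow> f k = V ^ th k * (K k - g k * Hs)"
  using theta_01[of k] G_0[of k] by (auto simp: f_def K_def g_def algebra_simps)

lemma Hsf: assumes k: "k \<in> Idx" shows "br Hs (f k) = - (of_nat (th k) * f k)"
proof -
  have "br Hs (f k) = - (of_nat (th k) * F k) + G k * Hs"
    by (simp add: f_def br_diff_right br_mult_right HsF[OF k] HsG[OF k])
  also have "\<dots> = - (of_nat (th k) * f k)"
    using theta_01[of k] G_0[OF k] by (auto simp: f_def)
  finally show ?thesis .
qed

text \<open>Normal ordering: powers of V to the far left, Hs to the far right. Moving Hs and K_k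
  past V^m produces terms m V^m g_k Z of opposite signs, which cancel. The second claim renews the
  weight hypothesis for the next factor.\<close>

lemma f_mult:
  assumes k: "k \<in> Idx" and Z: "br Hs (V ^ m * Z) = - (of_nat m * (V ^ m * Z))"
  shows "f k * (V ^ m * Z) = V ^ (th k + m) * (K k * Z - g k * (Z * Hs))"
    and "br Hs (V ^ (th k + m) * (K k * Z - g k * (Z * Hs))) =
      - (of_nat (th k + m) * (V ^ (th k + m) * (K k * Z - g k * (Z * Hs))))"
proof -
  have HZ: "Hs * (V ^ m * Z) = V ^ m * (Z * Hs) - of_nat m * (V ^ m * Z)"
    using Z by (simp add: br_def algebra_simps)
  have KZ: "K k * (V ^ m * Z) = V ^ m * (K k * Z) - of_nat m * (V ^ m * (g k * Z))"
  proof -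
    have "K k * V ^ m = V ^ m * K k - of_nat m * (V ^ m * g k)"
      using KV_pow[OF k, of m] by (simp add: br_def algebra_simps)
    then show ?thesis by (simp add: left_diff_distrib flip: mult.assoc)
  qed
  have "g k * (V ^ m) = V ^ m * g k"
    using br_power_0[OF br_V[OF gT[OF k]], of m] by (simp add: br_def)
  then have gZ: "g k * (V ^ m * z) = V ^ m * (g k * z)" for z by (metis mult.assoc)
  show 1: "f k * (V ^ m * Z) = V ^ (th k + m) * (K k * Z - g k * (Z * Hs))"
    by (simp add: f_eq[OF k] mult.assoc left_diff_distrib right_diff_distrib HZ KZ gZ power_add of_nat_left_commute)
  show "br Hs (V ^ (th k + m) * (K k * Z - g k * (Z * Hs))) =
      - (of_nat (th k + m) * (V ^ (th k + m) * (K k * Z - g k * (Z * Hs))))"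
    unfolding 1[symmetric] br_mult_right[of Hs "f k"] Hsf[OF k] Z by (simp add: algebra_simps of_nat_left_commute)
qed

text \<open>In normal order a product of f's is a power of V times the product of the K + s g, with
  each s^p replaced by (-Hs)^p at the right end. Serre expressions in the f's can thus be read off
  from the coefficients in s.\<close>

lemma f_products:
  assumes "x \<in> Idx" "y \<in> Idx"
  shows "f x * f y = V ^ (th x + th y) *
      (K x * K y - (K x * g y + g x * K y) * Hs + g x * g y * (Hs * Hs))" (is ?two)
    and "z \<in> Idx \<Longrightarrow> f z * (f x * f y) = V ^ (th z + (th x + th y)) *
      (K z * K x * K y - (K z * K x * g y + K z * g x * K y + g z * K x * K y) * Hs
        + (K z * g x * g y + g z * K x * g y + g z * g x * K y) * (Hs * Hs)
        - g z * g x * g y * (Hs * Hs * Hs))"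
proof -
  have Z0: "br Hs (V ^ 0 * 1) = - (of_nat 0 * (V ^ 0 * 1))" by simp
  note Z1 = f_mult[OF assms(2) Z0]
  note Z2 = f_mult[OF assms(1) Z1(2)]
  have fy: "f y = V ^ (th y + 0) * (K y * 1 - g y * (1 * Hs))"
    using Z1(1) by simp
  have fxy: "f x * f y = V ^ (th x + (th y + 0)) * (K x * (K y * 1 - g y * (1 * Hs)) - g x * ((K y * 1 - g y * (1 * Hs)) * Hs))"
    unfolding fy by (rule Z2(1))
  then show "f x * f y = V ^ (th x + th y) *
      (K x * K y - (K x * g y + g x * K y) * Hs + g x * g y * (Hs * Hs))"
    by (simp add: algebra_simps)
  assume z: "z \<in> Idx"
  show "f z * (f x * f y) = V ^ (th z + (th x + th y)) *
      (K z * K x * K y - (K z * K x * g y + K z * g x * K y + g z * K x * K y) * Hs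
        + (K z * g x * g y + g z * K x * g y + g z * g x * K y) * (Hs * Hs)
        - g z * g x * g y * (Hs * Hs * Hs))"
    unfolding fxy f_mult(1)[OF z Z2(2)] by (simp add: algebra_simps)
qed

lemma ff:
  assumes ik: "i \<in> Idx" "k \<in> Idx" "i \<noteq> k" "cartan i k = 0"
  shows "br (f i) (f k) = 0"
proof -
  have "br (f i) (f k) = V ^ (th i + th k) * (br (K i) (K k)
      - (br (K i) (g k) + br (g i) (K k)) * Hs + br (g i) (g k) * (Hs * Hs))"
    using ik by (simp add: br_def f_products add.commute[of "th k"]) (simp add: algebra_simps)
  then show ?thesis
    using KK_coeffs[OF ik] KK[OF ik] by (simp add: K_def)
qed

lemma fff:
  assumes ik: "i \<in> Idx" "k \<in> Idx" "cartan i k = -1"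
  shows "br (f i) (br (f i) (f k)) = 0"
proof -
  have e: "th k + (th i + th i) = th i + (th i + th k)" "th i + (th k + th i) = th i + (th i + th k)"
    by simp_all
  have "br (f i) (br (f i) (f k)) =
      f i * (f i * f k) - f i * (f k * f i) - (f i * (f k * f i) - f k * (f i * f i))"
    by (simp add: br_def algebra_simps)
  also have "\<dots> = V ^ (th i + (th i + th k)) * (br (K i) (br (K i) (K k))
      - (br (g i) (br (K i) (K k)) + br (K i) (br (g i) (K k)) + br (K i) (br (K i) (g k))) * Hs
      + (br (K i) (br (g i) (g k)) + br (g i) (br (K i) (g k)) + br (g i) (br (g i) (K k))) * (Hs * Hs)
      - br (g i) (br (g i) (g k)) * (Hs * Hs * Hs))"
    unfolding f_products(2)[OF ik(1) ik(2) ik(1)] f_products(2)[OF ik(2) ik(1) ik(1)]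
      f_products(2)[OF ik(1) ik(1) ik(2)] e
    by (simp only: right_diff_distrib[symmetric])
      (rule arg_cong[where f = "\<lambda>x. _ * x"], simp add: br_def algebra_simps)
  finally show ?thesis
    by (simp add: KKK_coeffs[OF ik])
qed

end

context jordan_rep
begin

lemma HV: assumes i: "i \<in> Idx" shows "br (H i) V = - (of_nat (th i) * (V * V * D))"
proof -
  have DV: "D * V = V * D"
    using br_V[OF br_eq_0_sym[OF br_D[of T]]] by (simp add: br_def)
  have "0 = br (H i) (V * T)" by simp
  also have "\<dots> = br (H i) V * T + V * (of_nat (th i) * D)" by (simp only: br_mult_right HT[OF i])
  finally have "br (H i) V * T * V = - (V * (of_nat (th i) * D)) * V" by (metis eq_neg_iff_add_eq_0)
  then show ?thesis by (simp add: mult.assoc DV of_nat_left_commute)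
qed

lemma HsVV: "br Hs (V * V) = - (V * V * (1 - V * V)) - V * V * (1 - V * V)"
  using Hs_weight_pow[of 2] by (simp add: power2_eq_square mult_2)

lemma Hts_a: "i \<in> Idx \<Longrightarrow> br Hts (a i) = of_nat (th i) * a i"
proof -
  assume i: "i \<in> Idx"
  have HsV: "br Hs V = - (V * (1 - V * V))"
    using Hs_weight_pow[of 1] by simp
  have "br Hts (a i) = T * T * br Hs (a i)"
    using Ta[OF i] by (simp add: Hts_def br_mult_left)
  also have "\<dots> = of_nat (th i) * a i"
    using theta_01[of i] HsE[OF i] by (auto simp: a_def br_mult_right HsV algebra_simps)
  finally show ?thesis .
qed

lemma ag: assumes "i \<in> Idx" "k \<in> Idx"
  shows "br (a i) (g k) = (if i = k then of_nat (th i) * (T * D) else 0)"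
proof -
  have "br (a i) (g k) = T * br (a i) (G k)"
    using br_eq_0_sym[OF Ta[OF assms(1)]] by (simp add: g_def br_mult_right)
  also have "br (a i) (G k) = V ^ th i * br (E i) (G k)"
    using br_power_0[OF GV[OF assms(2)], of "th i"] by (simp add: a_def br_mult_left br_eq_0_sym)
  finally show ?thesis
    using EG[OF assms] theta_01[of i] by auto
qed

lemma VK: "k \<in> Idx \<Longrightarrow> br V (K k) = V * g k"
  using KV_pow[of k 1] by (simp add: br_commute[of V])

end

section \<open>Two commuting representations and the coproduct formulas\<close>

definition commutant_set :: "'a::ring set \<Rightarrow> 'a set" where
  "commutant_set A = {x. \<forall>y\<in>A. br x y = 0}"

text \<open>Models the elements x (x) 1 and 1 (x) y of a tensor square inside one ring; commutation
  across is assumed for the generators.\<close>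

locale jordan_pair =
  A: jordan_rep j N E F H T V h + B: jordan_rep j N E2 F2 H2 T2 V2 h
  for j :: "complex \<Rightarrow> 'a::ring_1" and N E F H T V E2 F2 H2 T2 V2 h +
  assumes cross: "\<lbrakk>x \<in> E ` {1..N-1} \<union> F ` {1..N-1} \<union> H ` {1..N-1} \<union> {T, V};
    y \<in> E2 ` {1..N-1} \<union> F2 ` {1..N-1} \<union> H2 ` {1..N-1} \<union> {T2, V2}\<rbrakk> \<Longrightarrow> br x y = 0"
begin

abbreviation "Idx \<equiv> {1..N-1}"
abbreviation "th \<equiv> theta N"
abbreviation "c2 \<equiv> j (1/2)"

text \<open>\<open>C2\<close> is the commutant of the first representation and contains the second;
  \<open>C1\<close> is the bicommutant and contains the first. Both are closed under the ring
  operations, so all derived elements commute across as well.\<close>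

definition "C2 = commutant_set (E ` Idx \<union> F ` Idx \<union> H ` Idx \<union> {T, V})"
definition "C1 = commutant_set C2"

lemma C12: "x \<in> C1 \<Longrightarrow> y \<in> C2 \<Longrightarrow> br x y = 0"
  by (simp add: C1_def commutant_set_def)

lemma C21: "x \<in> C1 \<Longrightarrow> y \<in> C2 \<Longrightarrow> br y x = 0"
  using C12 br_eq_0_sym by blast

lemma C2_comm: "x \<in> C1 \<Longrightarrow> y \<in> C2 \<Longrightarrow> y * x = x * y"
  using C21 by (simp add: br_def)

lemma C2_comm': "x \<in> C1 \<Longrightarrow> y \<in> C2 \<Longrightarrow> y * (x * z) = x * (y * z)"
  using C2_comm by (metis mult.assoc)

lemma commutant_set_closed:
  "x \<in> commutant_set S \<Longrightarrow> y \<in> commutant_set S \<Longrightarrow> x + y \<in> commutant_set S"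
  "x \<in> commutant_set S \<Longrightarrow> y \<in> commutant_set S \<Longrightarrow> x - y \<in> commutant_set S"
  "x \<in> commutant_set S \<Longrightarrow> y \<in> commutant_set S \<Longrightarrow> x * y \<in> commutant_set S"
  "x \<in> commutant_set S \<Longrightarrow> x ^ k \<in> commutant_set S"
  "j c \<in> commutant_set S" "of_nat k \<in> commutant_set S" "(1::'a) \<in> commutant_set S"
  by (auto simp: commutant_set_def br_add_left br_diff_left br_mult_left A.j_central
      intro: br_eq_0_sym br_power_0)

lemmas C_closed = commutant_set_closed[where S = C2, folded C1_def]
  commutant_set_closed[where S = "E ` Idx \<union> F ` Idx \<union> H ` Idx \<union> {T, V}", folded C2_def]

lemma sum_C1: "(\<And>i. i \<in> S \<Longrightarrow> x i \<in> C1) \<Longrightarrow> sum x S \<in> C1"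
  and sum_C2: "(\<And>i. i \<in> S \<Longrightarrow> x i \<in> C2) \<Longrightarrow> sum x S \<in> C2"
  unfolding C1_def C2_def commutant_set_def by (auto simp: br_sum_left)

lemma gens_C2:
  "i \<in> Idx \<Longrightarrow> E2 i \<in> C2" "i \<in> Idx \<Longrightarrow> F2 i \<in> C2" "i \<in> Idx \<Longrightarrow> H2 i \<in> C2" "T2 \<in> C2" "V2 \<in> C2"
  unfolding C2_def commutant_set_def by (auto intro!: br_eq_0_sym[OF cross])

lemma gens_C1:
  "i \<in> Idx \<Longrightarrow> E i \<in> C1" "i \<in> Idx \<Longrightarrow> F i \<in> C1" "i \<in> Idx \<Longrightarrow> H i \<in> C1" "T \<in> C1" "V \<in> C1"
  unfolding C1_def C2_def commutant_set_def by (auto intro: br_eq_0_sym)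

lemma br_C1: "x \<in> C1 \<Longrightarrow> y \<in> C1 \<Longrightarrow> br x y \<in> C1"
  and br_C2: "x \<in> C2 \<Longrightarrow> y \<in> C2 \<Longrightarrow> br x y \<in> C2"
  by (auto simp: br_def intro: C_closed)

lemma derived_C1:
  "A.Hs \<in> C1" "A.D \<in> C1" "i \<in> Idx \<Longrightarrow> A.G i \<in> C1" "i \<in> Idx \<Longrightarrow> A.a i \<in> C1" "i \<in> Idx \<Longrightarrow> A.K i \<in> C1"
  "i \<in> Idx \<Longrightarrow> A.Ht i \<in> C1" "A.Hts \<in> C1"
  unfolding A.Hs_def A.D_def A.G_def A.a_def A.K_def A.Ht_def A.Hts_def
  by (auto intro!: C_closed gens_C1 sum_C1 br_C1)

lemma derived_C2:
  "B.Hs \<in> C2" "B.D \<in> C2" "i \<in> Idx \<Longrightarrow> B.G i \<in> C2" "i \<in> Idx \<Longrightarrow> B.g i \<in> C2" "i \<in> Idx \<Longrightarrow> B.a i \<in> C2"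
  "i \<in> Idx \<Longrightarrow> B.K i \<in> C2" "i \<in> Idx \<Longrightarrow> B.Ht i \<in> C2"
  unfolding B.Hs_def B.D_def B.G_def B.g_def B.a_def B.K_def B.Ht_def
  by (auto intro!: C_closed gens_C2 sum_C2 br_C2)

lemmas C1_intros = gens_C1 derived_C1 C_closed(1-7)
lemmas C2_intros = gens_C2 derived_C2 C_closed(8-14)

lemma br_cross:
  assumes "x \<in> C1" "y \<in> C1" "p \<in> C2" "q \<in> C2"
  shows "br (x * p) (y * q) = x * y * br p q + br x y * (q * p)"
proof -
  have "p * y = y * p" "q * x = x * q"
    using assms by (auto intro: C2_comm)
  then have "p * (y * z) = y * (p * z)" "q * (x * z) = x * (q * z)" for z
    by (metis mult.assoc)+
  then show ?thesis by (simp add: br_def algebra_simps)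
qed

definition "ED i = E i + T ^ th i * E2 i"
definition "FD i = F i + V ^ th i * F2 i + T * sum H Idx * (V2 * br (F2 i) T2)"
definition "HD i = H i + H2 i - of_nat (th i) * (c2 * ((1 - V * V) * sum H2 Idx))"
definition "TD = T * T2"
definition "VD = V * V2"

lemma FD: "FD i = F i + V ^ th i * F2 i + T * A.Hs * B.G i"
  by (simp add: FD_def A.Hs_def B.G_def)

lemma HD: "HD i = H i + H2 i - of_nat (th i) * (c2 * ((1 - V * V) * B.Hs))"
  by (simp add: HD_def B.Hs_def)

lemma T_commutes: "br T2 T = 0" "br T2 V = 0" "br V2 T = 0" "br V2 V = 0"
  by (simp_all add: C21 gens_C1 gens_C2)

lemma TV_comm: "T2 * T = T * T2" "T2 * V = V * T2" "V2 * T = T * V2" "V2 * V = V * V2"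
  "T2 * (T * x) = T * (T2 * x)" "T2 * (V * x) = V * (T2 * x)"
  "V2 * (T * x) = T * (V2 * x)" "V2 * (V * x) = V * (V2 * x)"
  by (rule C2_comm C2_comm'; rule gens_C1 gens_C2)+

text \<open>The theta_i sum to 2, so the corrections total (1 - V^2) Hs2, and V^2 Hs2 remains of the
  second sum.\<close>

lemma HsD: "sum HD Idx = A.Hs + V * V * B.Hs"
proof -
  have "sum HD Idx = A.Hs + B.Hs - of_nat (\<Sum>i\<in>Idx. th i) * (c2 * ((1 - V * V) * B.Hs))"
    unfolding HD by (simp add: sum.distrib sum_subtractf sum_distrib_right of_nat_sum A.Hs_def B.Hs_def)
  also have "\<dots> = A.Hs + V * V * B.Hs"
    by (simp add: theta_sum[OF A.N] mult_2 A.c2_mult) (simp add: algebra_simps)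
  finally show ?thesis .
qed

text \<open>The mixed brackets vanish, since x and y commute with T and with the second factor.
  Brackets of the \<open>ED i\<close> therefore split into a left and a right part.\<close>

lemma br_plus:
  assumes "x \<in> C1" "y \<in> C1" "p \<in> C2" "q \<in> C2" "br x T = 0" "br y T = 0"
  shows "br (x + T ^ m * p) (y + T ^ l * q) = br x y + T ^ (m + l) * br p q"
proof -
  have 1: "br x (T ^ l * q) = 0" "br (T ^ m * p) y = 0"
    using assms C12[of x q] C12[of y p] br_power_0[of x T] br_power_0[of y T]
    by (auto simp: br_mult_right br_mult_left br_eq_0_sym)
  have 2: "br (T ^ m * p) (T ^ l * q) = T ^ (m + l) * br p q"
    using assms br_cross[of "T ^ m" "T ^ l" p q] br_power_0[OF br_eq_0_sym[OF br_power_0[of T T m]], of l]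
    by (simp add: C1_intros power_add)
  show ?thesis
    by (simp add: br_add_left br_add_right 1 2)
qed

lemma E_rnest_T: "1 \<le> k \<Longrightarrow> k \<le> N - 1 \<Longrightarrow> br (rnest E (N-1) k) T = 0"
  by (intro br_eq_0_sym[OF br_rnest_0] A.TE) auto

lemma rnest_C1: "1 \<le> k \<Longrightarrow> k \<le> N - 1 \<Longrightarrow> rnest E (N-1) k \<in> C1"
  and rnest_C2: "1 \<le> k \<Longrightarrow> k \<le> N - 1 \<Longrightarrow> rnest E2 (N-1) k \<in> C2"
proof -
  assume k: "1 \<le> k" "k \<le> N - 1"
  have "br y (rnest E (N-1) k) = 0" if "y \<in> C2" for y
    using k that by (intro br_rnest_0 C21 gens_C1) auto
  then show "rnest E (N-1) k \<in> C1"
    by (auto simp: C1_def commutant_set_def intro: br_eq_0_sym)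
  have "br y (rnest E2 (N-1) k) = 0" if "y \<in> E ` Idx \<union> F ` Idx \<union> H ` Idx \<union> {T, V}" for y
    using k that by (intro br_rnest_0 cross) auto
  then show "rnest E2 (N-1) k \<in> C2"
    unfolding C2_def commutant_set_def by (blast intro: br_eq_0_sym)
qed

text \<open>Every further bracket falls under \<open>br_plus\<close>, and the exponents of T
  accumulate. For the full nest the exponent is 2: X becomes X (x) 1 + T^2 (x) X.\<close>

lemma rnest_ED:
  assumes "1 \<le> k" "k \<le> N - 1"
  shows "rnest ED (N-1) k = rnest E (N-1) k + T ^ (\<Sum>m=k..N-1. th m) * rnest E2 (N-1) k"
  using assms(2,1)
proof (induction k rule: inc_induct)
  case base
  then show ?case by (simp add: ED_def)
next
  case (step k)
  have "rnest ED (N-1) k = br (ED k) (rnest ED (N-1) (Suc k))"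
    using step by (simp add: rnest_step)
  also have "\<dots> = br (E k + T ^ th k * E2 k)
      (rnest E (N-1) (Suc k) + T ^ (\<Sum>m=Suc k..N-1. th m) * rnest E2 (N-1) (Suc k))"
    using step by (simp add: ED_def[of k])
  also have "\<dots> = br (E k) (rnest E (N-1) (Suc k))
      + T ^ (th k + (\<Sum>m=Suc k..N-1. th m)) * br (E2 k) (rnest E2 (N-1) (Suc k))"
    using step by (intro br_plus) (auto intro!: gens_C1 gens_C2 rnest_C1 rnest_C2 A.ET E_rnest_T)
  finally show ?case
    using step by (simp add: rnest_step sum.atLeast_Suc_atMost)
qed

lemma rnest_ED_1: "rnest ED (N-1) 1 = rnest E (N-1) 1 + T * T * rnest E2 (N-1) 1"
  using rnest_ED[of 1] A.N by (simp add: theta_sum power2_eq_square)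

text \<open>The left side is T^2 (1 + 2h X2) = 1 + 2hX + 2h T^2 X2, and X + T^2 X2 is the nest of
  the \<open>ED i\<close>.\<close>

lemma TD_square: "TD * TD = 1 + j (2 * h) * rnest ED (N-1) 1"
proof -
  have "TD * TD = T * T * (T2 * T2)"
    by (simp add: TD_def TV_comm mult.assoc)
  also have "\<dots> = T * T * (1 + j (2 * h) * rnest E2 (N-1) 1)"
    by (simp add: B.T_square)
  also have "\<dots> = 1 + j (2 * h) * rnest ED (N-1) 1"
  proof -
    have "T * T * (1 + j (2 * h) * rnest E2 (N-1) 1) = T * T + j (2 * h) * (T * T * rnest E2 (N-1) 1)"
      by (simp only: distrib_left mult_1_right A.j_commute')
    also have "\<dots> = 1 + j (2 * h) * rnest E (N-1) 1 + j (2 * h) * (T * T * rnest E2 (N-1) 1)"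
      using A.T_square by simp
    finally show ?thesis by (simp only: rnest_ED_1 distrib_left add.assoc)
  qed
  finally show ?thesis .
qed

text \<open>Takes the place of \<open>commutant\<close> for T (x) T; it is the commutation that
  uniqueness of square roots will ask for.\<close>

lemma TD_rnest: "br TD (rnest ED (N-1) 1) = 0"
proof -
  have "br T (rnest E (N-1) 1) = 0" "br T2 (rnest E2 (N-1) 1) = 0"
    using br_eq_0_sym[OF A.XT] A.XT B.XT br_eq_0_sym by auto
  moreover have "br T2 (rnest E (N-1) 1) = 0" "br T (rnest E2 (N-1) 1) = 0"
    using C12[OF gens_C1(4) rnest_C2[of 1]] C21[OF rnest_C1[of 1] gens_C2(4)] A.N by auto
  ultimately show ?thesis
    using T_commutes by (simp add: TD_def rnest_ED_1 br_mult_left br_mult_right br_add_right)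
qed

lemma TD_VD: "TD * VD = 1" "VD * TD = 1"
  by (simp_all add: TD_def VD_def TV_comm mult.assoc)

lemma ED_TD: "i \<in> Idx \<Longrightarrow> br (ED i) TD = 0"
  using A.ET[of i] B.ET[of i] A.TE[of i] T_commutes C12[OF gens_C1(1) gens_C2(4)] C21[OF gens_C1(4) gens_C2(1)]
   br_power_0[of T T "th i"] br_power_0[of T2 T "th i"]
  by (simp add: TD_def ED_def br_mult_left br_mult_right br_add_left br_eq_0_sym)

lemma EED: "i \<in> Idx \<Longrightarrow> k \<in> Idx \<Longrightarrow> br (ED i) (ED k) = br (E i) (E k) + T ^ (th i + th k) * br (E2 i) (E2 k)"
  unfolding ED_def by (intro br_plus) (auto intro!: gens_C1 gens_C2 A.ET)

lemma EEED: assumes "i \<in> Idx" "k \<in> Idx"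
  shows "br (ED i) (br (ED i) (ED k)) = br (E i) (br (E i) (E k))
     + T ^ (th i + (th i + th k)) * br (E2 i) (br (E2 i) (E2 k))"
proof -
  have "br (br (E i) (E k)) T = 0"
    by (simp add: br_jacobi_left A.ET[OF assms(1)] A.ET[OF assms(2)])
  then show ?thesis
    unfolding EED[OF assms] unfolding ED_def using assms
    by (intro br_plus) (auto intro!: gens_C1 gens_C2 A.ET br_C1 br_C2)
qed

lemma br_c2: "br (of_nat m * (c2 * x)) y = of_nat m * (c2 * br x y)"
    "br y (of_nat m * (c2 * x)) = of_nat m * (c2 * br y x)"
  by (simp_all add: br_mult_left br_mult_right A.j_central A.j_central' br_eq_0_sym[OF br_of_nat])

lemma c2_of_nat: "of_nat m * (c2 * (of_nat n * x)) = of_nat (m * n) * (c2 * x)"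
  by (metis of_nat_left_commute of_nat_mult mult.assoc)

text \<open>[H_l, (1 - V^2) Hs2] = theta_l Q with one Q for all l. The two surviving terms both
  carry theta_i theta_k, with opposite signs.\<close>

lemma HDHD: assumes ik: "i \<in> Idx" "k \<in> Idx" shows "br (HD i) (HD k) = 0"
proof -
  let ?P = "1 - V * V"
  have P: "br (H l) ?P = of_nat (th l) * (V * V * A.D * V + V * (V * V * A.D))" if "l \<in> Idx" for l
    by (simp add: br_diff_right br_mult_right A.HV[OF that] algebra_simps of_nat_left_commute)
  define Q where "Q = (V * V * A.D * V + V * (V * V * A.D)) * B.Hs"
  have Hc: "br (H l) (?P * B.Hs) = of_nat (th l) * Q" if "l \<in> Idx" for l
    using that C12[OF gens_C1(3) derived_C2(1)] by (simp add: br_mult_right P Q_def mult.assoc)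
  have H2c: "br (H2 l) (?P * B.Hs) = 0" if "l \<in> Idx" for l
    using that C21[of ?P "H2 l"] B.HHs[OF that] by (simp add: br_mult_right C1_intros C2_intros)
  have Hc': "br (?P * B.Hs) (H k) = - (of_nat (th k) * Q)"
    using Hc[OF ik(2)] br_commute[of "?P * B.Hs" "H k"] by simp
  have H12: "br (H i) (H2 k) = 0" "br (H2 i) (H k) = 0"
    by (intro C12 gens_C1 gens_C2 ik, intro C21 gens_C1 gens_C2 ik)
  have "br (HD i) (HD k) = of_nat (th i) * (c2 * (of_nat (th k) * Q)) - of_nat (th k) * (c2 * (of_nat (th i) * Q))"
    unfolding HD
    by (simp only: br_add_left br_add_right br_diff_left br_diff_right br_c2 A.HH[OF ik] B.HH[OF ik] H12
        Hc[OF ik(1)] H2c[OF ik(1)] Hc' br_eq_0_sym[OF H2c[OF ik(2)]] br_self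
        mult_zero_right add_0_left add_0_right diff_0_right diff_self mult_minus_right minus_zero diff_0) simp
  also have "\<dots> = 0"
    unfolding c2_of_nat by (simp only: mult.commute[of "th i" "th k"]) simp
  finally show ?thesis .
qed

lemma HDED: assumes ik: "i \<in> Idx" "k \<in> Idx" shows "br (HD i) (ED k) = of_int (cartan i k) * ED k"
proof -
  let ?P = "1 - V * V"
  \<comment> \<open>Half of (1 - V^2) T is D. Hence the correction in \<open>HD i\<close> cancels
    the bracket of H_i with the factor T^theta of \<open>ED k\<close>.\<close>
  have PT: "c2 * (?P * (T * x)) = A.D * x" for x
    by (simp add: A.D_def algebra_simps)
  have DT: "br (H i) (T ^ th k) = of_nat (th i) * of_nat (th k) * A.D"
    using A.theta_01[of k] A.HT[OF ik(1)] by auto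
  have z: "br (H i) (E2 k) = 0" "br (H2 i) (E k) = 0" "br (H2 i) (T ^ th k) = 0" "br B.Hs (E k) = 0"
    using ik by (auto intro!: C12[OF gens_C1(3)] C21[OF gens_C1(1)] C21[OF C_closed(4)] C1_intros C2_intros)
  have "br V (T ^ th k) = 0"
    by (intro br_power_0 br_eq_0_sym[OF A.br_V]) simp
  then have "br ?P (E k) = 0" "br ?P (T ^ th k) = 0"
    using A.VE[OF ik(2)] by (simp_all add: br_diff_left br_mult_left)
  then have P: "br (?P * B.Hs) (E k) = 0"
    "br (?P * B.Hs) (T ^ th k * E2 k) = ?P * (T ^ th k * (of_nat (th k) * E2 k))"
    using br_cross[of ?P "T ^ th k" B.Hs "E2 k"] ik z
    by (simp_all add: br_mult_left C1_intros C2_intros B.HsE[OF ik(2)] mult.assoc)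
  have 1: "br (HD i) (E k) = of_int (cartan i k) * E k"
    unfolding HD by (simp add: br_add_left br_diff_left br_c2 P z A.HE[OF ik])
  have 2: "br (HD i) (T ^ th k * E2 k) = of_nat (th i) * of_nat (th k) * A.D * E2 k
     + T ^ th k * (of_int (cartan i k) * E2 k) - of_nat (th i) * (c2 * (?P * (T ^ th k * (of_nat (th k) * E2 k))))"
    unfolding HD br_add_left br_diff_left br_c2 P(2)
    by (simp add: br_mult_right z DT B.HE[OF ik] algebra_simps)
  have "br (HD i) (ED k) = of_int (cartan i k) * E k + (of_nat (th i) * of_nat (th k) * A.D * E2 k
     + T ^ th k * (of_int (cartan i k) * E2 k) - of_nat (th i) * (c2 * (?P * (T ^ th k * (of_nat (th k) * E2 k)))))"
    unfolding ED_def br_add_right 1 2 ..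
  also have "\<dots> = of_int (cartan i k) * ED k"
    using A.theta_01[of k] PT[of "E2 k"]
    by (auto simp: ED_def of_int_left_commute distrib_left mult.assoc)
  finally show ?thesis .
qed

end

section \<open>Serre, mixed and weight relations for the coproduct of F\<close>

context jordan_pair
begin

definition "KD i = TD ^ th i * FD i"
text \<open>\<open>M i\<close> and \<open>L i\<close> are commuting parts of \<open>KD i\<close>:
  K_i (x) T^theta, and 1 (x) K_i + T^2 Hs (x) g_i. The latter is K_i + s g_i with s = T^2 Hs
  commuting with the right factor, which is the reason for the polynomial Serre relations.\<close>

definition "M i = A.K i * T2 ^ th i"
definition "L i = B.K i + A.Hts * B.g i"

lemma KD: assumes i: "i \<in> Idx" shows "KD i = M i + L i"
proof -
  consider "th i = 0" | "th i = 1" using A.theta_01[of i] by auto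
  then show ?thesis
  proof cases
    case 1
    then show ?thesis
      using B.G_0[OF i] by (simp add: KD_def M_def L_def FD A.K_def B.K_def B.g_def)
  next
    case 2
    have T2F: "T2 * F i = F i * T2" "T2 * (A.Hs * x) = A.Hs * (T2 * x)" for x
      by (intro C2_comm C2_comm' gens_C1 gens_C2 derived_C1 i)+
    show ?thesis
      using 2 by (simp add: KD_def M_def L_def FD A.K_def B.K_def B.g_def A.Hts_def TD_def TV_comm
          T2F distrib_left mult.assoc)
  qed
qed

lemma br_K_T2: assumes "i \<in> Idx" "k \<in> Idx"
  shows "br (A.K i * T2 ^ n) (B.K k) = A.K i * br (T2 ^ n) (B.K k)"
  using C12[OF derived_C1(5) derived_C2(6)] assms by (simp add: br_mult_left)

text \<open>For theta_i = 1 two nonzero terms cancel: T2 commutes with the second K_k only up to T2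
  g_k, and the first K_i has weight -1 under \<open>Hts\<close>.\<close>

lemma M_L: assumes ik: "i \<in> Idx" "k \<in> Idx" shows "br (M i) (L k) = 0"
proof -
  consider "th i = 0" | "th i = 1" using A.theta_01[of i] by auto
  then show ?thesis
  proof cases
    case 1
    have "br (A.K i) (A.Hts * B.g k) = 0"
      using 1 A.HtsK[OF ik(1)] C12[OF derived_C1(5)[OF ik(1)] derived_C2(4)[OF ik(2)]]
      by (simp add: br_mult_right br_eq_0_sym)
    then show ?thesis
      using 1 C12[OF derived_C1(5)[OF ik(1)] derived_C2(6)[OF ik(2)]] by (simp add: M_def L_def br_add_right)
  next
    case 2
    have 1: "br (M i) (B.K k) = - (A.K i * (T2 * B.g k))"
      using 2 br_K_T2[OF ik, of 1] B.KT[OF ik(2)] by (simp add: M_def br_commute[of T2])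
    have "br T2 (B.g k) = 0"
      using B.gT[OF ik(2)] by (rule br_eq_0_sym)
    then have "br (M i) (A.Hts * B.g k) = br (A.K i) A.Hts * (B.g k * T2)"
      using 2 br_cross[of "A.K i" A.Hts T2 "B.g k"] ik by (simp add: M_def C1_intros C2_intros)
    also have "\<dots> = A.K i * (T2 * B.g k)"
      using A.HtsK[OF ik(1)] 2 B.gT[OF ik(2)] by (simp add: br_commute[of "A.K i"] br_eq_0_iff)
    finally show ?thesis
      by (simp add: L_def br_add_right 1)
  qed
qed

lemma M_M: assumes ik: "i \<in> Idx" "k \<in> Idx"
  shows "br (M i) (M k) = br (A.K i) (A.K k) * (T2 ^ th k * T2 ^ th i)"
proof -
  have "br (T2 ^ th i) (T2 ^ th k) = 0"
    by (intro br_power_0 br_eq_0_sym[OF br_power_0]) simp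
  then show ?thesis
    unfolding M_def using ik by (subst br_cross) (simp_all add: C1_intros C2_intros)
qed

lemma MMM: assumes ik: "i \<in> Idx" "k \<in> Idx" and 0: "br (A.K i) (br (A.K i) (A.K k)) = 0"
  shows "br (M i) (br (M i) (M k)) = 0"
proof -
  have "br (T2 ^ th i) (T2 ^ th k) = 0" "br (T2 ^ th i) (T2 ^ th i) = 0"
    by (intro br_power_0 br_eq_0_sym[OF br_power_0]; simp)+
  then have "br (T2 ^ th i) (T2 ^ th k * T2 ^ th i) = 0"
    by (rule br_mult_0)
  then show ?thesis
    unfolding M_M[OF ik] unfolding M_def using ik 0
    by (subst br_cross) (simp_all add: C1_intros C2_intros br_C1)
qed

lemma br_Hts: "i \<in> Idx \<Longrightarrow> br A.Hts (B.K i) = 0" "i \<in> Idx \<Longrightarrow> br A.Hts (B.g i) = 0"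
  by (auto intro!: C12 derived_C1 derived_C2)

lemma LL: assumes ik: "i \<in> Idx" "k \<in> Idx" "i \<noteq> k" "cartan i k = 0"
  shows "br (L i) (L k) = 0"
  unfolding L_def using ik B.KK_coeffs[OF ik] B.KK[OF ik, folded B.K_def]
  by (subst A.bilinear_expand) (auto simp: br_Hts)

lemma LLL: assumes ik: "i \<in> Idx" "k \<in> Idx" "cartan i k = -1"
  shows "br (L i) (br (L i) (L k)) = 0"
  unfolding L_def using ik B.KKK_coeffs[OF ik]
  by (subst A.trilinear_expand) (simp_all add: br_Hts)

lemma KDKD: assumes ik: "i \<in> Idx" "k \<in> Idx"
  shows "br (KD i) (KD k) = br (M i) (M k) + br (L i) (L k)"
  using M_L[OF ik] br_eq_0_sym[OF M_L[OF ik(2) ik(1)]]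
  by (simp add: KD[OF ik(1)] KD[OF ik(2)] br_add_left br_add_right)

lemma KDKDKD: assumes ik: "i \<in> Idx" "k \<in> Idx"
  shows "br (KD i) (br (KD i) (KD k)) = br (M i) (br (M i) (M k)) + br (L i) (br (L i) (L k))"
proof -
  have "br (M i) (br (L i) (L k)) = 0"
    by (simp add: br_jacobi[of "M i" "L i" "L k"] M_L[OF ik(1) ik(1)] M_L[OF ik])
  moreover have "br (L i) (br (M i) (M k)) = 0"
    by (simp add: br_jacobi[of "L i" "M i" "M k"] br_eq_0_sym[OF M_L[OF ik(1) ik(1)]] br_eq_0_sym[OF M_L[OF ik(2) ik(1)]])
  ultimately show ?thesis
    unfolding KDKD[OF ik] unfolding KD[OF ik(1)] by (simp add: br_add_left br_add_right)
qed

lemma KD_serre_far: "\<lbrakk>i \<in> Idx; k \<in> Idx; i \<noteq> k; cartan i k = 0\<rbrakk> \<Longrightarrow> br (KD i) (KD k) = 0"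
  using A.KK[of i k] by (simp add: KDKD M_M LL A.K_def)

lemma KD_serre_near: "\<lbrakk>i \<in> Idx; k \<in> Idx; cartan i k = -1\<rbrakk> \<Longrightarrow> br (KD i) (br (KD i) (KD k)) = 0"
  using A.KKK[of i k] by (simp add: KDKDKD MMM LLL A.K_def)

definition "aD i = VD ^ th i * ED i"

lemma aD: assumes i: "i \<in> Idx" shows "aD i = A.a i * V2 ^ th i + B.a i"
proof -
  have "V2 * E i = E i * V2"
    by (intro C2_comm gens_C1 gens_C2 i)
  then show ?thesis
    using A.theta_01[of i]
    by (auto simp: aD_def ED_def A.a_def B.a_def VD_def TV_comm mult.assoc distrib_left)
qed

text \<open>The value of the bracket of \<open>aD i\<close> with \<open>KD i\<close>;
  \<open>HtD_HD\<close> identifies it with the right-hand side of the mixed relation written in the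
  \<open>HD i\<close>.\<close>

definition "HtD i = A.Ht i + B.Ht i + of_nat (th i) * (T2 * B.D * A.Hts)"

text \<open>Four brackets between the parts of \<open>aD i\<close> and of \<open>KD k\<close>. That
  of the left part with \<open>L k\<close> vanishes by a cancellation like the one in
  \<open>M_L\<close>; that of the right part with \<open>L k\<close> contributes the term with
  \<open>Hts\<close>, through [a_i, g_i].\<close>

lemma aD_KD: assumes ik: "i \<in> Idx" "k \<in> Idx"
  shows "br (aD i) (KD k) = (if i = k then HtD i else 0)"
proof -
  let ?x = "A.a i * V2 ^ th i"
  have "br (V2 ^ th i) (T2 ^ th k) = 0"
    by (intro br_power_0 br_eq_0_sym[OF br_power_0]) (simp add: br_def)
  then have "br ?x (M k) = br (A.a i) (A.K k) * (T2 ^ th k * V2 ^ th i)"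
    unfolding M_def using ik by (subst br_cross) (simp_all add: C1_intros C2_intros)
  then have 1: "br ?x (M k) = (if i = k then A.Ht i else 0)"
    using A.aK[OF ik] A.theta_01[of i] by auto
  have "br ?x (L k) = 0"
  proof -
    consider "th i = 0" | "th i = 1" using A.theta_01[of i] by auto
    then show ?thesis
    proof cases
      case 1
      have "br (A.a i) A.Hts = 0"
        using A.Hts_a[OF ik(1)] 1 by (simp add: br_eq_0_sym)
      then show ?thesis
        using 1 C12[OF derived_C1(4)[OF ik(1)] derived_C2(4)[OF ik(2)]] C12[OF derived_C1(4)[OF ik(1)] derived_C2(6)[OF ik(2)]]
        by (simp add: L_def br_add_right br_mult_right)
    next
      case 2
      have gV: "B.g k * V2 = V2 * B.g k"
        using B.br_V[OF B.gT[OF ik(2)]] by (simp add: br_eq_0_iff)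
      then have Vg: "br V2 (B.g k) = 0"
        by (simp add: br_eq_0_iff)
      have "br ?x (B.K k) = A.a i * (V2 * B.g k)"
        using 2 B.VK[OF ik(2)] C12[OF derived_C1(4)[OF ik(1)] derived_C2(6)[OF ik(2)]] by (simp add: br_mult_left)
      moreover have "br ?x (A.Hts * B.g k) = - (A.a i * (V2 * B.g k))"
        using 2 br_cross[of "A.a i" A.Hts V2 "B.g k"] ik A.Hts_a[OF ik(1)] Vg
        by (simp add: C1_intros C2_intros br_commute[of "A.a i"] gV)
      ultimately show ?thesis
        by (simp add: L_def br_add_right)
    qed
  qed
  moreover have "br (B.a i) (M k) = 0"
    using br_power_0[OF br_eq_0_sym[OF B.Ta[OF ik(1)]], of "th k"] C21[OF derived_C1(5)[OF ik(2)] derived_C2(5)[OF ik(1)]]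
    by (simp add: M_def br_mult_right)
  moreover have "br (B.a i) (L k) = (if i = k then B.Ht i + of_nat (th i) * (T2 * B.D * A.Hts) else 0)"
  proof -
    have "br (B.a i) (A.Hts * B.g k) = A.Hts * br (B.a i) (B.g k)"
      using C21[OF derived_C1(7) derived_C2(5)[OF ik(1)]] by (simp add: br_mult_right)
    moreover have "A.Hts * (T2 * B.D) = T2 * B.D * A.Hts"
      by (rule C2_comm[symmetric]) (auto intro!: C1_intros C2_intros)
    ultimately show ?thesis
      using B.aK[OF ik] B.ag[OF ik] by (simp add: L_def br_add_right of_nat_left_commute)
  qed
  ultimately show ?thesis
    by (simp add: aD[OF ik(1)] KD[OF ik(2)] br_add_left br_add_right 1 HtD_def)
qed

lemma VD_ED: "i \<in> Idx \<Longrightarrow> br VD (ED i) = 0"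
proof -
  assume i: "i \<in> Idx"
  have "ED i * TD = TD * ED i" using ED_TD[OF i] by (simp add: br_def)
  then have "VD * (ED i * TD) * VD = VD * (TD * ED i) * VD" by simp
  then have "VD * ED i = ED i * VD"
    by (metis TD_VD mult.assoc mult_1_left mult_1_right)
  then show ?thesis by (simp add: br_def)
qed

lemma HtD_HD: assumes i: "i \<in> Idx"
  shows "VD ^ th i * HtD i = VD ^ th i * HD i + of_nat (th i) * (c2 * ((TD - VD) * sum HD Idx))"
proof -
  have c: "V2 * (A.Hs * x) = A.Hs * (V2 * x)" "T2 * (A.Hs * x) = A.Hs * (T2 * x)"
    "V2 * A.Hs = A.Hs * V2" "T2 * A.Hs = A.Hs * T2" for x
    by (intro C2_comm C2_comm' gens_C1 gens_C2 derived_C1 i)+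
  show ?thesis
    unfolding HsD using A.theta_01[of i]
    by (auto simp: HtD_def HD[of i] A.Ht_def B.Ht_def A.D_def B.D_def A.Hts_def VD_def TD_def
        TV_comm c A.j_commute' algebra_simps)
qed

lemma aD_FD: assumes ik: "i \<in> Idx" "k \<in> Idx"
  shows "br (VD ^ th i * ED i) (FD k) = (if i = k then VD ^ th i * HD i
         + of_nat (th i) * (c2 * ((TD - VD) * sum HD Idx)) else 0)"
proof -
  have FK: "FD k = VD ^ th k * KD k"
    using A.theta_01[of k] by (auto simp: KD_def TD_VD simp flip: mult.assoc)
  have "br VD (aD i) = 0"
    unfolding aD_def using VD_ED[OF ik(1)] by (intro br_mult_0 br_power_0) auto
  then have "br (aD i) (VD ^ th k) = 0"
    by (intro br_power_0) (rule br_eq_0_sym)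
  then have "br (aD i) (FD k) = VD ^ th k * (if i = k then HtD i else 0)"
    by (simp add: FK br_mult_right aD_KD[OF ik])
  then show ?thesis
    using HtD_HD[OF ik(1)] by (auto simp: aD_def)
qed

text \<open>Says that G_k is skew-primitive. The weight relation for the coproduct of F_k and
  coassociativity on F_k both rest on it.\<close>

lemma FD_TD: assumes k: "k \<in> Idx"
  shows "VD * br (FD k) TD = A.G k + T * B.G k"
proof -
  have cG: "B.G k * T2 = T2 * B.G k" using B.G_T[OF k] .
  have 1: "br (F k) (T * T2) = T * A.G k * T2"
    using C12[OF gens_C1(2)[OF k] gens_C2(4)] by (simp add: br_mult_right A.FT)
  have 2: "br (V ^ th k * F2 k) (T * T2) = V ^ th k * T * (T2 * B.G k)"
  proof -
    have "br (V ^ th k) T = 0"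
      by (intro br_eq_0_sym[OF br_power_0]) (simp add: br_def)
    then show ?thesis
      using k by (subst br_cross) (auto intro!: C1_intros C2_intros simp: B.FT)
  qed
  have 3: "br (T * A.Hs * B.G k) (T * T2) = T * (T - V) * (T2 * B.G k)"
  proof -
    have "br (T * A.Hs) T = T * (T - V)"
      by (simp add: br_mult_left A.HsT)
    then show ?thesis
      using k B.GT[OF k] by (subst br_cross) (auto intro!: C1_intros C2_intros)
  qed
  have c: "V2 * (A.G k * x) = A.G k * (V2 * x)" for x
    by (intro C2_comm' derived_C1 gens_C2 k)
  have VG: "V * (V ^ th k * (T * B.G k)) = V * B.G k"
    using A.theta_01[of k] B.G_0[OF k] by auto
  have VT': "V ^ m * (V2 * x) = V2 * (V ^ m * x)" for m x
    using TV_comm(8) by (induction m) (simp_all add: mult.assoc)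
  show ?thesis
    using A.theta_01[of k] B.G_0[OF k]
    unfolding FD br_add_left TD_def VD_def 1 2 3
    by (auto simp: TV_comm c mult.assoc distrib_left left_diff_distrib right_diff_distrib)
qed

text \<open>The three summands of \<open>FD k\<close> are bracketed separately. The relation
  requires the product (G_k + T G2_k)(Hs + V^2 Hs2), and the term V G2_k Hs2 in it appears only when
  the second and third contributions are added, as V^3 + (V - V^3).\<close>

lemma HDFD: assumes ik: "i \<in> Idx" "k \<in> Idx"
  shows "br (HD i) (FD k) = - (of_int (cartan i k) * FD k)
    + of_nat (th i) * (VD * br (FD k) TD * sum HD Idx)"
proof -
  let ?c = "of_int (cartan i k) :: 'a" and ?t = "of_nat (th i) :: 'a" and ?P = "1 - V * V"
  let ?R = "?P * B.Hs"
  note ic = ik(1) and kc = ik(2)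
  have D: "c2 * (?P * (V * x)) = V * (V * (A.D * x))" "c2 * (?P * (T * x)) = A.D * x" for x
    by (simp_all add: A.D_def algebra_simps A.j_commute')
  have z: "br (H i) (F2 k) = 0" "br (H i) (B.G k) = 0" "br (H2 i) (F k) = 0" "br (H2 i) (V ^ th k) = 0"
    "br (H2 i) (T * A.Hs) = 0"
    using ik by (auto intro!: C12[OF gens_C1(3)] C21[OF gens_C1(2)] C21[OF C_closed(4)] C21[OF C_closed(3)]
        C1_intros C2_intros)
  have HVp: "br (H i) (V ^ th k) = - (of_nat (th k) * (?t * (V * V * A.D)))"
    using A.theta_01[of k] A.HV[OF ic] by auto
  have p1: "br (HD i) (F k) = - (?c * F k) + ?t * (A.G k * A.Hs) + ?t * (V * V * A.G k * B.Hs)"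
  proof -
    have G_V': "A.G k * (V * x) = V * (A.G k * x)" for x
      using A.G_V[OF kc] by (metis mult.assoc)
    have "br V (F k) = V * A.G k"
      using A.FV[OF kc] by (simp add: br_commute[of V])
    then have "br ?R (F k) = - (V * V * A.G k * B.Hs) - V * V * A.G k * B.Hs"
      using C21[OF gens_C1(2)[OF kc] derived_C2(1)] A.G_V[OF kc] G_V'
      by (simp add: br_mult_left br_diff_left mult.assoc algebra_simps)
    then have "c2 * br ?R (F k) = - (V * V * A.G k * B.Hs)"
      using A.c2_mult[of "V * V * A.G k * B.Hs"] by (simp add: right_diff_distrib)
        (metis add_uminus_conv_diff minus_add_distrib)
    then show ?thesis
      unfolding HD br_add_left br_diff_left br_c2 A.HF'[OF ik] z by simp
  qed
  have p2: "br (HD i) (V ^ th k * F2 k) = - (?c * (V ^ th k * F2 k)) + ?t * (V ^ th k * (B.G k * B.Hs))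
     - ?t * (?P * (V ^ th k * (B.G k * B.Hs)))"
  proof -
    have "br ?P (V ^ th k) = 0"
      by (intro br_power_0) (simp add: br_def algebra_simps)
    then have "br ?R (V ^ th k * F2 k) = ?P * (V ^ th k * (- (of_nat (th k) * F2 k) + B.G k * B.Hs + B.G k * B.Hs))"
      using ik by (subst br_cross) (auto intro!: C1_intros C2_intros simp: B.HsF[OF kc] mult.assoc)
    also have "\<dots> = - (of_nat (th k) * (?P * (V ^ th k * F2 k))) + (?P * (V ^ th k * (B.G k * B.Hs)) + ?P * (V ^ th k * (B.G k * B.Hs)))"
      by (simp only: distrib_left of_nat_left_commute mult_minus_right add.assoc)
    finally have R: "c2 * br ?R (V ^ th k * F2 k) = - (of_nat (th k) * (c2 * (?P * (V ^ th k * F2 k)))) + ?P * (V ^ th k * (B.G k * B.Hs))"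
      by (simp only: distrib_left mult_minus_right of_nat_left_commute A.c2_mult)
    have 1: "of_nat (th k) * (c2 * (?P * (V ^ th k * F2 k))) = of_nat (th k) * (V * (V * (A.D * F2 k)))"
      using A.theta_01[of k] D(1)[of "F2 k"] by auto
    have 2: "V ^ th k * br (H2 i) (F2 k) = - (?c * (V ^ th k * F2 k)) + ?t * (V ^ th k * (B.G k * B.Hs))"
      by (simp only: B.HF'[OF ik] distrib_left mult_minus_right of_int_left_commute of_nat_left_commute)
    show ?thesis
      unfolding HD br_add_left br_diff_left br_c2 R br_mult_right[of "H i"] br_mult_right[of "H2 i"] z HVp 1 2
      using A.theta_01[of k] by (auto simp: right_diff_distrib distrib_left mult.assoc)
  qed
  have p3: "br (HD i) (T * A.Hs * B.G k) = of_int (int (th i) - cartan i k) * (T * A.Hs * B.G k)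
      + ?t * (V * ?P * (B.G k * B.Hs))"
  proof -
    have HsV: "br A.Hs (V * V) = - (V * V * ?P) - V * V * ?P"
      by (rule A.HsVV)
    have "br (V * V) (T * A.Hs) = T * br (V * V) A.Hs"
      by (simp add: br_mult_right br_mult_left) (simp add: br_def)
    then have "br ?P (T * A.Hs) = - (V * ?P) - V * ?P"
      by (simp add: br_diff_left br_commute[of "V * V" A.Hs] HsV distrib_left right_diff_distrib mult.assoc)
    then have "br ?R (T * A.Hs * B.G k) = ?P * (T * (A.Hs * B.G k)) + (- (V * ?P) - V * ?P) * (B.G k * B.Hs)"
      using ik by (subst br_cross) (auto intro!: C1_intros C2_intros simp: B.HsG[OF kc] mult.assoc)
    also have "\<dots> = ?P * (T * (A.Hs * B.G k)) - (V * ?P * (B.G k * B.Hs) + V * ?P * (B.G k * B.Hs))"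
      by (simp add: left_diff_distrib)
    finally have R: "c2 * br ?R (T * A.Hs * B.G k) = A.D * (A.Hs * B.G k) - V * ?P * (B.G k * B.Hs)"
      by (simp only: right_diff_distrib[of c2] distrib_left[of c2] A.c2_mult D(2))
    have H1: "br (H i) (T * A.Hs * B.G k) = ?t * (A.D * (A.Hs * B.G k))"
      by (simp add: br_mult_right z A.HHs[OF ic] A.HT[OF ic] mult.assoc)
    have H2: "br (H2 i) (T * A.Hs * B.G k) = of_int (int (th i) - cartan i k) * (T * A.Hs * B.G k)"
      by (simp only: br_mult_right[of "H2 i" "T * A.Hs"] z B.HG[OF ik] of_int_left_commute mult_zero_left add_0_left)
    show ?thesis
      unfolding HD br_add_left br_diff_left br_c2 R H1 H2 by (simp add: right_diff_distrib)
  qed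
  have G_V': "A.G k * (V * x) = V * (A.G k * x)" for x
    using A.G_V[OF kc] by (metis mult.assoc)
  have c: "B.G k * (A.Hs * x) = A.Hs * (B.G k * x)" "B.G k * A.Hs = A.Hs * B.G k"
     "B.G k * (V * x) = V * (B.G k * x)" for x
    using ik by (auto intro!: C2_comm C2_comm' C1_intros C2_intros)
  consider "th k = 0" | "th k = 1" using A.theta_01[of k] by auto
  then show ?thesis
  proof cases
    case 1
    then have G: "A.G k = 0" "B.G k = 0" using A.G_0[OF kc] B.G_0[OF kc] by auto
    then show ?thesis
      unfolding FD_TD[OF kc] by (simp add: FD br_add_right[of "HD i"] p1 p2[unfolded 1, simplified] G 1 distrib_left)
  next
    case 2
    have "br (HD i) (FD k) = br (HD i) (F k) + br (HD i) (V ^ th k * F2 k) + br (HD i) (T * A.Hs * B.G k)"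
      unfolding FD by (simp only: br_add_right)
    also have "\<dots> = - (?c * FD k) + ?t * ((A.G k + T * B.G k) * (A.Hs + V * V * B.Hs))"
      unfolding p1 p2 p3 FD unfolding 2 by (simp add: algebra_simps c G_V')
    finally show ?thesis
      unfolding FD_TD[OF kc] HsD by (simp add: mult.assoc)
  qed
qed

end

section \<open>The antipode formulas\<close>

context jordan_rep
begin

definition "ES i = - (V ^ th i * E i)"
definition "FS i = - (T ^ th i * F i) + T * T * sum H Idx * (V * V) * br (F i) T"
definition "HS i = - H i + of_nat (th i) * (c2 * ((1 - T * T) * sum H Idx))"

lemma TD: "T * D = c2 * (T * T - 1)"
  by (simp add: D_def j_commute' right_diff_distrib)

lemma DT: "D * T = T * D" and DV: "D * V = V * D"
  using br_D[of T] br_D[of V] br_V[of T] by (simp_all add: br_def)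

lemma DT': "D * (T * x) = T * (D * x)" and DV': "D * (V * x) = V * (D * x)"
  using DT DV by (metis mult.assoc)+

lemma ES: "ES i = - a i" by (simp add: ES_def a_def)

lemma HS: "HS i = - Ht i"
  using TD by (simp add: HS_def Ht_def Hs_def[symmetric] flip: mult.assoc) (simp add: algebra_simps)

lemma G_T': "k \<in> Idx \<Longrightarrow> G k * (T * x) = T * (G k * x)" and G_V': "k \<in> Idx \<Longrightarrow> G k * (V * x) = V * (G k * x)"
  using G_T[of k] G_V[of k] by (metis mult.assoc)+

lemma HsV: "br Hs V = - (V * (1 - V * V))"
  using Hs_weight_pow[of 1] by simp

lemma Hs_T: "Hs * T = T * Hs + T - V" "Hs * (T * x) = T * (Hs * x) + T * x - V * x"
proof -
  show 1: "Hs * T = T * Hs + T - V"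
    using HsT by (simp add: br_def algebra_simps)
  have "Hs * T * x = (T * Hs + T - V) * x" by (simp only: 1)
  then show "Hs * (T * x) = T * (Hs * x) + T * x - V * x"
    by (simp add: algebra_simps)
qed

lemma Hs_V: "Hs * V = V * Hs - V + V * (V * V)" "Hs * (V * x) = V * (Hs * x) - V * x + V * (V * (V * x))"
proof -
  show 1: "Hs * V = V * Hs - V + V * (V * V)"
    using HsV by (simp add: br_def algebra_simps)
  have "Hs * V * x = (V * Hs - V + V * (V * V)) * x" by (simp only: 1)
  then show "Hs * (V * x) = V * (Hs * x) - V * x + V * (V * (V * x))"
    by (simp add: algebra_simps)
qed

lemma Hs_G: "k \<in> Idx \<Longrightarrow> Hs * G k = G k * Hs + G k"
  using HsG[of k] by (simp add: br_def algebra_simps)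

text \<open>In T^2 Hs V^2 [F_k, T] the sum Hs is moved to the right of G_k, where it combines with
  F_k to form f_k; the commutators on the way leave V G_k.\<close>

lemma FS: assumes k: "k \<in> Idx" shows "FS k = - (T ^ th k * f k) + V * G k"
  using theta_01[of k] G_0[OF k]
  by (auto simp: FS_def f_def Hs_def[symmetric] FT Hs_T Hs_V Hs_G[OF k] mult_2 algebra_simps G_T'[OF k] G_V'[OF k])

text \<open>The left side is the antipode of T^theta F_k, with reversed product and T sent to V. It
  is -f_k conjugated by T^2, so its Serre relations are those of the f_k.\<close>

lemma KS: assumes k: "k \<in> Idx" shows "FS k * V ^ th k = - (T * T * f k * (V * V))"
proof -
  have F_V: "F k * V = V * F k - V * G k"
    using FV[OF k] by (simp add: br_def algebra_simps)
  have "F k * V * x = (V * F k - V * G k) * x" for x by (simp only: F_V)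
  then have F_V': "F k * (V * x) = V * (F k * x) - V * (G k * x)" for x
    by (simp add: algebra_simps)
  show ?thesis
    unfolding FS[OF k] using theta_01[of k] G_0[OF k]
    by (auto simp: f_def F_V F_V' Hs_V algebra_simps G_T'[OF k] G_V'[OF k] G_T[OF k] G_V[OF k])
qed

lemma conj_br2: "br (T * T * x * (V * V)) (T * T * y * (V * V)) = T * T * br x y * (V * V)"
  by (simp add: br_def algebra_simps)

lemma KS_far: "\<lbrakk>i \<in> Idx; k \<in> Idx; i \<noteq> k; cartan i k = 0\<rbrakk> \<Longrightarrow> br (FS k * V ^ th k) (FS i * V ^ th i) = 0"
  using ff[of k i] by (simp add: KS br_minus_left br_minus_right conj_br2 cartan_sym[of k i])

lemma KS_near: "\<lbrakk>i \<in> Idx; k \<in> Idx; cartan i k = -1\<rbrakk> \<Longrightarrow>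
    br (br (FS k * V ^ th k) (FS i * V ^ th i)) (FS i * V ^ th i) = 0"
proof -
  assume ik: "i \<in> Idx" "k \<in> Idx" "cartan i k = -1"
  have "br (br (f k) (f i)) (f i) = br (f i) (br (f i) (f k))"
    by (simp add: br_def algebra_simps)
  then show ?thesis
    using fff[OF ik] ik by (simp add: KS br_minus_left br_minus_right conj_br2)
qed

lemma ES_far: "\<lbrakk>i \<in> Idx; k \<in> Idx; i \<noteq> k; cartan i k = 0\<rbrakk> \<Longrightarrow> br (ES k) (ES i) = 0"
  using EE[of k i] VE[of i] VE[of k]
  by (simp add: ES br_minus_left br_minus_right a_def V_pow_br cartan_sym[of k i])

lemma ES_near: "\<lbrakk>i \<in> Idx; k \<in> Idx; cartan i k = -1\<rbrakk> \<Longrightarrow> br (br (ES k) (ES i)) (ES i) = 0"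
proof -
  assume ik: "i \<in> Idx" "k \<in> Idx" "cartan i k = -1"
  have "br (br (a k) (a i)) (a i) = br (a i) (br (a i) (a k))"
    by (simp add: br_def algebra_simps)
  also have "\<dots> = 0"
    using EEE[OF ik] VE[OF ik(1)] VE[OF ik(2)] by (simp add: a_def V_pow_br br_V_0)
  finally show ?thesis
    by (simp add: ES br_minus_left br_minus_right)
qed

text \<open>T D = (T^2 - 1)/2 is hX, which has weight theta_i.\<close>

lemma br_H_TD: assumes i: "i \<in> Idx" shows "br (H i) (T * D) = of_nat (th i) * (T * D)"
proof -
  have "br (H i) (T * D) = c2 * (br (H i) T * T + T * br (H i) T)"
    by (simp add: TD br_mult_right br_diff_right j_central')
  also have "\<dots> = of_nat (th i) * (c2 * (T * D) + c2 * (T * D))"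
    using theta_01[of i] by (auto simp: HT[OF i] DT distrib_left)
  also have "c2 * (T * D) + c2 * (T * D) = T * D"
    by (rule c2_mult)
  finally show ?thesis .
qed

text \<open>\<open>Ht i\<close> is H_i + theta_i W with [H_l, W] = theta_l W, so the mixed terms
  carry theta_i theta_k and cancel.\<close>

lemma HtHt: assumes ik: "i \<in> Idx" "k \<in> Idx" shows "br (Ht i) (Ht k) = 0"
proof -
  let ?W = "T * D * Hs"
  have 1: "br (H l) ?W = of_nat (th l) * ?W" if "l \<in> Idx" for l
    unfolding br_mult_right[of _ "T * D"] br_H_TD[OF that] HHs[OF that] by (simp add: mult.assoc)
  have 2: "br ?W (H l) = - (of_nat (th l) * ?W)" if "l \<in> Idx" for l
    using 1[OF that] br_commute[of ?W] by simp
  have "br (Ht i) (Ht k) = of_nat (th k) * (of_nat (th i) * ?W) - of_nat (th i) * (of_nat (th k) * ?W)"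
    unfolding Ht_def br_add_left br_add_right br_mult_right[of _ "of_nat _"] br_mult_left[of "of_nat _"]
      1[OF ik(1)] 2[OF ik(2)] by (simp add: HH[OF ik] br_eq_0_sym[OF br_of_nat])
  then show ?thesis
    using theta_01[of i] theta_01[of k] by auto
qed

lemma Hta: assumes ik: "i \<in> Idx" "k \<in> Idx" shows "br (Ht i) (a k) = of_int (cartan i k) * a k"
proof -
  have Hsa: "br Hs (a k) = of_nat (th k) * (V * (V * a k))"
  proof -
    have "T * (T * br Hs (a k)) = of_nat (th k) * a k"
      using Hts_a[OF ik(2)] br_eq_0_sym[OF Ta[OF ik(2)]] Ta[OF ik(2)]
      by (simp add: Hts_def br_mult_left mult.assoc)
    then have "V * (V * (T * (T * br Hs (a k)))) = V * (V * (of_nat (th k) * a k))" by simp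
    then show ?thesis by (simp add: of_nat_left_commute)
  qed
  have aTD: "br (T * D) (a k) = 0"
    using Ta[OF ik(2)] br_D[OF br_eq_0_sym[OF Ta[OF ik(2)]]] by (simp add: br_mult_left br_eq_0_sym)
  have "br (H i) (a k) = - (of_nat (th k) * (of_nat (th i) * (V * V * D * E k))) + of_int (cartan i k) * a k"
    using theta_01[of k] HV[OF ik(1)] HE[OF ik]
    by (auto simp: a_def br_mult_right mult.assoc of_int_left_commute)
  moreover have "br (T * D * Hs) (a k) = of_nat (th k) * (T * (D * (V * (V * a k))))"
    unfolding br_mult_left[of "T * D"] aTD Hsa using theta_01[of k] by (auto simp: mult.assoc)
  moreover have "of_nat (th k) * (T * (D * (V * (V * a k)))) = of_nat (th k) * (V * V * D * E k)"
    using theta_01[of k] by (auto simp: a_def DV' mult.assoc)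
  ultimately show ?thesis
    using theta_01[of i] theta_01[of k] by (auto simp: Ht_def br_add_left)
qed

text \<open>The summand -G_k Hs of f_k removes both the T-dependent part of \<open>Ht i\<close> and
  the term G_k E_i of [E_i, F_k]; the classical relation is what remains.\<close>

lemma Ef: assumes ik: "i \<in> Idx" "k \<in> Idx" shows "br (E i) (f k) = (if i = k then H i else 0)"
proof -
  have E: "E i = T ^ th i * a i"
    using theta_01[of i] by (auto simp: a_def)
  have EF: "br (E i) (F k) = (if i = k then Ht i else 0) - of_nat (th i) * (G k * E i)"
  proof -
    consider "th i = 0" | "th i = 1" using theta_01[of i] by auto
    then show ?thesis
    proof cases
      case 1
      then show ?thesis using EF_a[OF ik] by (auto simp: E)
    next
      case 2
      then show ?thesis using EF_a[OF ik]
        by (auto simp: E br_mult_left br_commute[of T "F k"] FT G_T'[OF ik(2)] mult.assoc)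
    qed
  qed
  have "br (E i) (G k * Hs) = br (E i) (G k) * Hs - of_nat (th i) * (G k * E i)"
    using HsE[OF ik(1)] by (simp add: br_mult_right br_commute[of "E i" Hs] of_nat_left_commute)
  then have "br (E i) (f k) = (if i = k then Ht i else 0) - br (E i) (G k) * Hs"
    by (simp add: f_def br_diff_right EF)
  then show ?thesis
    using EG[OF ik] by (auto simp: Ht_def mult.assoc)
qed

lemma fT: assumes k: "k \<in> Idx" shows "br (f k) T = V * G k" and "br (f k) V = - (V * (V * (V * G k)))"
proof -
  show 1: "br (f k) T = V * G k"
    by (simp add: f_def br_diff_left br_mult_left FT HsT GT[OF k] right_diff_distrib G_T[OF k] G_V[OF k])
  have "0 = br (f k) (T * V)" by simp
  also have "\<dots> = V * G k * V + T * br (f k) V" unfolding br_mult_right 1 by simp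
  finally have "T * br (f k) V = - (V * G k * V)" by (metis eq_neg_iff_add_eq_0 add.commute)
  then have "V * (T * br (f k) V) = V * (- (V * G k * V))" by simp
  then show "br (f k) V = - (V * (V * (V * G k)))" by (simp add: mult.assoc G_V[OF k])
qed

lemma VFS: assumes k: "k \<in> Idx" shows "br V (FS k) = - (V * (V * G k))"
proof -
  have "br V (f k) = V * (V * (V * G k))"
    using fT(2)[OF k] br_commute[of V "f k"] by simp
  moreover have "br V (V * G k) = 0" "br V (T ^ m) = 0" for m
    using br_eq_0_sym[OF GV[OF k]] br_power_0[of V T] by (auto simp: br_mult_right) (simp add: br_def)
  ultimately show ?thesis
    unfolding FS[OF k] using theta_01[of k] G_0[OF k]
    by (auto simp: br_add_right br_diff_right br_minus_right br_mult_right)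
qed

lemma Htf: assumes ik: "i \<in> Idx" "k \<in> Idx" shows "br (H i) (f k) = - (of_int (cartan i k) * f k)"
proof -
  have "br (H i) (f k) = - (of_int (cartan i k) * F k) + of_nat (th i) * (G k * Hs) - of_int (int (th i) - cartan i k) * (G k * Hs)"
    by (simp only: f_def br_diff_right HF'[OF ik] br_mult_right[of _ "G k"] HG[OF ik] HHs[OF ik(1)] mult_zero_right add_0_right mult.assoc)
  then show ?thesis by (simp add: f_def algebra_simps)
qed

text \<open>The relation for [H_i, F_k] as it reads in the opposite ring, with T and V exchanged;
  -\<open>Hts\<close> stands for the sum of the \<open>HS i\<close>.\<close>

lemma HFS: assumes ik: "i \<in> Idx" "k \<in> Idx"
  shows "br (FS k) (HS i) = - (of_int (cartan i k) * FS k) + of_nat (th i) * (- Hts * (br V (FS k) * T))"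
proof -
  let ?c = "of_int (cartan i k) :: 'a" and ?t = "of_nat (th i) :: 'a"
  note G1 = G_T[OF ik(2)] G_V[OF ik(2)] G_T'[OF ik(2)] G_V'[OF ik(2)]
  consider "th k = 0" | "th k = 1" using theta_01[of k] by auto
  then show ?thesis
  proof cases
    case 1
    then have G: "G k = 0" using G_0[OF ik(2)] by simp
    have "br (T * D) (f k) = 0"
      using br_eq_0_sym[OF br_D[of "f k"]] br_eq_0_sym[of "f k" T] fT(1)[OF ik(2)] by (simp add: G br_mult_left)
    then have "br (T * D * Hs) (f k) = 0"
      using Hsf[OF ik(2)] 1 by (simp add: br_mult_left[of "T * D"])
    then have "br (Ht i) (f k) = - (?c * f k)"
      by (simp add: Ht_def br_add_left Htf[OF ik] br_mult_left[of ?t] br_eq_0_sym[OF br_of_nat])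
    then show ?thesis
      using 1 by (simp add: VFS[OF ik(2)] FS[OF ik(2)] HS G fT(2)[OF ik(2)] br_commute[of V] br_minus_left br_minus_right br_commute[of "f k" "Ht i"])
  next
    case 2
    have fTT: "br (T * T) (f k) = - G k - G k"
      using fT(1)[OF ik(2)] by (simp add: br_mult_left br_commute[of T "f k"] G1 mult.assoc)
    then have TDf: "br (T * D) (f k) = - G k"
      by (simp add: TD br_mult_left[of c2] br_diff_left j_central right_diff_distrib)
        (metis add_uminus_conv_diff c2_mult minus_add_distrib mult_minus_right)
    have W: "br (T * D * Hs) (f k) = - (T * D * f k) - G k * Hs"
      using 2 Hsf[OF ik(2)] TDf by (simp add: br_mult_left[of "T * D"])
    have f: "br (Ht i) (f k) = - (?c * f k) + ?t * (- (T * D * f k) - G k * Hs)"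
      by (simp add: Ht_def br_add_left Htf[OF ik] br_mult_left[of ?t] br_eq_0_sym[OF br_of_nat] W)
    have TDG: "br (T * D) (G k) = 0"
      using GT[OF ik(2)] br_D[OF GT[OF ik(2)]] by (simp add: br_mult_left br_eq_0_sym)
    have g: "br (Ht i) (G k) = of_int (int (th i) - cartan i k) * G k + ?t * (T * D * G k)"
      by (simp add: Ht_def br_add_left HG[OF ik] br_mult_left[of ?t] br_eq_0_sym[OF br_of_nat]
        br_mult_left[of "T * D"] TDG HsG[OF ik(2)])
    have HtV: "br (Ht i) V = - (?t * D)"
    proof -
      have "0 = br (Ht i) (T * V)" by simp
      also have "\<dots> = ?t * (T * T * D) * V + T * br (Ht i) V"
        by (simp only: br_mult_right HtT[OF ik(1)])
      finally have "T * br (Ht i) V = - (?t * (T * T * D) * V)" by (metis eq_neg_iff_add_eq_0 add.commute)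
      then have "V * (T * br (Ht i) V) = V * (- (?t * (T * T * D) * V))" by simp
      then show ?thesis using theta_01[of i] by (auto simp: mult.assoc DV)
    qed
    have "br (FS k) (HS i) = br (Ht i) (FS k)"
      by (simp add: HS br_minus_right br_commute[of "FS k"])
    also have "\<dots> = - (?t * (T * T * D) * f k + T * (- (?c * f k) + ?t * (- (T * D * f k) - G k * Hs)))
        + (- (?t * D) * G k + V * (of_int (int (th i) - cartan i k) * G k + ?t * (T * D * G k)))"
      by (simp only: FS[OF ik(2)] 2 power_one_right br_add_right br_minus_right br_mult_right HtT[OF ik(1)] f g HtV)
    also have "\<dots> = ?c * (T * f k) + ?t * (T * (G k * Hs)) + of_int (int (th i) - cartan i k) * (V * G k)"
      using theta_01[of i] by (auto simp: algebra_simps of_int_left_commute)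
    also have "\<dots> = - (?c * FS k) + ?t * (T * (G k * Hs) + V * G k)"
      by (simp add: FS[OF ik(2)] 2 algebra_simps)
    also have "T * (G k * Hs) + V * G k = - Hts * (br V (FS k) * T)"
      by (simp add: VFS[OF ik(2)] Hts_def mult.assoc G1 Hs_V Hs_G[OF ik(2)] algebra_simps)
    finally show ?thesis .
  qed
qed

lemma EFS: assumes ik: "i \<in> Idx" "k \<in> Idx"
  shows "br (FS k) (ES i * T ^ th i) = (if i = k then HS i * T ^ th i
    + of_nat (th i) * (c2 * (- Hts * (V - T))) else 0)"
proof -
  have E: "ES i * T ^ th i = - E i"
    using theta_01[of i] ET[OF ik(1)] by (auto simp: ES a_def mult.assoc br_eq_0_iff)
  have "br (E i) (T ^ th k) = 0" "br (E i) V = 0"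
    using ET[OF ik(1)] by (auto intro!: br_power_0 br_V)
  then have "br (FS k) (ES i * T ^ th i) = - (T ^ th k * br (E i) (f k)) + V * br (E i) (G k)"
    unfolding E FS[OF ik(2)] by (simp add: br_minus_right br_commute[of _ "E i"] br_add_right br_diff_right br_mult_right)
  also have "\<dots> = (if i = k then - (T ^ th i * H i) + of_nat (th i) * D else 0)"
    using Ef[OF ik] EG[OF ik] theta_01[of i] by (auto simp: mult.assoc)
  also have "- (T ^ th i * H i) + of_nat (th i) * D = HS i * T ^ th i
    + of_nat (th i) * (c2 * (- Hts * (V - T)))"
  proof -
    consider "th i = 0" | "th i = 1" using theta_01[of i] by auto
    then show ?thesis
    proof cases
      case 1
      then show ?thesis by (simp add: HS Ht_def)
    next
      case 2
      have H_T: "H i * T = T * H i + D"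
        using HT[OF ik(1)] 2 by (simp add: br_def algebra_simps)
      have 3: "T * D * Hs * T = T * (T * D * Hs) + (T * D * T - T * D * V)"
        by (simp add: Hs_T mult.assoc DT' algebra_simps)
      have 4: "c2 * (- Hts * (V - T)) = T * (T * D * Hs) + c2 * (T * (T * T) - V)"
        by (simp add: Hts_def D_def Hs_T Hs_V algebra_simps j_commute')
      have 5: "T * D * T - T * D * V = c2 * (T * (T * T) - V) - (D + D)"
        unfolding DD by (simp add: D_def algebra_simps j_commute')
          (metis (no_types, opaque_lifting) add.assoc add.commute c2_mult)
      have "c2 * (- Hts * (V - T)) = T * D * Hs * T + (D + D)"
        unfolding 3 4 5 by simp
      then show ?thesis
        using 2 by (simp only: HS Ht_def) (simp add: H_T algebra_simps)
    qed
  qed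
  finally show ?thesis by simp
qed

lemma HsS: "sum HS Idx = - Hts"
proof -
  have "sum HS Idx = - Hs - of_nat (\<Sum>i\<in>Idx. th i) * (T * D * Hs)"
    by (simp add: HS Ht_def sum_negf sum.distrib sum_subtractf sum_distrib_right of_nat_sum Hs_def)
  also have "\<dots> = - Hts"
  proof -
    have "T * D * Hs + T * D * Hs = T * (D + D) * Hs" by (simp add: algebra_simps)
    also have "\<dots> = Hts - Hs" by (simp add: DD Hts_def algebra_simps)
    finally show ?thesis by (simp add: theta_sum N mult_2 distrib_right)
  qed
  finally show ?thesis .
qed

end

section \<open>Opposite rings and the relations in rings with a carrier\<close>

definition opp :: "'a ring \<Rightarrow> 'a ring" where
  "opp R = \<lparr>carrier = carrier R, monoid.mult = (\<lambda>x y. y \<otimes>\<^bsub>R\<^esub> x), one = \<one>\<^bsub>R\<^esub>, ring.zero = \<zero>\<^bsub>R\<^esub>, add = add R\<rparr>"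

lemma opp_simps [simp]:
  "carrier (opp R) = carrier R" "x \<otimes>\<^bsub>opp R\<^esub> y = y \<otimes>\<^bsub>R\<^esub> x" "\<one>\<^bsub>opp R\<^esub> = \<one>\<^bsub>R\<^esub>"
  "\<zero>\<^bsub>opp R\<^esub> = \<zero>\<^bsub>R\<^esub>" "x \<oplus>\<^bsub>opp R\<^esub> y = x \<oplus>\<^bsub>R\<^esub> y"
  by (simp_all add: opp_def)

lemma opp_add [simp]: "add (opp R) = add R"
  by (simp add: opp_def)

lemma opp_a_inv [simp]: "\<ominus>\<^bsub>opp R\<^esub> x = \<ominus>\<^bsub>R\<^esub> x" and opp_minus [simp]: "x \<ominus>\<^bsub>opp R\<^esub> y = x \<ominus>\<^bsub>R\<^esub> y"
  and opp_finsum [simp]: "finsum (opp R) f A = finsum R f A"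
  by (simp_all add: a_inv_def a_minus_def finsum_def)

lemma ring_opp: assumes "ring R" shows "ring (opp R)"
proof -
  interpret ring R by fact
  have "\<exists>y\<in>carrier R. y \<oplus>\<^bsub>R\<^esub> x = \<zero>\<^bsub>R\<^esub>" if "x \<in> carrier R" for x
    using that by (intro bexI[of _ "\<ominus>\<^bsub>R\<^esub> x"]) (auto simp: l_neg)
  then show ?thesis
    by (intro ringI abelian_groupI monoidI) (auto simp: a_assoc m_assoc a_comm a_lcomm l_distr r_distr)
qed

lemma opp_pow: assumes "ring R" "x \<in> carrier R" shows "x [^]\<^bsub>opp R\<^esub> (k::nat) = x [^]\<^bsub>R\<^esub> k"
proof -
  interpret ring R by fact
  show ?thesis
  proof (induction k)
    case (Suc k)
    have "x [^]\<^bsub>opp R\<^esub> (Suc k) = x \<otimes>\<^bsub>R\<^esub> x [^]\<^bsub>opp R\<^esub> k"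
      by (simp add: nat_pow_def)
    then show ?case
      by (simp only: Suc nat_pow_Suc2[OF assms(2)])
  qed (simp add: nat_pow_def)
qed

lemma lie_opp: "\<lbrakk>x, y\<rbrakk>\<^bsub>opp R\<^esub> = y \<otimes>\<^bsub>R\<^esub> x \<ominus>\<^bsub>R\<^esub> x \<otimes>\<^bsub>R\<^esub> y"
  by (simp add: lie_def)

text \<open>A complex algebra, given by the image of the scalars in the centre instead of by an
  action; scalar multiplication is then part of the ring arithmetic.\<close>

definition cemb :: "('a, 'b) ring_scheme \<Rightarrow> (complex \<Rightarrow> 'a) \<Rightarrow> bool" where
  "cemb R \<iota> \<longleftrightarrow> (\<forall>c. \<iota> c \<in> carrier R) \<and> (\<forall>c d. \<iota> (c + d) = \<iota> c \<oplus>\<^bsub>R\<^esub> \<iota> d) \<and>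
    (\<forall>c d. \<iota> (c * d) = \<iota> c \<otimes>\<^bsub>R\<^esub> \<iota> d) \<and> \<iota> 1 = \<one>\<^bsub>R\<^esub> \<and>
    (\<forall>c. \<forall>x\<in>carrier R. \<iota> c \<otimes>\<^bsub>R\<^esub> x = x \<otimes>\<^bsub>R\<^esub> \<iota> c)"

lemma cembD:
  assumes "cemb R \<iota>"
  shows "\<iota> c \<in> carrier R" "\<iota> (c + d) = \<iota> c \<oplus>\<^bsub>R\<^esub> \<iota> d" "\<iota> (c * d) = \<iota> c \<otimes>\<^bsub>R\<^esub> \<iota> d" "\<iota> 1 = \<one>\<^bsub>R\<^esub>"
    "x \<in> carrier R \<Longrightarrow> \<iota> c \<otimes>\<^bsub>R\<^esub> x = x \<otimes>\<^bsub>R\<^esub> \<iota> c"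
  using assms unfolding cemb_def by blast+

definition XR :: "('a, 'b) ring_scheme \<Rightarrow> nat \<Rightarrow> (nat \<Rightarrow> 'a) \<Rightarrow> 'a" where
  "XR R N E = foldr (lie R) (map E [1..<N - 1]) (E (N - 1))"

abbreviation relators where
  "relators R \<iota> \<equiv> jordanian_data.relators R (\<lambda>c x. \<iota> c \<otimes>\<^bsub>R\<^esub> x)"

lemma lie_closed: "ring R \<Longrightarrow> x \<in> carrier R \<Longrightarrow> y \<in> carrier R \<Longrightarrow> \<lbrakk>x, y\<rbrakk>\<^bsub>R\<^esub> \<in> carrier R"
proof -
  assume "ring R" and xy: "x \<in> carrier R" "y \<in> carrier R"
  then interpret ring R by simp
  show ?thesis using xy by (simp add: lie_def)
qed

lemma lie_funpow_closed:
  "ring R \<Longrightarrow> x \<in> carrier R \<Longrightarrow> y \<in> carrier R \<Longrightarrow> ((\<lambda>z. \<lbrakk>x, z\<rbrakk>\<^bsub>R\<^esub>) ^^ k) y \<in> carrier R"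
  by (induction k) (simp_all add: lie_closed)

lemma foldr_lie_closed:
  "ring R \<Longrightarrow> set xs \<subseteq> carrier R \<Longrightarrow> y \<in> carrier R \<Longrightarrow> foldr (lie R) xs y \<in> carrier R"
  by (induction xs) (simp_all add: lie_closed)

context ring_hom_ring
begin

lemma hom_minus: "x \<in> carrier R \<Longrightarrow> y \<in> carrier R \<Longrightarrow> h (x \<ominus>\<^bsub>R\<^esub> y) = h x \<ominus>\<^bsub>S\<^esub> h y"
  by (simp add: a_minus_def)

lemma hom_lie: "x \<in> carrier R \<Longrightarrow> y \<in> carrier R \<Longrightarrow> h (\<lbrakk>x, y\<rbrakk>\<^bsub>R\<^esub>) = \<lbrakk>h x, h y\<rbrakk>\<^bsub>S\<^esub>"
  by (simp add: lie_def hom_minus)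

lemma hom_lie_funpow: "x \<in> carrier R \<Longrightarrow> y \<in> carrier R \<Longrightarrow>
    h (((\<lambda>z. \<lbrakk>x, z\<rbrakk>\<^bsub>R\<^esub>) ^^ k) y) = ((\<lambda>z. \<lbrakk>h x, z\<rbrakk>\<^bsub>S\<^esub>) ^^ k) (h y)"
  by (induction k) (simp_all add: hom_lie lie_funpow_closed R.ring_axioms)

lemma hom_foldr_lie:
  "set xs \<subseteq> carrier R \<Longrightarrow> y \<in> carrier R \<Longrightarrow> h (foldr (lie R) xs y) = foldr (lie S) (map h xs) (h y)"
  by (induction xs) (simp_all add: hom_lie foldr_lie_closed R.ring_axioms)

lemma hom_XR:
  assumes "N \<ge> 3" "\<And>i. i \<in> {1..N-1} \<Longrightarrow> E i \<in> carrier R" "\<And>i. i \<in> {1..N-1} \<Longrightarrow> E' i = h (E i)"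
  shows "h (XR R N E) = XR S N E'"
proof -
  have "h (XR R N E) = foldr (lie S) (map h (map E [1..<N-1])) (h (E (N-1)))"
    unfolding XR_def using assms(1,2) by (intro hom_foldr_lie) auto
  also have "map h (map E [1..<N-1]) = map E' [1..<N-1]"
    using assms(3) by auto
  finally show ?thesis
    using assms(1,3) by (simp add: XR_def)
qed

text \<open>Every relator is a noncommutative polynomial in the generators with scalar coefficients,
  hence is respected by homomorphisms compatible with the scalars. The transfers between rings go
  through this lemma.\<close>

lemma hom_relators:
  assumes s: "\<And>c x. x \<in> carrier R \<Longrightarrow> h (s c x) = s' c (h x)" "\<And>c x. x \<in> carrier R \<Longrightarrow> s c x \<in> carrier R"
    and c: "\<And>i. i \<in> {1..N-1} \<Longrightarrow> E i \<in> carrier R \<and> F i \<in> carrier R \<and> H i \<in> carrier R"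
      "T \<in> carrier R" "V \<in> carrier R"
    and d: "\<And>i. i \<in> {1..N-1} \<Longrightarrow> E' i = h (E i)" "\<And>i. i \<in> {1..N-1} \<Longrightarrow> F' i = h (F i)"
      "\<And>i. i \<in> {1..N-1} \<Longrightarrow> H' i = h (H i)" "T' = h T" "V' = h V"
  shows "jordanian_data.relators S s' N E' F' H' T' V' = h ` jordanian_data.relators R s N E F H T V"
proof -
  have Hs: "(\<Oplus>\<^bsub>R\<^esub>k\<in>{1..N-1}. H k) \<in> carrier R"
    using c by (intro R.finsum_closed) auto
  have "h (\<Oplus>\<^bsub>R\<^esub>k\<in>{1..N-1}. H k) = (\<Oplus>\<^bsub>S\<^esub>k\<in>{1..N-1}. (h \<circ> H) k)"
    using c by (subst hom_finsum) (auto simp: comp_def)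
  also have "\<dots> = (\<Oplus>\<^bsub>S\<^esub>k\<in>{1..N-1}. H' k)"
    using c d by (intro S.finsum_cong') auto
  finally have hHs: "(\<Oplus>\<^bsub>S\<^esub>k\<in>{1..N-1}. H' k) = h (\<Oplus>\<^bsub>R\<^esub>k\<in>{1..N-1}. H k)" by simp
  show ?thesis
    unfolding jordanian_data.relators_def jordanian_data.TF_def jordanian_data.H_sum_def hHs image_UN
    by (intro SUP_cong refl)
      (simp add: image_Un c Hs d s hom_lie hom_minus hom_lie_funpow hom_nat_pow lie_closed R.ring_axioms)
qed

end

subsection \<open>Rings given by type classes\<close>

abbreviation type_ring :: "'a::ring_1 ring" where
  "type_ring \<equiv> ring_of_type_algebra"

lemma type_ring_simps [simp]:
  "carrier type_ring = UNIV" "x \<otimes>\<^bsub>type_ring\<^esub> y = x * y" "x \<oplus>\<^bsub>type_ring\<^esub> y = x + y"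
  "\<one>\<^bsub>type_ring\<^esub> = 1" "\<zero>\<^bsub>type_ring\<^esub> = 0"
  by (simp_all add: ring_of_type_algebra_def)

lemma ring_type_ring: "ring (type_ring :: 'a::ring_1 ring)"
proof -
  have "\<exists>y. y + x = 0" for x :: 'a
    by (rule exI[of _ "- x"]) simp
  then show ?thesis
    by (intro ringI abelian_groupI monoidI) (auto simp: algebra_simps)
qed

lemma type_ring_a_inv [simp]: "\<ominus>\<^bsub>type_ring\<^esub> x = - x" for x :: "'a::ring_1"
proof -
  interpret ring "type_ring :: 'a ring" by (rule ring_type_ring)
  show ?thesis using minus_equality[of "- x" x] by simp
qed

lemma type_ring_minus [simp]: "x \<ominus>\<^bsub>type_ring\<^esub> y = x - y"
  by (simp add: a_minus_def)

lemma type_ring_pow [simp]: "x [^]\<^bsub>type_ring\<^esub> (k::nat) = x ^ k" for x :: "'a::ring_1"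
proof -
  interpret ring "type_ring :: 'a ring" by (rule ring_type_ring)
  show ?thesis by (induction k) (simp_all add: power_commutes)
qed

lemma type_ring_finsum [simp]: "finite A \<Longrightarrow> finsum type_ring f A = sum f A" for f :: "'b \<Rightarrow> 'a::ring_1"
proof -
  interpret ring "type_ring :: 'a ring" by (rule ring_type_ring)
  show "finite A \<Longrightarrow> ?thesis" by (induction A rule: finite_induct) auto
qed

lemma type_ring_lie [simp]: "\<lbrakk>x, y\<rbrakk>\<^bsub>type_ring\<^esub> = br x y"
  by (simp add: lie_def br_def)

lemma opp_type_ring_lie: "lie (opp type_ring) x = (\<lambda>y. br y x)" for x :: "'a::ring_1"
  by (intro ext) (simp add: lie_opp br_def)

lemma type_ring_XR: "XR type_ring N E = rnest E (N-1) 1" for E :: "nat \<Rightarrow> 'a::ring_1"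
proof -
  have "lie type_ring = (br :: 'a \<Rightarrow> _)" by (intro ext) simp
  then show ?thesis by (simp add: XR_def rnest_def)
qed

lemma cartan_0_iff: "cartan i k = 0 \<longleftrightarrow> \<bar>int i - int k\<bar> > 1"
  and cartan_neg_iff: "cartan i k = -1 \<longleftrightarrow> \<bar>int i - int k\<bar> = 1"
  and cartan_cases: "i \<noteq> k \<Longrightarrow> cartan i k = 0 \<or> cartan i k = -1"
  by (auto simp: cartan_def)

lemma of_int_scalar:
  fixes j :: "complex \<Rightarrow> 'a::ring_1"
  assumes "\<And>c d. j (c + d) = j c + j d" "j 1 = 1"
  shows "j (of_int m) = of_int m" "j (of_nat k) = of_nat k"
proof -
  have 0: "j 0 = 0" using assms(1)[of 0 0] by simp
  show n: "j (of_nat k) = of_nat k" for k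
    by (induction k) (simp_all add: 0 assms)
  have "j (- of_nat k) = - of_nat k" for k
    using assms(1)[of "- of_nat k" "of_nat k"] by (simp add: n 0 eq_neg_iff_add_eq_0)
  then show "j (of_int m) = of_int m"
    by (cases m rule: int_cases2) (simp_all add: n)
qed

lemma relators_iff:
  "jordanian_data.relators R s N E F H T V \<subseteq> {\<zero>\<^bsub>R\<^esub>} \<longleftrightarrow> (\<forall>i\<in>{1..N-1}. \<forall>k\<in>{1..N-1}.
    \<lbrakk>H i, H k\<rbrakk>\<^bsub>R\<^esub> = \<zero>\<^bsub>R\<^esub> \<and>
    \<lbrakk>H i, E k\<rbrakk>\<^bsub>R\<^esub> \<ominus>\<^bsub>R\<^esub> s (of_int (cartan i k)) (E k) = \<zero>\<^bsub>R\<^esub> \<and>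
    \<lbrakk>H i, F k\<rbrakk>\<^bsub>R\<^esub> \<ominus>\<^bsub>R\<^esub> (s (- of_int (cartan i k)) (F k) \<oplus>\<^bsub>R\<^esub>
      s (of_nat (theta N i)) (V \<otimes>\<^bsub>R\<^esub> \<lbrakk>F k, T\<rbrakk>\<^bsub>R\<^esub> \<otimes>\<^bsub>R\<^esub> finsum R H {1..N-1})) = \<zero>\<^bsub>R\<^esub> \<and>
    \<lbrakk>V [^]\<^bsub>R\<^esub> theta N i \<otimes>\<^bsub>R\<^esub> E i, F k\<rbrakk>\<^bsub>R\<^esub> \<ominus>\<^bsub>R\<^esub> s (of_bool (i = k)) (V [^]\<^bsub>R\<^esub> theta N i \<otimes>\<^bsub>R\<^esub> H i \<oplus>\<^bsub>R\<^esub>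
      s (of_nat (theta N i) / 2) ((T \<ominus>\<^bsub>R\<^esub> V) \<otimes>\<^bsub>R\<^esub> finsum R H {1..N-1})) = \<zero>\<^bsub>R\<^esub> \<and>
    (\<bar>int i - int k\<bar> > 1 \<longrightarrow> \<lbrakk>E i, E k\<rbrakk>\<^bsub>R\<^esub> = \<zero>\<^bsub>R\<^esub> \<and>
      \<lbrakk>T [^]\<^bsub>R\<^esub> theta N i \<otimes>\<^bsub>R\<^esub> F i, T [^]\<^bsub>R\<^esub> theta N k \<otimes>\<^bsub>R\<^esub> F k\<rbrakk>\<^bsub>R\<^esub> = \<zero>\<^bsub>R\<^esub>) \<and>
    (i \<noteq> k \<longrightarrow> (lie R (E i) ^^ nat (1 - cartan i k)) (E k) = \<zero>\<^bsub>R\<^esub> \<and>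
      (lie R (T [^]\<^bsub>R\<^esub> theta N i \<otimes>\<^bsub>R\<^esub> F i) ^^ nat (1 - cartan i k)) (T [^]\<^bsub>R\<^esub> theta N k \<otimes>\<^bsub>R\<^esub> F k) = \<zero>\<^bsub>R\<^esub>))"
proof -
  have if_sub: "(if P then A else {}) \<subseteq> Z \<longleftrightarrow> (P \<longrightarrow> A \<subseteq> Z)" for P A Z
    by auto
  show ?thesis
    unfolding jordanian_data.relators_def jordanian_data.TF_def jordanian_data.H_sum_def
    by (simp only: UN_subset_iff Un_subset_iff insert_subset empty_subsetI singleton_iff if_sub simp_thms conj_assoc)
qed

lemma nat_1_minus_cartan: "i \<noteq> k \<Longrightarrow> nat (1 - cartan i k) = (if cartan i k = 0 then 1 else 2)"
  by (auto simp: cartan_def)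

lemma cemb_scalars:
  fixes j :: "complex \<Rightarrow> 'a::ring_1"
  assumes "\<And>c d. j (c + d) = j c + j d" "\<And>c d. j (c * d) = j c * j d" "j 1 = 1"
  shows "j (of_int m) = of_int m" "j (- of_int m) = - of_int m" "j (of_nat k) = of_nat k"
    "j (of_nat k / 2) = of_nat k * j (1/2)" "j (of_bool P) * x = (if P then x else 0)"
proof -
  note sc = of_int_scalar[of j, OF assms(1,3)]
  show "j (of_int m) = of_int m" "j (- of_int m) = - of_int m" "j (of_nat k) = of_nat k"
    using sc(1)[of m] sc(1)[of "- m"] sc(2)[of k] by simp_all
  show "j (of_nat k / 2) = of_nat k * j (1/2)"
    using assms(2)[of "of_nat k" "1/2"] sc by simp
  show "j (of_bool P) * x = (if P then x else 0)"
    using sc(2)[of 0] assms(3) by simp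
qed

lemma type_ring_relators_iff:
  fixes j :: "complex \<Rightarrow> 'a::ring_1"
  assumes j: "\<And>c d. j (c + d) = j c + j d" "\<And>c d. j (c * d) = j c * j d" "j 1 = 1"
  shows "relators type_ring j N E F H T V \<subseteq> {\<zero>\<^bsub>type_ring\<^esub>} \<longleftrightarrow> (\<forall>i\<in>{1..N-1}. \<forall>k\<in>{1..N-1}.
    br (H i) (H k) = 0 \<and> br (H i) (E k) = of_int (cartan i k) * E k \<and>
    br (H i) (F k) = - (of_int (cartan i k) * F k) + of_nat (theta N i) * (V * br (F k) T * sum H {1..N-1}) \<and>
    br (V ^ theta N i * E i) (F k) = (if i = k then V ^ theta N i * H i
         + of_nat (theta N i) * (j (1/2) * ((T - V) * sum H {1..N-1})) else 0) \<and>
    (i \<noteq> k \<longrightarrow> cartan i k = 0 \<longrightarrow> br (E i) (E k) = 0 \<and> br (T ^ theta N i * F i) (T ^ theta N k * F k) = 0) \<and>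
    (cartan i k = -1 \<longrightarrow> br (E i) (br (E i) (E k)) = 0 \<and>
      br (T ^ theta N i * F i) (br (T ^ theta N i * F i) (T ^ theta N k * F k)) = 0))"
proof -
  note sc = cemb_scalars[of j, OF j]
  have far: "\<bar>int i - int k\<bar> > 1 \<longleftrightarrow> i \<noteq> k \<and> cartan i k = 0" for i k
    by (auto simp: cartan_def)
  \<comment> \<open>For distinct i and k the exponent 1 - a_ik is 1 or 2, so the iterated adjoint
    action is a single or a double bracket.\<close>
  have near: "(i \<noteq> k \<longrightarrow> (f i k ^^ nat (1 - cartan i k)) x = 0 \<and> (g i k ^^ nat (1 - cartan i k)) y = 0)
     \<longleftrightarrow> (i \<noteq> k \<longrightarrow> cartan i k = 0 \<longrightarrow> f i k x = 0 \<and> g i k y = 0) \<and>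
      (cartan i k = -1 \<longrightarrow> f i k (f i k x) = 0 \<and> g i k (g i k y) = 0)" for i k x y and f g :: "nat \<Rightarrow> nat \<Rightarrow> 'a \<Rightarrow> 'a"
    using cartan_cases[of i k] by (auto simp: nat_1_minus_cartan numeral_2_eq_2 cartan_def)
  have eq: "x - (- a + b) = 0 \<longleftrightarrow> x = - a + b" for x a b :: 'a by simp
  show ?thesis
    unfolding relators_iff
  proof (intro ball_cong refl, goal_cases)
    case (1 i k)
    show ?case
      unfolding far
      unfolding type_ring_lie type_ring_simps type_ring_pow type_ring_minus type_ring_finsum[OF finite_atLeastAtMost]
        sc mult_minus_left eq
      using near[of i k "\<lambda>i _. br (E i)" "E k" "\<lambda>i _. br (T ^ theta N i * F i)" "T ^ theta N k * F k"]
      by (simp only: mult.assoc eq_iff_diff_eq_0[symmetric]) blast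
  qed
qed

lemma (in jordan_rels) relators_type_ring:
  "relators type_ring j N E F H T V \<subseteq> {\<zero>\<^bsub>type_ring\<^esub>}"
  unfolding type_ring_relators_iff[OF j_add j_mult j_one]
  by (intro ballI conjI impI HH HE HF EF EE KK EEE KKK)

lemma jordan_rep_type_ring:
  assumes N: "N \<ge> 3" and j: "cemb type_ring j"
    and r: "relators type_ring j N E F H T V \<subseteq> {\<zero>\<^bsub>type_ring\<^esub>}"
    and t: "T * V = 1" "V * T = 1" "T * T = 1 + j (2 * h) * rnest E (N-1) 1"
      "\<And>z. br z (rnest E (N-1) 1) = 0 \<Longrightarrow> br z T = 0"
  shows "jordan_rep j N E F H T V h"
proof -
  have ja: "j (c + d) = j c + j d" "j (c * d) = j c * j d" "j 1 = 1" "br (j c) x = 0" for c d x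
    using cembD(2)[OF j, of c d] cembD(3)[OF j, of c d] cembD(4)[OF j] cembD(5)[OF j, of x c]
    by (simp_all add: br_eq_0_iff)
  have R: "\<forall>i\<in>{1..N-1}. \<forall>k\<in>{1..N-1}.
    br (H i) (H k) = 0 \<and> br (H i) (E k) = of_int (cartan i k) * E k \<and>
    br (H i) (F k) = - (of_int (cartan i k) * F k) + of_nat (theta N i) * (V * br (F k) T * sum H {1..N-1}) \<and>
    br (V ^ theta N i * E i) (F k) = (if i = k then V ^ theta N i * H i
         + of_nat (theta N i) * (j (1/2) * ((T - V) * sum H {1..N-1})) else 0) \<and>
    (i \<noteq> k \<longrightarrow> cartan i k = 0 \<longrightarrow> br (E i) (E k) = 0 \<and> br (T ^ theta N i * F i) (T ^ theta N k * F k) = 0) \<and>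
    (cartan i k = -1 \<longrightarrow> br (E i) (br (E i) (E k)) = 0 \<and>
      br (T ^ theta N i * F i) (br (T ^ theta N i * F i) (T ^ theta N k * F k)) = 0)"
    using r unfolding type_ring_relators_iff[of j, OF ja(1-3)] .
  then have R': "\<And>i k. \<lbrakk>i \<in> {1..N-1}; k \<in> {1..N-1}\<rbrakk> \<Longrightarrow> br (H i) (H k) = 0"
    "\<And>i k. \<lbrakk>i \<in> {1..N-1}; k \<in> {1..N-1}\<rbrakk> \<Longrightarrow> br (H i) (E k) = of_int (cartan i k) * E k"
    "\<And>i k. \<lbrakk>i \<in> {1..N-1}; k \<in> {1..N-1}\<rbrakk> \<Longrightarrow> br (H i) (F k) =
      - (of_int (cartan i k) * F k) + of_nat (theta N i) * (V * br (F k) T * sum H {1..N-1})"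
    "\<And>i k. \<lbrakk>i \<in> {1..N-1}; k \<in> {1..N-1}\<rbrakk> \<Longrightarrow> br (V ^ theta N i * E i) (F k) =
      (if i = k then V ^ theta N i * H i
         + of_nat (theta N i) * (j (1/2) * ((T - V) * sum H {1..N-1})) else 0)"
    "\<And>i k. \<lbrakk>i \<in> {1..N-1}; k \<in> {1..N-1}; i \<noteq> k; cartan i k = 0\<rbrakk> \<Longrightarrow> br (E i) (E k) = 0"
    "\<And>i k. \<lbrakk>i \<in> {1..N-1}; k \<in> {1..N-1}; i \<noteq> k; cartan i k = 0\<rbrakk> \<Longrightarrow>
      br (T ^ theta N i * F i) (T ^ theta N k * F k) = 0"
    "\<And>i k. \<lbrakk>i \<in> {1..N-1}; k \<in> {1..N-1}; cartan i k = -1\<rbrakk> \<Longrightarrow> br (E i) (br (E i) (E k)) = 0"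
    "\<And>i k. \<lbrakk>i \<in> {1..N-1}; k \<in> {1..N-1}; cartan i k = -1\<rbrakk> \<Longrightarrow>
      br (T ^ theta N i * F i) (br (T ^ theta N i * F i) (T ^ theta N k * F k)) = 0"
    by simp_all
  show ?thesis
    by unfold_locales (fact N ja t R')+
qed

text \<open>[x, y] of the opposite ring is \<open>br y x\<close>, so the arguments of every bracket
  and the factors of every product change places.\<close>

lemma opp_type_ring_relators:
  fixes j :: "complex \<Rightarrow> 'a::ring_1"
  assumes j: "\<And>c d. j (c + d) = j c + j d" "\<And>c d. j (c * d) = j c * j d" "j 1 = 1" "\<And>c x. br (j c) x = 0"
    and R: "\<And>i k. \<lbrakk>i \<in> {1..N-1}; k \<in> {1..N-1}\<rbrakk> \<Longrightarrow>
    br (H k) (H i) = 0 \<and> br (E k) (H i) = of_int (cartan i k) * E k \<and>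
    br (F k) (H i) = - (of_int (cartan i k) * F k) + of_nat (theta N i) * (sum H {1..N-1} * (br T (F k) * V)) \<and>
    br (F k) (E i * V ^ theta N i) = (if i = k then H i * V ^ theta N i
         + of_nat (theta N i) * (j (1/2) * (sum H {1..N-1} * (T - V))) else 0) \<and>
    (i \<noteq> k \<longrightarrow> cartan i k = 0 \<longrightarrow> br (E k) (E i) = 0 \<and> br (F k * T ^ theta N k) (F i * T ^ theta N i) = 0) \<and>
    (cartan i k = -1 \<longrightarrow> br (br (E k) (E i)) (E i) = 0 \<and>
      br (br (F k * T ^ theta N k) (F i * T ^ theta N i)) (F i * T ^ theta N i) = 0)"
  shows "relators (opp type_ring) j N E F H T V \<subseteq> {\<zero>\<^bsub>opp type_ring\<^esub>}"
proof -
  note sc = cemb_scalars[of j, OF j(1-3)]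
  have jc: "x * j c = j c * x" for x c using j(4) by (simp add: br_eq_0_iff)
  have sc': "x * j (of_int m) = of_int m * x" "x * j (- of_int m) = - (of_int m * x)" "x * j (of_nat k) = of_nat k * x"
    "x * j (of_nat k / 2) = of_nat k * (j (1/2) * x)" "x * j (of_bool P) = (if P then x else 0)" for x m k P
    unfolding jc unfolding sc by (simp_all add: mult.assoc)
  have far: "\<bar>int i - int k\<bar> > 1 \<longleftrightarrow> i \<noteq> k \<and> cartan i k = 0" for i k
    by (auto simp: cartan_def)
  have near: "(i \<noteq> k \<longrightarrow> (f i k ^^ nat (1 - cartan i k)) x = 0 \<and> (g i k ^^ nat (1 - cartan i k)) y = 0)
     \<longleftrightarrow> (i \<noteq> k \<longrightarrow> cartan i k = 0 \<longrightarrow> f i k x = 0 \<and> g i k y = 0) \<and>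
      (cartan i k = -1 \<longrightarrow> f i k (f i k x) = 0 \<and> g i k (g i k y) = 0)" for i k x y and f g :: "nat \<Rightarrow> nat \<Rightarrow> 'a \<Rightarrow> 'a"
    using cartan_cases[of i k] by (auto simp: nat_1_minus_cartan numeral_2_eq_2 cartan_def)
  note pow = opp_pow[OF ring_type_ring, simplified]
  show ?thesis
    unfolding relators_iff
  proof (intro ballI, goal_cases)
    case (1 i k)
    have eq: "x - (- a + b) = 0 \<longleftrightarrow> x = - a + b" for x a b :: 'a by simp
    show ?case
      unfolding far
      unfolding opp_type_ring_lie opp_simps type_ring_simps pow opp_minus type_ring_minus opp_finsum
        type_ring_finsum[OF finite_atLeastAtMost] sc' mult_minus_left eq
      using near[of i k "\<lambda>i _ x. br x (E i)" "E k" "\<lambda>i _ x. br x (F i * T ^ theta N i)" "F k * T ^ theta N k"] R[OF 1]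
      by (simp only: mult.assoc eq_iff_diff_eq_0[symmetric]) blast
  qed
qed

text \<open>\<open>V\<close> and \<open>T\<close> are exchanged because the antipode sends T to its
  inverse.\<close>

lemma (in jordan_rep) opp_relators:
  "relators (opp type_ring) j N ES FS HS V T \<subseteq> {\<zero>\<^bsub>opp type_ring\<^esub>}"
proof (rule opp_type_ring_relators)
  fix i k assume ik: "i \<in> {1..N-1}" "k \<in> {1..N-1}"
  have "br (HS k) (HS i) = 0"
    using HtHt[OF ik(2) ik(1)] by (simp add: HS br_minus_left br_minus_right)
  moreover have "br (ES k) (HS i) = of_int (cartan i k) * ES k"
    using Hta[OF ik] br_commute[of "a k" "Ht i"] by (simp add: HS ES br_minus_left br_minus_right)
  ultimately show "br (HS k) (HS i) = 0 \<and> br (ES k) (HS i) = of_int (cartan i k) * ES k \<and>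
    br (FS k) (HS i) = - (of_int (cartan i k) * FS k) + of_nat (th i) * (sum HS Idx * (br V (FS k) * T)) \<and>
    br (FS k) (ES i * T ^ th i) = (if i = k then HS i * T ^ th i
         + of_nat (th i) * (j (1/2) * (sum HS Idx * (V - T))) else 0) \<and>
    (i \<noteq> k \<longrightarrow> cartan i k = 0 \<longrightarrow> br (ES k) (ES i) = 0 \<and> br (FS k * V ^ th k) (FS i * V ^ th i) = 0) \<and>
    (cartan i k = -1 \<longrightarrow> br (br (ES k) (ES i)) (ES i) = 0 \<and>
      br (br (FS k * V ^ th k) (FS i * V ^ th i)) (FS i * V ^ th i) = 0)"
    unfolding HsS using HFS[OF ik] EFS[OF ik] ES_far ES_near KS_far KS_near ik by blast
qed (rule j_add j_mult j_one j_central)+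

subsection \<open>The product of all algebras on a given type\<close>

declare split_paired_All [simp del] split_paired_Ex [simp del]

text \<open>A type cannot depend on a given ring, so all algebra structures on subsets of the type
  'a are multiplied together. The given algebra is one of the factors and is reached by the
  projection \<open>pr\<close>.\<close>

definition structure_ok :: "'a ring \<times> (complex \<Rightarrow> 'a) \<Rightarrow> bool" where
  "structure_ok S \<longleftrightarrow> ring (fst S) \<and> cemb (fst S) (snd S)"

lemma structure_ok_ring: "structure_ok S \<Longrightarrow> ring (fst S)"
  and structure_ok_cemb: "structure_ok S \<Longrightarrow> cemb (fst S) (snd S)"
  by (simp_all add: structure_ok_def)

lemma ring_zero_in: "ring R \<Longrightarrow> \<zero>\<^bsub>R\<^esub> \<in> carrier R"
  and ring_one_in: "ring R \<Longrightarrow> \<one>\<^bsub>R\<^esub> \<in> carrier R"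
  by (simp_all add: ring.ring_simprules)

text \<open>The factor of complex numbers only serves to make one and zero different.\<close>

typedef 'a prodalg = "{x :: complex \<times> ('a ring \<times> (complex \<Rightarrow> 'a) \<Rightarrow> 'a).
    \<forall>S. if structure_ok S then snd x S \<in> carrier (fst S) else snd x S = undefined}"
  by (rule exI[of _ "(0, \<lambda>S. if structure_ok S then \<zero>\<^bsub>fst S\<^esub> else undefined)"])
    (simp add: ring_zero_in structure_ok_ring)

definition pc :: "'a prodalg \<Rightarrow> complex" where "pc x = fst (Rep_prodalg x)"
definition pr :: "'a ring \<times> (complex \<Rightarrow> 'a) \<Rightarrow> 'a prodalg \<Rightarrow> 'a" where "pr S x = snd (Rep_prodalg x) S"
definition mk :: "complex \<Rightarrow> ('a ring \<times> (complex \<Rightarrow> 'a) \<Rightarrow> 'a) \<Rightarrow> 'a prodalg" where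
  "mk c f = Abs_prodalg (c, \<lambda>S. if structure_ok S then f S else undefined)"

lemma pr_closed [simp]: "structure_ok S \<Longrightarrow> pr S x \<in> carrier (fst S)"
  using Rep_prodalg[of x] by (simp add: pr_def split: if_splits)

lemma mk_simps:
  assumes "\<And>S. structure_ok S \<Longrightarrow> f S \<in> carrier (fst S)"
  shows "pc (mk c f) = c" "structure_ok S \<Longrightarrow> pr S (mk c f) = f S"
  using assms by (simp_all add: pc_def pr_def mk_def Abs_prodalg_inverse)

text \<open>Outside the valid structures every element takes the value \<open>undefined\<close>, so
  the valid factors and the complex factor decide.\<close>

lemma prodalg_eqI:
  assumes "pc x = pc y" "\<And>S. structure_ok S \<Longrightarrow> pr S x = pr S y"
  shows "x = y"
proof -
  have "snd (Rep_prodalg x) S = snd (Rep_prodalg y) S" for S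
    using assms(2)[of S] Rep_prodalg[of x] Rep_prodalg[of y]
    by (cases "structure_ok S") (simp_all add: pr_def)
  then have "Rep_prodalg x = Rep_prodalg y"
    using assms(1) by (intro prod_eqI) (auto simp: pc_def)
  then show ?thesis by (simp add: Rep_prodalg_inject)
qed

instantiation prodalg :: (type) ring_1
begin

definition "0 = mk 0 (\<lambda>S. \<zero>\<^bsub>fst S\<^esub>)"
definition "1 = mk 1 (\<lambda>S. \<one>\<^bsub>fst S\<^esub>)"
definition "x + y = mk (pc x + pc y) (\<lambda>S. pr S x \<oplus>\<^bsub>fst S\<^esub> pr S y)"
definition "x - y = mk (pc x - pc y) (\<lambda>S. pr S x \<ominus>\<^bsub>fst S\<^esub> pr S y)"
definition "- x = mk (- pc x) (\<lambda>S. \<ominus>\<^bsub>fst S\<^esub> pr S x)"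
definition "x * y = mk (pc x * pc y) (\<lambda>S. pr S x \<otimes>\<^bsub>fst S\<^esub> pr S y)"

lemma pc_simps [simp]: "pc 0 = 0" "pc 1 = 1" "pc (x + y) = pc x + pc y" "pc (x - y) = pc x - pc y"
  "pc (- x) = - pc x" "pc (x * y) = pc x * pc y"
  by (simp_all add: zero_prodalg_def one_prodalg_def plus_prodalg_def minus_prodalg_def uminus_prodalg_def
      times_prodalg_def mk_simps ring.ring_simprules structure_ok_ring)

lemma pr_simps [simp]:
  assumes "structure_ok S"
  shows "pr S 0 = \<zero>\<^bsub>fst S\<^esub>" "pr S 1 = \<one>\<^bsub>fst S\<^esub>" "pr S (x + y) = pr S x \<oplus>\<^bsub>fst S\<^esub> pr S y"
    "pr S (x - y) = pr S x \<ominus>\<^bsub>fst S\<^esub> pr S y" "pr S (- x) = \<ominus>\<^bsub>fst S\<^esub> pr S x"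
    "pr S (x * y) = pr S x \<otimes>\<^bsub>fst S\<^esub> pr S y"
  using assms
  by (simp_all add: zero_prodalg_def one_prodalg_def plus_prodalg_def minus_prodalg_def uminus_prodalg_def
      times_prodalg_def mk_simps ring.ring_simprules structure_ok_ring)

instance
proof
  fix a b c :: "'a prodalg"
  note R = ring.ring_simprules[OF structure_ok_ring]
  show "a + b + c = a + (b + c)" by (rule prodalg_eqI) (simp_all add: R(7))
  show "a + b = b + a" by (rule prodalg_eqI) (simp_all add: R(10))
  show "0 + a = a" by (rule prodalg_eqI) (simp_all add: R(8))
  show "- a + a = 0" by (rule prodalg_eqI) (simp_all add: R(9))
  show "a - b = a + - b" by (rule prodalg_eqI) (simp_all add: a_minus_def)
  show "a * b * c = a * (b * c)" by (rule prodalg_eqI) (simp_all add: R(11))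
  show "1 * a = a" by (rule prodalg_eqI) (simp_all add: R(12))
  show "a * 1 = a" by (rule prodalg_eqI) (simp_all add: monoid.r_one[OF ring.is_monoid[OF structure_ok_ring]])
  show "(a + b) * c = a * c + b * c" by (rule prodalg_eqI) (simp_all add: R(13) distrib_right)
  show "a * (b + c) = a * b + a * c" by (rule prodalg_eqI) (simp_all add: ring.ring_simprules(23)[OF structure_ok_ring] distrib_left)
  show "(0::'a prodalg) \<noteq> 1" using pc_simps(1,2) by (metis zero_neq_one)
qed

end

definition jP :: "complex \<Rightarrow> 'a prodalg" where "jP c = mk c (\<lambda>S. snd S c)"

lemma snd_closed: "structure_ok S \<Longrightarrow> snd S c \<in> carrier (fst S)"
  by (rule cembD(1)[OF structure_ok_cemb])

lemma pc_jP [simp]: "pc (jP c) = c"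
  unfolding jP_def by (rule mk_simps(1)) (rule snd_closed)

lemma pr_jP [simp]: "structure_ok S \<Longrightarrow> pr S (jP c) = snd S c"
  unfolding jP_def by (rule mk_simps(2)) (rule snd_closed)

lemma cemb_jP: "cemb type_ring jP"
proof -
  note C = cembD[OF structure_ok_cemb]
  have "jP (c + d) = jP c + jP d" "jP (c * d) = jP c * jP d" "jP 1 = 1" "jP c * x = x * jP c" for c d x
    by (rule prodalg_eqI; simp add: C(2,3,4) C(5)[symmetric])+
  then show ?thesis unfolding cemb_def type_ring_simps by blast
qed

lemma ring_hom_pr:
  assumes "structure_ok S" shows "ring_hom_ring type_ring (fst S) (pr S)"
  using assms by (intro ring_hom_ringI2 ring_type_ring structure_ok_ring) (auto simp: ring_hom_def)

lemma ring_hom_pc: "ring_hom_ring type_ring type_ring pc"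
  by (intro ring_hom_ringI2 ring_type_ring) (auto simp: ring_hom_def)

text \<open>Places x in the factor \<open>S0\<close> and the constant 1 or 0, according to
  \<open>t\<close>, in all others. With 1 for T and V and 0 for E, F, H the other factors carry the
  trivial representation.\<close>

definition lift :: "'a ring \<times> (complex \<Rightarrow> 'a) \<Rightarrow> bool \<Rightarrow> 'a \<Rightarrow> 'a prodalg" where
  "lift S0 t x = mk (of_bool t) (\<lambda>S. if S = S0 \<and> x \<in> carrier (fst S) then x
     else if t then \<one>\<^bsub>fst S\<^esub> else \<zero>\<^bsub>fst S\<^esub>)"

lemma lift_simps:
  "pc (lift S0 t x) = of_bool t"
  "structure_ok S \<Longrightarrow> x \<in> carrier (fst S) \<Longrightarrow> pr S (lift S t x) = x"
  "structure_ok S \<Longrightarrow> S \<noteq> S0 \<Longrightarrow> pr S (lift S0 t x) = (if t then \<one>\<^bsub>fst S\<^esub> else \<zero>\<^bsub>fst S\<^esub>)"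
proof -
  let ?f = "\<lambda>S. if S = S0 \<and> x \<in> carrier (fst S) then x else if t then \<one>\<^bsub>fst S\<^esub> else \<zero>\<^bsub>fst S\<^esub>"
  have c: "?f S \<in> carrier (fst S)" if "structure_ok S" for S S0
    using that by (auto simp: ring_zero_in ring_one_in structure_ok_ring)
  show "pc (lift S0 t x) = of_bool t"
    unfolding lift_def using c by (rule mk_simps(1))
  have *: "structure_ok S \<Longrightarrow> pr S (lift S0 t x) = (if S = S0 \<and> x \<in> carrier (fst S) then x
     else if t then \<one>\<^bsub>fst S\<^esub> else \<zero>\<^bsub>fst S\<^esub>)" for S S0
    unfolding lift_def by (rule mk_simps(2)) (auto simp: ring_zero_in ring_one_in structure_ok_ring)
  show "structure_ok S \<Longrightarrow> x \<in> carrier (fst S) \<Longrightarrow> pr S (lift S t x) = x"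
    "structure_ok S \<Longrightarrow> S \<noteq> S0 \<Longrightarrow> pr S (lift S0 t x) = (if t then \<one>\<^bsub>fst S\<^esub> else \<zero>\<^bsub>fst S\<^esub>)"
    by (simp_all add: *)
qed

lemma pr_pow: "structure_ok S \<Longrightarrow> pr S (x ^ k) = pr S x [^]\<^bsub>fst S\<^esub> (k::nat)"
  using ring_hom_ring.hom_nat_pow[OF ring_hom_pr, of S x k] by simp

lemma pr_br: "structure_ok S \<Longrightarrow> pr S (br x y) = \<lbrakk>pr S x, pr S y\<rbrakk>\<^bsub>fst S\<^esub>"
  by (simp add: br_def lie_def)

lemma pr_sum:
  assumes "structure_ok S" "finite A" shows "pr S (sum f A) = finsum (fst S) (\<lambda>i. pr S (f i)) A"
proof -
  interpret ring_hom_ring type_ring "fst S" "pr S" by (rule ring_hom_pr) fact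
  show ?thesis using hom_finsum[of f A] assms by (simp add: comp_def)
qed

lemma XR_zero: assumes "ring R" shows "XR R N (\<lambda>_. \<zero>\<^bsub>R\<^esub>) = \<zero>\<^bsub>R\<^esub>"
proof -
  interpret ring R by fact
  have "foldr (lie R) (map (\<lambda>_. \<zero>\<^bsub>R\<^esub>) xs) \<zero>\<^bsub>R\<^esub> = \<zero>\<^bsub>R\<^esub>" for xs :: "nat list"
    by (induction xs) (simp_all add: lie_def minus_eq)
  then show ?thesis by (simp add: XR_def)
qed

text \<open>The trivial representation. It fills the idle factors of the product and, over the
  complex numbers, yields the counit.\<close>

lemma trivial_relators:
  assumes "ring R" "cemb R \<iota>"
  shows "relators R \<iota> N (\<lambda>_. \<zero>\<^bsub>R\<^esub>) (\<lambda>_. \<zero>\<^bsub>R\<^esub>) (\<lambda>_. \<zero>\<^bsub>R\<^esub>) \<one>\<^bsub>R\<^esub> \<one>\<^bsub>R\<^esub> \<subseteq> {\<zero>\<^bsub>R\<^esub>}"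
proof -
  interpret ring R by fact
  have lie: "\<lbrakk>\<zero>\<^bsub>R\<^esub>, x\<rbrakk>\<^bsub>R\<^esub> = \<zero>\<^bsub>R\<^esub>" if "x \<in> carrier R" for x
    using that by (simp add: lie_def minus_eq)
  have f: "(lie R \<zero>\<^bsub>R\<^esub> ^^ k) \<zero>\<^bsub>R\<^esub> = \<zero>\<^bsub>R\<^esub>" for k
    by (induction k) (simp_all add: lie)
  have fs: "finsum R (\<lambda>_. \<zero>\<^bsub>R\<^esub>) {1..N-1} = \<zero>\<^bsub>R\<^esub>"
    by simp
  show ?thesis
    unfolding relators_iff fs by (simp add: lie f cembD(1)[OF assms(2)] nat_pow_one minus_eq)
qed

text \<open>The counterpart of \<open>jordan_rep\<close> for a ring with carrier; the commutant
  condition ranges over the carrier only.\<close>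

definition jrep :: "'a ring \<Rightarrow> (complex \<Rightarrow> 'a) \<Rightarrow> nat \<Rightarrow> complex \<Rightarrow> (nat \<Rightarrow> 'a) \<Rightarrow> (nat \<Rightarrow> 'a) \<Rightarrow> (nat \<Rightarrow> 'a) \<Rightarrow> 'a \<Rightarrow> 'a \<Rightarrow> bool"
  where "jrep R \<iota> N h E F H T V \<longleftrightarrow> N \<ge> 3 \<and> ring R \<and> cemb R \<iota> \<and>
    (\<forall>i\<in>{1..N-1}. E i \<in> carrier R \<and> F i \<in> carrier R \<and> H i \<in> carrier R) \<and> T \<in> carrier R \<and> V \<in> carrier R \<and>
    relators R \<iota> N E F H T V \<subseteq> {\<zero>\<^bsub>R\<^esub>} \<and> T \<otimes>\<^bsub>R\<^esub> V = \<one>\<^bsub>R\<^esub> \<and> V \<otimes>\<^bsub>R\<^esub> T = \<one>\<^bsub>R\<^esub> \<and>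
    T \<otimes>\<^bsub>R\<^esub> T = \<one>\<^bsub>R\<^esub> \<oplus>\<^bsub>R\<^esub> \<iota> (2 * h) \<otimes>\<^bsub>R\<^esub> XR R N E \<and>
    (\<forall>z\<in>carrier R. z \<otimes>\<^bsub>R\<^esub> XR R N E = XR R N E \<otimes>\<^bsub>R\<^esub> z \<longrightarrow> z \<otimes>\<^bsub>R\<^esub> T = T \<otimes>\<^bsub>R\<^esub> z)"

text \<open>Identities in the product are checked factor by factor: at \<open>S0\<close> they are
  the hypotheses, elsewhere they hold for the trivial representation.\<close>

lemma jrep_lift:
  assumes J: "jrep R \<iota> N h E F H T V"
  defines "S0 \<equiv> (R, \<iota>)"
  shows "jordan_rep jP N (\<lambda>i. lift S0 False (E i)) (\<lambda>i. lift S0 False (F i)) (\<lambda>i. lift S0 False (H i))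
     (lift S0 True T) (lift S0 True V) h"
proof -
  let ?E = "\<lambda>i. lift S0 False (E i)" and ?F = "\<lambda>i. lift S0 False (F i)" and ?H = "\<lambda>i. lift S0 False (H i)"
    and ?T = "lift S0 True T" and ?V = "lift S0 True V"
  have N: "N \<ge> 3" and S0: "structure_ok S0"
    and c: "\<And>i. i \<in> {1..N-1} \<Longrightarrow> E i \<in> carrier R" "\<And>i. i \<in> {1..N-1} \<Longrightarrow> F i \<in> carrier R"
      "\<And>i. i \<in> {1..N-1} \<Longrightarrow> H i \<in> carrier R" "T \<in> carrier R" "V \<in> carrier R"
    using J by (auto simp: jrep_def S0_def structure_ok_def)
  have at0: "pr S0 (lift S0 t x) = x" if "x \<in> carrier R" for x t
    using lift_simps(2)[OF S0] that by (simp add: S0_def)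
  have X0: "pr S0 (XR type_ring N ?E) = XR R N E"
    using ring_hom_ring.hom_XR[OF ring_hom_pr[OF S0] N, of ?E E] c at0 by (simp add: S0_def)
  have X1: "pr S (XR type_ring N ?E) = \<zero>\<^bsub>fst S\<^esub>" if "structure_ok S" "S \<noteq> S0" for S
    using ring_hom_ring.hom_XR[OF ring_hom_pr[OF that(1)] N, of ?E "\<lambda>_. \<zero>\<^bsub>fst S\<^esub>"] that
    by (simp add: lift_simps XR_zero structure_ok_ring)
  have Xc: "pc (XR type_ring N ?E) = 0"
    using ring_hom_ring.hom_XR[OF ring_hom_pc N, of ?E "\<lambda>_. 0"] XR_zero[of "type_ring :: complex ring" N] ring_type_ring
    by (simp add: lift_simps)
  have rel: "relators type_ring jP N ?E ?F ?H ?T ?V \<subseteq> {\<zero>\<^bsub>type_ring\<^esub>}"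
  proof
    fix r assume r: "r \<in> relators type_ring jP N ?E ?F ?H ?T ?V"
    have "pc r \<in> relators type_ring id N (\<lambda>_. 0) (\<lambda>_. 0) (\<lambda>_. 0) 1 1"
      using r by (subst ring_hom_ring.hom_relators[OF ring_hom_pc]) (auto simp: lift_simps)
    moreover have "cemb (type_ring :: complex ring) id" by (simp add: cemb_def)
    ultimately have 1: "pc r = 0"
      using trivial_relators[OF ring_type_ring, of id N] by auto
    have "pr S r = \<zero>\<^bsub>fst S\<^esub>" if S: "structure_ok S" for S
    proof (cases "S = S0")
      case True
      have "relators (fst S0) (snd S0) N E F H T V = pr S0 ` relators type_ring jP N ?E ?F ?H ?T ?V"
        by (rule ring_hom_ring.hom_relators[OF ring_hom_pr[OF S0]]) (use c S0 in \<open>simp_all add: at0\<close>)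
      then have "pr S0 r \<in> relators R \<iota> N E F H T V"
        using r by (simp add: S0_def)
      then show ?thesis using J True by (auto simp: jrep_def S0_def)
    next
      case False
      have "pr S r \<in> relators (fst S) (snd S) N (\<lambda>_. \<zero>\<^bsub>fst S\<^esub>) (\<lambda>_. \<zero>\<^bsub>fst S\<^esub>) (\<lambda>_. \<zero>\<^bsub>fst S\<^esub>) \<one>\<^bsub>fst S\<^esub> \<one>\<^bsub>fst S\<^esub>"
        using r S False by (subst ring_hom_ring.hom_relators[OF ring_hom_pr[OF S]]) (auto simp: lift_simps)
      then show ?thesis
        using trivial_relators[OF structure_ok_ring[OF S] structure_ok_cemb[OF S]] by blast
    qed
    then show "r \<in> {\<zero>\<^bsub>type_ring\<^esub>}"
      using 1 by (auto intro!: prodalg_eqI)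
  qed
  have one: "\<one>\<^bsub>fst S\<^esub> \<otimes>\<^bsub>fst S\<^esub> \<one>\<^bsub>fst S\<^esub> = \<one>\<^bsub>fst S\<^esub>" "x \<otimes>\<^bsub>fst S\<^esub> \<one>\<^bsub>fst S\<^esub> = x" "\<one>\<^bsub>fst S\<^esub> \<otimes>\<^bsub>fst S\<^esub> x = x"
    "snd S d \<otimes>\<^bsub>fst S\<^esub> \<zero>\<^bsub>fst S\<^esub> = \<zero>\<^bsub>fst S\<^esub>" "x \<oplus>\<^bsub>fst S\<^esub> \<zero>\<^bsub>fst S\<^esub> = x"
    if "structure_ok S" "x \<in> carrier (fst S)" for S x d
  proof -
    interpret ring "fst S" using that(1) by (rule structure_ok_ring)
    show "\<one>\<^bsub>fst S\<^esub> \<otimes>\<^bsub>fst S\<^esub> \<one>\<^bsub>fst S\<^esub> = \<one>\<^bsub>fst S\<^esub>" "x \<otimes>\<^bsub>fst S\<^esub> \<one>\<^bsub>fst S\<^esub> = x" "\<one>\<^bsub>fst S\<^esub> \<otimes>\<^bsub>fst S\<^esub> x = x"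
    "snd S d \<otimes>\<^bsub>fst S\<^esub> \<zero>\<^bsub>fst S\<^esub> = \<zero>\<^bsub>fst S\<^esub>" "x \<oplus>\<^bsub>fst S\<^esub> \<zero>\<^bsub>fst S\<^esub> = x"
      using that cembD(1)[OF structure_ok_cemb[OF that(1)]] by simp_all
  qed
  have one': "snd S d \<otimes>\<^bsub>fst S\<^esub> \<zero>\<^bsub>fst S\<^esub> = \<zero>\<^bsub>fst S\<^esub>" "\<one>\<^bsub>fst S\<^esub> \<oplus>\<^bsub>fst S\<^esub> \<zero>\<^bsub>fst S\<^esub> = \<one>\<^bsub>fst S\<^esub>"
    if "structure_ok S" for S d
    using one(4,5)[OF that ring_one_in[OF structure_ok_ring[OF that]]] .
  have J': "T \<otimes>\<^bsub>R\<^esub> V = \<one>\<^bsub>R\<^esub>" "V \<otimes>\<^bsub>R\<^esub> T = \<one>\<^bsub>R\<^esub>" "T \<otimes>\<^bsub>R\<^esub> T = \<one>\<^bsub>R\<^esub> \<oplus>\<^bsub>R\<^esub> \<iota> (2 * h) \<otimes>\<^bsub>R\<^esub> XR R N E"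
    "\<And>z. z \<in> carrier R \<Longrightarrow> z \<otimes>\<^bsub>R\<^esub> XR R N E = XR R N E \<otimes>\<^bsub>R\<^esub> z \<Longrightarrow> z \<otimes>\<^bsub>R\<^esub> T = T \<otimes>\<^bsub>R\<^esub> z"
    using J by (auto simp: jrep_def)
  have eqI: "x = y" if "pc x = pc y" "pr S0 x = pr S0 y"
      "\<And>S. structure_ok S \<Longrightarrow> S \<noteq> S0 \<Longrightarrow> pr S x = pr S y" for x y :: "'a prodalg"
    using that by (intro prodalg_eqI) metis+
  show ?thesis
  proof (rule jordan_rep_type_ring[OF N cemb_jP rel], unfold type_ring_XR[symmetric] br_eq_0_iff)
    show "?T * ?V = 1" "?V * ?T = 1"
      by (rule eqI; use J' c S0 in \<open>simp add: lift_simps at0 one ring_one_in structure_ok_ring\<close>;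
          simp add: S0_def)+
    show "?T * ?T = 1 + jP (2 * h) * XR type_ring N ?E"
      by (rule eqI; use J' c S0 in \<open>simp add: lift_simps at0 one one' X0 X1 Xc ring_one_in structure_ok_ring\<close>;
          simp add: S0_def)
    fix z assume z: "z * XR type_ring N ?E = XR type_ring N ?E * z"
    have zc: "pr S0 z \<in> carrier R"
      using pr_closed[OF S0, of z] by (simp add: S0_def)
    have "pr S0 (z * XR type_ring N ?E) = pr S0 (XR type_ring N ?E * z)" by (simp only: z)
    then have "pr S0 z \<otimes>\<^bsub>R\<^esub> T = T \<otimes>\<^bsub>R\<^esub> pr S0 z"
      using S0 by (intro J'(4)[OF zc]) (simp add: X0, simp add: S0_def)
    then show "z * ?T = ?T * z"
      by (intro eqI) (use c S0 in \<open>simp_all add: lift_simps at0 one, simp_all add: S0_def\<close>)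
  qed
qed


section \<open>Transfer of the coproduct and antipode relations\<close>

lemma nat_pow_2: "ring R \<Longrightarrow> x \<in> carrier R \<Longrightarrow> x [^]\<^bsub>R\<^esub> (2::nat) = x \<otimes>\<^bsub>R\<^esub> x"
proof -
  assume "ring R" "x \<in> carrier R"
  then interpret ring R by simp
  show ?thesis using \<open>x \<in> carrier R\<close> by (simp add: numeral_2_eq_2)
qed

text \<open>The identities hold for the lifted elements and are read off through the projection onto
  the factor of R. Beside the relators they give the values at T, at the sum of the H_k and at T^-1
  [F_i, T], on which the Hopf axioms depend.\<close>

lemma coproduct_relations:
  fixes R :: "'a ring" (structure)
  assumes J1: "jrep R \<iota> N h E F H T V" and J2: "jrep R \<iota> N h E2 F2 H2 T2 V2"
    and cross: "\<And>x y. \<lbrakk>x \<in> E ` {1..N-1} \<union> F ` {1..N-1} \<union> H ` {1..N-1} \<union> {T, V};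
      y \<in> E2 ` {1..N-1} \<union> F2 ` {1..N-1} \<union> H2 ` {1..N-1} \<union> {T2, V2}\<rbrakk> \<Longrightarrow> x \<otimes> y = y \<otimes> x"
    and ED: "\<And>i. i \<in> {1..N-1} \<Longrightarrow> ED i = E i \<oplus> T [^] theta N i \<otimes> E2 i"
    and FD: "\<And>i. i \<in> {1..N-1} \<Longrightarrow> FD i = F i \<oplus> V [^] theta N i \<otimes> F2 i \<oplus>
        T \<otimes> finsum R H {1..N-1} \<otimes> (V2 \<otimes> \<lbrakk>F2 i, T2\<rbrakk>)"
    and HD: "\<And>i. i \<in> {1..N-1} \<Longrightarrow> HD i = H i \<oplus> H2 i \<ominus>
        \<iota> (of_nat (theta N i) / 2) \<otimes> ((\<one> \<ominus> V [^] (2::nat)) \<otimes> finsum R H2 {1..N-1})"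
  shows "relators R \<iota> N ED FD HD (T \<otimes> T2) (V \<otimes> V2) \<subseteq> {\<zero>}"
    and "(T \<otimes> T2) \<otimes> (T \<otimes> T2) = \<one> \<oplus> \<iota> (2 * h) \<otimes> XR R N ED"
    and "(T \<otimes> T2) \<otimes> XR R N ED = XR R N ED \<otimes> (T \<otimes> T2)"
    and "finsum R HD {1..N-1} = finsum R H {1..N-1} \<oplus> V \<otimes> V \<otimes> finsum R H2 {1..N-1}"
    and "\<And>i. i \<in> {1..N-1} \<Longrightarrow> (V \<otimes> V2) \<otimes> \<lbrakk>FD i, T \<otimes> T2\<rbrakk> = V \<otimes> \<lbrakk>F i, T\<rbrakk> \<oplus> T \<otimes> (V2 \<otimes> \<lbrakk>F2 i, T2\<rbrakk>)"
    and "(T \<otimes> T2) \<otimes> (V \<otimes> V2) = \<one>" "(V \<otimes> V2) \<otimes> (T \<otimes> T2) = \<one>"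
proof -
  define S where "S = (R, \<iota>)"
  have S: "structure_ok S" and [simp]: "fst S = R" "snd S = \<iota>" and N: "N \<ge> 3" and R: "ring R"
    using J1 by (simp_all add: jrep_def S_def structure_ok_def)
  let ?L = "lift S False" and ?L1 = "lift S True"
  interpret hm: ring_hom_ring type_ring R "pr S"
    using ring_hom_pr[OF S] by simp
  interpret A: jordan_rep jP N "\<lambda>i. ?L (E i)" "\<lambda>i. ?L (F i)" "\<lambda>i. ?L (H i)" "?L1 T" "?L1 V" h
    unfolding S_def by (rule jrep_lift) fact
  interpret B: jordan_rep jP N "\<lambda>i. ?L (E2 i)" "\<lambda>i. ?L (F2 i)" "\<lambda>i. ?L (H2 i)" "?L1 T2" "?L1 V2" h
    unfolding S_def by (rule jrep_lift) fact
  have c: "\<And>i. i \<in> {1..N-1} \<Longrightarrow> E i \<in> carrier R" "\<And>i. i \<in> {1..N-1} \<Longrightarrow> F i \<in> carrier R"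
      "\<And>i. i \<in> {1..N-1} \<Longrightarrow> H i \<in> carrier R" "T \<in> carrier R" "V \<in> carrier R"
      "\<And>i. i \<in> {1..N-1} \<Longrightarrow> E2 i \<in> carrier R" "\<And>i. i \<in> {1..N-1} \<Longrightarrow> F2 i \<in> carrier R"
      "\<And>i. i \<in> {1..N-1} \<Longrightarrow> H2 i \<in> carrier R" "T2 \<in> carrier R" "V2 \<in> carrier R"
    using J1 J2 by (auto simp: jrep_def)
  have at: "pr S (lift S t x) = x" if "x \<in> carrier R" for x t
    using lift_simps(2)[OF S] that by simp
  \<comment> \<open>In the other factors both elements are 0 or 1 and so commute anyway.\<close>
  have cm: "br (lift S t x) (lift S t' y) = 0"
    if xy: "x \<in> carrier R" "y \<in> carrier R" "x \<otimes> y = y \<otimes> x" for x y t t'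
  proof -
    have "lift S t x * lift S t' y = lift S t' y * lift S t x"
    proof (rule prodalg_eqI)
      fix S' :: "'a ring \<times> (complex \<Rightarrow> 'a)" assume S': "structure_ok S'"
      interpret r: ring "fst S'" using S' by (rule structure_ok_ring)
      show "pr S' (lift S t x * lift S t' y) = pr S' (lift S t' y * lift S t x)"
        by (cases "S' = S") (use S' xy at in \<open>auto simp: lift_simps(3)\<close>)
    qed simp
    then show ?thesis by (simp add: br_def)
  qed
  interpret P: jordan_pair jP N "\<lambda>i. ?L (E i)" "\<lambda>i. ?L (F i)" "\<lambda>i. ?L (H i)" "?L1 T" "?L1 V"
    "\<lambda>i. ?L (E2 i)" "\<lambda>i. ?L (F2 i)" "\<lambda>i. ?L (H2 i)" "?L1 T2" "?L1 V2" h
  proof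
    fix x y assume x: "x \<in> (\<lambda>i. ?L (E i)) ` {1..N - 1} \<union> (\<lambda>i. ?L (F i)) ` {1..N - 1} \<union> (\<lambda>i. ?L (H i)) ` {1..N - 1} \<union> {?L1 T, ?L1 V}"
      and y: "y \<in> (\<lambda>i. ?L (E2 i)) ` {1..N - 1} \<union> (\<lambda>i. ?L (F2 i)) ` {1..N - 1} \<union> (\<lambda>i. ?L (H2 i)) ` {1..N - 1} \<union> {?L1 T2, ?L1 V2}"
    from x obtain t x' where x': "x = lift S t x'" "x' \<in> E ` {1..N-1} \<union> F ` {1..N-1} \<union> H ` {1..N-1} \<union> {T, V}"
      by blast
    from y obtain t' y' where y': "y = lift S t' y'" "y' \<in> E2 ` {1..N-1} \<union> F2 ` {1..N-1} \<union> H2 ` {1..N-1} \<union> {T2, V2}"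
      by blast
    have "x' \<in> carrier R" "y' \<in> carrier R" using x'(2) y'(2) c by auto
    then show "br x y = 0"
      unfolding x'(1) y'(1) by (rule cm) (rule cross[OF x'(2) y'(2)])
  qed
  note pr = pr_simps[OF S] pr_pow[OF S] pr_br[OF S] pr_jP[OF S]
  have sums: "pr S (sum (\<lambda>i. ?L (H i)) {1..N-1}) = finsum R H {1..N-1}"
    "pr S (sum (\<lambda>i. ?L (H2 i)) {1..N-1}) = finsum R H2 {1..N-1}"
    unfolding pr_sum[OF S finite_atLeastAtMost] using c at by (auto intro!: hm.S.finsum_cong')
  have ED': "ED i = pr S (P.ED i)" if "i \<in> {1..N-1}" for i
    using that c by (simp add: ED P.ED_def pr at)
  have FD': "FD i = pr S (P.FD i)" if "i \<in> {1..N-1}" for i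
    using that c by (simp add: FD P.FD_def pr at sums)
  have sc: "of_nat k * (jP (1 / 2) * x) = jP (of_nat k / 2) * x" for k and x :: "'a prodalg"
    using cemb_scalars(4)[of jP k, OF A.j_add A.j_mult A.j_one] by (simp add: mult.assoc)
  have HD': "HD i = pr S (P.HD i)" if "i \<in> {1..N-1}" for i
    using that c R by (simp add: HD P.HD_def sc pr at sums nat_pow_2)
  have T': "T \<otimes> T2 = pr S P.TD" "V \<otimes> V2 = pr S P.VD"
    using c by (simp_all add: P.TD_def P.VD_def pr at)
  have X': "XR R N ED = pr S (rnest P.ED (N-1) 1)"
    using hm.hom_XR[OF N, of P.ED ED] ED' by (simp add: type_ring_XR)
  have "jordan_rels jP N P.ED P.FD P.HD P.TD P.VD"
  proof (unfold_locales, goal_cases)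
    case 1 show ?case by (rule N)
  next
    case 2 show ?case by (rule A.j_add)
  next
    case 3 show ?case by (rule A.j_mult)
  next
    case 4 show ?case by (rule A.j_one)
  next
    case 5 show ?case by (rule A.j_central)
  next
    case 6 then show ?case by (rule P.HDHD)
  next
    case 7 then show ?case by (rule P.HDED)
  next
    case 8 then show ?case by (rule P.HDFD)
  next
    case 9 then show ?case by (rule P.aD_FD)
  next
    case 10 then show ?case by (simp add: P.EED A.EE B.EE)
  next
    case 11 then show ?case by (rule P.KD_serre_far[unfolded P.KD_def])
  next
    case 12 then show ?case by (simp add: P.EEED A.EEE B.EEE)
  next
    case 13 then show ?case by (rule P.KD_serre_near[unfolded P.KD_def])
  qed
  then have rel: "relators type_ring jP N P.ED P.FD P.HD P.TD P.VD \<subseteq> {\<zero>\<^bsub>type_ring\<^esub>}"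
    by (rule jordan_rels.relators_type_ring)
  have "relators R \<iota> N ED FD HD (T \<otimes> T2) (V \<otimes> V2) = pr S ` relators type_ring jP N P.ED P.FD P.HD P.TD P.VD"
    by (rule hm.hom_relators) (use ED' FD' HD' T' in \<open>simp_all add: pr\<close>)
  then show "relators R \<iota> N ED FD HD (T \<otimes> T2) (V \<otimes> V2) \<subseteq> {\<zero>}"
    using rel pr(1) by auto
  show "(T \<otimes> T2) \<otimes> (T \<otimes> T2) = \<one> \<oplus> \<iota> (2 * h) \<otimes> XR R N ED"
    using arg_cong[OF P.TD_square, of "pr S"] by (simp add: T' X' pr)
  show "(T \<otimes> T2) \<otimes> XR R N ED = XR R N ED \<otimes> (T \<otimes> T2)"
    using arg_cong[OF P.TD_rnest[unfolded br_eq_0_iff], of "pr S"] by (simp add: T' X' pr)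
  have "finsum R HD {1..N-1} = pr S (sum P.HD {1..N-1})"
    unfolding pr_sum[OF S finite_atLeastAtMost] using HD' pr_closed[OF S] by (auto intro!: hm.S.finsum_cong')
  then show "finsum R HD {1..N-1} = finsum R H {1..N-1} \<oplus> V \<otimes> V \<otimes> finsum R H2 {1..N-1}"
    unfolding P.HsD A.Hs_def B.Hs_def using c by (simp add: pr at sums)
  show "(V \<otimes> V2) \<otimes> \<lbrakk>FD i, T \<otimes> T2\<rbrakk> = V \<otimes> \<lbrakk>F i, T\<rbrakk> \<oplus> T \<otimes> (V2 \<otimes> \<lbrakk>F2 i, T2\<rbrakk>)" if i: "i \<in> {1..N-1}" for i
    using arg_cong[OF P.FD_TD[OF i], of "pr S"] c i
    by (simp add: T' FD'[OF i] pr A.G_def B.G_def at)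
  show "(T \<otimes> T2) \<otimes> (V \<otimes> V2) = \<one>" "(V \<otimes> V2) \<otimes> (T \<otimes> T2) = \<one>"
    using arg_cong[OF P.TD_VD(1), of "pr S"] arg_cong[OF P.TD_VD(2), of "pr S"] by (simp_all add: T' pr)
qed

lemma antipode_relations:
  fixes R :: "'a ring" (structure)
  assumes J: "jrep R \<iota> N h E F H T V"
    and ES: "\<And>i. i \<in> {1..N-1} \<Longrightarrow> ES i = \<ominus> (V [^] theta N i \<otimes> E i)"
    and FS: "\<And>i. i \<in> {1..N-1} \<Longrightarrow> FS i = \<ominus> (T [^] theta N i \<otimes> F i) \<oplus>
        T [^] (2::nat) \<otimes> finsum R H {1..N-1} \<otimes> V [^] (2::nat) \<otimes> \<lbrakk>F i, T\<rbrakk>"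
    and HS: "\<And>i. i \<in> {1..N-1} \<Longrightarrow> HS i = \<ominus> H i \<oplus>
        \<iota> (of_nat (theta N i) / 2) \<otimes> ((\<one> \<ominus> T [^] (2::nat)) \<otimes> finsum R H {1..N-1})"
  shows "relators (opp R) \<iota> N ES FS HS V T \<subseteq> {\<zero>}"
    and "V \<otimes> V = \<one> \<oplus> \<iota> (2 * h) \<otimes> XR (opp R) N ES"
    and "V \<otimes> XR (opp R) N ES = XR (opp R) N ES \<otimes> V"
    and "finsum R HS {1..N-1} = \<ominus> (T \<otimes> T \<otimes> finsum R H {1..N-1})"
    and "\<And>i. i \<in> {1..N-1} \<Longrightarrow> \<lbrakk>V, FS i\<rbrakk> \<otimes> T = \<ominus> (V \<otimes> V \<otimes> \<lbrakk>F i, T\<rbrakk>)"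
proof -
  define S where "S = (R, \<iota>)"
  have S: "structure_ok S" and [simp]: "fst S = R" "snd S = \<iota>" and N: "N \<ge> 3" and R: "ring R"
    using J by (simp_all add: jrep_def S_def structure_ok_def)
  let ?L = "lift S False" and ?L1 = "lift S True"
  interpret hm: ring_hom_ring type_ring R "pr S"
    using ring_hom_pr[OF S] by simp
  interpret ho: ring_hom_ring "opp type_ring" "opp R" "pr S"
    by (intro ring_hom_ringI2 ring_opp ring_type_ring R) (use S in \<open>auto simp: ring_hom_def pr_simps[OF S]\<close>)
  interpret A: jordan_rep jP N "\<lambda>i. ?L (E i)" "\<lambda>i. ?L (F i)" "\<lambda>i. ?L (H i)" "?L1 T" "?L1 V" h
    unfolding S_def by (rule jrep_lift) fact
  have c: "\<And>i. i \<in> {1..N-1} \<Longrightarrow> E i \<in> carrier R" "\<And>i. i \<in> {1..N-1} \<Longrightarrow> F i \<in> carrier R"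
      "\<And>i. i \<in> {1..N-1} \<Longrightarrow> H i \<in> carrier R" "T \<in> carrier R" "V \<in> carrier R"
    using J by (auto simp: jrep_def)
  have at: "pr S (lift S t x) = x" if "x \<in> carrier R" for x t
    using lift_simps(2)[OF S] that by simp
  note pr = pr_simps[OF S] pr_pow[OF S] pr_br[OF S] pr_jP[OF S]
  have sums: "pr S (sum (\<lambda>i. ?L (H i)) {1..N-1}) = finsum R H {1..N-1}"
    unfolding pr_sum[OF S finite_atLeastAtMost] using c at by (auto intro!: hm.S.finsum_cong')
  have sc: "of_nat k * (jP (1 / 2) * x) = jP (of_nat k / 2) * x" for k and x :: "'a prodalg"
    using cemb_scalars(4)[of jP k, OF A.j_add A.j_mult A.j_one] by (simp add: mult.assoc)
  have ES': "ES i = pr S (A.ES i)" if "i \<in> {1..N-1}" for i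
    using that c by (simp add: ES A.ES_def pr at)
  have FS': "FS i = pr S (A.FS i)" if "i \<in> {1..N-1}" for i
    using that c R by (simp add: FS A.FS_def pr at sums nat_pow_2 del: uminus_add_conv_diff)
  have HS': "HS i = pr S (A.HS i)" if "i \<in> {1..N-1}" for i
    using that c R by (simp add: HS A.HS_def sc pr at sums nat_pow_2 del: uminus_add_conv_diff)
  \<comment> \<open>Reversing a bracket costs a sign and each \<open>A.ES i\<close> is -a_i, so
    exactly one sign is left at every stage. X is sent to -\<open>Xa\<close>, in accordance with V^2
    = 1 - 2h Xa.\<close>
  have X: "XR (opp type_ring) N A.ES = - A.Xa"
  proof -
    have "foldr (lie (opp type_ring)) (map A.ES [k..<N-1]) (A.ES (N-1)) = - rnest A.a (N-1) k" if "k \<le> N-1" for k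
      using that
    proof (induction k rule: inc_induct)
      case base
      then show ?case by (simp add: A.ES)
    next
      case (step k)
      then show ?case
        by (simp add: upt_conv_Cons rnest_step A.ES opp_type_ring_lie br_minus_left br_minus_right br_commute[of _ "A.a k"])
    qed
    then show ?thesis using N by (simp add: XR_def)
  qed
  have X': "XR (opp R) N ES = pr S (- A.Xa)"
    using ho.hom_XR[OF N, of A.ES ES] ES' by (simp add: X)
  have "relators (opp R) \<iota> N ES FS HS V T = pr S ` relators (opp type_ring) jP N A.ES A.FS A.HS (?L1 V) (?L1 T)"
    by (rule ho.hom_relators) (use ES' FS' HS' c in \<open>simp_all add: pr at\<close>)
  then show "relators (opp R) \<iota> N ES FS HS V T \<subseteq> {\<zero>}"
    using A.opp_relators pr(1) by auto
  show "V \<otimes> V = \<one> \<oplus> \<iota> (2 * h) \<otimes> XR (opp R) N ES"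
  proof -
    have "?L1 V * ?L1 V = 1 + jP (2 * h) * (- A.Xa)"
      by (simp add: A.VV)
    from arg_cong[OF this, of "pr S"] show ?thesis
      unfolding X' using c by (simp only: pr at \<open>fst S = R\<close> \<open>snd S = \<iota>\<close>)
  qed
  have "br (?L1 V) (- A.Xa) = 0"
    using A.br_V[OF br_eq_0_sym[OF A.T_Xa]] by (simp add: br_minus_right br_eq_0_sym)
  then have "pr S (?L1 V * (- A.Xa)) = pr S ((- A.Xa) * ?L1 V)"
    by (simp only: br_eq_0_iff)
  then show "V \<otimes> XR (opp R) N ES = XR (opp R) N ES \<otimes> V"
    unfolding X' using c by (simp only: pr at \<open>fst S = R\<close>)
  have "finsum R HS {1..N-1} = pr S (sum A.HS {1..N-1})"
    unfolding pr_sum[OF S finite_atLeastAtMost] using HS' pr_closed[OF S] by (auto intro!: hm.S.finsum_cong')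
  then show "finsum R HS {1..N-1} = \<ominus> (T \<otimes> T \<otimes> finsum R H {1..N-1})"
    unfolding A.HsS A.Hts_def A.Hs_def using c by (simp add: pr at sums)
  show "\<lbrakk>V, FS i\<rbrakk> \<otimes> T = \<ominus> (V \<otimes> V \<otimes> \<lbrakk>F i, T\<rbrakk>)" if i: "i \<in> {1..N-1}" for i
  proof -
    have "br (?L1 V) (A.FS i) * ?L1 T = - (?L1 V * ?L1 V * br (?L (F i)) (?L1 T))"
      using A.VFS[OF i] by (simp add: A.G_T[OF i] mult.assoc) (simp add: A.G_def)
    from arg_cong[OF this, of "pr S"] show ?thesis
      using c i by (simp add: pr at FS'[OF i])
  qed
qed

declare One_nat_def [simp] of_int_sum [simp] of_nat_sum [simp] split_paired_All [simp] split_paired_Ex [simp]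

section \<open>Completed monoid algebras\<close>

locale graded_monoid = monoid M for M :: "'m monoid" (structure) +
  fixes d :: "'m \<Rightarrow> int"
  assumes deg_mult: "u \<in> carrier M \<Longrightarrow> v \<in> carrier M \<Longrightarrow> d (u \<otimes> v) = d u + d v"
begin

abbreviation "Sr \<equiv> series_ring M d"

lemma deg_one: "d \<one> = 0"
  using deg_mult[of \<one> \<one>] by simp

lemma series_iff: "f \<in> carrier Sr \<longleftrightarrow> (\<forall>w. f w \<noteq> 0 \<longrightarrow> w \<in> carrier M) \<and> (\<forall>n. finite {w. f w \<noteq> 0 \<and> d w \<le> n})"
  by (simp add: series_ring_def)

lemma add_Sr [simp]: "f \<oplus>\<^bsub>Sr\<^esub> g = (\<lambda>w. f w + g w)" and zero_Sr [simp]: "\<zero>\<^bsub>Sr\<^esub> = (\<lambda>w. 0)"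
  and one_Sr: "\<one>\<^bsub>Sr\<^esub> = (\<lambda>w. if w = \<one> then 1 else 0)"
  by (simp_all add: series_ring_def)

definition factors :: "'m series \<Rightarrow> 'm series \<Rightarrow> 'm \<Rightarrow> ('m \<times> 'm) set" where
  "factors f g w = {(u, v). u \<in> carrier M \<and> v \<in> carrier M \<and> f u \<noteq> 0 \<and> g v \<noteq> 0 \<and> u \<otimes> v = w}"

lemma mult_Sr: "(f \<otimes>\<^bsub>Sr\<^esub> g) w = (\<Sum>(u, v)\<in>factors f g w. f u * g v)"
  by (simp add: series_ring_def factors_def)

text \<open>Only finitely many elements of the support have degree at most 0; the smallest of their
  degrees, or else 0, is a bound.\<close>

lemma series_bound:
  assumes "f \<in> carrier Sr" obtains m where "\<And>w. f w \<noteq> 0 \<Longrightarrow> m \<le> d w"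
proof -
  let ?A = "{w. f w \<noteq> 0 \<and> d w \<le> 0}"
  have "finite (insert 0 (d ` ?A))" using assms by (simp add: series_iff)
  then have "Min (insert 0 (d ` ?A)) \<le> d w" if "f w \<noteq> 0" for w
    using that by (cases "d w \<le> 0") (auto intro: Min_le order_trans[of _ 0])
  then show ?thesis using that by blast
qed

text \<open>A bound on the sum of the degrees together with a lower bound for one of them bounds the
  other from above.\<close>

lemma finite_pairs:
  assumes f: "f \<in> carrier Sr" and g: "g \<in> carrier Sr"
  shows "finite {(u, v). f u \<noteq> 0 \<and> g v \<noteq> 0 \<and> d u + d v \<le> n}"
proof -
  obtain a b where a: "\<And>w. f w \<noteq> 0 \<Longrightarrow> a \<le> d w" and b: "\<And>w. g w \<noteq> 0 \<Longrightarrow> b \<le> d w"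
    using series_bound[OF f] series_bound[OF g] by metis
  have "{(u, v). f u \<noteq> 0 \<and> g v \<noteq> 0 \<and> d u + d v \<le> n} \<subseteq> {u. f u \<noteq> 0 \<and> d u \<le> n - b} \<times> {v. g v \<noteq> 0 \<and> d v \<le> n - a}"
    using a b by fastforce
  then show ?thesis
    using f g by (auto simp: series_iff intro: finite_subset)
qed

lemma finite_factors: "f \<in> carrier Sr \<Longrightarrow> g \<in> carrier Sr \<Longrightarrow> finite (factors f g w)"
  by (rule finite_subset[OF _ finite_pairs[of f g "d w"]]) (auto simp: factors_def deg_mult)

text \<open>Pairs outside the supports contribute 0, so several products can be written over one
  common finite set of factorisations.\<close>

lemma mult_Sr_superset:
  assumes "finite Z" "factors f g w \<subseteq> Z" "\<And>u v. (u, v) \<in> Z \<Longrightarrow> u \<in> carrier M \<and> v \<in> carrier M \<and> u \<otimes> v = w"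
  shows "(f \<otimes>\<^bsub>Sr\<^esub> g) w = (\<Sum>(u, v)\<in>Z. f u * g v)"
  unfolding mult_Sr using assms
  by (intro sum.mono_neutral_left) (auto simp: factors_def)

lemma mult_Sr_nonzero:
  assumes "(f \<otimes>\<^bsub>Sr\<^esub> g) w \<noteq> 0"
  obtains u v where "u \<in> carrier M" "v \<in> carrier M" "f u \<noteq> 0" "g v \<noteq> 0" "w = u \<otimes> v"
proof -
  obtain p where "p \<in> factors f g w"
    using assms unfolding mult_Sr by (metis (no_types, lifting) sum.neutral)
  then show ?thesis using that by (auto simp: factors_def)
qed

lemma mult_Sr_closed:
  assumes f: "f \<in> carrier Sr" and g: "g \<in> carrier Sr" shows "f \<otimes>\<^bsub>Sr\<^esub> g \<in> carrier Sr"
  unfolding series_iff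
proof (intro conjI allI impI)
  fix w assume "(f \<otimes>\<^bsub>Sr\<^esub> g) w \<noteq> 0"
  then show "w \<in> carrier M" by (elim mult_Sr_nonzero) simp
next
  fix n
  have "{w. (f \<otimes>\<^bsub>Sr\<^esub> g) w \<noteq> 0 \<and> d w \<le> n} \<subseteq> (\<lambda>(u, v). u \<otimes> v) ` {(u, v). f u \<noteq> 0 \<and> g v \<noteq> 0 \<and> d u + d v \<le> n}"
    by (auto elim!: mult_Sr_nonzero simp: deg_mult image_iff)
  then show "finite {w. (f \<otimes>\<^bsub>Sr\<^esub> g) w \<noteq> 0 \<and> d w \<le> n}"
    using finite_pairs[OF f g] by (meson finite_imageI finite_subset)
qed

lemma add_closed: assumes "f \<in> carrier Sr" "g \<in> carrier Sr" shows "(\<lambda>w. f w + g w) \<in> carrier Sr"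
proof -
  have "finite {w. f w + g w \<noteq> 0 \<and> d w \<le> n}" for n
    by (rule finite_subset[of _ "{w. f w \<noteq> 0 \<and> d w \<le> n} \<union> {w. g w \<noteq> 0 \<and> d w \<le> n}"])
      (use assms in \<open>auto simp: series_iff\<close>)
  then show ?thesis
    using assms unfolding series_iff by (metis add_0)
qed

lemma sc_closed: "f \<in> carrier Sr \<Longrightarrow> sc c f \<in> carrier Sr"
  by (auto simp: series_iff sc_def elim: rev_finite_subset)

text \<open>Both sides equal a sum over the triples with product w. There are finitely many, since
  lower bounds for two of the degrees bound the third from above.\<close>

lemma mult_Sr_assoc:
  assumes f: "f \<in> carrier Sr" and g: "g \<in> carrier Sr" and h: "h \<in> carrier Sr"
  shows "(f \<otimes>\<^bsub>Sr\<^esub> g) \<otimes>\<^bsub>Sr\<^esub> h = f \<otimes>\<^bsub>Sr\<^esub> (g \<otimes>\<^bsub>Sr\<^esub> h)"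
proof
  fix w
  define Tr where "Tr = {(u, v, z). u \<in> carrier M \<and> v \<in> carrier M \<and> z \<in> carrier M \<and> f u \<noteq> 0 \<and> g v \<noteq> 0 \<and> h z \<noteq> 0 \<and> u \<otimes> v \<otimes> z = w}"
  have Tr: "(u, v, z) \<in> Tr \<longleftrightarrow> u \<in> carrier M \<and> v \<in> carrier M \<and> z \<in> carrier M \<and> f u \<noteq> 0 \<and> g v \<noteq> 0 \<and> h z \<noteq> 0 \<and> u \<otimes> v \<otimes> z = w" for u v z
    by (simp add: Tr_def)
  obtain a b c where a: "\<And>w. f w \<noteq> 0 \<Longrightarrow> a \<le> d w" and b: "\<And>w. g w \<noteq> 0 \<Longrightarrow> b \<le> d w"
    and c: "\<And>w. h w \<noteq> 0 \<Longrightarrow> c \<le> d w"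
    using series_bound[OF f] series_bound[OF g] series_bound[OF h] by metis
  have imZ: "(u \<otimes> v, z) \<in> (\<lambda>(u, v, z). (u \<otimes> v, z)) ` Tr" and imY: "(u, v \<otimes> z) \<in> (\<lambda>(u, v, z). (u, v \<otimes> z)) ` Tr"
    if "(u, v, z) \<in> Tr" for u v z
    using that by force+
  have "Tr \<subseteq> {u. f u \<noteq> 0 \<and> d u \<le> d w - b - c} \<times> {v. g v \<noteq> 0 \<and> d v \<le> d w - a - c} \<times> {z. h z \<noteq> 0 \<and> d z \<le> d w - a - b}"
  proof
    fix t assume "t \<in> Tr"
    then obtain u v z where t: "t = (u, v, z)" and uvz: "u \<in> carrier M" "v \<in> carrier M" "z \<in> carrier M"
      "f u \<noteq> 0" "g v \<noteq> 0" "h z \<noteq> 0" and w: "u \<otimes> v \<otimes> z = w" by (auto simp: Tr_def)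
    have "d w = d u + d v + d z" using w uvz by (auto simp: deg_mult)
    then show "t \<in> {u. f u \<noteq> 0 \<and> d u \<le> d w - b - c} \<times> {v. g v \<noteq> 0 \<and> d v \<le> d w - a - c} \<times> {z. h z \<noteq> 0 \<and> d z \<le> d w - a - b}"
      using a[of u] b[of v] c[of z] uvz t by simp
  qed
  moreover have "finite ({u. f u \<noteq> 0 \<and> d u \<le> d w - b - c} \<times> {v. g v \<noteq> 0 \<and> d v \<le> d w - a - c} \<times> {z. h z \<noteq> 0 \<and> d z \<le> d w - a - b})"
    using f g h unfolding series_iff by (intro finite_cartesian_product) blast+
  ultimately have T: "finite Tr"
    by (rule finite_subset)
  let ?s = "\<lambda>(u, v, z). f u * g v * h z"
  let ?Z = "(\<lambda>(u, v, z). (u \<otimes> v, z)) ` Tr" and ?Y = "(\<lambda>(u, v, z). (u, v \<otimes> z)) ` Tr"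
  have "((f \<otimes>\<^bsub>Sr\<^esub> g) \<otimes>\<^bsub>Sr\<^esub> h) w = (\<Sum>(x, z)\<in>?Z. (f \<otimes>\<^bsub>Sr\<^esub> g) x * h z)"
  proof (rule mult_Sr_superset)
    show "factors (f \<otimes>\<^bsub>Sr\<^esub> g) h w \<subseteq> ?Z"
      unfolding factors_def by (clarify, elim mult_Sr_nonzero) (auto intro!: imZ simp: Tr)
  qed (use T in \<open>auto simp: Tr\<close>)
  also have "\<dots> = (\<Sum>p\<in>?Z. \<Sum>q\<in>factors f g (fst p). f (fst q) * g (snd q) * h (snd p))"
    by (simp add: mult_Sr sum_distrib_right split_def)
  also have "\<dots> = (\<Sum>(p, q)\<in>(SIGMA p:?Z. factors f g (fst p)). f (fst q) * g (snd q) * h (snd p))"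
    using T finite_factors[OF f g] by (intro sum.Sigma) auto
  also have "\<dots> = sum ?s Tr"
    by (rule sum.reindex_bij_witness[of _ "\<lambda>(u, v, z). ((u \<otimes> v, z), (u, v))" "\<lambda>(p, q). (fst q, snd q, snd p)"])
      (auto simp: factors_def Tr intro!: imZ)
  finally have 1: "((f \<otimes>\<^bsub>Sr\<^esub> g) \<otimes>\<^bsub>Sr\<^esub> h) w = sum ?s Tr" .
  have "(f \<otimes>\<^bsub>Sr\<^esub> (g \<otimes>\<^bsub>Sr\<^esub> h)) w = (\<Sum>(u, x)\<in>?Y. f u * (g \<otimes>\<^bsub>Sr\<^esub> h) x)"
  proof (rule mult_Sr_superset)
    show "factors f (g \<otimes>\<^bsub>Sr\<^esub> h) w \<subseteq> ?Y"
      unfolding factors_def by (clarify, elim mult_Sr_nonzero) (auto intro!: imY simp: Tr m_assoc)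
  qed (use T in \<open>auto simp: Tr m_assoc\<close>)
  also have "\<dots> = (\<Sum>p\<in>?Y. \<Sum>q\<in>factors g h (snd p). f (fst p) * g (fst q) * h (snd q))"
    by (simp add: mult_Sr sum_distrib_left split_def mult.assoc)
  also have "\<dots> = (\<Sum>(p, q)\<in>(SIGMA p:?Y. factors g h (snd p)). f (fst p) * g (fst q) * h (snd q))"
    using T finite_factors[OF g h] by (intro sum.Sigma) auto
  also have "\<dots> = sum ?s Tr"
    by (rule sum.reindex_bij_witness[of _ "\<lambda>(u, v, z). ((u, v \<otimes> z), (v, z))" "\<lambda>(p, q). (fst p, fst q, snd q)"])
      (auto simp: factors_def Tr m_assoc intro!: imY)
  finally show "((f \<otimes>\<^bsub>Sr\<^esub> g) \<otimes>\<^bsub>Sr\<^esub> h) w = (f \<otimes>\<^bsub>Sr\<^esub> (g \<otimes>\<^bsub>Sr\<^esub> h)) w"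
    using 1 by simp
qed

lemma mult_Sr_distrib:
  assumes f: "f \<in> carrier Sr" and g: "g \<in> carrier Sr" and h: "h \<in> carrier Sr"
  shows "(\<lambda>w. f w + g w) \<otimes>\<^bsub>Sr\<^esub> h = (\<lambda>w. (f \<otimes>\<^bsub>Sr\<^esub> h) w + (g \<otimes>\<^bsub>Sr\<^esub> h) w)"
    and "h \<otimes>\<^bsub>Sr\<^esub> (\<lambda>w. f w + g w) = (\<lambda>w. (h \<otimes>\<^bsub>Sr\<^esub> f) w + (h \<otimes>\<^bsub>Sr\<^esub> g) w)"
proof -
  show "(\<lambda>w. f w + g w) \<otimes>\<^bsub>Sr\<^esub> h = (\<lambda>w. (f \<otimes>\<^bsub>Sr\<^esub> h) w + (g \<otimes>\<^bsub>Sr\<^esub> h) w)"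
  proof
    fix w
    let ?Z = "factors f h w \<union> factors g h w"
    have fin: "finite ?Z" using f g h by (simp add: finite_factors)
    have "(k \<otimes>\<^bsub>Sr\<^esub> h) w = (\<Sum>(u, v)\<in>?Z. k u * h v)" if "factors k h w \<subseteq> ?Z" for k
      using fin that by (intro mult_Sr_superset) (auto simp: factors_def)
    moreover have "factors (\<lambda>w. f w + g w) h w \<subseteq> ?Z"
      by (auto simp: factors_def)
    ultimately show "((\<lambda>w. f w + g w) \<otimes>\<^bsub>Sr\<^esub> h) w = (f \<otimes>\<^bsub>Sr\<^esub> h) w + (g \<otimes>\<^bsub>Sr\<^esub> h) w"
      by (simp add: split_def distrib_right sum.distrib)
  qed
  show "h \<otimes>\<^bsub>Sr\<^esub> (\<lambda>w. f w + g w) = (\<lambda>w. (h \<otimes>\<^bsub>Sr\<^esub> f) w + (h \<otimes>\<^bsub>Sr\<^esub> g) w)"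
  proof
    fix w
    let ?Z = "factors h f w \<union> factors h g w"
    have fin: "finite ?Z" using f g h by (simp add: finite_factors)
    have "(h \<otimes>\<^bsub>Sr\<^esub> k) w = (\<Sum>(u, v)\<in>?Z. h u * k v)" if "factors h k w \<subseteq> ?Z" for k
      using fin that by (intro mult_Sr_superset) (auto simp: factors_def)
    moreover have "factors h (\<lambda>w. f w + g w) w \<subseteq> ?Z"
      by (auto simp: factors_def)
    ultimately show "(h \<otimes>\<^bsub>Sr\<^esub> (\<lambda>w. f w + g w)) w = (h \<otimes>\<^bsub>Sr\<^esub> f) w + (h \<otimes>\<^bsub>Sr\<^esub> g) w"
      by (simp add: split_def distrib_left sum.distrib)
  qed
qed

definition delta :: "'m \<Rightarrow> 'm series" where "delta u = (\<lambda>w. if w = u then 1 else 0)"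

lemma delta_closed [simp]: "u \<in> carrier M \<Longrightarrow> delta u \<in> carrier Sr"
  by (auto simp: series_iff delta_def)

lemma one_delta: "\<one>\<^bsub>Sr\<^esub> = delta \<one>"
  by (simp add: one_Sr delta_def)

lemma delta_one_mult: assumes f: "f \<in> carrier Sr" shows "delta \<one> \<otimes>\<^bsub>Sr\<^esub> f = f" "f \<otimes>\<^bsub>Sr\<^esub> delta \<one> = f"
proof -
  show "delta \<one> \<otimes>\<^bsub>Sr\<^esub> f = f"
  proof
    fix w
    show "(delta \<one> \<otimes>\<^bsub>Sr\<^esub> f) w = f w"
    proof (cases "w \<in> carrier M")
      case True
      then have "(delta \<one> \<otimes>\<^bsub>Sr\<^esub> f) w = (\<Sum>(u, v)\<in>{(\<one>, w)}. delta \<one> u * f v)"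
        by (intro mult_Sr_superset) (auto simp: factors_def delta_def split: if_splits)
      then show ?thesis by (simp add: delta_def)
    next
      case False
      then show ?thesis using f mult_Sr_nonzero[of "delta \<one>" f w] by (metis m_closed series_iff)
    qed
  qed
  show "f \<otimes>\<^bsub>Sr\<^esub> delta \<one> = f"
  proof
    fix w
    show "(f \<otimes>\<^bsub>Sr\<^esub> delta \<one>) w = f w"
    proof (cases "w \<in> carrier M")
      case True
      then have "(f \<otimes>\<^bsub>Sr\<^esub> delta \<one>) w = (\<Sum>(u, v)\<in>{(w, \<one>)}. f u * delta \<one> v)"
        by (intro mult_Sr_superset) (auto simp: factors_def delta_def split: if_splits)
      then show ?thesis by (simp add: delta_def)
    next
      case False
      then show ?thesis using f mult_Sr_nonzero[of f "delta \<one>" w] by (metis m_closed series_iff)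
    qed
  qed
qed

lemma delta_mult: "u \<in> carrier M \<Longrightarrow> v \<in> carrier M \<Longrightarrow> delta u \<otimes>\<^bsub>Sr\<^esub> delta v = delta (u \<otimes> v)"
proof
  fix w assume uv: "u \<in> carrier M" "v \<in> carrier M"
  show "(delta u \<otimes>\<^bsub>Sr\<^esub> delta v) w = delta (u \<otimes> v) w"
  proof (cases "w = u \<otimes> v")
    case True
    then have "(delta u \<otimes>\<^bsub>Sr\<^esub> delta v) w = (\<Sum>(a, b)\<in>{(u, v)}. delta u a * delta v b)"
      using uv by (intro mult_Sr_superset) (auto simp: factors_def delta_def split: if_splits)
    then show ?thesis using True by (simp add: delta_def)
  next
    case False
    have "(delta u \<otimes>\<^bsub>Sr\<^esub> delta v) w = 0"
    proof (rule ccontr)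
      assume "(delta u \<otimes>\<^bsub>Sr\<^esub> delta v) w \<noteq> 0"
      then show False
        by (elim mult_Sr_nonzero) (use False in \<open>auto simp: delta_def split: if_splits\<close>)
    qed
    then show ?thesis using False by (simp add: delta_def)
  qed
qed

lemma ring_Sr: "ring Sr"
proof (intro ringI abelian_groupI monoidI)
  fix f assume "f \<in> carrier Sr"
  then have "sc (-1) f \<in> carrier Sr" by (rule sc_closed)
  then show "\<exists>g\<in>carrier Sr. g \<oplus>\<^bsub>Sr\<^esub> f = \<zero>\<^bsub>Sr\<^esub>"
    by (intro bexI[of _ "sc (-1) f"]) (auto simp: sc_def)
qed (auto simp: mult_Sr_assoc mult_Sr_distrib mult_Sr_closed add_closed one_delta delta_one_mult add.assoc add.commute
    simp: series_iff[of "\<lambda>_. 0"])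

sublocale Sr: ring Sr by (rule ring_Sr)

lemma uminus_Sr: "f \<in> carrier Sr \<Longrightarrow> \<ominus>\<^bsub>Sr\<^esub> f = (\<lambda>w. - f w)"
proof -
  assume f: "f \<in> carrier Sr"
  have "(\<lambda>w. - f w) \<in> carrier Sr" using sc_closed[OF f, of "-1"] by (simp add: sc_def)
  then show ?thesis using f by (intro Sr.minus_equality) auto
qed

lemma minus_Sr: "f \<in> carrier Sr \<Longrightarrow> g \<in> carrier Sr \<Longrightarrow> f \<ominus>\<^bsub>Sr\<^esub> g = (\<lambda>w. f w - g w)"
  by (simp add: Sr.minus_eq uminus_Sr)

lemma sc_mult: assumes "f \<in> carrier Sr" "g \<in> carrier Sr"
  shows "sc c f \<otimes>\<^bsub>Sr\<^esub> g = sc c (f \<otimes>\<^bsub>Sr\<^esub> g)" "f \<otimes>\<^bsub>Sr\<^esub> sc c g = sc c (f \<otimes>\<^bsub>Sr\<^esub> g)"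
proof -
  have "(sc c f \<otimes>\<^bsub>Sr\<^esub> g) w = sc c (f \<otimes>\<^bsub>Sr\<^esub> g) w" for w
  proof -
    have "(sc c f \<otimes>\<^bsub>Sr\<^esub> g) w = (\<Sum>(u, v)\<in>factors f g w. sc c f u * g v)"
      by (rule mult_Sr_superset[OF finite_factors[OF assms]]) (auto simp: factors_def sc_def)
    then show ?thesis
      by (simp add: sc_def mult_Sr sum_distrib_left split_def mult.assoc)
  qed
  moreover have "(f \<otimes>\<^bsub>Sr\<^esub> sc c g) w = sc c (f \<otimes>\<^bsub>Sr\<^esub> g) w" for w
  proof -
    have "(f \<otimes>\<^bsub>Sr\<^esub> sc c g) w = (\<Sum>(u, v)\<in>factors f g w. f u * sc c g v)"
      by (rule mult_Sr_superset[OF finite_factors[OF assms]]) (auto simp: factors_def sc_def)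
    then show ?thesis
      by (simp add: sc_def mult_Sr sum_distrib_left split_def mult.left_commute)
  qed
  ultimately show "sc c f \<otimes>\<^bsub>Sr\<^esub> g = sc c (f \<otimes>\<^bsub>Sr\<^esub> g)" "f \<otimes>\<^bsub>Sr\<^esub> sc c g = sc c (f \<otimes>\<^bsub>Sr\<^esub> g)"
    by auto
qed

lemma sc_one_mult: "f \<in> carrier Sr \<Longrightarrow> sc c \<one>\<^bsub>Sr\<^esub> \<otimes>\<^bsub>Sr\<^esub> f = sc c f" "f \<in> carrier Sr \<Longrightarrow> f \<otimes>\<^bsub>Sr\<^esub> sc c \<one>\<^bsub>Sr\<^esub> = sc c f"
  by (simp_all add: sc_mult)

lemma deg_ge_iff: "f \<in> deg_ge M d n \<longleftrightarrow> f \<in> carrier Sr \<and> (\<forall>w. f w \<noteq> 0 \<longrightarrow> n \<le> d w)"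
  by (simp add: deg_ge_def)

lemma deg_ge_mult: "f \<in> deg_ge M d m \<Longrightarrow> g \<in> deg_ge M d n \<Longrightarrow> f \<otimes>\<^bsub>Sr\<^esub> g \<in> deg_ge M d (m + n)"
  by (auto simp: deg_ge_iff mult_Sr_closed elim!: mult_Sr_nonzero simp: deg_mult add_mono)

lemma deg_ge_add: "f \<in> deg_ge M d n \<Longrightarrow> g \<in> deg_ge M d n \<Longrightarrow> f \<oplus>\<^bsub>Sr\<^esub> g \<in> deg_ge M d n"
  unfolding deg_ge_iff add_Sr using add_closed by (metis add_0)

lemma deg_ge_sc: "f \<in> deg_ge M d n \<Longrightarrow> sc c f \<in> deg_ge M d n"
  by (auto simp: deg_ge_iff sc_closed) (auto simp: sc_def)

lemma deg_ge_minus: "f \<in> deg_ge M d n \<Longrightarrow> g \<in> deg_ge M d n \<Longrightarrow> f \<ominus>\<^bsub>Sr\<^esub> g \<in> deg_ge M d n"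
  using deg_ge_add[of f n "sc (-1) g"] deg_ge_sc[of g n "-1"]
  by (simp add: deg_ge_iff minus_Sr sc_def)

lemma deg_ge_mono: "f \<in> deg_ge M d n \<Longrightarrow> m \<le> n \<Longrightarrow> f \<in> deg_ge M d m"
  by (auto simp: deg_ge_iff)

lemma delta_deg: "u \<in> carrier M \<Longrightarrow> delta u \<in> deg_ge M d (d u)"
  by (auto simp: deg_ge_iff) (auto simp: delta_def split: if_splits)

text \<open>Below any given degree a series has finitely many terms, so finite combinations of
  monoid elements are dense.\<close>

lemma series_approx:
  assumes f: "f \<in> carrier Sr"
  defines "W n \<equiv> {w. f w \<noteq> 0 \<and> d w < n}"
  shows "finite (W n)" "W n \<subseteq> carrier M"
    "f \<ominus>\<^bsub>Sr\<^esub> (\<lambda>v. \<Sum>w\<in>W n. f w * delta w v) \<in> deg_ge M d n" "(\<lambda>v. \<Sum>w\<in>W n. f w * delta w v) \<in> carrier Sr"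
proof -
  show W: "finite (W n)" "W n \<subseteq> carrier M"
    using f unfolding W_def series_iff
    by (auto intro: finite_subset[of _ "{w. f w \<noteq> 0 \<and> d w \<le> n}"])
  have e: "(\<Sum>w\<in>W n. f w * delta w v) = (if v \<in> W n then f v else 0)" for v
    using W(1) by (simp add: delta_def if_distrib[of "\<lambda>x. _ * x"] sum.delta' cong: if_cong)
  show c: "(\<lambda>v. \<Sum>w\<in>W n. f w * delta w v) \<in> carrier Sr"
    unfolding e using f by (auto simp: series_iff elim: rev_finite_subset)
  show "f \<ominus>\<^bsub>Sr\<^esub> (\<lambda>v. \<Sum>w\<in>W n. f w * delta w v) \<in> deg_ge M d n"
    using Sr.minus_closed[OF f c] unfolding minus_Sr[OF f c] unfolding e deg_ge_iff
    by (auto simp: W_def split: if_splits)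
qed

text \<open>The whole ring is a closed ideal containing S, so the intersection runs over a nonempty
  family.\<close>

lemma closed_ideal_gen_props:
  assumes S: "S \<subseteq> carrier Sr"
  shows "ideal (closed_ideal_gen M d S) Sr" "closed_set M d (closed_ideal_gen M d S)" "S \<subseteq> closed_ideal_gen M d S"
    "ideal J Sr \<Longrightarrow> closed_set M d J \<Longrightarrow> S \<subseteq> J \<Longrightarrow> closed_ideal_gen M d S \<subseteq> J"
proof -
  let ?A = "{J. ideal J Sr \<and> closed_set M d J \<and> S \<subseteq> J}"
  have "carrier Sr \<in> ?A" using S by (simp add: Sr.oneideal closed_set_def)
  then show "ideal (closed_ideal_gen M d S) Sr"
    unfolding closed_ideal_gen_def by (intro Sr.i_Intersect) auto
  show "closed_set M d (closed_ideal_gen M d S)"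
    unfolding closed_ideal_gen_def closed_set_def by blast
  show "S \<subseteq> closed_ideal_gen M d S" "ideal J Sr \<Longrightarrow> closed_set M d J \<Longrightarrow> S \<subseteq> J \<Longrightarrow> closed_ideal_gen M d S \<subseteq> J"
    unfolding closed_ideal_gen_def by auto
qed

end

lemma (in ring) minus_minus_cancel:
  "x \<in> carrier R \<Longrightarrow> y \<in> carrier R \<Longrightarrow> z \<in> carrier R \<Longrightarrow> (x \<ominus> z) \<ominus> (y \<ominus> z) = x \<ominus> y"
proof -
  assume c: "x \<in> carrier R" "y \<in> carrier R" "z \<in> carrier R"
  have "(x \<ominus> z) \<ominus> (y \<ominus> z) = (x \<ominus> y) \<oplus> (z \<ominus> z)"
    using c by (simp add: minus_eq minus_add a_ac)
  then show ?thesis using c by (simp add: minus_eq r_neg)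
qed

lemma (in ring) difference_of_squares:
  assumes c: "y \<in> carrier R" "z \<in> carrier R" and yz: "y \<otimes> z = z \<otimes> y" "y \<otimes> y = z \<otimes> z"
  shows "(y \<ominus> z) \<otimes> (y \<oplus> z) = \<zero>"
proof -
  have "(y \<ominus> z) \<otimes> (y \<oplus> z) = (y \<otimes> y \<oplus> y \<otimes> z) \<ominus> (z \<otimes> y \<oplus> z \<otimes> z)"
    using c by (simp add: minus_eq l_distr r_distr l_minus minus_add a_ac)
  also have "\<dots> = (z \<otimes> z \<oplus> z \<otimes> y) \<ominus> (z \<otimes> z \<oplus> z \<otimes> y)"
    using c by (simp only: yz a_comm m_closed)
  finally show ?thesis using c by (simp add: minus_eq r_neg)
qed

lemma (in ring) sum_around_one:
  assumes c: "y \<in> carrier R" "z \<in> carrier R"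
  shows "y \<oplus> z = \<one> \<oplus> \<one> \<oplus> ((y \<ominus> \<one>) \<oplus> (z \<ominus> \<one>))"
proof -
  have "x = \<one> \<oplus> (x \<ominus> \<one>)" if "x \<in> carrier R" for x
    using that by (simp add: minus_eq a_lcomm[of \<one> x] r_neg)
  then have "y \<oplus> z = (\<one> \<oplus> (y \<ominus> \<one>)) \<oplus> (\<one> \<oplus> (z \<ominus> \<one>))" using c by metis
  also have "\<dots> = \<one> \<oplus> \<one> \<oplus> ((y \<ominus> \<one>) \<oplus> (z \<ominus> \<one>))"
    using minus_closed[OF c(1) one_closed] minus_closed[OF c(2) one_closed] by (simp only: a_assoc a_lcomm one_closed a_closed)
  finally show ?thesis .
qed

section \<open>Quotients by closed ideals and their filtration\<close>

locale calgebra = graded_monoid "mon P" "dgr P" for P :: "'m calg" +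
  assumes rel_ideal: "ideal (rel_ideal P) (cover P)"
    and rel_closed: "closed_set (mon P) (dgr P) (rel_ideal P)"
begin

lemma cover: "cover P = Sr"
  by (simp add: cover_def)

lemma ideal_Sr: "ideal (rel_ideal P) Sr"
  using rel_ideal by (simp add: cover)

sublocale A: ring "alg P"
  unfolding alg_def by (rule ideal.quotient_is_ring[OF rel_ideal])

lemma cls_hom: "ring_hom_ring Sr (alg P) (cls P)"
proof (rule ring_hom_ringI2)
  have "cls P = (+>\<^bsub>Sr\<^esub>) (rel_ideal P)" by (intro ext) (simp add: cls_def cover)
  then show "cls P \<in> ring_hom Sr (alg P)"
    using ideal.rcos_ring_hom[OF ideal_Sr] by (simp add: alg_def cover)
qed (rule ring_Sr, rule A.ring_axioms)

sublocale cls: ring_hom_ring Sr "alg P" "cls P"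
  by (rule cls_hom)

lemma cls_surj: "carrier (alg P) = cls P ` carrier Sr"
  by (auto simp: alg_def FactRing_def A_RCOSETS_def' cls_def cover)

lemma cls_0_iff: assumes x: "x \<in> carrier Sr" shows "cls P x = \<zero>\<^bsub>alg P\<^esub> \<longleftrightarrow> x \<in> rel_ideal P"
proof -
  interpret ideal "rel_ideal P" Sr by (rule ideal_Sr)
  have "\<zero>\<^bsub>alg P\<^esub> = rel_ideal P" "cls P x = rel_ideal P +>\<^bsub>Sr\<^esub> x"
    by (simp_all add: alg_def FactRing_def cls_def cover)
  then show ?thesis
    using a_rcos_self[OF x] a_rcos_const[of x] by auto
qed

lemma cls_eq_iff:
  assumes "f \<in> carrier Sr" "g \<in> carrier Sr"
  shows "cls P f = cls P g \<longleftrightarrow> f \<ominus>\<^bsub>Sr\<^esub> g \<in> rel_ideal P"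
proof -
  have "cls P f = cls P g \<longleftrightarrow> cls P (f \<ominus>\<^bsub>Sr\<^esub> g) = \<zero>\<^bsub>alg P\<^esub>"
    using assms by (simp add: cls.hom_minus)
  then show ?thesis using cls_0_iff assms by simp
qed

lemma rel_sub: "f \<in> rel_ideal P \<Longrightarrow> f \<in> carrier Sr"
  using additive_subgroup.a_subset[OF ideal.axioms(1)[OF ideal_Sr]] by auto

lemma scalar_eq: "scalar P c = cls P (sc c \<one>\<^bsub>Sr\<^esub>)"
  by (simp add: scalar_def cover)

lemma sc_one_closed: "sc c \<one>\<^bsub>Sr\<^esub> \<in> carrier Sr"
  by (rule sc_closed) simp

lemma smul_cls: "f \<in> carrier Sr \<Longrightarrow> smul P c (cls P f) = cls P (sc c f)"
  unfolding smul_def scalar_eq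
  by (subst cls.hom_mult[symmetric]) (simp_all add: sc_one_closed sc_one_mult)

lemma cemb_scalar: "cemb (alg P) (scalar P)"
  unfolding cemb_def
proof (intro conjI allI ballI)
  show "scalar P c \<in> carrier (alg P)" for c by (simp add: scalar_eq sc_one_closed)
  show "scalar P (c + d) = scalar P c \<oplus>\<^bsub>alg P\<^esub> scalar P d" for c d
    unfolding scalar_eq by (subst cls.hom_add[symmetric]) (simp_all add: sc_one_closed, simp add: sc_def distrib_right)
  show "scalar P (c * d) = scalar P c \<otimes>\<^bsub>alg P\<^esub> scalar P d" for c d
    unfolding scalar_eq by (subst cls.hom_mult[symmetric]) (simp_all add: sc_one_closed sc_one_mult, simp add: sc_def mult.assoc mult.left_commute)
  have "sc 1 \<one>\<^bsub>Sr\<^esub> = \<one>\<^bsub>Sr\<^esub>" by (simp add: sc_def)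
  then show "scalar P 1 = \<one>\<^bsub>alg P\<^esub>" by (simp add: scalar_eq)
  fix c x assume "x \<in> carrier (alg P)"
  then obtain f where f: "f \<in> carrier Sr" "x = cls P f" unfolding cls_surj by auto
  then show "scalar P c \<otimes>\<^bsub>alg P\<^esub> x = x \<otimes>\<^bsub>alg P\<^esub> scalar P c"
    unfolding scalar_eq f(2) by (subst (1 2) cls.hom_mult[symmetric]) (simp_all add: sc_one_closed sc_one_mult)
qed

lemma smul_closed: "x \<in> carrier (alg P) \<Longrightarrow> smul P c x \<in> carrier (alg P)"
  by (simp add: smul_def cembD(1)[OF cemb_scalar])

lemma smul_mult: "x \<in> carrier (alg P) \<Longrightarrow> y \<in> carrier (alg P) \<Longrightarrow> smul P c (x \<otimes>\<^bsub>alg P\<^esub> y) = smul P c x \<otimes>\<^bsub>alg P\<^esub> y"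
  "x \<in> carrier (alg P) \<Longrightarrow> y \<in> carrier (alg P) \<Longrightarrow> smul P c (x \<otimes>\<^bsub>alg P\<^esub> y) = x \<otimes>\<^bsub>alg P\<^esub> smul P c y"
proof -
  assume xy: "x \<in> carrier (alg P)" "y \<in> carrier (alg P)"
  note c = cembD(1)[OF cemb_scalar]
  show 1: "smul P c (x \<otimes>\<^bsub>alg P\<^esub> y) = smul P c x \<otimes>\<^bsub>alg P\<^esub> y"
    using xy c by (simp add: smul_def A.m_assoc)
  show "smul P c (x \<otimes>\<^bsub>alg P\<^esub> y) = x \<otimes>\<^bsub>alg P\<^esub> smul P c y"
    unfolding 1 using xy c by (simp add: smul_def cembD(5)[OF cemb_scalar, of x] A.m_assoc)
qed

lemma smul_0: "smul P c \<zero>\<^bsub>alg P\<^esub> = \<zero>\<^bsub>alg P\<^esub>"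
  by (simp add: smul_def cembD(1)[OF cemb_scalar])

lemma smul_neg: "x \<in> carrier (alg P) \<Longrightarrow> smul P (-1) x = \<ominus>\<^bsub>alg P\<^esub> x"
proof -
  assume "x \<in> carrier (alg P)"
  then obtain f where f: "f \<in> carrier Sr" "x = cls P f" unfolding cls_surj by auto
  have "sc (-1) f = \<ominus>\<^bsub>Sr\<^esub> f" using f by (simp add: uminus_Sr sc_def)
  then show ?thesis using f by (simp add: smul_cls)
qed

lemma fil_iff: "x \<in> fil P n \<longleftrightarrow> (\<exists>f\<in>deg_ge (mon P) (dgr P) n. x = cls P f)"
  by (auto simp: fil_def)

lemma deg_ge_carrier: "f \<in> deg_ge (mon P) (dgr P) n \<Longrightarrow> f \<in> carrier Sr"
  by (simp add: deg_ge_iff)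

lemma fil_carrier: "x \<in> fil P n \<Longrightarrow> x \<in> carrier (alg P)"
  by (auto simp: fil_iff deg_ge_carrier)

lemma cls_fil: "f \<in> deg_ge (mon P) (dgr P) n \<Longrightarrow> cls P f \<in> fil P n"
  by (auto simp: fil_iff)

lemma fil_mono: "x \<in> fil P n \<Longrightarrow> m \<le> n \<Longrightarrow> x \<in> fil P m"
  using deg_ge_mono by (auto simp: fil_iff)

lemma fil_add: "x \<in> fil P n \<Longrightarrow> y \<in> fil P n \<Longrightarrow> x \<oplus>\<^bsub>alg P\<^esub> y \<in> fil P n"
proof -
  assume "x \<in> fil P n" "y \<in> fil P n"
  then obtain f g where fg: "f \<in> deg_ge (mon P) (dgr P) n" "g \<in> deg_ge (mon P) (dgr P) n" "x = cls P f" "y = cls P g"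
    unfolding fil_iff by blast
  then show ?thesis
    unfolding fg(3,4) cls.hom_add[OF deg_ge_carrier[OF fg(1)] deg_ge_carrier[OF fg(2)], symmetric]
    by (intro cls_fil deg_ge_add)
qed

lemma fil_minus: "x \<in> fil P n \<Longrightarrow> y \<in> fil P n \<Longrightarrow> x \<ominus>\<^bsub>alg P\<^esub> y \<in> fil P n"
proof -
  assume "x \<in> fil P n" "y \<in> fil P n"
  then obtain f g where fg: "f \<in> deg_ge (mon P) (dgr P) n" "g \<in> deg_ge (mon P) (dgr P) n" "x = cls P f" "y = cls P g"
    unfolding fil_iff by blast
  then show ?thesis
    unfolding fg(3,4) cls.hom_minus[OF deg_ge_carrier[OF fg(1)] deg_ge_carrier[OF fg(2)], symmetric]
    by (intro cls_fil deg_ge_minus)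
qed

lemma fil_mult: "x \<in> fil P m \<Longrightarrow> y \<in> fil P n \<Longrightarrow> x \<otimes>\<^bsub>alg P\<^esub> y \<in> fil P (m + n)"
proof -
  assume "x \<in> fil P m" "y \<in> fil P n"
  then obtain f g where fg: "f \<in> deg_ge (mon P) (dgr P) m" "g \<in> deg_ge (mon P) (dgr P) n" "x = cls P f" "y = cls P g"
    unfolding fil_iff by blast
  then show ?thesis
    unfolding fg(3,4) cls.hom_mult[OF deg_ge_carrier[OF fg(1)] deg_ge_carrier[OF fg(2)], symmetric]
    by (intro cls_fil deg_ge_mult)
qed

lemma fil_smul: "x \<in> fil P n \<Longrightarrow> smul P c x \<in> fil P n"
proof -
  assume "x \<in> fil P n"
  then obtain f where f: "f \<in> deg_ge (mon P) (dgr P) n" "x = cls P f"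
    unfolding fil_iff by blast
  then show ?thesis
    unfolding f(2) smul_cls[OF deg_ge_carrier[OF f(1)]] by (intro cls_fil deg_ge_sc)
qed

lemma fil_zero: "\<zero>\<^bsub>alg P\<^esub> \<in> fil P n"
proof -
  have "\<zero>\<^bsub>Sr\<^esub> \<in> deg_ge (mon P) (dgr P) n" using Sr.zero_closed unfolding deg_ge_iff by simp
  then show ?thesis using cls_fil cls.hom_zero by metis
qed

lemma fil_uminus: "x \<in> fil P n \<Longrightarrow> \<ominus>\<^bsub>alg P\<^esub> x \<in> fil P n"
  using fil_minus[OF fil_zero, of x n] fil_carrier by (simp add: A.minus_eq)

lemma fil_one: "\<one>\<^bsub>alg P\<^esub> \<in> fil P 0"
  using cls_fil[OF delta_deg[of "\<one>\<^bsub>mon P\<^esub>"]] one_delta cls.hom_one deg_one by simp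

lemma fil_scalar: "scalar P c \<in> fil P 0"
proof -
  have "scalar P c = smul P c \<one>\<^bsub>alg P\<^esub>"
    using cembD(1)[OF cemb_scalar] by (simp add: smul_def)
  then show ?thesis using fil_smul[OF fil_one] by simp
qed

lemma series_deg: "f \<in> carrier Sr \<Longrightarrow> \<exists>n. f \<in> deg_ge (mon P) (dgr P) n"
  using series_bound[of f] unfolding deg_ge_iff by metis

lemma fil_exhaust: "x \<in> carrier (alg P) \<Longrightarrow> \<exists>n. x \<in> fil P n"
  using series_deg cls_fil unfolding cls_surj by blast

text \<open>Closedness of the ideal is what makes this true: if the class of f has representatives g
  of arbitrarily high degree, then f is a limit of the elements f - g of the ideal.\<close>

lemma hausdorff: assumes "\<And>n. x \<in> fil P n" shows "x = \<zero>\<^bsub>alg P\<^esub>"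
proof -
  obtain f where f: "f \<in> carrier Sr" "x = cls P f"
    using fil_carrier[OF assms[of 0]] unfolding cls_surj by auto
  have "\<exists>g\<in>rel_ideal P. f \<ominus>\<^bsub>Sr\<^esub> g \<in> deg_ge (mon P) (dgr P) n" for n
  proof -
    obtain g where g: "g \<in> deg_ge (mon P) (dgr P) n" "x = cls P g"
      using assms[of n] by (auto simp: fil_iff)
    then have gc: "g \<in> carrier Sr" by (simp add: deg_ge_carrier)
    have "f \<ominus>\<^bsub>Sr\<^esub> g \<in> rel_ideal P" using cls_eq_iff[OF f(1) gc] f g by simp
    moreover have "f \<ominus>\<^bsub>Sr\<^esub> (f \<ominus>\<^bsub>Sr\<^esub> g) = g"
      using f(1) gc Sr.minus_closed[OF f(1) gc] by (simp add: minus_Sr)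
    ultimately show ?thesis using g(1) by metis
  qed
  then have "f \<in> rel_ideal P"
    using rel_closed f(1) unfolding closed_set_def by blast
  then show ?thesis using f by (simp add: cls_0_iff)
qed

lemma eq_if_close:
  assumes "x \<in> carrier (alg P)" "y \<in> carrier (alg P)" "\<And>n. x \<ominus>\<^bsub>alg P\<^esub> y \<in> fil P n"
  shows "x = y"
  using hausdorff[OF assms(3)] assms(1,2) A.r_right_minus_eq by blast

text \<open>Needs no inverse of \<open>y + z\<close>: its leading term is 2, so \<open>(y - z)(y + z) = 0\<close> pushes \<open>y - z\<close> ever
  deeper into the filtration.\<close>

lemma sqrt_unique:
  assumes y: "y \<in> carrier (alg P)" "y \<ominus>\<^bsub>alg P\<^esub> \<one>\<^bsub>alg P\<^esub> \<in> fil P 1"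
    and z: "z \<in> carrier (alg P)" "z \<ominus>\<^bsub>alg P\<^esub> \<one>\<^bsub>alg P\<^esub> \<in> fil P 1"
    and yz: "y \<otimes>\<^bsub>alg P\<^esub> z = z \<otimes>\<^bsub>alg P\<^esub> y" "y \<otimes>\<^bsub>alg P\<^esub> y = z \<otimes>\<^bsub>alg P\<^esub> z"
  shows "y = z"
proof -
  let ?A = "alg P"
  define e where "e = y \<ominus>\<^bsub>?A\<^esub> z"
  define r where "r = (y \<ominus>\<^bsub>?A\<^esub> \<one>\<^bsub>?A\<^esub>) \<oplus>\<^bsub>?A\<^esub> (z \<ominus>\<^bsub>?A\<^esub> \<one>\<^bsub>?A\<^esub>)"
  have e: "e \<in> carrier ?A" and r: "r \<in> fil P 1" "r \<in> carrier ?A"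
    using y z fil_add by (auto simp: e_def r_def)
  have "e \<otimes>\<^bsub>?A\<^esub> (y \<oplus>\<^bsub>?A\<^esub> z) = \<zero>\<^bsub>?A\<^esub>"
    using A.difference_of_squares[OF y(1) z(1) yz] by (simp add: e_def)
  moreover have "y \<oplus>\<^bsub>?A\<^esub> z = \<one>\<^bsub>?A\<^esub> \<oplus>\<^bsub>?A\<^esub> \<one>\<^bsub>?A\<^esub> \<oplus>\<^bsub>?A\<^esub> r"
    using A.sum_around_one[OF y(1) z(1)] by (simp add: r_def)
  ultimately have "e \<oplus>\<^bsub>?A\<^esub> e \<oplus>\<^bsub>?A\<^esub> e \<otimes>\<^bsub>?A\<^esub> r = \<zero>\<^bsub>?A\<^esub>"
    using e r(2) by (simp add: A.r_distr)
  then have ee: "e \<oplus>\<^bsub>?A\<^esub> e = \<ominus>\<^bsub>?A\<^esub> (e \<otimes>\<^bsub>?A\<^esub> r)"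
    using A.minus_equality[of "e \<oplus>\<^bsub>?A\<^esub> e" "e \<otimes>\<^bsub>?A\<^esub> r"] e r(2) by simp
  have half: "smul P (1/2) (e \<oplus>\<^bsub>?A\<^esub> e) = e"
  proof -
    note s = cembD[OF cemb_scalar]
    have "smul P (1/2) (e \<oplus>\<^bsub>?A\<^esub> e) = scalar P (1/2) \<otimes>\<^bsub>?A\<^esub> e \<oplus>\<^bsub>?A\<^esub> scalar P (1/2) \<otimes>\<^bsub>?A\<^esub> e"
      using e s(1) by (simp add: smul_def A.r_distr)
    also have "\<dots> = scalar P (1/2 + 1/2) \<otimes>\<^bsub>?A\<^esub> e"
      using e s(1) by (simp only: s(2) A.l_distr)
    finally show ?thesis using e s(4) by simp
  qed
  have step: "e \<in> fil P (n + 1)" if "e \<in> fil P n" for n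
    using fil_smul[OF fil_uminus[OF fil_mult[OF that r(1)]], of "1/2"] half ee by simp
  obtain n0 where n0: "e \<in> fil P n0" using fil_exhaust[OF e] by blast
  have "e \<in> fil P (n0 + int k)" for k
  proof (induction k)
    case (Suc k)
    then show ?case using step[of "n0 + int k"] by (simp add: algebra_simps)
  qed (use n0 in simp)
  then have "e \<in> fil P n" for n
    by (rule fil_mono[of e "n0 + int (nat (n - n0))" n]) linarith
  then show ?thesis using hausdorff[of e] y z A.r_right_minus_eq unfolding e_def by blast
qed

end

section \<open>Continuous linear maps on series\<close>

definition slin :: "'m calg \<Rightarrow> 'n calg \<Rightarrow> int \<Rightarrow> ('m series \<Rightarrow> 'n series set) \<Rightarrow> bool" where
  "slin P R m L \<longleftrightarrow> (\<forall>f\<in>carrier (cover P). L f \<in> carrier (alg R)) \<and>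
    (\<forall>f\<in>carrier (cover P). \<forall>g\<in>carrier (cover P). L (\<lambda>w. f w + g w) = L f \<oplus>\<^bsub>alg R\<^esub> L g) \<and>
    (\<forall>c. \<forall>f\<in>carrier (cover P). L (sc c f) = smul R c (L f)) \<and>
    (\<forall>n. \<forall>f\<in>deg_ge (mon P) (dgr P) n. L f \<in> fil R (n + m))"

locale calgebra_pair = P: calgebra P + R: calgebra R for P :: "'m calg" and R :: "'n calg"
begin

lemma slinD:
  assumes "slin P R m L"
  shows "f \<in> carrier P.Sr \<Longrightarrow> L f \<in> carrier (alg R)"
    "f \<in> carrier P.Sr \<Longrightarrow> g \<in> carrier P.Sr \<Longrightarrow> L (f \<oplus>\<^bsub>P.Sr\<^esub> g) = L f \<oplus>\<^bsub>alg R\<^esub> L g"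
    "f \<in> carrier P.Sr \<Longrightarrow> L (sc c f) = smul R c (L f)"
    "f \<in> deg_ge (mon P) (dgr P) n \<Longrightarrow> L f \<in> fil R (n + m)"
    "f \<in> carrier P.Sr \<Longrightarrow> g \<in> carrier P.Sr \<Longrightarrow> L (f \<ominus>\<^bsub>P.Sr\<^esub> g) = L f \<ominus>\<^bsub>alg R\<^esub> L g"
    "L (\<lambda>w. 0) = \<zero>\<^bsub>alg R\<^esub>"
proof -
  note A = assms[unfolded slin_def P.cover]
  show 1: "f \<in> carrier P.Sr \<Longrightarrow> L f \<in> carrier (alg R)" for f using A by blast
  show 2: "f \<in> carrier P.Sr \<Longrightarrow> g \<in> carrier P.Sr \<Longrightarrow> L (f \<oplus>\<^bsub>P.Sr\<^esub> g) = L f \<oplus>\<^bsub>alg R\<^esub> L g" for f g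
    using A by simp
  show 3: "f \<in> carrier P.Sr \<Longrightarrow> L (sc c f) = smul R c (L f)" for f c using A by blast
  show "f \<in> deg_ge (mon P) (dgr P) n \<Longrightarrow> L f \<in> fil R (n + m)" using A by blast
  show "L (f \<ominus>\<^bsub>P.Sr\<^esub> g) = L f \<ominus>\<^bsub>alg R\<^esub> L g" if "f \<in> carrier P.Sr" "g \<in> carrier P.Sr"
  proof -
    have "f \<ominus>\<^bsub>P.Sr\<^esub> g = f \<oplus>\<^bsub>P.Sr\<^esub> sc (-1) g"
      using that by (simp add: P.minus_Sr sc_def)
    then show ?thesis
      using 2[OF that(1) P.sc_closed[OF that(2), of "-1"]] 3[OF that(2), of "-1"] R.smul_neg[OF 1[OF that(2)]]
      by (simp only: R.A.minus_eq)
  qed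
  have z: "(\<lambda>w. 0) \<in> carrier P.Sr" using P.Sr.zero_closed by simp
  have "L (\<lambda>w. 0) = L (\<lambda>w. 0) \<oplus>\<^bsub>alg R\<^esub> L (\<lambda>w. 0)"
    using 2[OF z z] by simp
  then show "L (\<lambda>w. 0) = \<zero>\<^bsub>alg R\<^esub>"
    using 1[OF z] by (metis R.A.add.r_cancel_one')
qed

lemma slinI:
  assumes "\<And>f. f \<in> carrier P.Sr \<Longrightarrow> L f \<in> carrier (alg R)"
    "\<And>f g. f \<in> carrier P.Sr \<Longrightarrow> g \<in> carrier P.Sr \<Longrightarrow> L (f \<oplus>\<^bsub>P.Sr\<^esub> g) = L f \<oplus>\<^bsub>alg R\<^esub> L g"
    "\<And>f c. f \<in> carrier P.Sr \<Longrightarrow> L (sc c f) = smul R c (L f)"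
    "\<And>f n. f \<in> deg_ge (mon P) (dgr P) n \<Longrightarrow> L f \<in> fil R (n + m)"
  shows "slin P R m L"
  using assms unfolding slin_def P.cover by simp

lemma slin_finite:
  assumes L: "slin P R m L" and W: "finite W" "W \<subseteq> carrier (mon P)"
  shows "(\<lambda>v. \<Sum>w\<in>W. c w * P.delta w v) \<in> carrier P.Sr \<and>
    L (\<lambda>v. \<Sum>w\<in>W. c w * P.delta w v) = finsum (alg R) (\<lambda>w. smul R (c w) (L (P.delta w))) W"
  using W
proof (induction W rule: finite_induct)
  case empty
  then show ?case using slinD(6)[OF L] P.Sr.zero_closed by simp
next
  case (insert u W)
  let ?h = "\<lambda>v. \<Sum>w\<in>W. c w * P.delta w v"
  have d: "P.delta w \<in> carrier P.Sr" if "w \<in> insert u W" for w using insert.prems that by auto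
  have h: "?h \<in> carrier P.Sr" using insert by auto
  have e: "(\<lambda>v. \<Sum>w\<in>insert u W. c w * P.delta w v) = sc (c u) (P.delta u) \<oplus>\<^bsub>P.Sr\<^esub> ?h"
    using insert.hyps by (simp add: sc_def)
  have u: "sc (c u) (P.delta u) \<in> carrier P.Sr" using P.sc_closed[OF d] by simp
  have s: "smul R (c w) (L (P.delta w)) \<in> carrier (alg R)" if "w \<in> insert u W" for w
    using R.smul_closed slinD(1)[OF L d[OF that]] by blast
  have "L (sc (c u) (P.delta u) \<oplus>\<^bsub>P.Sr\<^esub> ?h) = smul R (c u) (L (P.delta u)) \<oplus>\<^bsub>alg R\<^esub> L ?h"
    using slinD(2)[OF L u h] slinD(3)[OF L d] by simp
  then show ?case
    unfolding e using insert P.Sr.a_closed[OF u h] s by (simp add: R.A.finsum_insert Pi_def)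
qed

text \<open>Finite combinations of monoid elements are dense and the target is Hausdorff. Truncation
  at n - min m1 m2 sends both errors into \<open>fil R n\<close> although the shifts may
  differ.\<close>

lemma slin_unique:
  assumes L1: "slin P R m1 L1" and L2: "slin P R m2 L2"
    and eq: "\<And>u. u \<in> carrier (mon P) \<Longrightarrow> L1 (P.delta u) = L2 (P.delta u)"
    and f: "f \<in> carrier P.Sr"
  shows "L1 f = L2 f"
proof (rule R.eq_if_close)
  show c: "L1 f \<in> carrier (alg R)" "L2 f \<in> carrier (alg R)"
    using slinD(1) L1 L2 f by auto
  fix n
  let ?p = "n - min m1 m2"
  let ?W = "{w. f w \<noteq> 0 \<and> dgr P w < ?p}"
  let ?g = "\<lambda>v. \<Sum>w\<in>?W. f w * P.delta w v"
  note A = P.series_approx[OF f, of ?p]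
  have "finsum (alg R) (\<lambda>w. smul R (f w) (L1 (P.delta w))) ?W = finsum (alg R) (\<lambda>w. smul R (f w) (L2 (P.delta w))) ?W"
    using eq A(2) by (intro R.A.finsum_cong') (auto simp: R.smul_closed slinD(1)[OF L2] subset_iff)
  then have "L1 ?g = L2 ?g"
    using slin_finite[OF L1 A(1,2), of f] slin_finite[OF L2 A(1,2), of f] by simp
  moreover have "L1 f \<ominus>\<^bsub>alg R\<^esub> L1 ?g \<in> fil R n" "L2 f \<ominus>\<^bsub>alg R\<^esub> L2 ?g \<in> fil R n"
    using slinD(4)[OF L1 A(3)] slinD(4)[OF L2 A(3)] slinD(5)[OF L1 f A(4)] slinD(5)[OF L2 f A(4)]
    by (auto elim: R.fil_mono)
  ultimately have "(L1 f \<ominus>\<^bsub>alg R\<^esub> L1 ?g) \<ominus>\<^bsub>alg R\<^esub> (L2 f \<ominus>\<^bsub>alg R\<^esub> L1 ?g) \<in> fil R n"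
    using R.fil_minus by simp
  moreover have "(L1 f \<ominus>\<^bsub>alg R\<^esub> L1 ?g) \<ominus>\<^bsub>alg R\<^esub> (L2 f \<ominus>\<^bsub>alg R\<^esub> L1 ?g) = L1 f \<ominus>\<^bsub>alg R\<^esub> L2 f"
    using c slinD(1)[OF L1 A(4)] by (intro R.A.minus_minus_cancel)
  ultimately show "L1 f \<ominus>\<^bsub>alg R\<^esub> L2 f \<in> fil R n" by simp
qed

text \<open>The value at w is represented by a series supported in degrees at least that of w. Hence
  only finitely many terms of f contribute to a given coefficient of the image.\<close>

lemma slin_ext:
  assumes \<phi>: "\<And>u. u \<in> carrier (mon P) \<Longrightarrow> \<phi> u \<in> fil R (dgr P u)"
  shows "\<exists>L. slin P R 0 L \<and> (\<forall>u\<in>carrier (mon P). L (P.delta u) = \<phi> u)"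
proof -
  have "\<exists>r. \<forall>u\<in>carrier (mon P). r u \<in> deg_ge (mon R) (dgr R) (dgr P u) \<and> \<phi> u = cls R (r u)"
    using \<phi> unfolding R.fil_iff by metis
  then obtain r where r: "\<And>u. u \<in> carrier (mon P) \<Longrightarrow> r u \<in> deg_ge (mon R) (dgr R) (dgr P u)"
    and \<phi>r: "\<And>u. u \<in> carrier (mon P) \<Longrightarrow> \<phi> u = cls R (r u)" by blast
  define Z where "Z f v = {w. f w \<noteq> 0 \<and> dgr P w \<le> dgr R v}" for f :: "'m series" and v
  define K where "K f v = (\<Sum>w\<in>Z f v. f w * r w v)" for f v
  have finZ: "finite (Z f v)" and ZM: "Z f v \<subseteq> carrier (mon P)" if "f \<in> carrier P.Sr" for f v
    using that by (auto simp: Z_def P.series_iff)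
  have K_sup: "K f v = (\<Sum>w\<in>Y. f w * r w v)"
    if "f \<in> carrier P.Sr" "finite Y" "Z f v \<subseteq> Y" "Y \<subseteq> carrier (mon P)" for f v Y
    unfolding K_def
  proof (rule sum.mono_neutral_left[OF that(2,3)], rule ballI)
    fix i assume i: "i \<in> Y - Z f v"
    then have "f i = 0 \<or> dgr R v < dgr P i" by (auto simp: Z_def)
    moreover have "r i v \<noteq> 0 \<longrightarrow> dgr P i \<le> dgr R v"
      using r[of i] i that(4) unfolding R.deg_ge_iff by blast
    ultimately show "f i * r i v = 0" by auto
  qed
  have K_nz: "\<exists>w. f w \<noteq> 0 \<and> w \<in> carrier (mon P) \<and> dgr P w \<le> dgr R v \<and> r w v \<noteq> 0" if nz: "K f v \<noteq> 0" and fc: "f \<in> carrier P.Sr" for f v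
  proof -
    obtain w where w: "w \<in> Z f v" "f w * r w v \<noteq> 0"
      using nz unfolding K_def by (rule sum.not_neutral_contains_not_neutral)
    then have "w \<in> carrier (mon P)" using ZM[OF fc] by blast
    with w show ?thesis by (intro exI[of _ w]) (auto simp: Z_def)
  qed
  have Kc: "K f \<in> carrier R.Sr" if f: "f \<in> carrier P.Sr" for f
    unfolding R.series_iff
  proof (intro conjI allI impI)
    fix v assume "K f v \<noteq> 0"
    then show "v \<in> carrier (mon R)"
      using K_nz[OF _ f, of v] r unfolding R.deg_ge_iff R.series_iff by blast
  next
    fix n
    have "{v. K f v \<noteq> 0 \<and> dgr R v \<le> n} \<subseteq> (\<Union>w\<in>{w. f w \<noteq> 0 \<and> dgr P w \<le> n}. {v. r w v \<noteq> 0 \<and> dgr R v \<le> n})"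
      using K_nz[OF _ f] by fastforce
    moreover have "finite {v. r w v \<noteq> 0 \<and> dgr R v \<le> n}" if "w \<in> {w. f w \<noteq> 0 \<and> dgr P w \<le> n}" for w
      using that f r[of w] by (auto simp: R.deg_ge_iff R.series_iff P.series_iff)
    ultimately show "finite {v. K f v \<noteq> 0 \<and> dgr R v \<le> n}"
      using f unfolding P.series_iff by (elim finite_subset) (intro finite_UN_I, blast+)
  qed
  have Kadd: "K (\<lambda>w. f w + g w) = (\<lambda>v. K f v + K g v)" if "f \<in> carrier P.Sr" "g \<in> carrier P.Sr" for f g
  proof
    fix v
    let ?Y = "Z f v \<union> Z g v"
    have Y: "finite ?Y" "?Y \<subseteq> carrier (mon P)" using finZ ZM that by auto
    have "Z (\<lambda>w. f w + g w) v \<subseteq> ?Y" by (auto simp: Z_def)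
    then show "K (\<lambda>w. f w + g w) v = K f v + K g v"
      using K_sup[OF that(1) Y(1) _ Y(2)] K_sup[OF that(2) Y(1) _ Y(2)] K_sup[OF P.add_closed[OF that] Y(1) _ Y(2)]
      by (simp add: distrib_right sum.distrib)
  qed
  have Ksc: "K (sc c f) = sc c (K f)" if "f \<in> carrier P.Sr" for c f
  proof
    fix v
    have "Z (sc c f) v \<subseteq> Z f v" by (auto simp: Z_def sc_def)
    then show "K (sc c f) v = sc c (K f) v"
      using K_sup[OF P.sc_closed[OF that] finZ[OF that] _ ZM[OF that], of c v v]
      by (simp add: sc_def K_def sum_distrib_left mult.assoc)
  qed
  have Kdeg: "K f \<in> deg_ge (mon R) (dgr R) n" if "f \<in> deg_ge (mon P) (dgr P) n" for f n
    using that Kc[of f] K_nz[of f] unfolding R.deg_ge_iff P.deg_ge_iff by (meson order_trans)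
  have Kdelta: "K (P.delta u) = r u" if u: "u \<in> carrier (mon P)" for u
  proof
    fix v
    have "Z (P.delta u) v \<subseteq> {u}" by (auto simp: Z_def P.delta_def split: if_splits)
    then have "K (P.delta u) v = (\<Sum>w\<in>{u}. P.delta u w * r w v)"
      using u by (intro K_sup) auto
    then show "K (P.delta u) v = r u v" by (simp add: P.delta_def)
  qed
  have "slin P R 0 (\<lambda>f. cls R (K f))"
  proof (rule slinI)
    fix f g assume fg: "f \<in> carrier P.Sr" "g \<in> carrier P.Sr"
    show "cls R (K (f \<oplus>\<^bsub>P.Sr\<^esub> g)) = cls R (K f) \<oplus>\<^bsub>alg R\<^esub> cls R (K g)"
      using R.cls.hom_add[OF Kc[OF fg(1)] Kc[OF fg(2)]] Kadd[OF fg] by simp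
  qed (use Kc Ksc Kdeg R.smul_cls R.cls_fil in auto)
  then show ?thesis using Kdelta \<phi>r by (intro exI[of _ "\<lambda>f. cls R (K f)"]) simp
qed

lemma filtered_linear_slin:
  assumes "filtered_linear P R k" shows "slin P R 0 (\<lambda>f. k (cls P f))"
proof -
  note K = assms[unfolded filtered_linear_def]
  show ?thesis
  proof (rule slinI)
    fix f c assume f: "f \<in> carrier P.Sr"
    show "k (cls P f) \<in> carrier (alg R)" using K f by auto
    show "k (cls P (sc c f)) = smul R c (k (cls P f))"
      using K f P.smul_cls[OF f, of c] by (metis P.cls.hom_closed)
  next
    fix f g assume fg: "f \<in> carrier P.Sr" "g \<in> carrier P.Sr"
    then show "k (cls P (f \<oplus>\<^bsub>P.Sr\<^esub> g)) = k (cls P f) \<oplus>\<^bsub>alg R\<^esub> k (cls P g)"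
      using K P.cls.hom_add[OF fg] by (metis P.cls.hom_closed)
  next
    fix f n assume "f \<in> deg_ge (mon P) (dgr P) n"
    then have "cls P f \<in> fil P n" by (rule P.cls_fil)
    then show "k (cls P f) \<in> fil R (n + 0)" using K by (simp add: image_subset_iff)
  qed
qed

lemma slin_descend:
  assumes L: "slin P R 0 L" and kill: "\<And>f. f \<in> rel_ideal P \<Longrightarrow> L f = \<zero>\<^bsub>alg R\<^esub>"
  shows "\<exists>k. filtered_linear P R k \<and> (\<forall>f\<in>carrier P.Sr. k (cls P f) = L f)"
proof -
  define k where "k x = L (SOME f. f \<in> carrier P.Sr \<and> x = cls P f)" for x
  have k: "k (cls P f) = L f" if f: "f \<in> carrier P.Sr" for f
  proof -
    define g where "g = (SOME g. g \<in> carrier P.Sr \<and> cls P f = cls P g)"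
    have g: "g \<in> carrier P.Sr \<and> cls P f = cls P g"
      unfolding g_def by (rule someI[of _ f]) (use f in simp)
    then have "f \<ominus>\<^bsub>P.Sr\<^esub> g \<in> rel_ideal P" using P.cls_eq_iff[OF f] by blast
    then have "L f \<ominus>\<^bsub>alg R\<^esub> L g = \<zero>\<^bsub>alg R\<^esub>"
      using kill slinD(5)[OF L f] g by metis
    then have "L f = L g" using slinD(1)[OF L] f g R.A.r_right_minus_eq by blast
    then show ?thesis by (simp add: k_def g_def)
  qed
  have "filtered_linear P R k"
    unfolding filtered_linear_def
  proof (intro conjI allI ballI)
    show "k \<in> carrier (alg P) \<rightarrow> carrier (alg R)"
      using slinD(1)[OF L] by (auto simp: P.cls_surj k)
    show "k (x \<oplus>\<^bsub>alg P\<^esub> y) = k x \<oplus>\<^bsub>alg R\<^esub> k y" if "x \<in> carrier (alg P)" "y \<in> carrier (alg P)" for x y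
    proof -
      from that obtain f g where fg: "f \<in> carrier P.Sr" "g \<in> carrier P.Sr" "x = cls P f" "y = cls P g"
        unfolding P.cls_surj by blast
      have "x \<oplus>\<^bsub>alg P\<^esub> y = cls P (f \<oplus>\<^bsub>P.Sr\<^esub> g)" using fg by (simp only: P.cls.hom_add)
      then show ?thesis
        using fg k P.Sr.a_closed[OF fg(1,2)] slinD(2)[OF L fg(1,2)] by simp
    qed
    show "k (smul P c x) = smul R c (k x)" if "x \<in> carrier (alg P)" for c x
      using that slinD(3)[OF L] by (auto simp: P.cls_surj k P.smul_cls P.sc_closed)
    show "k ` fil P n \<subseteq> fil R n" for n
      using slinD(4)[OF L, of _ n] by (auto simp: P.fil_iff k P.deg_ge_carrier)
  qed
  then show ?thesis using k by blast
qed

text \<open>The shift in \<open>slin\<close> exists for this: multiplication by an element of degree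
  at least p turns m into p + m. Together with \<open>slin_unique\<close> it allows identities to be
  checked on monoid elements, one argument at a time.\<close>

lemma slin_lmult:
  assumes L: "slin P R m L" and a: "a \<in> carrier P.Sr"
  shows "\<exists>m'. slin P R m' (\<lambda>f. L (a \<otimes>\<^bsub>P.Sr\<^esub> f))"
proof -
  obtain p where p: "a \<in> deg_ge (mon P) (dgr P) p" using P.series_deg[OF a] by blast
  have "slin P R (p + m) (\<lambda>f. L (a \<otimes>\<^bsub>P.Sr\<^esub> f))"
  proof (rule slinI)
    fix f n assume fn: "f \<in> deg_ge (mon P) (dgr P) n"
    show "L (a \<otimes>\<^bsub>P.Sr\<^esub> f) \<in> fil R (n + (p + m))"
      using slinD(4)[OF L P.deg_ge_mult[OF p fn]] by (simp add: algebra_simps)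
  qed (use a L in \<open>simp_all add: slinD[OF L] P.Sr.r_distr P.sc_mult del: P.add_Sr\<close>)
  then show ?thesis by blast
qed

lemma slin_rmult:
  assumes L: "slin P R m L" and a: "a \<in> carrier P.Sr"
  shows "\<exists>m'. slin P R m' (\<lambda>f. L (f \<otimes>\<^bsub>P.Sr\<^esub> a))"
proof -
  obtain p where p: "a \<in> deg_ge (mon P) (dgr P) p" using P.series_deg[OF a] by blast
  have "slin P R (p + m) (\<lambda>f. L (f \<otimes>\<^bsub>P.Sr\<^esub> a))"
  proof (rule slinI)
    fix f n assume fn: "f \<in> deg_ge (mon P) (dgr P) n"
    show "L (f \<otimes>\<^bsub>P.Sr\<^esub> a) \<in> fil R (n + (p + m))"
      using slinD(4)[OF L P.deg_ge_mult[OF fn p]] by (simp add: algebra_simps)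
  qed (use a L in \<open>simp_all add: slinD[OF L] P.Sr.l_distr P.sc_mult del: P.add_Sr\<close>)
  then show ?thesis by blast
qed

lemma slin_mult_left:
  assumes L: "slin P R m L" and x: "x \<in> carrier (alg R)"
  shows "\<exists>m'. slin P R m' (\<lambda>f. x \<otimes>\<^bsub>alg R\<^esub> L f)"
proof -
  obtain p where p: "x \<in> fil R p" using R.fil_exhaust[OF x] by blast
  have "slin P R (p + m) (\<lambda>f. x \<otimes>\<^bsub>alg R\<^esub> L f)"
  proof (rule slinI)
    fix f n assume fn: "f \<in> deg_ge (mon P) (dgr P) n"
    show "x \<otimes>\<^bsub>alg R\<^esub> L f \<in> fil R (n + (p + m))"
      using R.fil_mult[OF p slinD(4)[OF L fn]] by (simp add: algebra_simps)
  qed (use x L in \<open>simp_all add: slinD[OF L] R.A.r_distr R.smul_mult(2) del: P.add_Sr\<close>)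
  then show ?thesis by blast
qed

lemma slin_mult_right:
  assumes L: "slin P R m L" and x: "x \<in> carrier (alg R)"
  shows "\<exists>m'. slin P R m' (\<lambda>f. L f \<otimes>\<^bsub>alg R\<^esub> x)"
proof -
  obtain p where p: "x \<in> fil R p" using R.fil_exhaust[OF x] by blast
  have "slin P R (p + m) (\<lambda>f. L f \<otimes>\<^bsub>alg R\<^esub> x)"
  proof (rule slinI)
    fix f n assume fn: "f \<in> deg_ge (mon P) (dgr P) n"
    show "L f \<otimes>\<^bsub>alg R\<^esub> x \<in> fil R (n + (p + m))"
      using R.fil_mult[OF slinD(4)[OF L fn] p] by (simp add: algebra_simps)
  qed (use x L in \<open>simp_all add: slinD[OF L] R.A.l_distr R.smul_mult(1) del: P.add_Sr\<close>)
  then show ?thesis by blast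
qed

lemma slin_zero: "slin P R 0 (\<lambda>f. \<zero>\<^bsub>alg R\<^esub>)"
  by (rule slinI) (simp_all add: R.smul_0 R.fil_zero)

text \<open>L is merely linear, but the f with L (a f b) = 0 for all a and b form an ideal, and
  continuity of L makes it closed. It therefore contains the closed ideal generated by S.\<close>

lemma slin_kill:
  assumes L: "slin P R m L" and S: "S \<subseteq> carrier P.Sr" "rel_ideal P = closed_ideal_gen (mon P) (dgr P) S"
    and 0: "\<And>s a b. \<lbrakk>s \<in> S; a \<in> carrier P.Sr; b \<in> carrier P.Sr\<rbrakk> \<Longrightarrow> L (a \<otimes>\<^bsub>P.Sr\<^esub> s \<otimes>\<^bsub>P.Sr\<^esub> b) = \<zero>\<^bsub>alg R\<^esub>"
    and f: "f \<in> rel_ideal P"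
  shows "L f = \<zero>\<^bsub>alg R\<^esub>"
proof -
  let ?J = "{f \<in> carrier P.Sr. \<forall>a\<in>carrier P.Sr. \<forall>b\<in>carrier P.Sr. L (a \<otimes>\<^bsub>P.Sr\<^esub> f \<otimes>\<^bsub>P.Sr\<^esub> b) = \<zero>\<^bsub>alg R\<^esub>}"
  note [simp del] = P.add_Sr P.zero_Sr
  have L0: "L \<zero>\<^bsub>P.Sr\<^esub> = \<zero>\<^bsub>alg R\<^esub>" using slinD(6)[OF L] by (simp add: P.zero_Sr)
  have "ideal ?J P.Sr"
  proof (rule idealI[OF P.ring_Sr])
    have "additive_subgroup ?J P.Sr"
    proof (rule additive_subgroup.intro, rule subgroup.intro)
      show "inv\<^bsub>add_monoid P.Sr\<^esub> x \<in> ?J" if "x \<in> ?J" for x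
      proof -
        have x: "x \<in> carrier P.Sr" using that by simp
        have "inv\<^bsub>add_monoid P.Sr\<^esub> x = sc (-1) x"
          using P.uminus_Sr[OF x] by (simp add: a_inv_def sc_def)
        then show ?thesis
          using that x by (simp add: P.sc_closed P.sc_mult slinD(3)[OF L] R.smul_0)
      qed
    qed (auto simp: P.Sr.r_distr P.Sr.l_distr slinD(2)[OF L] L0)
    then show "subgroup ?J (add_monoid P.Sr)" by (rule additive_subgroup.a_subgroup)
  next
    fix a x assume a: "a \<in> ?J" and x: "x \<in> carrier P.Sr"
    show "x \<otimes>\<^bsub>P.Sr\<^esub> a \<in> ?J"
    proof (intro CollectI conjI ballI)
      fix c b assume cb: "c \<in> carrier P.Sr" "b \<in> carrier P.Sr"
      have "c \<otimes>\<^bsub>P.Sr\<^esub> (x \<otimes>\<^bsub>P.Sr\<^esub> a) \<otimes>\<^bsub>P.Sr\<^esub> b = (c \<otimes>\<^bsub>P.Sr\<^esub> x) \<otimes>\<^bsub>P.Sr\<^esub> a \<otimes>\<^bsub>P.Sr\<^esub> b"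
        using a x cb by (simp add: P.Sr.m_assoc)
      then show "L (c \<otimes>\<^bsub>P.Sr\<^esub> (x \<otimes>\<^bsub>P.Sr\<^esub> a) \<otimes>\<^bsub>P.Sr\<^esub> b) = \<zero>\<^bsub>alg R\<^esub>"
        using a x cb by simp
    qed (use a x in simp)
    show "a \<otimes>\<^bsub>P.Sr\<^esub> x \<in> ?J"
    proof (intro CollectI conjI ballI)
      fix c b assume cb: "c \<in> carrier P.Sr" "b \<in> carrier P.Sr"
      have "c \<otimes>\<^bsub>P.Sr\<^esub> (a \<otimes>\<^bsub>P.Sr\<^esub> x) \<otimes>\<^bsub>P.Sr\<^esub> b = c \<otimes>\<^bsub>P.Sr\<^esub> a \<otimes>\<^bsub>P.Sr\<^esub> (x \<otimes>\<^bsub>P.Sr\<^esub> b)"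
        using a x cb by (simp add: P.Sr.m_assoc)
      then show "L (c \<otimes>\<^bsub>P.Sr\<^esub> (a \<otimes>\<^bsub>P.Sr\<^esub> x) \<otimes>\<^bsub>P.Sr\<^esub> b) = \<zero>\<^bsub>alg R\<^esub>"
        using a x cb by simp
    qed (use a x in simp)
  qed
  moreover have "closed_set (mon P) (dgr P) ?J"
    unfolding closed_set_def
  proof (intro ballI impI)
    fix f assume f: "f \<in> carrier P.Sr" and lim: "\<forall>n. \<exists>g\<in>?J. f \<ominus>\<^bsub>P.Sr\<^esub> g \<in> deg_ge (mon P) (dgr P) n"
    have "L (a \<otimes>\<^bsub>P.Sr\<^esub> f \<otimes>\<^bsub>P.Sr\<^esub> b) = \<zero>\<^bsub>alg R\<^esub>" if ab: "a \<in> carrier P.Sr" "b \<in> carrier P.Sr" for a b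
    proof (rule R.hausdorff)
      fix n
      obtain p q where p: "a \<in> deg_ge (mon P) (dgr P) p" and q: "b \<in> deg_ge (mon P) (dgr P) q"
        using P.series_deg ab by blast
      obtain g where g: "g \<in> ?J" and fg: "f \<ominus>\<^bsub>P.Sr\<^esub> g \<in> deg_ge (mon P) (dgr P) (n - p - q - m)"
        using lim by blast
      have "a \<otimes>\<^bsub>P.Sr\<^esub> f \<otimes>\<^bsub>P.Sr\<^esub> b = (a \<otimes>\<^bsub>P.Sr\<^esub> (f \<ominus>\<^bsub>P.Sr\<^esub> g) \<otimes>\<^bsub>P.Sr\<^esub> b) \<oplus>\<^bsub>P.Sr\<^esub> (a \<otimes>\<^bsub>P.Sr\<^esub> g \<otimes>\<^bsub>P.Sr\<^esub> b)"
        using ab f g by (subst P.Sr.l_distr[symmetric]; simp add: P.Sr.r_distr[symmetric])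
          (simp add: P.Sr.minus_eq P.Sr.a_assoc P.Sr.l_neg)
      then have "L (a \<otimes>\<^bsub>P.Sr\<^esub> f \<otimes>\<^bsub>P.Sr\<^esub> b) = L (a \<otimes>\<^bsub>P.Sr\<^esub> (f \<ominus>\<^bsub>P.Sr\<^esub> g) \<otimes>\<^bsub>P.Sr\<^esub> b)"
        using ab f g by (simp add: slinD(1,2)[OF L])
      also have "\<dots> \<in> fil R n"
        using slinD(4)[OF L P.deg_ge_mult[OF P.deg_ge_mult[OF p fg] q]] by (simp add: algebra_simps)
      finally show "L (a \<otimes>\<^bsub>P.Sr\<^esub> f \<otimes>\<^bsub>P.Sr\<^esub> b) \<in> fil R n" .
    qed
    then show "f \<in> ?J" using f by blast
  qed
  moreover have "S \<subseteq> ?J" using S(1) 0 by blast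
  ultimately have "f \<in> ?J"
    using P.closed_ideal_gen_props(4)[OF S(1), of ?J] f S(2) by blast
  then have "L (\<one>\<^bsub>P.Sr\<^esub> \<otimes>\<^bsub>P.Sr\<^esub> f \<otimes>\<^bsub>P.Sr\<^esub> \<one>\<^bsub>P.Sr\<^esub>) = \<zero>\<^bsub>alg R\<^esub>" and "f \<in> carrier P.Sr"
    by (blast intro: P.Sr.one_closed, blast)
  then show ?thesis by simp
qed

text \<open>With one factor a monoid element, both sides are continuous in the other factor; a
  second extension frees the first factor.\<close>

lemma slin_hom:
  assumes L: "slin P R m L" and one: "L (P.delta \<one>\<^bsub>mon P\<^esub>) = \<one>\<^bsub>alg R\<^esub>"
    and mult: "\<And>u v. u \<in> carrier (mon P) \<Longrightarrow> v \<in> carrier (mon P) \<Longrightarrow>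
      L (P.delta (u \<otimes>\<^bsub>mon P\<^esub> v)) = L (P.delta u) \<otimes>\<^bsub>alg R\<^esub> L (P.delta v)"
  shows "L \<in> ring_hom P.Sr (alg R)"
proof (rule ring_hom_memI)
  show "L f \<in> carrier (alg R)" if "f \<in> carrier P.Sr" for f using slinD(1)[OF L that] .
  show "L (f \<oplus>\<^bsub>P.Sr\<^esub> g) = L f \<oplus>\<^bsub>alg R\<^esub> L g" if "f \<in> carrier P.Sr" "g \<in> carrier P.Sr" for f g
    using slinD(2)[OF L that] .
  show "L \<one>\<^bsub>P.Sr\<^esub> = \<one>\<^bsub>alg R\<^esub>" using one by (simp add: P.one_delta)
  have 1: "L (P.delta u \<otimes>\<^bsub>P.Sr\<^esub> g) = L (P.delta u) \<otimes>\<^bsub>alg R\<^esub> L g" if u: "u \<in> carrier (mon P)" and g: "g \<in> carrier P.Sr" for u g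
  proof -
    obtain m1 m2 where "slin P R m1 (\<lambda>g. L (P.delta u \<otimes>\<^bsub>P.Sr\<^esub> g))" "slin P R m2 (\<lambda>g. L (P.delta u) \<otimes>\<^bsub>alg R\<^esub> L g)"
      using slin_lmult[OF L] slin_mult_left[OF L] slinD(1)[OF L] u P.delta_closed by meson
    then show ?thesis
      by (rule slin_unique) (use mult u g in \<open>simp_all add: P.delta_mult\<close>)
  qed
  show "L (f \<otimes>\<^bsub>P.Sr\<^esub> g) = L f \<otimes>\<^bsub>alg R\<^esub> L g" if f: "f \<in> carrier P.Sr" and g: "g \<in> carrier P.Sr" for f g
  proof -
    obtain m1 m2 where "slin P R m1 (\<lambda>f. L (f \<otimes>\<^bsub>P.Sr\<^esub> g))" "slin P R m2 (\<lambda>f. L f \<otimes>\<^bsub>alg R\<^esub> L g)"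
      using slin_rmult[OF L g] slin_mult_right[OF L slinD(1)[OF L g]] by blast
    then show ?thesis
      by (rule slin_unique) (use 1 f g in simp_all)
  qed
qed

lemma filtered_linear_unique:
  assumes k: "filtered_linear P R k1" "filtered_linear P R k2"
    and eq: "\<And>u. u \<in> carrier (mon P) \<Longrightarrow> k1 (cls P (P.delta u)) = k2 (cls P (P.delta u))"
    and x: "x \<in> carrier (alg P)"
  shows "k1 x = k2 x"
proof -
  obtain f where f: "f \<in> carrier P.Sr" "x = cls P f" using x unfolding P.cls_surj by blast
  show ?thesis unfolding f(2)
    by (rule slin_unique[OF filtered_linear_slin[OF k(1)] filtered_linear_slin[OF k(2)] eq f(1)])
qed

text \<open>By density in each of the two outer factors, the condition of \<open>slin_kill\<close>
  need only be tested on monoid elements.\<close>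

lemma slin_kill_delta:
  assumes L: "slin P R m L" and S: "S \<subseteq> carrier P.Sr" "rel_ideal P = closed_ideal_gen (mon P) (dgr P) S"
    and 0: "\<And>s u v. \<lbrakk>s \<in> S; u \<in> carrier (mon P); v \<in> carrier (mon P)\<rbrakk> \<Longrightarrow>
      L (P.delta u \<otimes>\<^bsub>P.Sr\<^esub> s \<otimes>\<^bsub>P.Sr\<^esub> P.delta v) = \<zero>\<^bsub>alg R\<^esub>"
    and f: "f \<in> rel_ideal P"
  shows "L f = \<zero>\<^bsub>alg R\<^esub>"
proof (rule slin_kill[OF L S _ f])
  fix s a b assume s: "s \<in> S" and a: "a \<in> carrier P.Sr" and b: "b \<in> carrier P.Sr"
  have sc: "s \<in> carrier P.Sr" using s S(1) by blast
  have 1: "L (a \<otimes>\<^bsub>P.Sr\<^esub> (s \<otimes>\<^bsub>P.Sr\<^esub> P.delta v)) = \<zero>\<^bsub>alg R\<^esub>" if v: "v \<in> carrier (mon P)" for v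
  proof -
    obtain m' where "slin P R m' (\<lambda>f. L (f \<otimes>\<^bsub>P.Sr\<^esub> (s \<otimes>\<^bsub>P.Sr\<^esub> P.delta v)))"
      using slin_rmult[OF L, of "s \<otimes>\<^bsub>P.Sr\<^esub> P.delta v"] sc v by auto
    then show ?thesis
    proof (rule slin_unique[OF _ slin_zero _ a])
      fix u assume u: "u \<in> carrier (mon P)"
      show "L (P.delta u \<otimes>\<^bsub>P.Sr\<^esub> (s \<otimes>\<^bsub>P.Sr\<^esub> P.delta v)) = \<zero>\<^bsub>alg R\<^esub>"
        using 0[OF s u v] sc u v by (simp add: P.Sr.m_assoc)
    qed
  qed
  obtain m' where "slin P R m' (\<lambda>f. L ((a \<otimes>\<^bsub>P.Sr\<^esub> s) \<otimes>\<^bsub>P.Sr\<^esub> f))"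
    using slin_lmult[OF L, of "a \<otimes>\<^bsub>P.Sr\<^esub> s"] sc a by auto
  then show "L (a \<otimes>\<^bsub>P.Sr\<^esub> s \<otimes>\<^bsub>P.Sr\<^esub> b) = \<zero>\<^bsub>alg R\<^esub>"
  proof (rule slin_unique[OF _ slin_zero _ b])
    fix v assume v: "v \<in> carrier (mon P)"
    show "L (a \<otimes>\<^bsub>P.Sr\<^esub> s \<otimes>\<^bsub>P.Sr\<^esub> P.delta v) = \<zero>\<^bsub>alg R\<^esub>"
      using 1[OF v] sc a v by (simp add: P.Sr.m_assoc)
  qed
qed

end

lemma (in calgebra) hom_descend:
  assumes "(\<lambda>f. k (cls P f)) \<in> ring_hom Sr S" shows "k \<in> ring_hom (alg P) S"
proof (rule ring_hom_memI)
  show "k x \<in> carrier S" if "x \<in> carrier (alg P)" for x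
    using that ring_hom_closed[OF assms] by (auto simp: cls_surj)
  show "k (x \<otimes>\<^bsub>alg P\<^esub> y) = k x \<otimes>\<^bsub>S\<^esub> k y" "k (x \<oplus>\<^bsub>alg P\<^esub> y) = k x \<oplus>\<^bsub>S\<^esub> k y"
    if "x \<in> carrier (alg P)" "y \<in> carrier (alg P)" for x y
  proof -
    from that obtain f g where fg: "f \<in> carrier Sr" "g \<in> carrier Sr" "x = cls P f" "y = cls P g"
      unfolding cls_surj by blast
    show "k (x \<otimes>\<^bsub>alg P\<^esub> y) = k x \<otimes>\<^bsub>S\<^esub> k y"
      unfolding fg(3,4) using cls.hom_mult[OF fg(1,2)] ring_hom_mult[OF assms fg(1,2)] by simp
    show "k (x \<oplus>\<^bsub>alg P\<^esub> y) = k x \<oplus>\<^bsub>S\<^esub> k y"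
      unfolding fg(3,4) cls.hom_add[OF fg(1,2), symmetric] using ring_hom_add[OF assms fg(1,2)] .
  qed
  show "k \<one>\<^bsub>alg P\<^esub> = \<one>\<^bsub>S\<^esub>" using ring_hom_one[OF assms] by simp
qed

section \<open>Completed tensor products\<close>

lemma (in calgebra_pair) slin_antihom:
  assumes L: "slin P R m L" and one: "L (P.delta \<one>\<^bsub>mon P\<^esub>) = \<one>\<^bsub>alg R\<^esub>"
    and mult: "\<And>u v. u \<in> carrier (mon P) \<Longrightarrow> v \<in> carrier (mon P) \<Longrightarrow>
      L (P.delta (u \<otimes>\<^bsub>mon P\<^esub> v)) = L (P.delta v) \<otimes>\<^bsub>alg R\<^esub> L (P.delta u)"
  shows "L \<in> ring_hom P.Sr (opp (alg R))"
proof (rule ring_hom_memI)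
  show "L f \<in> carrier (opp (alg R))" if "f \<in> carrier P.Sr" for f using slinD(1)[OF L that] by simp
  show "L (f \<oplus>\<^bsub>P.Sr\<^esub> g) = L f \<oplus>\<^bsub>opp (alg R)\<^esub> L g" if "f \<in> carrier P.Sr" "g \<in> carrier P.Sr" for f g
    using slinD(2)[OF L that] by simp
  show "L \<one>\<^bsub>P.Sr\<^esub> = \<one>\<^bsub>opp (alg R)\<^esub>" using one by (simp add: P.one_delta)
  have 1: "L (P.delta u \<otimes>\<^bsub>P.Sr\<^esub> g) = L g \<otimes>\<^bsub>alg R\<^esub> L (P.delta u)" if u: "u \<in> carrier (mon P)" and g: "g \<in> carrier P.Sr" for u g
  proof -
    obtain m1 m2 where "slin P R m1 (\<lambda>g. L (P.delta u \<otimes>\<^bsub>P.Sr\<^esub> g))" "slin P R m2 (\<lambda>g. L g \<otimes>\<^bsub>alg R\<^esub> L (P.delta u))"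
      using slin_lmult[OF L] slin_mult_right[OF L] slinD(1)[OF L] u P.delta_closed by meson
    then show ?thesis
      by (rule slin_unique) (use mult u g in \<open>simp_all add: P.delta_mult\<close>)
  qed
  show "L (f \<otimes>\<^bsub>P.Sr\<^esub> g) = L f \<otimes>\<^bsub>opp (alg R)\<^esub> L g" if f: "f \<in> carrier P.Sr" and g: "g \<in> carrier P.Sr" for f g
  proof -
    obtain m1 m2 where "slin P R m1 (\<lambda>f. L (f \<otimes>\<^bsub>P.Sr\<^esub> g))" "slin P R m2 (\<lambda>f. L g \<otimes>\<^bsub>alg R\<^esub> L f)"
      using slin_rmult[OF L g] slin_mult_left[OF L slinD(1)[OF L g]] by blast
    then have "L (f \<otimes>\<^bsub>P.Sr\<^esub> g) = L g \<otimes>\<^bsub>alg R\<^esub> L f"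
      by (rule slin_unique) (use 1 f g in simp_all)
    then show ?thesis by simp
  qed
qed

lemma (in graded_monoid) calgebra_closed_ideal_gen:
  assumes "S \<subseteq> carrier Sr"
  shows "calgebra \<lparr>mon = M, dgr = d, rel_ideal = closed_ideal_gen M d S\<rparr>"
  using closed_ideal_gen_props(1,2)[OF assms] graded_monoid_axioms
  by (intro calgebra.intro calgebra_axioms.intro) (simp_all add: cover_def)

lemma (in calgebra) coset_cls:
  assumes f: "f \<in> carrier Sr"
  shows "f \<in> cls P f" "f' \<in> cls P f \<Longrightarrow> f' \<in> carrier Sr \<and> cls P f' = cls P f"
proof -
  interpret I: ideal "rel_ideal P" Sr by (rule ideal_Sr)
  show "f \<in> cls P f" using I.a_rcos_self[OF f] by (simp add: cls_def cover)
  show "f' \<in> carrier Sr \<and> cls P f' = cls P f" if "f' \<in> cls P f"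
  proof -
    have "\<exists>i\<in>rel_ideal P. f' = i \<oplus>\<^bsub>Sr\<^esub> f"
      using that by (simp add: cls_def cover a_r_coset_def' del: add_Sr)
    then obtain i where i: "i \<in> rel_ideal P" and f': "f' = i \<oplus>\<^bsub>Sr\<^esub> f" by (elim bexE)
    have ic: "i \<in> carrier Sr" by (rule rel_sub[OF i])
    have i0: "cls P i = \<zero>\<^bsub>alg P\<^esub>" using cls_0_iff[OF ic] i by (rule iffD2)
    have "cls P f' = cls P f"
      unfolding f' cls.hom_add[OF ic f] i0 by (rule A.l_zero[OF cls.hom_closed[OF f]])
    then show ?thesis using Sr.a_closed[OF ic f] unfolding f' by (rule conjI[rotated])
  qed
qed

locale calgebra_tensor = P: calgebra P + Q: calgebra Q for P :: "'m calg" and Q :: "'n calg"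
begin

lemma tensor_simps:
  "mon (P \<boxtimes> Q) = mon P \<times>\<times> mon Q" "dgr (P \<boxtimes> Q) = (\<lambda>(u, v). dgr P u + dgr Q v)"
  "rel_ideal (P \<boxtimes> Q) = closed_ideal_gen (mon (P \<boxtimes> Q)) (dgr (P \<boxtimes> Q))
     ((\<lambda>f. tprod f \<one>\<^bsub>Q.Sr\<^esub>) ` rel_ideal P \<union> (\<lambda>g. tprod \<one>\<^bsub>P.Sr\<^esub> g) ` rel_ideal Q)"
  by (simp_all add: ctensor_def Let_def P.cover Q.cover)

lemma tensor_carrier [simp]: "(u, v) \<in> carrier (mon (P \<boxtimes> Q)) \<longleftrightarrow> u \<in> carrier (mon P) \<and> v \<in> carrier (mon Q)"
  and tensor_mult [simp]: "(u, v) \<otimes>\<^bsub>mon (P \<boxtimes> Q)\<^esub> (u', v') = (u \<otimes>\<^bsub>mon P\<^esub> u', v \<otimes>\<^bsub>mon Q\<^esub> v')"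
  and tensor_one: "\<one>\<^bsub>mon (P \<boxtimes> Q)\<^esub> = (\<one>\<^bsub>mon P\<^esub>, \<one>\<^bsub>mon Q\<^esub>)"
  and tensor_dgr [simp]: "dgr (P \<boxtimes> Q) (u, v) = dgr P u + dgr Q v"
  by (simp_all add: tensor_simps DirProd_def)

lemma graded_tensor: "graded_monoid (mon (P \<boxtimes> Q)) (dgr (P \<boxtimes> Q))"
proof (intro graded_monoid.intro graded_monoid_axioms.intro)
  show "monoid (mon (P \<boxtimes> Q))"
    unfolding tensor_simps(1) by (intro DirProd_monoid P.monoid_axioms Q.monoid_axioms)
  fix p q assume "p \<in> carrier (mon (P \<boxtimes> Q))" "q \<in> carrier (mon (P \<boxtimes> Q))"
  then show "dgr (P \<boxtimes> Q) (p \<otimes>\<^bsub>mon (P \<boxtimes> Q)\<^esub> q) = dgr (P \<boxtimes> Q) p + dgr (P \<boxtimes> Q) q"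
    by (cases p; cases q) (simp add: P.deg_mult Q.deg_mult)
qed

lemma tprod_closed:
  assumes f: "f \<in> carrier P.Sr" and g: "g \<in> carrier Q.Sr"
  shows "tprod f g \<in> carrier (series_ring (mon (P \<boxtimes> Q)) (dgr (P \<boxtimes> Q)))"
proof -
  obtain a b where a: "\<And>w. f w \<noteq> 0 \<Longrightarrow> a \<le> dgr P w" and b: "\<And>w. g w \<noteq> 0 \<Longrightarrow> b \<le> dgr Q w"
    using P.series_bound[OF f] Q.series_bound[OF g] by metis
  have fin: "finite {w. tprod f g w \<noteq> 0 \<and> dgr (P \<boxtimes> Q) w \<le> n}" for n
  proof (rule finite_subset)
    show "{w. tprod f g w \<noteq> 0 \<and> dgr (P \<boxtimes> Q) w \<le> n} \<subseteq>
        {u. f u \<noteq> 0 \<and> dgr P u \<le> n - b} \<times> {v. g v \<noteq> 0 \<and> dgr Q v \<le> n - a}"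
      using a b by (fastforce simp: tprod_def)
    show "finite ({u. f u \<noteq> 0 \<and> dgr P u \<le> n - b} \<times> {v. g v \<noteq> 0 \<and> dgr Q v \<le> n - a})"
      using f g by (simp add: P.series_iff Q.series_iff)
  qed
  have "w \<in> carrier (mon (P \<boxtimes> Q))" if "tprod f g w \<noteq> 0" for w
    using that f g by (cases w) (simp add: tprod_def P.series_iff Q.series_iff)
  with fin show ?thesis
    by (simp add: graded_monoid.series_iff[OF graded_tensor])
qed

lemma tensor_gens_closed:
  "(\<lambda>f. tprod f \<one>\<^bsub>Q.Sr\<^esub>) ` rel_ideal P \<union> tprod \<one>\<^bsub>P.Sr\<^esub> ` rel_ideal Q
    \<subseteq> carrier (series_ring (mon (P \<boxtimes> Q)) (dgr (P \<boxtimes> Q)))"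
  using tprod_closed[OF P.rel_sub Q.Sr.one_closed] tprod_closed[OF P.Sr.one_closed Q.rel_sub] by blast

lemma calgebra_tensor: "calgebra (P \<boxtimes> Q)"
proof -
  have "calgebra \<lparr>mon = mon (P \<boxtimes> Q), dgr = dgr (P \<boxtimes> Q), rel_ideal = rel_ideal (P \<boxtimes> Q)\<rparr>"
    unfolding tensor_simps(3)
    by (rule graded_monoid.calgebra_closed_ideal_gen[OF graded_tensor tensor_gens_closed])
  moreover have "\<lparr>mon = mon (P \<boxtimes> Q), dgr = dgr (P \<boxtimes> Q), rel_ideal = rel_ideal (P \<boxtimes> Q)\<rparr> = P \<boxtimes> Q"
    by (simp add: ctensor_def Let_def)
  ultimately show ?thesis by simp
qed

sublocale PQ: calgebra "P \<boxtimes> Q"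
  by (rule calgebra_tensor)

text \<open>A factorisation of (u, v) in the product monoid is a factorisation of u together with
  one of v, so the double sum is a product of sums.\<close>

lemma tprod_mult:
  assumes f: "f \<in> carrier P.Sr" "f' \<in> carrier P.Sr" and g: "g \<in> carrier Q.Sr" "g' \<in> carrier Q.Sr"
  shows "tprod f g \<otimes>\<^bsub>PQ.Sr\<^esub> tprod f' g' = tprod (f \<otimes>\<^bsub>P.Sr\<^esub> f') (g \<otimes>\<^bsub>Q.Sr\<^esub> g')"
proof
  fix w :: "'m \<times> 'n"
  obtain u v where w: "w = (u, v)" by (cases w)
  let ?Y = "P.factors f f' u \<times> Q.factors g g' v"
  let ?Z = "(\<lambda>((a, b), (c, d)). ((a, c), (b, d))) ` ?Y"
  have Z: "((a, c), (b, d)) \<in> ?Z \<longleftrightarrow> ((a, b), (c, d)) \<in> ?Y" for a b c d by force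
  have "(tprod f g \<otimes>\<^bsub>PQ.Sr\<^esub> tprod f' g') (u, v) = (\<Sum>(p, q)\<in>?Z. tprod f g p * tprod f' g' q)"
  proof (rule PQ.mult_Sr_superset)
    show "finite ?Z" using P.finite_factors[OF f] Q.finite_factors[OF g] by simp
    show "PQ.factors (tprod f g) (tprod f' g') (u, v) \<subseteq> ?Z"
      unfolding PQ.factors_def by (clarsimp simp: Z) (simp add: P.factors_def Q.factors_def tprod_def)
    show "p \<in> carrier (mon (P \<boxtimes> Q)) \<and> q \<in> carrier (mon (P \<boxtimes> Q)) \<and> p \<otimes>\<^bsub>mon (P \<boxtimes> Q)\<^esub> q = (u, v)"
      if "(p, q) \<in> ?Z" for p q
      using that by (auto simp: P.factors_def Q.factors_def)
  qed
  also have "\<dots> = (\<Sum>(x, y)\<in>?Y. (f (fst x) * f' (snd x)) * (g (fst y) * g' (snd y)))"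
    by (rule sum.reindex_bij_witness[of _ "\<lambda>((a, b), (c, d)). ((a, c), (b, d))" "\<lambda>((a, c), (b, d)). ((a, b), (c, d))"])
      (auto simp: Z tprod_def)
  also have "\<dots> = (f \<otimes>\<^bsub>P.Sr\<^esub> f') u * (g \<otimes>\<^bsub>Q.Sr\<^esub> g') v"
    by (simp add: P.mult_Sr Q.mult_Sr sum_product sum.cartesian_product split_def)
  finally show "(tprod f g \<otimes>\<^bsub>PQ.Sr\<^esub> tprod f' g') w = tprod (f \<otimes>\<^bsub>P.Sr\<^esub> f') (g \<otimes>\<^bsub>Q.Sr\<^esub> g') w"
    by (simp add: w tprod_def)
qed

lemma tprod_delta: "tprod (P.delta u) (Q.delta v) = PQ.delta (u, v)"
  by (auto simp: tprod_def P.delta_def Q.delta_def PQ.delta_def)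

lemma tprod_linear:
  "tprod (f \<oplus>\<^bsub>P.Sr\<^esub> f') g = tprod f g \<oplus>\<^bsub>PQ.Sr\<^esub> tprod f' g"
  "tprod f (g \<oplus>\<^bsub>Q.Sr\<^esub> g') = tprod f g \<oplus>\<^bsub>PQ.Sr\<^esub> tprod f g'"
  "tprod (sc c f) g = sc c (tprod f g)" "tprod f (sc c g) = sc c (tprod f g)"
  by (auto simp: tprod_def sc_def algebra_simps)

lemma tprod_deg:
  "f \<in> deg_ge (mon P) (dgr P) m \<Longrightarrow> g \<in> deg_ge (mon Q) (dgr Q) n \<Longrightarrow>
    tprod f g \<in> deg_ge (mon (P \<boxtimes> Q)) (dgr (P \<boxtimes> Q)) (m + n)"
  using tprod_closed[of f g] unfolding PQ.deg_ge_iff P.deg_ge_iff Q.deg_ge_iff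
  by (auto simp: tprod_def add_mono)

text \<open>Writing f (x) g as (f (x) 1)(1 (x) g) reduces the claim to a change of one factor
  against 1, and such a difference is a generator of the ideal.\<close>

lemma cls_tprod_cong:
  assumes f: "f \<in> carrier P.Sr" "f' \<in> carrier P.Sr" "cls P f' = cls P f"
    and g: "g \<in> carrier Q.Sr" "g' \<in> carrier Q.Sr" "cls Q g' = cls Q g"
  shows "cls (P \<boxtimes> Q) (tprod f' g') = cls (P \<boxtimes> Q) (tprod f g)"
proof -
  have rel: "tprod i \<one>\<^bsub>Q.Sr\<^esub> \<in> rel_ideal (P \<boxtimes> Q)" if "i \<in> rel_ideal P" for i
    using subsetD[OF PQ.closed_ideal_gen_props(3)[OF tensor_gens_closed]] that unfolding tensor_simps(3) by blast
  have rel': "tprod \<one>\<^bsub>P.Sr\<^esub> i \<in> rel_ideal (P \<boxtimes> Q)" if "i \<in> rel_ideal Q" for i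
    using subsetD[OF PQ.closed_ideal_gen_props(3)[OF tensor_gens_closed]] that unfolding tensor_simps(3) by blast
  have 1: "cls (P \<boxtimes> Q) (tprod f' \<one>\<^bsub>Q.Sr\<^esub>) = cls (P \<boxtimes> Q) (tprod f \<one>\<^bsub>Q.Sr\<^esub>)"
  proof -
    have "f' \<ominus>\<^bsub>P.Sr\<^esub> f \<in> rel_ideal P" using f P.cls_eq_iff by blast
    moreover have "tprod (f' \<ominus>\<^bsub>P.Sr\<^esub> f) \<one>\<^bsub>Q.Sr\<^esub> = tprod f' \<one>\<^bsub>Q.Sr\<^esub> \<ominus>\<^bsub>PQ.Sr\<^esub> tprod f \<one>\<^bsub>Q.Sr\<^esub>"
      using f by (simp add: PQ.minus_Sr P.minus_Sr tprod_closed) (auto simp: tprod_def algebra_simps)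
    ultimately show ?thesis
      using rel[of "f' \<ominus>\<^bsub>P.Sr\<^esub> f"] f by (subst PQ.cls_eq_iff) (simp_all add: tprod_closed)
  qed
  have 2: "cls (P \<boxtimes> Q) (tprod \<one>\<^bsub>P.Sr\<^esub> g') = cls (P \<boxtimes> Q) (tprod \<one>\<^bsub>P.Sr\<^esub> g)"
  proof -
    have "g' \<ominus>\<^bsub>Q.Sr\<^esub> g \<in> rel_ideal Q" using g Q.cls_eq_iff by blast
    moreover have "tprod \<one>\<^bsub>P.Sr\<^esub> (g' \<ominus>\<^bsub>Q.Sr\<^esub> g) = tprod \<one>\<^bsub>P.Sr\<^esub> g' \<ominus>\<^bsub>PQ.Sr\<^esub> tprod \<one>\<^bsub>P.Sr\<^esub> g"
      using g by (simp add: PQ.minus_Sr Q.minus_Sr tprod_closed) (auto simp: tprod_def algebra_simps)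
    ultimately show ?thesis
      using rel'[of "g' \<ominus>\<^bsub>Q.Sr\<^esub> g"] g by (subst PQ.cls_eq_iff) (simp_all add: tprod_closed)
  qed
  have e: "cls (P \<boxtimes> Q) (tprod a b) = cls (P \<boxtimes> Q) (tprod a \<one>\<^bsub>Q.Sr\<^esub>) \<otimes>\<^bsub>alg (P \<boxtimes> Q)\<^esub> cls (P \<boxtimes> Q) (tprod \<one>\<^bsub>P.Sr\<^esub> b)"
    if "a \<in> carrier P.Sr" "b \<in> carrier Q.Sr" for a b
    using that by (simp add: PQ.cls.hom_mult[symmetric] tprod_closed tprod_mult)
  show ?thesis unfolding e[OF f(1) g(1)] e[OF f(2) g(2)] 1 2 ..
qed

text \<open>All members of the union that defines \<open>tens\<close> are one and the same coset, so
  the union is this coset.\<close>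

lemma tens_cls:
  assumes f: "f \<in> carrier P.Sr" and g: "g \<in> carrier Q.Sr"
  shows "tens P Q (cls P f) (cls Q g) = cls (P \<boxtimes> Q) (tprod f g)"
proof -
  have "cls (P \<boxtimes> Q) (tprod f' g') = cls (P \<boxtimes> Q) (tprod f g)" if "f' \<in> cls P f" "g' \<in> cls Q g" for f' g'
    using P.coset_cls(2)[OF f that(1)] Q.coset_cls(2)[OF g that(2)] f g by (intro cls_tprod_cong) auto
  then have "tens P Q (cls P f) (cls Q g) = (\<Union>f'\<in>cls P f. \<Union>g'\<in>cls Q g. cls (P \<boxtimes> Q) (tprod f g))"
    unfolding tens_def by (intro SUP_cong refl) blast
  then show ?thesis using P.coset_cls(1)[OF f] Q.coset_cls(1)[OF g] by blast
qed

lemma tens_closed: "x \<in> carrier (alg P) \<Longrightarrow> y \<in> carrier (alg Q) \<Longrightarrow> tens P Q x y \<in> carrier (alg (P \<boxtimes> Q))"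
  by (auto simp: P.cls_surj Q.cls_surj tens_cls tprod_closed)

lemma tens_add:
  "x \<in> carrier (alg P) \<Longrightarrow> x' \<in> carrier (alg P) \<Longrightarrow> y \<in> carrier (alg Q) \<Longrightarrow>
    tens P Q (x \<oplus>\<^bsub>alg P\<^esub> x') y = tens P Q x y \<oplus>\<^bsub>alg (P \<boxtimes> Q)\<^esub> tens P Q x' y"
  "x \<in> carrier (alg P) \<Longrightarrow> y \<in> carrier (alg Q) \<Longrightarrow> y' \<in> carrier (alg Q) \<Longrightarrow>
    tens P Q x (y \<oplus>\<^bsub>alg Q\<^esub> y') = tens P Q x y \<oplus>\<^bsub>alg (P \<boxtimes> Q)\<^esub> tens P Q x y'"
proof -
  note [simp del] = P.add_Sr Q.add_Sr PQ.add_Sr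
  show "tens P Q (x \<oplus>\<^bsub>alg P\<^esub> x') y = tens P Q x y \<oplus>\<^bsub>alg (P \<boxtimes> Q)\<^esub> tens P Q x' y"
    if "x \<in> carrier (alg P)" "x' \<in> carrier (alg P)" "y \<in> carrier (alg Q)"
    using that by (auto simp: P.cls_surj Q.cls_surj tens_cls tprod_closed tprod_linear P.cls.hom_add[symmetric] simp del: P.cls.hom_add)
  show "tens P Q x (y \<oplus>\<^bsub>alg Q\<^esub> y') = tens P Q x y \<oplus>\<^bsub>alg (P \<boxtimes> Q)\<^esub> tens P Q x y'"
    if "x \<in> carrier (alg P)" "y \<in> carrier (alg Q)" "y' \<in> carrier (alg Q)"
    using that by (auto simp: P.cls_surj Q.cls_surj tens_cls tprod_closed tprod_linear Q.cls.hom_add[symmetric] simp del: Q.cls.hom_add)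
qed

lemma tens_smul:
  "x \<in> carrier (alg P) \<Longrightarrow> y \<in> carrier (alg Q) \<Longrightarrow> tens P Q (smul P c x) y = smul (P \<boxtimes> Q) c (tens P Q x y)"
  "x \<in> carrier (alg P) \<Longrightarrow> y \<in> carrier (alg Q) \<Longrightarrow> tens P Q x (smul Q c y) = smul (P \<boxtimes> Q) c (tens P Q x y)"
  by (auto simp: P.cls_surj Q.cls_surj tens_cls tprod_closed tprod_linear P.smul_cls Q.smul_cls PQ.smul_cls P.sc_closed Q.sc_closed)

lemma tens_mult:
  assumes "x \<in> carrier (alg P)" "x' \<in> carrier (alg P)" "y \<in> carrier (alg Q)" "y' \<in> carrier (alg Q)"
  shows "tens P Q x y \<otimes>\<^bsub>alg (P \<boxtimes> Q)\<^esub> tens P Q x' y' = tens P Q (x \<otimes>\<^bsub>alg P\<^esub> x') (y \<otimes>\<^bsub>alg Q\<^esub> y')"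
proof -
  obtain f f' g g' where f: "f \<in> carrier P.Sr" "f' \<in> carrier P.Sr" "x = cls P f" "x' = cls P f'"
    and g: "g \<in> carrier Q.Sr" "g' \<in> carrier Q.Sr" "y = cls Q g" "y' = cls Q g'"
    using assms unfolding P.cls_surj Q.cls_surj by blast
  have "cls (P \<boxtimes> Q) (tprod f g) \<otimes>\<^bsub>alg (P \<boxtimes> Q)\<^esub> cls (P \<boxtimes> Q) (tprod f' g')
      = cls (P \<boxtimes> Q) (tprod (f \<otimes>\<^bsub>P.Sr\<^esub> f') (g \<otimes>\<^bsub>Q.Sr\<^esub> g'))"
    using f g by (simp add: PQ.cls.hom_mult[symmetric] tprod_closed tprod_mult del: PQ.cls.hom_mult)
  also have "\<dots> = tens P Q (cls P (f \<otimes>\<^bsub>P.Sr\<^esub> f')) (cls Q (g \<otimes>\<^bsub>Q.Sr\<^esub> g'))"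
    using f g by (simp only: tens_cls P.Sr.m_closed Q.Sr.m_closed)
  finally show ?thesis
    using f g by (simp add: tens_cls)
qed

lemma tens_one: "tens P Q \<one>\<^bsub>alg P\<^esub> \<one>\<^bsub>alg Q\<^esub> = \<one>\<^bsub>alg (P \<boxtimes> Q)\<^esub>"
proof -
  have "tens P Q (cls P \<one>\<^bsub>P.Sr\<^esub>) (cls Q \<one>\<^bsub>Q.Sr\<^esub>) = cls (P \<boxtimes> Q) \<one>\<^bsub>PQ.Sr\<^esub>"
    using P.delta_closed[OF P.one_closed] Q.delta_closed[OF Q.one_closed]
    unfolding P.one_delta Q.one_delta PQ.one_delta tensor_one by (simp add: tens_cls tprod_delta)
  then show ?thesis by simp
qed

lemma tens_fil: "x \<in> fil P m \<Longrightarrow> y \<in> fil Q n \<Longrightarrow> tens P Q x y \<in> fil (P \<boxtimes> Q) (m + n)"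
  by (auto simp: P.fil_iff Q.fil_iff tens_cls P.deg_ge_carrier Q.deg_ge_carrier intro!: PQ.cls_fil tprod_deg)

lemma tens_delta: "u \<in> carrier (mon P) \<Longrightarrow> v \<in> carrier (mon Q) \<Longrightarrow>
    tens P Q (cls P (P.delta u)) (cls Q (Q.delta v)) = cls (P \<boxtimes> Q) (PQ.delta (u, v))"
  by (simp add: tens_cls tprod_delta)

lemma tens_hom:
  "(\<lambda>x. tens P Q x \<one>\<^bsub>alg Q\<^esub>) \<in> ring_hom (alg P) (alg (P \<boxtimes> Q))"
  "(\<lambda>y. tens P Q \<one>\<^bsub>alg P\<^esub> y) \<in> ring_hom (alg Q) (alg (P \<boxtimes> Q))"
  by (intro ring_hom_memI; simp add: tens_closed tens_mult tens_add tens_one)+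

lemma tens_filtered_linear:
  "filtered_linear P (P \<boxtimes> Q) (\<lambda>x. tens P Q x \<one>\<^bsub>alg Q\<^esub>)"
  "filtered_linear Q (P \<boxtimes> Q) (\<lambda>y. tens P Q \<one>\<^bsub>alg P\<^esub> y)"
  using tens_fil[OF _ Q.fil_one] tens_fil[OF P.fil_one]
  by (auto simp: filtered_linear_def tens_closed tens_add tens_smul)

definition bilinear :: "'p calg \<Rightarrow> ('m series set \<Rightarrow> 'n series set \<Rightarrow> 'p series set) \<Rightarrow> bool" where
  "bilinear R \<beta> \<longleftrightarrow>
    (\<forall>x\<in>carrier (alg P). \<forall>y\<in>carrier (alg Q). \<beta> x y \<in> carrier (alg R)) \<and>
    (\<forall>x\<in>carrier (alg P). \<forall>x'\<in>carrier (alg P). \<forall>y\<in>carrier (alg Q). \<beta> (x \<oplus>\<^bsub>alg P\<^esub> x') y = \<beta> x y \<oplus>\<^bsub>alg R\<^esub> \<beta> x' y) \<and>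
    (\<forall>x\<in>carrier (alg P). \<forall>y\<in>carrier (alg Q). \<forall>y'\<in>carrier (alg Q). \<beta> x (y \<oplus>\<^bsub>alg Q\<^esub> y') = \<beta> x y \<oplus>\<^bsub>alg R\<^esub> \<beta> x y') \<and>
    (\<forall>c. \<forall>x\<in>carrier (alg P). \<forall>y\<in>carrier (alg Q). \<beta> (smul P c x) y = smul R c (\<beta> x y) \<and> \<beta> x (smul Q c y) = smul R c (\<beta> x y)) \<and>
    (\<forall>m n. \<forall>x\<in>fil P m. \<forall>y\<in>fil Q n. \<beta> x y \<in> fil R (m + n))"

text \<open>Prescribe the values on pairs of monoid elements and extend by continuity. The extension
  agrees with \<beta> on all \<open>tprod f g\<close>, by density in each variable; it kills the
  ideal because \<beta> vanishes when one argument is zero.\<close>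

lemma induced_exists:
  assumes "calgebra R" and \<beta>: "bilinear R \<beta>"
  shows "\<exists>k. induced P Q R \<beta> k"
proof -
  interpret R: calgebra R by fact
  interpret T: calgebra_pair "P \<boxtimes> Q" R ..
  interpret TP: calgebra_pair P R ..
  interpret TQ: calgebra_pair Q R ..
  have \<beta>c: "\<And>x y. x \<in> carrier (alg P) \<Longrightarrow> y \<in> carrier (alg Q) \<Longrightarrow> \<beta> x y \<in> carrier (alg R)"
    and \<beta>l: "\<And>x x' y. x \<in> carrier (alg P) \<Longrightarrow> x' \<in> carrier (alg P) \<Longrightarrow> y \<in> carrier (alg Q) \<Longrightarrow> \<beta> (x \<oplus>\<^bsub>alg P\<^esub> x') y = \<beta> x y \<oplus>\<^bsub>alg R\<^esub> \<beta> x' y"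
    and \<beta>r: "\<And>x y y'. x \<in> carrier (alg P) \<Longrightarrow> y \<in> carrier (alg Q) \<Longrightarrow> y' \<in> carrier (alg Q) \<Longrightarrow> \<beta> x (y \<oplus>\<^bsub>alg Q\<^esub> y') = \<beta> x y \<oplus>\<^bsub>alg R\<^esub> \<beta> x y'"
    and \<beta>s: "\<And>c x y. x \<in> carrier (alg P) \<Longrightarrow> y \<in> carrier (alg Q) \<Longrightarrow> \<beta> (smul P c x) y = smul R c (\<beta> x y)"
      "\<And>c x y. x \<in> carrier (alg P) \<Longrightarrow> y \<in> carrier (alg Q) \<Longrightarrow> \<beta> x (smul Q c y) = smul R c (\<beta> x y)"
    and \<beta>f: "\<And>m n x y. x \<in> fil P m \<Longrightarrow> y \<in> fil Q n \<Longrightarrow> \<beta> x y \<in> fil R (m + n)"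
    using \<beta> unfolding bilinear_def by blast+
  have \<beta>0: "\<beta> \<zero>\<^bsub>alg P\<^esub> y = \<zero>\<^bsub>alg R\<^esub>" if "y \<in> carrier (alg Q)" for y
    using \<beta>l[OF P.A.zero_closed P.A.zero_closed that] \<beta>c[OF P.A.zero_closed that]
    by (metis P.A.l_zero P.A.zero_closed R.A.add.r_cancel_one')
  have \<beta>0': "\<beta> x \<zero>\<^bsub>alg Q\<^esub> = \<zero>\<^bsub>alg R\<^esub>" if "x \<in> carrier (alg P)" for x
    using \<beta>r[OF that Q.A.zero_closed Q.A.zero_closed] \<beta>c[OF that Q.A.zero_closed]
    by (metis Q.A.l_zero Q.A.zero_closed R.A.add.r_cancel_one')
  have "(\<lambda>(u, v). \<beta> (cls P (P.delta u)) (cls Q (Q.delta v))) w \<in> fil R (dgr (P \<boxtimes> Q) w)"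
    if "w \<in> carrier (mon (P \<boxtimes> Q))" for w
    using that by (cases w) (auto intro!: \<beta>f P.cls_fil Q.cls_fil P.delta_deg Q.delta_deg)
  from T.slin_ext[OF this] obtain L where L: "slin (P \<boxtimes> Q) R 0 L"
    and L\<delta>: "\<And>u v. u \<in> carrier (mon P) \<Longrightarrow> v \<in> carrier (mon Q) \<Longrightarrow>
      L (PQ.delta (u, v)) = \<beta> (cls P (P.delta u)) (cls Q (Q.delta v))"
    by fastforce
  note [simp del] = P.add_Sr Q.add_Sr PQ.add_Sr
  have Lg: "\<exists>m. slin P R m (\<lambda>f. L (tprod f g))" "\<exists>m. slin P R m (\<lambda>f. \<beta> (cls P f) (cls Q g))"
    if g: "g \<in> carrier Q.Sr" for g
  proof -
    obtain q where q: "g \<in> deg_ge (mon Q) (dgr Q) q" using Q.series_deg[OF g] by blast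
    have "slin P R q (\<lambda>f. L (tprod f g))"
    proof (rule TP.slinI)
      show "L (tprod f g) \<in> fil R (n + q)" if "f \<in> deg_ge (mon P) (dgr P) n" for f n
        using T.slinD(4)[OF L tprod_deg[OF that q]] by simp
    qed (use g in \<open>simp_all add: tprod_closed tprod_linear T.slinD[OF L]\<close>)
    then show "\<exists>m. slin P R m (\<lambda>f. L (tprod f g))" by blast
    have "slin P R q (\<lambda>f. \<beta> (cls P f) (cls Q g))"
    proof (rule TP.slinI)
      show "\<beta> (cls P f) (cls Q g) \<in> fil R (n + q)" if "f \<in> deg_ge (mon P) (dgr P) n" for f n
        using \<beta>f[OF P.cls_fil[OF that] Q.cls_fil[OF q]] by simp
    qed (use g in \<open>simp_all add: \<beta>c \<beta>l \<beta>s P.smul_cls[symmetric]\<close>)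
    then show "\<exists>m. slin P R m (\<lambda>f. \<beta> (cls P f) (cls Q g))" by blast
  qed
  have Lf: "\<exists>m. slin Q R m (\<lambda>g. L (tprod f g))" "\<exists>m. slin Q R m (\<lambda>g. \<beta> (cls P f) (cls Q g))"
    if f: "f \<in> carrier P.Sr" for f
  proof -
    obtain q where q: "f \<in> deg_ge (mon P) (dgr P) q" using P.series_deg[OF f] by blast
    have "slin Q R q (\<lambda>g. L (tprod f g))"
    proof (rule TQ.slinI)
      show "L (tprod f g) \<in> fil R (n + q)" if "g \<in> deg_ge (mon Q) (dgr Q) n" for g n
        using T.slinD(4)[OF L tprod_deg[OF q that]] by (simp add: add.commute)
    qed (use f in \<open>simp_all add: tprod_closed tprod_linear T.slinD[OF L]\<close>)
    then show "\<exists>m. slin Q R m (\<lambda>g. L (tprod f g))" by blast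
    have "slin Q R q (\<lambda>g. \<beta> (cls P f) (cls Q g))"
    proof (rule TQ.slinI)
      show "\<beta> (cls P f) (cls Q g) \<in> fil R (n + q)" if "g \<in> deg_ge (mon Q) (dgr Q) n" for g n
        using \<beta>f[OF P.cls_fil[OF q] Q.cls_fil[OF that]] by (simp add: add.commute)
    qed (use f in \<open>simp_all add: \<beta>c \<beta>r \<beta>s Q.smul_cls[symmetric]\<close>)
    then show "\<exists>m. slin Q R m (\<lambda>g. \<beta> (cls P f) (cls Q g))" by blast
  qed
  have 1: "L (tprod (P.delta u) g) = \<beta> (cls P (P.delta u)) (cls Q g)" if u: "u \<in> carrier (mon P)" and g: "g \<in> carrier Q.Sr" for u g
  proof -
    obtain m1 m2 where "slin Q R m1 (\<lambda>g. L (tprod (P.delta u) g))" "slin Q R m2 (\<lambda>g. \<beta> (cls P (P.delta u)) (cls Q g))"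
      using Lf[OF P.delta_closed[OF u]] by blast
    then show ?thesis by (rule TQ.slin_unique) (use u g in \<open>simp_all add: tprod_delta L\<delta>\<close>)
  qed
  have Lt: "L (tprod f g) = \<beta> (cls P f) (cls Q g)" if f: "f \<in> carrier P.Sr" and g: "g \<in> carrier Q.Sr" for f g
  proof -
    obtain m1 m2 where "slin P R m1 (\<lambda>f. L (tprod f g))" "slin P R m2 (\<lambda>f. \<beta> (cls P f) (cls Q g))"
      using Lg[OF g] by blast
    then show ?thesis by (rule TP.slin_unique) (use f g 1 in simp_all)
  qed
  have kill: "L f = \<zero>\<^bsub>alg R\<^esub>" if f: "f \<in> rel_ideal (P \<boxtimes> Q)" for f
  proof (rule T.slin_kill_delta[OF L _ tensor_simps(3) _ f])
    show "(\<lambda>f. tprod f \<one>\<^bsub>Q.Sr\<^esub>) ` rel_ideal P \<union> tprod \<one>\<^bsub>P.Sr\<^esub> ` rel_ideal Q \<subseteq> carrier PQ.Sr"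
      by (rule tensor_gens_closed)
    fix s p q assume s: "s \<in> (\<lambda>f. tprod f \<one>\<^bsub>Q.Sr\<^esub>) ` rel_ideal P \<union> tprod \<one>\<^bsub>P.Sr\<^esub> ` rel_ideal Q"
      and pq: "p \<in> carrier (mon (P \<boxtimes> Q))" "q \<in> carrier (mon (P \<boxtimes> Q))"
    obtain u v u' v' where uv: "p = (u, v)" "q = (u', v')" by (cases p; cases q) blast
    have c: "P.delta u \<in> carrier P.Sr" "P.delta u' \<in> carrier P.Sr" "Q.delta v \<in> carrier Q.Sr" "Q.delta v' \<in> carrier Q.Sr"
      using pq uv by simp_all
    have e: "L (PQ.delta p \<otimes>\<^bsub>PQ.Sr\<^esub> tprod a b \<otimes>\<^bsub>PQ.Sr\<^esub> PQ.delta q) =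
        \<beta> (cls P (P.delta u \<otimes>\<^bsub>P.Sr\<^esub> a \<otimes>\<^bsub>P.Sr\<^esub> P.delta u')) (cls Q (Q.delta v \<otimes>\<^bsub>Q.Sr\<^esub> b \<otimes>\<^bsub>Q.Sr\<^esub> Q.delta v'))"
      if "a \<in> carrier P.Sr" "b \<in> carrier Q.Sr" for a b
      unfolding uv tprod_delta[symmetric] using c that by (simp add: tprod_mult Lt)
    consider i where "i \<in> rel_ideal P" "s = tprod i \<one>\<^bsub>Q.Sr\<^esub>" | i where "i \<in> rel_ideal Q" "s = tprod \<one>\<^bsub>P.Sr\<^esub> i"
      using s by blast
    then show "L (PQ.delta p \<otimes>\<^bsub>PQ.Sr\<^esub> s \<otimes>\<^bsub>PQ.Sr\<^esub> PQ.delta q) = \<zero>\<^bsub>alg R\<^esub>"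
    proof cases
      case 1
      have i: "i \<in> carrier P.Sr" "cls P i = \<zero>\<^bsub>alg P\<^esub>"
        using P.rel_sub[OF 1(1)] P.cls_0_iff 1(1) by blast+
      show ?thesis unfolding 1(2) e[OF i(1) Q.Sr.one_closed] using c i by (simp add: \<beta>0)
    next
      case 2
      have i: "i \<in> carrier Q.Sr" "cls Q i = \<zero>\<^bsub>alg Q\<^esub>"
        using Q.rel_sub[OF 2(1)] Q.cls_0_iff 2(1) by blast+
      show ?thesis unfolding 2(2) e[OF P.Sr.one_closed i(1)] using c i by (simp add: \<beta>0')
    qed
  qed
  obtain k where k: "filtered_linear (P \<boxtimes> Q) R k" "\<And>f. f \<in> carrier PQ.Sr \<Longrightarrow> k (cls (P \<boxtimes> Q) f) = L f"
    using T.slin_descend[OF L kill] by blast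
  have "k (tens P Q x y) = \<beta> x y" if "x \<in> carrier (alg P)" "y \<in> carrier (alg Q)" for x y
    using that by (auto simp: P.cls_surj Q.cls_surj tens_cls k(2) tprod_closed Lt)
  then show ?thesis using k(1) unfolding induced_def by blast
qed

lemma induced_hom:
  assumes R: "calgebra R" and k: "induced P Q R \<beta> k" and one: "\<beta> \<one>\<^bsub>alg P\<^esub> \<one>\<^bsub>alg Q\<^esub> = \<one>\<^bsub>alg R\<^esub>"
    and mult: "\<And>x x' y y'. \<lbrakk>x \<in> carrier (alg P); x' \<in> carrier (alg P); y \<in> carrier (alg Q); y' \<in> carrier (alg Q)\<rbrakk> \<Longrightarrow>
      \<beta> (x \<otimes>\<^bsub>alg P\<^esub> x') (y \<otimes>\<^bsub>alg Q\<^esub> y') = \<beta> x y \<otimes>\<^bsub>alg R\<^esub> \<beta> x' y'"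
  shows "k \<in> ring_hom (alg (P \<boxtimes> Q)) (alg R)"
proof -
  interpret R: calgebra R by fact
  interpret T: calgebra_pair "P \<boxtimes> Q" R ..
  have fl: "filtered_linear (P \<boxtimes> Q) R k"
    and kt: "\<And>x y. x \<in> carrier (alg P) \<Longrightarrow> y \<in> carrier (alg Q) \<Longrightarrow> k (tens P Q x y) = \<beta> x y"
    using k unfolding induced_def by auto
  have kd: "k (cls (P \<boxtimes> Q) (PQ.delta (u, v))) = \<beta> (cls P (P.delta u)) (cls Q (Q.delta v))"
    if "u \<in> carrier (mon P)" "v \<in> carrier (mon Q)" for u v
    using that by (simp add: tens_delta[symmetric] kt)
  have "(\<lambda>f. k (cls (P \<boxtimes> Q) f)) \<in> ring_hom PQ.Sr (alg R)"
  proof (rule T.slin_hom[OF T.filtered_linear_slin[OF fl]])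
    show "k (cls (P \<boxtimes> Q) (PQ.delta \<one>\<^bsub>mon (P \<boxtimes> Q)\<^esub>)) = \<one>\<^bsub>alg R\<^esub>"
      unfolding tensor_one using one by (simp add: kd P.one_delta[symmetric] Q.one_delta[symmetric])
    fix p q assume pq: "p \<in> carrier (mon (P \<boxtimes> Q))" "q \<in> carrier (mon (P \<boxtimes> Q))"
    obtain u v u' v' where uv: "p = (u, v)" "q = (u', v')" by (cases p; cases q) blast
    have c: "u \<in> carrier (mon P)" "v \<in> carrier (mon Q)" "u' \<in> carrier (mon P)" "v' \<in> carrier (mon Q)"
      using pq uv by simp_all
    show "k (cls (P \<boxtimes> Q) (PQ.delta (p \<otimes>\<^bsub>mon (P \<boxtimes> Q)\<^esub> q))) =
        k (cls (P \<boxtimes> Q) (PQ.delta p)) \<otimes>\<^bsub>alg R\<^esub> k (cls (P \<boxtimes> Q) (PQ.delta q))"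
      unfolding uv tensor_mult using c
      by (simp add: kd mult[symmetric] P.delta_mult[symmetric] Q.delta_mult[symmetric])
  qed
  then show ?thesis by (rule PQ.hom_descend)
qed

end

section \<open>The completed free algebra and the binomial series\<close>

text \<open>Needed where the formulas for F_i lead to V although V^theta_i is wanted: the two differ
  only for theta_i = 0, and there the term contains this vanishing bracket.\<close>

lemma jrep_interior:
  assumes J: "jrep R \<iota> N h E F H T V" and i: "i \<in> {1..N-1}" "theta N i = 0"
  shows "\<lbrakk>F i, T\<rbrakk>\<^bsub>R\<^esub> = \<zero>\<^bsub>R\<^esub>"
proof -
  define S where "S = (R, \<iota>)"
  have S: "structure_ok S" and [simp]: "fst S = R" using J by (simp_all add: jrep_def S_def structure_ok_def)
  interpret A: jordan_rep jP N "\<lambda>i. lift S False (E i)" "\<lambda>i. lift S False (F i)" "\<lambda>i. lift S False (H i)" "lift S True T" "lift S True V" h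
    unfolding S_def by (rule jrep_lift) fact
  have c: "F i \<in> carrier R" "T \<in> carrier R" using J i by (auto simp: jrep_def)
  have "br (lift S False (F i)) (lift S True T) = 0"
    using A.FT[of i] A.G_0[OF i] by simp
  from arg_cong[OF this, of "pr S"] show ?thesis
    using lift_simps(2)[OF S] c by (simp add: pr_br[OF S] pr_simps[OF S])
qed

lemma relators_closed:
  assumes R: "ring R" and s: "\<And>c x. x \<in> carrier R \<Longrightarrow> s c x \<in> carrier R"
    and c: "\<And>i. i \<in> {1..N-1} \<Longrightarrow> E i \<in> carrier R \<and> F i \<in> carrier R \<and> H i \<in> carrier R"
      "T \<in> carrier R" "V \<in> carrier R"
  shows "jordanian_data.relators R s N E F H T V \<subseteq> carrier R"
proof -
  interpret ring R by fact
  have Hs: "(\<Oplus>\<^bsub>R\<^esub>k\<in>{1..N-1}. H k) \<in> carrier R"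
    using c by (intro finsum_closed) auto
  show ?thesis
    unfolding jordanian_data.relators_def jordanian_data.TF_def jordanian_data.H_sum_def
    by (intro UN_least Un_least) (use c Hs s R in \<open>auto simp: lie_closed lie_funpow_closed split: if_splits\<close>)
qed

lemma (in monoid) commute_mult:
  "\<lbrakk>z \<otimes> p = p \<otimes> z; z \<otimes> q = q \<otimes> z; z \<in> carrier G; p \<in> carrier G; q \<in> carrier G\<rbrakk> \<Longrightarrow> z \<otimes> (p \<otimes> q) = (p \<otimes> q) \<otimes> z"
  by (metis m_assoc)

lemma (in calgebra_pair) slin_eq_approx:
  assumes L1: "slin P R m1 L1" and L2: "slin P R m2 L2" and f: "f \<in> carrier P.Sr"
    and a: "\<And>n. \<exists>g\<in>carrier P.Sr. f \<ominus>\<^bsub>P.Sr\<^esub> g \<in> deg_ge (mon P) (dgr P) n \<and> L1 g = L2 g"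
  shows "L1 f = L2 f"
proof (rule R.eq_if_close)
  show c: "L1 f \<in> carrier (alg R)" "L2 f \<in> carrier (alg R)"
    using slinD(1) L1 L2 f by auto
  fix n
  obtain g where g: "g \<in> carrier P.Sr" and fg: "f \<ominus>\<^bsub>P.Sr\<^esub> g \<in> deg_ge (mon P) (dgr P) (n - min m1 m2)" and e: "L1 g = L2 g"
    using a by blast
  have "L1 f \<ominus>\<^bsub>alg R\<^esub> L1 g \<in> fil R n" "L2 f \<ominus>\<^bsub>alg R\<^esub> L2 g \<in> fil R n"
    using slinD(4)[OF L1 fg] slinD(4)[OF L2 fg] slinD(5)[OF L1 f g] slinD(5)[OF L2 f g]
    by (auto elim: R.fil_mono)
  then have "(L1 f \<ominus>\<^bsub>alg R\<^esub> L1 g) \<ominus>\<^bsub>alg R\<^esub> (L2 f \<ominus>\<^bsub>alg R\<^esub> L1 g) \<in> fil R n"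
    using R.fil_minus e by simp
  moreover have "(L1 f \<ominus>\<^bsub>alg R\<^esub> L1 g) \<ominus>\<^bsub>alg R\<^esub> (L2 f \<ominus>\<^bsub>alg R\<^esub> L1 g) = L1 f \<ominus>\<^bsub>alg R\<^esub> L2 f"
    using c slinD(1)[OF L1 g] by (intro R.A.minus_minus_cancel)
  ultimately show "L1 f \<ominus>\<^bsub>alg R\<^esub> L2 f \<in> fil R n" by simp
qed

locale jord_base =
  fixes N :: nat and h :: complex and P :: "letter list calg"
  assumes N3: "3 \<le> N" and P: "P = jordanian N h"
begin

definition "letters = (\<Union>i\<in>{1..N-1}. {GE i, GF i, GH i})"

lemma P_carrier: "carrier (mon P) = lists letters"
  and P_mult [simp]: "u \<otimes>\<^bsub>mon P\<^esub> v = u @ v" and P_one [simp]: "\<one>\<^bsub>mon P\<^esub> = []"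
  and dgr_Nil [simp]: "dgr P [] = 0" and dgr_Cons [simp]: "dgr P (g # w) = letter_deg g + dgr P w"
  by (simp_all add: P jordanian_def word_monoid_def letters_def word_deg_def)

lemma dgr_append [simp]: "dgr P (u @ v) = dgr P u + dgr P v"
  by (simp add: P jordanian_def word_deg_def)

lemma free_alg: "free_alg N = series_ring (mon P) (dgr P)"
  by (simp add: free_alg_def P jordanian_def)

sublocale W: graded_monoid "mon P" "dgr P"
  by unfold_locales (auto simp: P_carrier)

abbreviation (input) "lE i \<equiv> letter_series (GE i)"
abbreviation (input) "lF i \<equiv> letter_series (GF i)"
abbreviation (input) "lH i \<equiv> letter_series (GH i)"
abbreviation (input) "Xser \<equiv> X_series N"
abbreviation (input) "TT \<equiv> T_series N h"

lemma letter_delta: "letter_series g = W.delta [g]"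
  by (simp add: letter_series_def W.delta_def)

lemma letter_closed: "g \<in> letters \<Longrightarrow> letter_series g \<in> carrier W.Sr"
  by (simp add: letter_delta P_carrier)

lemma letters_mem: "i \<in> {1..N-1} \<Longrightarrow> GE i \<in> letters" "i \<in> {1..N-1} \<Longrightarrow> GF i \<in> letters" "i \<in> {1..N-1} \<Longrightarrow> GH i \<in> letters"
  by (auto simp: letters_def)

lemma X_eq: "Xser = XR W.Sr N lE"
  by (simp add: X_series_def XR_def free_alg)

lemma X_closed: "Xser \<in> carrier W.Sr"
  unfolding X_eq XR_def using N3 by (intro foldr_lie_closed W.ring_Sr) (auto intro!: letter_closed letters_mem)

text \<open>X is homogeneous for length and for degree at once, with equal values, as its words
  consist of letters E_i. Length limits the powers of X in which a word can occur; degree places the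
  binomial series in the completion.\<close>

definition homog :: "nat \<Rightarrow> letter list series \<Rightarrow> bool" where
  "homog n f \<longleftrightarrow> (\<forall>w. f w \<noteq> 0 \<longrightarrow> length w = n \<and> dgr P w = int n)"

lemma homog_mult: "homog m f \<Longrightarrow> homog n g \<Longrightarrow> homog (m + n) (f \<otimes>\<^bsub>W.Sr\<^esub> g)"
  unfolding homog_def by (auto elim!: W.mult_Sr_nonzero)

lemma homog_lie:
  assumes "homog m f" "homog n g" "f \<in> carrier W.Sr" "g \<in> carrier W.Sr"
  shows "homog (m + n) (\<lbrakk>f, g\<rbrakk>\<^bsub>W.Sr\<^esub>)"
  unfolding homog_def
proof (intro allI impI)
  fix w assume "\<lbrakk>f, g\<rbrakk>\<^bsub>W.Sr\<^esub> w \<noteq> 0"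
  then have "(f \<otimes>\<^bsub>W.Sr\<^esub> g) w \<noteq> 0 \<or> (g \<otimes>\<^bsub>W.Sr\<^esub> f) w \<noteq> 0"
    using assms(3,4) by (auto simp: lie_def W.minus_Sr)
  then show "length w = m + n \<and> dgr P w = int (m + n)"
    using homog_mult[OF assms(1,2)] homog_mult[OF assms(2,1)] unfolding homog_def by (auto simp: add.commute)
qed

lemma homog_X: "homog (N - 1) Xser"
proof -
  have "homog (length xs + 1) (foldr (lie W.Sr) (map lE xs) (lE (N-1)))" if "set xs \<subseteq> {1..N-1}" for xs
    using that
  proof (induction xs)
    case Nil
    then show ?case by (auto simp: homog_def letter_series_def)
  next
    case (Cons i xs)
    have "homog 1 (lE i)" by (auto simp: homog_def letter_series_def)
    moreover have "foldr (lie W.Sr) (map lE xs) (lE (N-1)) \<in> carrier W.Sr"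
      using Cons.prems N3 by (intro foldr_lie_closed W.ring_Sr) (auto intro!: letter_closed letters_mem)
    ultimately show ?case
      using homog_lie[of 1 "lE i" "length xs + 1"] Cons letter_closed[OF letters_mem(1), of i] by simp
  qed
  from this[of "[1..<N-1]"] have "homog (length [1..<N-1] + 1) Xser"
    unfolding X_series_def free_alg by fastforce
  moreover have "length [1..<N-1] + 1 = N - 1" using N3 by simp
  ultimately show ?thesis by metis
qed

lemma X_pow_closed: "Xser [^]\<^bsub>W.Sr\<^esub> (k::nat) \<in> carrier W.Sr"
  using X_closed by simp

lemma homog_Xser_pow: "homog (k * (N - 1)) (Xser [^]\<^bsub>W.Sr\<^esub> k)"
proof (induction k)
  case 0
  show ?case by (auto simp: homog_def W.one_Sr)
next
  case (Suc k)
  then show ?case using homog_mult[OF Suc homog_X] by (simp add: add.commute)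
qed

lemma X_pow_0: "length w < k \<Longrightarrow> (Xser [^]\<^bsub>W.Sr\<^esub> k) w = 0"
proof (rule ccontr)
  assume "length w < k" "(Xser [^]\<^bsub>W.Sr\<^esub> k) w \<noteq> 0"
  then have "k * (N - 1) < k" using homog_Xser_pow[of k] by (auto simp: homog_def)
  moreover have "k * 1 \<le> k * (N - 1)" using N3 by (intro mult_le_mono2) simp
  ultimately show False by simp
qed

lemma X_pow_nonzero: "(Xser [^]\<^bsub>W.Sr\<^esub> k) w \<noteq> 0 \<Longrightarrow> k \<le> length w"
  using X_pow_0[of w k] by linarith

definition Tc :: "complex \<Rightarrow> nat \<Rightarrow> complex" where "Tc a k = (a gchoose k) * (2 * h) ^ k"

text \<open>The cut-off may be any bound for the length, so coefficients of different words can
  share one range of summation.\<close>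

lemma T_sum: "length w \<le> M \<Longrightarrow> TT a w = (\<Sum>k\<le>M. Tc a k * (Xser [^]\<^bsub>W.Sr\<^esub> k) w)"
  unfolding T_series_def free_alg Tc_def
  by (intro sum.mono_neutral_left) (auto simp: X_pow_0)

lemma T_nonzero: assumes "TT a w \<noteq> 0" obtains k :: nat where "k \<le> length w" "(Xser [^]\<^bsub>W.Sr\<^esub> k) w \<noteq> 0" "dgr P w = int (length w)"
proof -
  obtain k where "k \<in> {..length w}" "Tc a k * (Xser [^]\<^bsub>W.Sr\<^esub> k) w \<noteq> 0"
    using assms unfolding T_sum[OF order_refl] by (rule sum.not_neutral_contains_not_neutral)
  then have "k \<le> length w" "(Xser [^]\<^bsub>W.Sr\<^esub> k) w \<noteq> 0" "dgr P w = int (length w)"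
    using homog_Xser_pow[of k] by (auto simp: homog_def)
  then show ?thesis by (rule that)
qed

text \<open>On the support the degree equals the length, so in degrees up to n only the powers of X
  up to n occur, and each of them has finitely many terms there.\<close>

lemma T_closed: "TT a \<in> carrier W.Sr"
  unfolding W.series_iff
proof (intro conjI allI impI)
  fix w assume "TT a w \<noteq> 0"
  then obtain k :: nat where "(Xser [^]\<^bsub>W.Sr\<^esub> k) w \<noteq> 0" by (elim T_nonzero) blast
  then show "w \<in> carrier (mon P)" using X_pow_closed[of k] unfolding W.series_iff by blast
next
  fix n
  have "{w. TT a w \<noteq> 0 \<and> dgr P w \<le> n} \<subseteq> (\<Union>k\<le>nat n. {w. (Xser [^]\<^bsub>W.Sr\<^esub> k) w \<noteq> 0 \<and> dgr P w \<le> n})"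
  proof
    fix w assume w: "w \<in> {w. TT a w \<noteq> 0 \<and> dgr P w \<le> n}"
    then have "TT a w \<noteq> 0" by blast
    then obtain k where "k \<le> length w" "(Xser [^]\<^bsub>W.Sr\<^esub> k) w \<noteq> 0" "dgr P w = int (length w)" by (rule T_nonzero)
    then show "w \<in> (\<Union>k\<le>nat n. {w. (Xser [^]\<^bsub>W.Sr\<^esub> k) w \<noteq> 0 \<and> dgr P w \<le> n})"
      using w by (intro UN_I[of k]) auto
  qed
  moreover have "finite {w. (Xser [^]\<^bsub>W.Sr\<^esub> k) w \<noteq> 0 \<and> dgr P w \<le> n}" for k :: nat
    using X_pow_closed[of k] unfolding W.series_iff by blast
  ultimately show "finite {w. TT a w \<noteq> 0 \<and> dgr P w \<le> n}"
    by (elim finite_subset) simp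
qed

definition "Tn a n = (\<lambda>w. \<Sum>k<n. Tc a k * (Xser [^]\<^bsub>W.Sr\<^esub> k) w)"

lemma Tn_Suc: "Tn a (Suc n) = Tn a n \<oplus>\<^bsub>W.Sr\<^esub> sc (Tc a n) (Xser [^]\<^bsub>W.Sr\<^esub> n)"
  by (simp add: Tn_def sc_def)

lemma Tn_0: "Tn a 0 = \<zero>\<^bsub>W.Sr\<^esub>" by (simp add: Tn_def)

lemma Tn_closed: "Tn a n \<in> carrier W.Sr"
proof (induction n)
  case (Suc n)
  then show ?case unfolding Tn_Suc by (intro W.Sr.a_closed W.sc_closed X_pow_closed)
qed (simp add: Tn_0 del: W.zero_Sr)

text \<open>The partial sum has the right coefficients at all words shorter than n, and on the
  support of the difference degree and length agree.\<close>

lemma T_approx: "TT a \<ominus>\<^bsub>W.Sr\<^esub> Tn a n \<in> deg_ge (mon P) (dgr P) (int n)"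
  unfolding W.deg_ge_iff
proof (intro conjI allI impI)
  show "TT a \<ominus>\<^bsub>W.Sr\<^esub> Tn a n \<in> carrier W.Sr" using T_closed Tn_closed by simp
  fix w assume nz: "(TT a \<ominus>\<^bsub>W.Sr\<^esub> Tn a n) w \<noteq> 0"
  then have ne: "TT a w \<noteq> Tn a n w" by (simp add: W.minus_Sr T_closed Tn_closed)
  then have "\<exists>k::nat. (Xser [^]\<^bsub>W.Sr\<^esub> k) w \<noteq> 0"
    unfolding Tn_def T_sum[OF order_refl] by (rule_tac ccontr) simp
  then have d: "dgr P w = int (length w)" using homog_Xser_pow by (auto simp: homog_def)
  have "\<not> length w < n"
  proof
    assume lt: "length w < n"
    then obtain M where M: "n = Suc M" by (cases n) auto
    with lt have "TT a w = (\<Sum>k\<le>M. Tc a k * (Xser [^]\<^bsub>W.Sr\<^esub> k) w)" by (intro T_sum) simp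
    then show False using ne by (simp add: Tn_def M lessThan_Suc_atMost)
  qed
  then show "int n \<le> dgr P w" using d by simp
qed

text \<open>The exponent law of the binomial series, by Vandermonde's convolution. It supplies both
  the inverse and the square of T.\<close>

lemma T_mult: "TT a \<otimes>\<^bsub>W.Sr\<^esub> TT b = TT (a + b)"
proof
  fix w
  show "(TT a \<otimes>\<^bsub>W.Sr\<^esub> TT b) w = TT (a + b) w"
  proof (cases "w \<in> carrier (mon P)")
    case False
    then show ?thesis using T_closed[of "a + b"] W.mult_Sr_closed[OF T_closed T_closed, of a b] unfolding W.series_iff by metis
  next
    case w: True
    let ?L = "length w"
    let ?Z = "(\<lambda>i. (take i w, drop i w)) ` {..?L}"
    let ?Xser = "\<lambda>k. Xser [^]\<^bsub>W.Sr\<^esub> (k::nat)"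
    \<comment> \<open>In the word monoid all factorisations of w are cuts of w, so one index set
      serves every product.\<close>
    have Z: "(f \<otimes>\<^bsub>W.Sr\<^esub> g) w = (\<Sum>(u, v)\<in>?Z. f u * g v)" for f g
    proof (rule W.mult_Sr_superset)
      show "W.factors f g w \<subseteq> ?Z"
      proof
        fix p assume "p \<in> W.factors f g w"
        then obtain u v where p: "p = (u, v)" "u @ v = w" by (auto simp: W.factors_def)
        then show "p \<in> ?Z" by (intro image_eqI[of _ _ "length u"]) auto
      qed
      show "u \<in> carrier (mon P) \<and> v \<in> carrier (mon P) \<and> u \<otimes>\<^bsub>mon P\<^esub> v = w" if "(u, v) \<in> ?Z" for u v
        using that w by (auto simp: P_carrier dest: in_set_takeD in_set_dropD)
    qed simp
    have Xs: "(\<Sum>(u, v)\<in>?Z. ?Xser k u * ?Xser l v) = ?Xser (k + l) w" for k l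
      unfolding Z[symmetric] using W.Sr.nat_pow_mult[OF X_closed] by simp
    have "(TT a \<otimes>\<^bsub>W.Sr\<^esub> TT b) w = (\<Sum>(u, v)\<in>?Z. (\<Sum>k\<le>?L. Tc a k * ?Xser k u) * (\<Sum>l\<le>?L. Tc b l * ?Xser l v))"
      unfolding Z by (intro sum.cong refl) (auto simp: T_sum[of _ ?L])
    also have "\<dots> = (\<Sum>z\<in>?Z. \<Sum>k\<le>?L. \<Sum>l\<le>?L. Tc a k * Tc b l * (?Xser k (fst z) * ?Xser l (snd z)))"
      by (intro sum.cong refl) (simp add: sum_product split_def mult_ac)
    also have "\<dots> = (\<Sum>k\<le>?L. \<Sum>l\<le>?L. \<Sum>z\<in>?Z. Tc a k * Tc b l * (?Xser k (fst z) * ?Xser l (snd z)))"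
      by (subst sum.swap, intro sum.cong refl, rule sum.swap)
    also have "\<dots> = (\<Sum>k\<le>?L. \<Sum>l\<le>?L. Tc a k * Tc b l * ?Xser (k + l) w)"
      by (simp add: sum_distrib_left[symmetric] Xs[symmetric] split_def)
    also have "\<dots> = (\<Sum>(k, l)\<in>{..?L} \<times> {..?L}. Tc a k * Tc b l * ?Xser (k + l) w)"
      by (simp add: sum.cartesian_product)
    \<comment> \<open>For k + l beyond the length of w the coefficient of X^(k + l) vanishes, which
      cuts the square down to a triangle.\<close>
    also have "\<dots> = (\<Sum>(k, l)\<in>{(i, j). i + j \<le> ?L}. Tc a k * Tc b l * ?Xser (k + l) w)"
      by (intro sum.mono_neutral_right) (auto dest: X_pow_nonzero)
    also have "\<dots> = (\<Sum>m\<le>?L. \<Sum>k\<le>m. Tc a k * Tc b (m - k) * ?Xser (k + (m - k)) w)"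
      by (rule sum.triangle_reindex_eq)
    also have "\<dots> = (\<Sum>m\<le>?L. Tc (a + b) m * ?Xser m w)"
    proof (intro sum.cong refl)
      fix m
      have "Tc a k * Tc b (m - k) * ?Xser (k + (m - k)) w = (a gchoose k) * (b gchoose (m - k)) * ((2 * h) ^ m * ?Xser m w)"
        if "k \<in> {..m}" for k
      proof -
        have "k + (m - k) = m" using that by simp
        then have "(2 * h) ^ k * (2 * h) ^ (m - k) = (2 * h) ^ m" by (metis power_add)
        moreover have "Tc a k * Tc b (m - k) * x = (a gchoose k) * (b gchoose (m - k)) * ((2 * h) ^ k * (2 * h) ^ (m - k) * x)" for x
          unfolding Tc_def by (simp only: mult_ac)
        ultimately show ?thesis using \<open>k + (m - k) = m\<close> by (simp only:)
      qed
      then have "(\<Sum>k\<le>m. Tc a k * Tc b (m - k) * ?Xser (k + (m - k)) w) = (\<Sum>k\<le>m. (a gchoose k) * (b gchoose (m - k))) * ((2 * h) ^ m * ?Xser m w)"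
        unfolding sum_distrib_right by (intro sum.cong refl)
      then show "(\<Sum>k\<le>m. Tc a k * Tc b (m - k) * ?Xser (k + (m - k)) w) = Tc (a + b) m * ?Xser m w"
        by (simp add: gbinomial_Vandermonde Tc_def atMost_atLeast0 mult.assoc)
    qed
    also have "\<dots> = TT (a + b) w" by (rule T_sum[OF order_refl, symmetric])
    finally show ?thesis .
  qed
qed

lemma Tc_nat: "Tc (of_nat m) k = of_nat (m choose k) * (2 * h) ^ k"
  by (simp add: Tc_def binomial_gbinomial)

lemma T_0: "TT 0 = \<one>\<^bsub>W.Sr\<^esub>"
proof
  fix w
  have "TT 0 w = (\<Sum>k\<le>length w. if k = 0 then \<one>\<^bsub>W.Sr\<^esub> w else 0)"
    unfolding T_sum[OF order_refl] using Tc_nat[of 0]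
    by (intro sum.cong) auto
  then show "TT 0 w = \<one>\<^bsub>W.Sr\<^esub> w" by simp
qed

lemma T_1: "TT 1 = \<one>\<^bsub>W.Sr\<^esub> \<oplus>\<^bsub>W.Sr\<^esub> sc (2 * h) Xser"
proof
  fix w
  have e: "Tc 1 k * (Xser [^]\<^bsub>W.Sr\<^esub> k) w = (if k = 0 then \<one>\<^bsub>W.Sr\<^esub> w else 0) + (if k = 1 then 2 * h * Xser w else 0)" for k
  proof -
    consider "k = 0" | "k = 1" | "k > 1" by linarith
    then show ?thesis
    proof cases
      case 2
      have "Xser [^]\<^bsub>W.Sr\<^esub> (1::nat) = Xser" using W.Sr.nat_pow_eone[OF X_closed] .
      then show ?thesis using Tc_nat[of 1 k] 2 by simp
    qed (use Tc_nat[of 1 k] in auto)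
  qed
  have d: "(\<Sum>k\<le>M. if k = 1 then c else 0) = c" if "1 \<le> M" for M :: nat and c :: complex
    using that by simp
  \<comment> \<open>The range is enlarged by one so that it contains k = 1 even when w is the empty
    word.\<close>
  have "TT 1 w = (\<Sum>k\<le>length w + 1. Tc 1 k * (Xser [^]\<^bsub>W.Sr\<^esub> k) w)" by (rule T_sum) simp
  also have "\<dots> = (\<Sum>k\<le>length w + 1. if k = 0 then \<one>\<^bsub>W.Sr\<^esub> w else 0) + (\<Sum>k\<le>length w + 1. if k = 1 then 2 * h * Xser w else 0)"
    unfolding e by (rule sum.distrib)
  also have "(\<Sum>k\<le>length w + 1. if k = 1 then 2 * h * Xser w else 0) = 2 * h * Xser w"
    by (rule d) simp
  also have "(\<Sum>k\<le>length w + 1. if k = 0 then \<one>\<^bsub>W.Sr\<^esub> w else 0) = \<one>\<^bsub>W.Sr\<^esub> w"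
    by simp
  finally show "TT 1 w = (\<one>\<^bsub>W.Sr\<^esub> \<oplus>\<^bsub>W.Sr\<^esub> sc (2 * h) Xser) w"
    by (simp add: sc_def)
qed

lemma T_minus_one: "TT a \<ominus>\<^bsub>W.Sr\<^esub> \<one>\<^bsub>W.Sr\<^esub> \<in> deg_ge (mon P) (dgr P) 1"
proof -
  have "Tn a 1 = \<one>\<^bsub>W.Sr\<^esub>" by (simp add: Tn_def lessThan_Suc Tc_def One_nat_def)
  then show ?thesis using T_approx[of a 1] by simp
qed

lemma T_inverse: "TT (1/2) \<otimes>\<^bsub>W.Sr\<^esub> TT (-1/2) = \<one>\<^bsub>W.Sr\<^esub>" "TT (-1/2) \<otimes>\<^bsub>W.Sr\<^esub> TT (1/2) = \<one>\<^bsub>W.Sr\<^esub>"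
  and T_square: "TT (1/2) \<otimes>\<^bsub>W.Sr\<^esub> TT (1/2) = \<one>\<^bsub>W.Sr\<^esub> \<oplus>\<^bsub>W.Sr\<^esub> sc (2 * h) Xser"
proof -
  show "TT (1/2) \<otimes>\<^bsub>W.Sr\<^esub> TT (-1/2) = \<one>\<^bsub>W.Sr\<^esub>" "TT (-1/2) \<otimes>\<^bsub>W.Sr\<^esub> TT (1/2) = \<one>\<^bsub>W.Sr\<^esub>"
    using T_mult[of "1/2" "-1/2"] T_mult[of "-1/2" "1/2"] by (simp_all add: T_0)
  show "TT (1/2) \<otimes>\<^bsub>W.Sr\<^esub> TT (1/2) = \<one>\<^bsub>W.Sr\<^esub> \<oplus>\<^bsub>W.Sr\<^esub> sc (2 * h) Xser"
    using T_mult[of "1/2" "1/2"] T_1 by (simp del: W.add_Sr)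
qed

definition "Rels = jordanian_data.relators W.Sr sc N lE lF lH (TT (1/2)) (TT (-1/2))"

lemma letters_closed: "i \<in> {1..N-1} \<Longrightarrow> lE i \<in> carrier W.Sr \<and> lF i \<in> carrier W.Sr \<and> lH i \<in> carrier W.Sr"
  using letter_closed letters_mem by blast

lemma Rels_closed: "Rels \<subseteq> carrier W.Sr"
  unfolding Rels_def using letters_closed T_closed W.sc_closed by (intro relators_closed W.ring_Sr) blast+

lemma rel_ideal_P: "rel_ideal P = closed_ideal_gen (mon P) (dgr P) Rels"
proof -
  have "free_alg N = W.Sr" by (rule free_alg)
  then show ?thesis unfolding Rels_def by (simp add: P jordanian_def)
qed

lemma calgebra_P: "calgebra P"
proof -
  have "P = \<lparr>mon = mon P, dgr = dgr P, rel_ideal = closed_ideal_gen (mon P) (dgr P) Rels\<rparr>"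
    using rel_ideal_P by simp
  then show ?thesis using W.calgebra_closed_ideal_gen[OF Rels_closed] by metis
qed

end

section \<open>Maps out of the completed algebra\<close>

locale jord = jord_base N h P + C: calgebra P for N :: nat and h :: complex and P :: "letter list calg"
begin

text \<open>The universal property of the completed free algebra. S is the target or its opposite,
  so that homomorphisms and antihomomorphisms are handled together; the opposite is for the
  antipode.\<close>

lemma word_ext:
  assumes R: "calgebra R" and S: "S = alg R \<or> S = opp (alg R)"
    and \<psi>: "\<And>g. g \<in> letters \<Longrightarrow> \<psi> g \<in> fil R (letter_deg g)"
  shows "\<exists>L. slin P R 0 L \<and> L \<in> ring_hom W.Sr S \<and> (\<forall>g\<in>letters. L (letter_series g) = \<psi> g)"
proof -
  interpret R: calgebra R by fact
  interpret T: calgebra_pair P R ..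
  interpret S: ring S using S ring_opp R.A.ring_axioms by auto
  have cS: "carrier S = carrier (alg R)" "\<one>\<^bsub>S\<^esub> = \<one>\<^bsub>alg R\<^esub>" using S by auto
  define \<phi> where "\<phi> w = foldr (\<lambda>g x. \<psi> g \<otimes>\<^bsub>S\<^esub> x) w \<one>\<^bsub>S\<^esub>" for w
  have fS: "x \<otimes>\<^bsub>S\<^esub> y \<in> fil R (m + n)" if "x \<in> fil R m" "y \<in> fil R n" for x y m n
    using S R.fil_mult[OF that] R.fil_mult[OF that(2,1)] by (auto simp: add.commute)
  have \<phi>f: "\<phi> w \<in> fil R (dgr P w)" if "w \<in> lists letters" for w
    using that by (induction w) (use R.fil_one cS in \<open>auto simp: \<phi>_def intro!: fS \<psi>\<close>)
  have \<phi>c: "\<phi> w \<in> carrier S" if "w \<in> lists letters" for w using R.fil_carrier[OF \<phi>f[OF that]] cS by simp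
  have \<psi>c: "\<psi> g \<in> carrier S" if "g \<in> letters" for g using R.fil_carrier[OF \<psi>[OF that]] cS by simp
  have \<phi>a: "\<phi> (u @ v) = \<phi> u \<otimes>\<^bsub>S\<^esub> \<phi> v" if "u \<in> lists letters" "v \<in> lists letters" for u v
    using that
  proof (induction u)
    case Nil
    then show ?case using \<phi>c[of v] by (simp add: \<phi>_def)
  next
    case (Cons g u)
    have "\<phi> ((g # u) @ v) = \<psi> g \<otimes>\<^bsub>S\<^esub> \<phi> (u @ v)" "\<phi> (g # u) = \<psi> g \<otimes>\<^bsub>S\<^esub> \<phi> u" by (simp_all add: \<phi>_def)
    then show ?case using Cons \<phi>c \<psi>c by (simp add: S.m_assoc)
  qed
  obtain L where L: "slin P R 0 L" and L\<phi>: "\<And>u. u \<in> lists letters \<Longrightarrow> L (W.delta u) = \<phi> u"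
    using T.slin_ext[of \<phi>] \<phi>f by (auto simp: P_carrier)
  have L1: "L (W.delta []) = \<one>\<^bsub>alg R\<^esub>" using L\<phi>[of "[]"] cS by (simp add: \<phi>_def)
  have La: "L (W.delta (u @ v)) = L (W.delta u) \<otimes>\<^bsub>S\<^esub> L (W.delta v)" if "u \<in> lists letters" "v \<in> lists letters" for u v
    using that L\<phi> \<phi>a by simp
  have "L \<in> ring_hom W.Sr S"
    using S
  proof
    assume S': "S = alg R"
    show ?thesis unfolding S'
      by (rule T.slin_hom[OF L]) (simp_all only: P_one P_mult P_carrier L1 La S')
  next
    assume S': "S = opp (alg R)"
    show ?thesis unfolding S'
      by (rule T.slin_antihom[OF L]) (simp_all only: P_one P_mult P_carrier L1 La S' opp_simps)
  qed
  moreover have "L (letter_series g) = \<psi> g" if "g \<in> letters" for g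
    using that \<psi>c by (simp add: letter_delta L\<phi>) (simp add: \<phi>_def)
  ultimately show ?thesis using L by blast
qed

lemma hom_slin_descend:
  assumes R: "calgebra R" and S: "S = alg R \<or> S = opp (alg R)"
    and L: "slin P R 0 L" "L \<in> ring_hom W.Sr S" and kill: "\<And>s. s \<in> Rels \<Longrightarrow> L s = \<zero>\<^bsub>alg R\<^esub>"
  shows "\<exists>k. filtered_linear P R k \<and> k \<in> ring_hom (alg P) S \<and> (\<forall>f\<in>carrier W.Sr. k (cls P f) = L f)"
proof -
  interpret R: calgebra R by fact
  interpret T: calgebra_pair P R ..
  interpret S: ring S using S ring_opp R.A.ring_axioms by auto
  have cS: "carrier S = carrier (alg R)" "\<zero>\<^bsub>S\<^esub> = \<zero>\<^bsub>alg R\<^esub>" using S by auto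
  have "L f = \<zero>\<^bsub>alg R\<^esub>" if "f \<in> rel_ideal P" for f
  proof (rule T.slin_kill_delta[OF L(1) Rels_closed rel_ideal_P _ that])
    fix s u v assume s: "s \<in> Rels" and uv: "u \<in> carrier (mon P)" "v \<in> carrier (mon P)"
    have s': "s \<in> carrier W.Sr" using s Rels_closed by blast
    have "L (W.delta u \<otimes>\<^bsub>W.Sr\<^esub> s \<otimes>\<^bsub>W.Sr\<^esub> W.delta v) = L (W.delta u) \<otimes>\<^bsub>S\<^esub> L s \<otimes>\<^bsub>S\<^esub> L (W.delta v)"
      using s' uv by (simp add: ring_hom_mult[OF L(2)])
    also have "\<dots> = \<zero>\<^bsub>S\<^esub>"
      using uv ring_hom_closed[OF L(2)] by (simp add: kill[OF s] cS(2)[symmetric])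
    finally show "L (W.delta u \<otimes>\<^bsub>W.Sr\<^esub> s \<otimes>\<^bsub>W.Sr\<^esub> W.delta v) = \<zero>\<^bsub>alg R\<^esub>" using cS by simp
  qed
  from T.slin_descend[OF L(1) this] obtain k where k: "filtered_linear P R k" "\<And>f. f \<in> carrier W.Sr \<Longrightarrow> k (cls P f) = L f"
    by blast
  have "(\<lambda>f. k (cls P f)) \<in> ring_hom W.Sr S"
    by (rule ring_hom_memI)
      (use k(2) ring_hom_closed[OF L(2)] ring_hom_mult[OF L(2)] ring_hom_add[OF L(2)] ring_hom_one[OF L(2)]
       in \<open>simp_all del: W.add_Sr C.cls.hom_add C.cls.hom_mult C.cls.hom_one\<close>)
  then have "k \<in> ring_hom (alg P) S" by (rule C.hom_descend)
  then show ?thesis using k by blast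
qed

lemma letters_unique:
  assumes R: "calgebra R" and S: "S = alg R \<or> S = opp (alg R)"
    and k: "filtered_linear P R k1" "filtered_linear P R k2" "k1 \<in> ring_hom (alg P) S" "k2 \<in> ring_hom (alg P) S"
    and eq: "\<And>g. g \<in> letters \<Longrightarrow> k1 (cls P (letter_series g)) = k2 (cls P (letter_series g))"
    and x: "x \<in> carrier (alg P)"
  shows "k1 x = k2 x"
proof -
  interpret R: calgebra R by fact
  interpret T: calgebra_pair P R ..
  have "k1 (cls P (W.delta w)) = k2 (cls P (W.delta w))" if "w \<in> lists letters" for w
    using that
  proof (induction w)
    case Nil
    have "cls P (W.delta []) = \<one>\<^bsub>alg P\<^esub>" using C.cls.hom_one by (simp add: W.one_delta)
    then show ?case using ring_hom_one[OF k(3)] ring_hom_one[OF k(4)] by simp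
  next
    case (Cons g w)
    have gw: "W.delta [g] \<in> carrier W.Sr" "W.delta w \<in> carrier W.Sr" using Cons by (simp_all add: P_carrier)
    have "W.delta (g # w) = W.delta [g] \<otimes>\<^bsub>W.Sr\<^esub> W.delta w" using Cons by (simp add: W.delta_mult P_carrier)
    then have "cls P (W.delta (g # w)) = cls P (W.delta [g]) \<otimes>\<^bsub>alg P\<^esub> cls P (W.delta w)" using gw by simp
    then show ?case
      using Cons gw eq[of g] by (simp add: ring_hom_mult[OF k(3)] ring_hom_mult[OF k(4)] letter_delta)
  qed
  then show ?thesis by (intro T.filtered_linear_unique[OF k(1,2) _ x]) (simp add: P_carrier)
qed

end

context jord
begin

text \<open>The source of the condition \<open>commutant\<close>: commuting with the image of X
  passes to its powers, to the partial sums and, by continuity, to the image of the whole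
  series.\<close>

lemma T_comm:
  assumes R: "calgebra R" and S: "S = alg R \<or> S = opp (alg R)" and L: "slin P R 0 L" "L \<in> ring_hom W.Sr S"
    and z: "z \<in> carrier (alg R)" "z \<otimes>\<^bsub>alg R\<^esub> L Xser = L Xser \<otimes>\<^bsub>alg R\<^esub> z"
  shows "z \<otimes>\<^bsub>alg R\<^esub> L (TT a) = L (TT a) \<otimes>\<^bsub>alg R\<^esub> z"
proof -
  interpret R: calgebra R by fact
  interpret T: calgebra_pair P R ..
  note Lc = T.slinD(1)[OF L(1)]
  have pow: "z \<otimes>\<^bsub>alg R\<^esub> L (Xser [^]\<^bsub>W.Sr\<^esub> k) = L (Xser [^]\<^bsub>W.Sr\<^esub> k) \<otimes>\<^bsub>alg R\<^esub> z" for k :: nat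
  proof (induction k)
    case 0
    have "\<one>\<^bsub>S\<^esub> = \<one>\<^bsub>alg R\<^esub>" using S by (elim disjE) simp_all
    then have one: "L \<one>\<^bsub>W.Sr\<^esub> = \<one>\<^bsub>alg R\<^esub>" using ring_hom_one[OF L(2)] by (rule trans[rotated])
    show ?case unfolding W.Sr.nat_pow_0 one R.A.l_one[OF z(1)] R.A.r_one[OF z(1)] ..
  next
    case (Suc k)
    have "L (Xser [^]\<^bsub>W.Sr\<^esub> (Suc k)) = L (Xser [^]\<^bsub>W.Sr\<^esub> k) \<otimes>\<^bsub>S\<^esub> L Xser"
      using ring_hom_mult[OF L(2) X_pow_closed[of k] X_closed] by simp
    note e = this
    from S show ?case
    proof (elim disjE)
      assume S': "S = alg R"
      show ?case unfolding e S'
        by (rule R.A.commute_mult[OF Suc z(2) z(1) Lc[OF X_pow_closed] Lc[OF X_closed]])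
    next
      assume S': "S = opp (alg R)"
      show ?case unfolding e S' opp_simps
        by (rule R.A.commute_mult[OF z(2) Suc z(1) Lc[OF X_closed] Lc[OF X_pow_closed]])
    qed
  qed
  have fin: "z \<otimes>\<^bsub>alg R\<^esub> L (Tn a n) = L (Tn a n) \<otimes>\<^bsub>alg R\<^esub> z" for n
  proof (induction n)
    case 0
    show ?case using z(1) T.slinD(6)[OF L(1)] by (simp add: Tn_0)
  next
    case (Suc n)
    have s: "sc (Tc a n) (Xser [^]\<^bsub>W.Sr\<^esub> n) \<in> carrier W.Sr" by (intro W.sc_closed X_pow_closed)
    have e: "L (Tn a (Suc n)) = L (Tn a n) \<oplus>\<^bsub>alg R\<^esub> smul R (Tc a n) (L (Xser [^]\<^bsub>W.Sr\<^esub> n))"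
      unfolding Tn_Suc T.slinD(2)[OF L(1) Tn_closed s] T.slinD(3)[OF L(1) X_pow_closed] ..
    have "z \<otimes>\<^bsub>alg R\<^esub> smul R c y = smul R c y \<otimes>\<^bsub>alg R\<^esub> z" if "y \<in> carrier (alg R)" "z \<otimes>\<^bsub>alg R\<^esub> y = y \<otimes>\<^bsub>alg R\<^esub> z" for c y
      unfolding R.smul_mult(1)[OF that(1) z(1), symmetric] R.smul_mult(2)[OF z(1) that(1), symmetric] that(2) ..
    note sm = this[OF Lc[OF X_pow_closed] pow]
    show ?case
      unfolding e R.A.r_distr[OF Lc[OF Tn_closed] R.smul_closed[OF Lc[OF X_pow_closed]] z(1)]
        R.A.l_distr[OF Lc[OF Tn_closed] R.smul_closed[OF Lc[OF X_pow_closed]] z(1)] Suc sm ..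
  qed
  obtain m1 m2 where m: "slin P R m1 (\<lambda>f. z \<otimes>\<^bsub>alg R\<^esub> L f)" "slin P R m2 (\<lambda>f. L f \<otimes>\<^bsub>alg R\<^esub> z)"
    using T.slin_mult_left[OF L(1) z(1)] T.slin_mult_right[OF L(1) z(1)] by blast
  show ?thesis
  proof (rule T.slin_eq_approx[OF m T_closed])
    fix n :: int
    have "TT a \<ominus>\<^bsub>W.Sr\<^esub> Tn a (nat n) \<in> deg_ge (mon P) (dgr P) n"
      by (rule W.deg_ge_mono[OF T_approx]) simp
    then show "\<exists>g\<in>carrier W.Sr. TT a \<ominus>\<^bsub>W.Sr\<^esub> g \<in> deg_ge (mon P) (dgr P) n \<and>
        z \<otimes>\<^bsub>alg R\<^esub> L g = L g \<otimes>\<^bsub>alg R\<^esub> z"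
      using Tn_closed fin by blast
  qed
qed

lemma hom_T:
  assumes R: "calgebra R" and S: "S = alg R \<or> S = opp (alg R)" and L: "slin P R 0 L" "L \<in> ring_hom W.Sr S"
  shows "L Xser = XR S N (\<lambda>i. L (lE i))"
    and "L (TT (1/2)) \<otimes>\<^bsub>alg R\<^esub> L (TT (1/2)) = \<one>\<^bsub>alg R\<^esub> \<oplus>\<^bsub>alg R\<^esub> scalar R (2 * h) \<otimes>\<^bsub>alg R\<^esub> L Xser"
    and "L (TT (1/2)) \<otimes>\<^bsub>alg R\<^esub> L (TT (-1/2)) = \<one>\<^bsub>alg R\<^esub>" "L (TT (-1/2)) \<otimes>\<^bsub>alg R\<^esub> L (TT (1/2)) = \<one>\<^bsub>alg R\<^esub>"
    and "L (TT a) \<ominus>\<^bsub>alg R\<^esub> \<one>\<^bsub>alg R\<^esub> \<in> fil R 1"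
proof -
  interpret R: calgebra R by fact
  interpret T: calgebra_pair P R ..
  have rS: "ring S" using S ring_opp R.A.ring_axioms by auto
  interpret LS: ring_hom_ring W.Sr S L by (rule ring_hom_ringI2[OF W.ring_Sr rS L(2)])
  show "L Xser = XR S N (\<lambda>i. L (lE i))"
    unfolding X_eq by (rule LS.hom_XR[OF N3]) (use letters_closed in auto)
  have "\<one>\<^bsub>S\<^esub> = \<one>\<^bsub>alg R\<^esub>" using S by (elim disjE) simp_all
  with LS.hom_one have one: "L \<one>\<^bsub>W.Sr\<^esub> = \<one>\<^bsub>alg R\<^esub>" by (rule trans)
  have "L (TT (1/2)) \<otimes>\<^bsub>S\<^esub> L (TT (1/2)) = L (\<one>\<^bsub>W.Sr\<^esub> \<oplus>\<^bsub>W.Sr\<^esub> sc (2 * h) Xser)"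
    unfolding T_square[symmetric] by (rule LS.hom_mult[OF T_closed T_closed, symmetric])
  also have "\<dots> = \<one>\<^bsub>alg R\<^esub> \<oplus>\<^bsub>alg R\<^esub> smul R (2 * h) (L Xser)"
    unfolding T.slinD(2)[OF L(1) W.Sr.one_closed W.sc_closed[OF X_closed]] T.slinD(3)[OF L(1) X_closed] one ..
  finally have sq: "L (TT (1/2)) \<otimes>\<^bsub>S\<^esub> L (TT (1/2)) = \<one>\<^bsub>alg R\<^esub> \<oplus>\<^bsub>alg R\<^esub> smul R (2 * h) (L Xser)" .
  have "L (TT (1/2)) \<otimes>\<^bsub>alg R\<^esub> L (TT (1/2)) = L (TT (1/2)) \<otimes>\<^bsub>S\<^esub> L (TT (1/2))"
    using S by (elim disjE) simp_all
  then show "L (TT (1/2)) \<otimes>\<^bsub>alg R\<^esub> L (TT (1/2)) = \<one>\<^bsub>alg R\<^esub> \<oplus>\<^bsub>alg R\<^esub> scalar R (2 * h) \<otimes>\<^bsub>alg R\<^esub> L Xser"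
    using sq unfolding smul_def by (rule trans)
  have ab: "L (TT (1/2)) \<otimes>\<^bsub>S\<^esub> L (TT (-1/2)) = \<one>\<^bsub>alg R\<^esub>" "L (TT (-1/2)) \<otimes>\<^bsub>S\<^esub> L (TT (1/2)) = \<one>\<^bsub>alg R\<^esub>"
    unfolding LS.hom_mult[OF T_closed T_closed, symmetric] T_inverse one by (rule refl)+
  from S have "L (TT (1/2)) \<otimes>\<^bsub>alg R\<^esub> L (TT (-1/2)) = \<one>\<^bsub>alg R\<^esub> \<and> L (TT (-1/2)) \<otimes>\<^bsub>alg R\<^esub> L (TT (1/2)) = \<one>\<^bsub>alg R\<^esub>"
  proof (elim disjE)
    assume "S = alg R" then show ?thesis using ab by (simp only: simp_thms)
  next
    assume "S = opp (alg R)" then show ?thesis using ab by (simp only: opp_simps simp_thms)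
  qed
  then show "L (TT (1/2)) \<otimes>\<^bsub>alg R\<^esub> L (TT (-1/2)) = \<one>\<^bsub>alg R\<^esub>" "L (TT (-1/2)) \<otimes>\<^bsub>alg R\<^esub> L (TT (1/2)) = \<one>\<^bsub>alg R\<^esub>"
    by blast+
  have "L (TT a) \<ominus>\<^bsub>alg R\<^esub> \<one>\<^bsub>alg R\<^esub> \<in> fil R (1 + 0)"
    unfolding one[symmetric] T.slinD(5)[OF L(1) T_closed W.Sr.one_closed, symmetric]
    by (rule T.slinD(4)[OF L(1) T_minus_one])
  then show "L (TT a) \<ominus>\<^bsub>alg R\<^esub> \<one>\<^bsub>alg R\<^esub> \<in> fil R 1" by simp
qed

text \<open>L is prescribed on letters only, so its value at the series T is not free. Once this
  value is known to be y, relations verified with y become statements about the images of the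
  relators.\<close>

lemma T_image:
  assumes R: "calgebra R" and S: "S = alg R \<or> S = opp (alg R)" and L: "slin P R 0 L" "L \<in> ring_hom W.Sr S"
    and y: "y \<in> carrier (alg R)" "y \<ominus>\<^bsub>alg R\<^esub> \<one>\<^bsub>alg R\<^esub> \<in> fil R 1"
      "y \<otimes>\<^bsub>alg R\<^esub> y = \<one>\<^bsub>alg R\<^esub> \<oplus>\<^bsub>alg R\<^esub> scalar R (2 * h) \<otimes>\<^bsub>alg R\<^esub> XR S N (\<lambda>i. L (lE i))"
      "y \<otimes>\<^bsub>alg R\<^esub> XR S N (\<lambda>i. L (lE i)) = XR S N (\<lambda>i. L (lE i)) \<otimes>\<^bsub>alg R\<^esub> y"
    and y': "y' \<in> carrier (alg R)" "y' \<otimes>\<^bsub>alg R\<^esub> y = \<one>\<^bsub>alg R\<^esub>"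
  shows "L (TT (1/2)) = y" "L (TT (-1/2)) = y'"
proof -
  interpret R: calgebra R by fact
  interpret T: calgebra_pair P R ..
  note h = hom_T[OF R S L]
  note Lc = T.slinD(1)[OF L(1) T_closed]
  show 1: "L (TT (1/2)) = y"
  proof (rule R.sqrt_unique[OF Lc h(5) y(1,2)])
    show "L (TT (1/2)) \<otimes>\<^bsub>alg R\<^esub> y = y \<otimes>\<^bsub>alg R\<^esub> L (TT (1/2))"
      by (rule T_comm[OF R S L y(1), symmetric]) (unfold h(1), rule y(4))
    show "L (TT (1/2)) \<otimes>\<^bsub>alg R\<^esub> L (TT (1/2)) = y \<otimes>\<^bsub>alg R\<^esub> y"
      unfolding h(2) y(3) unfolding h(1) ..
  qed
  show "L (TT (-1/2)) = y'"
    by (rule R.A.inv_unique[OF y'(2) h(3)[unfolded 1] y(1) y'(1) Lc, symmetric])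
qed

lemma rep:
  assumes R: "calgebra R" and L: "slin P R 0 L" "L \<in> ring_hom W.Sr (alg R)"
    and kill: "\<And>s. s \<in> Rels \<Longrightarrow> L s = \<zero>\<^bsub>alg R\<^esub>"
  shows "jrep (alg R) (scalar R) N h (\<lambda>i. L (lE i)) (\<lambda>i. L (lF i)) (\<lambda>i. L (lH i)) (L (TT (1/2))) (L (TT (-1/2)))"
proof -
  interpret R: calgebra R by fact
  interpret T: calgebra_pair P R ..
  interpret LS: ring_hom_ring W.Sr "alg R" L by (rule ring_hom_ringI2[OF W.ring_Sr R.A.ring_axioms L(2)])
  note h = hom_T[OF R disjI1[OF refl] L]
  have "relators (alg R) (scalar R) N (\<lambda>i. L (lE i)) (\<lambda>i. L (lF i)) (\<lambda>i. L (lH i)) (L (TT (1/2))) (L (TT (-1/2))) = L ` Rels"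
    unfolding Rels_def
  proof (rule LS.hom_relators)
    show "L (sc c x) = scalar R c \<otimes>\<^bsub>alg R\<^esub> L x" if "x \<in> carrier W.Sr" for c x
      using T.slinD(3)[OF L(1) that] unfolding smul_def .
    show "sc c x \<in> carrier W.Sr" if "x \<in> carrier W.Sr" for c x using that by (rule W.sc_closed)
  qed (use letters_closed T_closed in blast)+
  then have "relators (alg R) (scalar R) N (\<lambda>i. L (lE i)) (\<lambda>i. L (lF i)) (\<lambda>i. L (lH i)) (L (TT (1/2))) (L (TT (-1/2))) \<subseteq> {\<zero>\<^bsub>alg R\<^esub>}"
    using kill by auto
  moreover have "z \<otimes>\<^bsub>alg R\<^esub> L (TT (1/2)) = L (TT (1/2)) \<otimes>\<^bsub>alg R\<^esub> z"
    if "z \<in> carrier (alg R)" "z \<otimes>\<^bsub>alg R\<^esub> XR (alg R) N (\<lambda>i. L (lE i)) = XR (alg R) N (\<lambda>i. L (lE i)) \<otimes>\<^bsub>alg R\<^esub> z" for z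
    by (rule T_comm[OF R disjI1[OF refl] L that(1)]) (unfold h(1), rule that(2))
  ultimately show ?thesis
    unfolding jrep_def h(1)[symmetric]
    by (intro conjI ballI allI impI N3 R.A.ring_axioms R.cemb_scalar h(2-4) LS.hom_closed T_closed)
      (use letters_closed h(1) in auto)
qed

end

section \<open>Coproduct, antipode and counit\<close>

lemma filtered_linearD:
  assumes "filtered_linear P Q k"
  shows "x \<in> carrier (alg P) \<Longrightarrow> k x \<in> carrier (alg Q)"
    "x \<in> carrier (alg P) \<Longrightarrow> y \<in> carrier (alg P) \<Longrightarrow> k (x \<oplus>\<^bsub>alg P\<^esub> y) = k x \<oplus>\<^bsub>alg Q\<^esub> k y"
    "x \<in> carrier (alg P) \<Longrightarrow> k (smul P c x) = smul Q c (k x)"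
    "x \<in> fil P n \<Longrightarrow> k x \<in> fil Q n"
  using assms unfolding filtered_linear_def by blast+

lemma filtered_linear_id: "filtered_linear P P (\<lambda>x. x)"
  by (simp add: filtered_linear_def)

lemma filtered_linear_comp:
  "filtered_linear P Q k \<Longrightarrow> filtered_linear Q R l \<Longrightarrow> filtered_linear P R (\<lambda>x. l (k x))"
  unfolding filtered_linear_def by (auto simp: Pi_iff image_subset_iff)

lemma ring_hom_comp: "f \<in> ring_hom R S \<Longrightarrow> g \<in> ring_hom S T \<Longrightarrow> (\<lambda>x. g (f x)) \<in> ring_hom R T"
  using ring_hom_trans[of f R S g T] by (simp add: comp_def)

lemma (in calgebra) fil_pow: "x \<in> fil P 0 \<Longrightarrow> x [^]\<^bsub>alg P\<^esub> (k::nat) \<in> fil P 0"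
proof (induction k)
  case (Suc k)
  then show ?case using fil_mult[of "x [^]\<^bsub>alg P\<^esub> k" 0 x 0] by simp
qed (simp add: fil_one)

lemma (in calgebra) fil_finsum: "finite B \<Longrightarrow> (\<And>i. i \<in> B \<Longrightarrow> f i \<in> fil P n) \<Longrightarrow> finsum (alg P) f B \<in> fil P n"
proof (induction B rule: finite_induct)
  case (insert b B)
  have "finsum (alg P) f (insert b B) = f b \<oplus>\<^bsub>alg P\<^esub> finsum (alg P) f B"
    using insert fil_carrier by (intro A.finsum_insert) auto
  then show ?case using insert fil_add by simp
qed (simp add: fil_zero)

lemma (in ring) product_minus_one:
  assumes "x \<in> carrier R" "y \<in> carrier R" shows "x \<otimes> y \<ominus> \<one> = (x \<ominus> \<one>) \<otimes> y \<oplus> (y \<ominus> \<one>)"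
  using assms by (simp add: minus_eq l_distr l_minus a_assoc r_neg1)

lemma (in calgebra) near_one_mult:
  assumes "x \<in> carrier (alg P)" "x \<ominus>\<^bsub>alg P\<^esub> \<one>\<^bsub>alg P\<^esub> \<in> fil P 1" "y \<in> fil P 0" "y \<ominus>\<^bsub>alg P\<^esub> \<one>\<^bsub>alg P\<^esub> \<in> fil P 1"
  shows "x \<otimes>\<^bsub>alg P\<^esub> y \<ominus>\<^bsub>alg P\<^esub> \<one>\<^bsub>alg P\<^esub> \<in> fil P 1"
proof -
  have "(x \<ominus>\<^bsub>alg P\<^esub> \<one>\<^bsub>alg P\<^esub>) \<otimes>\<^bsub>alg P\<^esub> y \<in> fil P (1 + 0)" by (rule fil_mult[OF assms(2,3)])
  then show ?thesis
    unfolding A.product_minus_one[OF assms(1) fil_carrier[OF assms(3)]] using fil_add assms(4) by simp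
qed

lemma (in monoid) interchange:
  assumes "a' \<otimes> b = b \<otimes> a'" "a \<in> carrier G" "a' \<in> carrier G" "b \<in> carrier G" "b' \<in> carrier G"
  shows "(a \<otimes> a') \<otimes> (b \<otimes> b') = (a \<otimes> b) \<otimes> (a' \<otimes> b')"
proof -
  have "(a \<otimes> a') \<otimes> (b \<otimes> b') = a \<otimes> ((a' \<otimes> b) \<otimes> b')" using assms(2-) by (simp add: m_assoc)
  also have "\<dots> = (a \<otimes> b) \<otimes> (a' \<otimes> b')" unfolding assms(1) using assms(2-) by (simp add: m_assoc)
  finally show ?thesis .
qed

context calgebra_tensor
begin

text \<open>The maps on tensor products that the Hopf axioms ask for can all be brought to the form
  x (x) y to f(x) g(y), so one existence result serves them.\<close>

lemma induced_mult:
  assumes R: "calgebra R" and f: "filtered_linear P R f" and g: "filtered_linear Q R g"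
  shows "\<exists>k. induced P Q R (\<lambda>x y. f x \<otimes>\<^bsub>alg R\<^esub> g y) k"
proof (rule induced_exists[OF R])
  interpret R: calgebra R by fact
  note F = filtered_linearD[OF f] and G = filtered_linearD[OF g]
  show "bilinear R (\<lambda>x y. f x \<otimes>\<^bsub>alg R\<^esub> g y)"
    unfolding bilinear_def
  proof (intro conjI allI ballI)
    fix x y assume xy: "x \<in> carrier (alg P)" "y \<in> carrier (alg Q)"
    show "f x \<otimes>\<^bsub>alg R\<^esub> g y \<in> carrier (alg R)" by (rule R.A.m_closed[OF F(1)[OF xy(1)] G(1)[OF xy(2)]])
    show "f (x \<oplus>\<^bsub>alg P\<^esub> x') \<otimes>\<^bsub>alg R\<^esub> g y = f x \<otimes>\<^bsub>alg R\<^esub> g y \<oplus>\<^bsub>alg R\<^esub> f x' \<otimes>\<^bsub>alg R\<^esub> g y" if "x' \<in> carrier (alg P)" for x'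
      unfolding F(2)[OF xy(1) that] by (rule R.A.l_distr[OF F(1)[OF xy(1)] F(1)[OF that] G(1)[OF xy(2)]])
    show "f x \<otimes>\<^bsub>alg R\<^esub> g (y \<oplus>\<^bsub>alg Q\<^esub> y') = f x \<otimes>\<^bsub>alg R\<^esub> g y \<oplus>\<^bsub>alg R\<^esub> f x \<otimes>\<^bsub>alg R\<^esub> g y'" if "y' \<in> carrier (alg Q)" for y'
      unfolding G(2)[OF xy(2) that] by (rule R.A.r_distr[OF G(1)[OF xy(2)] G(1)[OF that] F(1)[OF xy(1)]])
    show "f (smul P c x) \<otimes>\<^bsub>alg R\<^esub> g y = smul R c (f x \<otimes>\<^bsub>alg R\<^esub> g y)" for c
      unfolding F(3)[OF xy(1)] by (rule R.smul_mult(1)[OF F(1)[OF xy(1)] G(1)[OF xy(2)], symmetric])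
    show "f x \<otimes>\<^bsub>alg R\<^esub> g (smul Q c y) = smul R c (f x \<otimes>\<^bsub>alg R\<^esub> g y)" for c
      unfolding G(3)[OF xy(2)] by (rule R.smul_mult(2)[OF F(1)[OF xy(1)] G(1)[OF xy(2)], symmetric])
  next
    fix x y m n assume "x \<in> fil P m" "y \<in> fil Q n"
    then show "f x \<otimes>\<^bsub>alg R\<^esub> g y \<in> fil R (m + n)" by (intro R.fil_mult F(4) G(4))
  qed
qed

lemma induced_mult_hom:
  assumes R: "calgebra R" and k: "induced P Q R (\<lambda>x y. f x \<otimes>\<^bsub>alg R\<^esub> g y) k"
    and f: "f \<in> ring_hom (alg P) (alg R)" and g: "g \<in> ring_hom (alg Q) (alg R)"
    and comm: "\<And>x y. x \<in> carrier (alg P) \<Longrightarrow> y \<in> carrier (alg Q) \<Longrightarrow> f x \<otimes>\<^bsub>alg R\<^esub> g y = g y \<otimes>\<^bsub>alg R\<^esub> f x"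
  shows "k \<in> ring_hom (alg (P \<boxtimes> Q)) (alg R)"
proof (rule induced_hom[OF R k])
  interpret R: calgebra R by fact
  show "f \<one>\<^bsub>alg P\<^esub> \<otimes>\<^bsub>alg R\<^esub> g \<one>\<^bsub>alg Q\<^esub> = \<one>\<^bsub>alg R\<^esub>"
    unfolding ring_hom_one[OF f] ring_hom_one[OF g] by simp
  fix x x' y y' assume c: "x \<in> carrier (alg P)" "x' \<in> carrier (alg P)" "y \<in> carrier (alg Q)" "y' \<in> carrier (alg Q)"
  show "f (x \<otimes>\<^bsub>alg P\<^esub> x') \<otimes>\<^bsub>alg R\<^esub> g (y \<otimes>\<^bsub>alg Q\<^esub> y') = f x \<otimes>\<^bsub>alg R\<^esub> g y \<otimes>\<^bsub>alg R\<^esub> (f x' \<otimes>\<^bsub>alg R\<^esub> g y')"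
    unfolding ring_hom_mult[OF f c(1,2)] ring_hom_mult[OF g c(3,4)]
    by (rule R.A.interchange[OF comm[OF c(2,3)]]) (use c ring_hom_closed[OF f] ring_hom_closed[OF g] in blast)+
qed

text \<open>Both products with z are continuous in w, and pure tensors span a dense
  subspace.\<close>

lemma commute_dense:
  assumes R: "calgebra R" and k: "filtered_linear (P \<boxtimes> Q) R k" and z: "z \<in> carrier (alg R)"
    and comm: "\<And>x y. x \<in> carrier (alg P) \<Longrightarrow> y \<in> carrier (alg Q) \<Longrightarrow>
      k (tens P Q x y) \<otimes>\<^bsub>alg R\<^esub> z = z \<otimes>\<^bsub>alg R\<^esub> k (tens P Q x y)"
    and w: "w \<in> carrier (alg (P \<boxtimes> Q))"
  shows "k w \<otimes>\<^bsub>alg R\<^esub> z = z \<otimes>\<^bsub>alg R\<^esub> k w"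
proof -
  interpret R: calgebra R by fact
  interpret T: calgebra_pair "P \<boxtimes> Q" R ..
  obtain f where f: "f \<in> carrier PQ.Sr" "w = cls (P \<boxtimes> Q) f" using w unfolding PQ.cls_surj by blast
  note L = T.filtered_linear_slin[OF k]
  obtain m1 m2 where m: "slin (P \<boxtimes> Q) R m1 (\<lambda>f. k (cls (P \<boxtimes> Q) f) \<otimes>\<^bsub>alg R\<^esub> z)" "slin (P \<boxtimes> Q) R m2 (\<lambda>f. z \<otimes>\<^bsub>alg R\<^esub> k (cls (P \<boxtimes> Q) f))"
    using T.slin_mult_left[OF L z] T.slin_mult_right[OF L z] by blast
  show ?thesis unfolding f(2)
  proof (rule T.slin_unique[OF m _ f(1)])
    fix p assume "p \<in> carrier (mon (P \<boxtimes> Q))"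
    then obtain u v where p: "p = (u, v)" "u \<in> carrier (mon P)" "v \<in> carrier (mon Q)" by (cases p) simp
    show "k (cls (P \<boxtimes> Q) (PQ.delta p)) \<otimes>\<^bsub>alg R\<^esub> z = z \<otimes>\<^bsub>alg R\<^esub> k (cls (P \<boxtimes> Q) (PQ.delta p))"
      unfolding p(1) tens_delta[OF p(2,3), symmetric]
      by (rule comm) (use p in simp_all)
  qed
qed

lemma tens_split:
  assumes "x \<in> carrier (alg P)" "y \<in> carrier (alg Q)"
  shows "tens P Q x \<one>\<^bsub>alg Q\<^esub> \<otimes>\<^bsub>alg (P \<boxtimes> Q)\<^esub> tens P Q \<one>\<^bsub>alg P\<^esub> y = tens P Q x y"
    "tens P Q \<one>\<^bsub>alg P\<^esub> y \<otimes>\<^bsub>alg (P \<boxtimes> Q)\<^esub> tens P Q x \<one>\<^bsub>alg Q\<^esub> = tens P Q x y"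
  using assms by (simp_all add: tens_mult)

end

section \<open>Existence of the three structure maps\<close>

context jord
begin

definition "gE i = cls P (letter_series (GE i))"
definition "gF i = cls P (letter_series (GF i))"
definition "gH i = cls P (letter_series (GH i))"
definition "gT = cls P (T_series N h (1/2))"
definition "gV = cls P (T_series N h (-1/2))"
definition "gHs = finsum (alg P) gH {1..N-1}"

lemma fil_gens: "i \<in> {1..N-1} \<Longrightarrow> gE i \<in> fil P 1" "i \<in> {1..N-1} \<Longrightarrow> gF i \<in> fil P (-1)" "i \<in> {1..N-1} \<Longrightarrow> gH i \<in> fil P 0"
  "gT \<in> fil P 0" "gV \<in> fil P 0" "gHs \<in> fil P 0"
proof -
  have l: "cls P (letter_series g) \<in> fil P (letter_deg g)" if "g \<in> letters" for g
  proof -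
    have "W.delta [g] \<in> deg_ge (mon P) (dgr P) (dgr P [g])" using that by (intro W.delta_deg) (simp add: P_carrier)
    from C.cls_fil[OF this] show ?thesis by (simp add: letter_delta)
  qed
  show "gE i \<in> fil P 1" "gF i \<in> fil P (-1)" "gH i \<in> fil P 0" if "i \<in> {1..N-1}" for i
    using l[OF letters_mem(1)[OF that]] l[OF letters_mem(2)[OF that]] l[OF letters_mem(3)[OF that]]
    by (simp_all add: gE_def gF_def gH_def)
  then show "gHs \<in> fil P 0" unfolding gHs_def by (intro C.fil_finsum) auto
  have "cls P (TT a) \<in> fil P 0" for a
  proof -
    have "TT a \<ominus>\<^bsub>W.Sr\<^esub> Tn a 0 = TT a"
      unfolding Tn_0 using T_closed[of a] by (simp add: W.Sr.minus_eq del: W.zero_Sr W.add_Sr)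
    then show ?thesis using C.cls_fil[OF T_approx[of a 0]] by simp
  qed
  then show "gT \<in> fil P 0" "gV \<in> fil P 0" by (simp_all add: gT_def gV_def)
qed

lemma gens_closed: "i \<in> {1..N-1} \<Longrightarrow> gE i \<in> carrier (alg P)" "i \<in> {1..N-1} \<Longrightarrow> gF i \<in> carrier (alg P)"
  "i \<in> {1..N-1} \<Longrightarrow> gH i \<in> carrier (alg P)" "gT \<in> carrier (alg P)" "gV \<in> carrier (alg P)" "gHs \<in> carrier (alg P)"
  using fil_gens C.fil_carrier by blast+

text \<open>For the identity this is the defining representation, for x (x) 1 and 1 (x) x it gives
  the two commuting representations in the tensor square.\<close>

lemma rep_hom:
  assumes R: "calgebra R" and k: "filtered_linear P R k" "k \<in> ring_hom (alg P) (alg R)"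
  shows "jrep (alg R) (scalar R) N h (\<lambda>i. k (gE i)) (\<lambda>i. k (gF i)) (\<lambda>i. k (gH i)) (k gT) (k gV)"
    and "k gT \<ominus>\<^bsub>alg R\<^esub> \<one>\<^bsub>alg R\<^esub> \<in> fil R 1" "k gV \<ominus>\<^bsub>alg R\<^esub> \<one>\<^bsub>alg R\<^esub> \<in> fil R 1"
proof -
  interpret R: calgebra R by fact
  interpret T: calgebra_pair P R ..
  have L: "slin P R 0 (\<lambda>f. k (cls P f))" "(\<lambda>f. k (cls P f)) \<in> ring_hom W.Sr (alg R)"
    using T.filtered_linear_slin[OF k(1)] ring_hom_comp[OF C.cls.homh k(2)] by blast+
  interpret k: ring_hom_ring "alg P" "alg R" k
    by (rule ring_hom_ringI2[OF C.A.ring_axioms R.A.ring_axioms k(2)])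
  have "k (cls P s) = \<zero>\<^bsub>alg R\<^esub>" if "s \<in> Rels" for s
  proof -
    have "s \<in> rel_ideal P" using that W.closed_ideal_gen_props(3)[OF Rels_closed] unfolding rel_ideal_P by blast
    then have "cls P s = \<zero>\<^bsub>alg P\<^esub>" using C.cls_0_iff C.rel_sub by blast
    then show ?thesis by (simp only: k.hom_zero)
  qed
  from rep[OF R L this] show "jrep (alg R) (scalar R) N h (\<lambda>i. k (gE i)) (\<lambda>i. k (gF i)) (\<lambda>i. k (gH i)) (k gT) (k gV)"
    unfolding gE_def gF_def gH_def gT_def gV_def .
  show "k gT \<ominus>\<^bsub>alg R\<^esub> \<one>\<^bsub>alg R\<^esub> \<in> fil R 1" "k gV \<ominus>\<^bsub>alg R\<^esub> \<one>\<^bsub>alg R\<^esub> \<in> fil R 1"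
    using hom_T(5)[OF R disjI1[OF refl] L] unfolding gT_def gV_def by blast+
qed

lemma id_hom: "(\<lambda>x. x) \<in> ring_hom (alg P) (alg P)"
  by (rule ring_hom_memI) simp_all

lemmas gens_rep = rep_hom(1)[OF calgebra_P filtered_linear_id id_hom]
lemmas gT_near = rep_hom(2,3)[OF calgebra_P filtered_linear_id id_hom]

lemma TV: "gT \<otimes>\<^bsub>alg P\<^esub> gV = \<one>\<^bsub>alg P\<^esub>" "gV \<otimes>\<^bsub>alg P\<^esub> gT = \<one>\<^bsub>alg P\<^esub>"
  using gens_rep by (simp_all add: jrep_def)

lemma Rels_image:
  assumes R: "calgebra R" and S: "S = alg R \<or> S = opp (alg R)" and L: "slin P R 0 L" "L \<in> ring_hom W.Sr S"
  shows "relators S (scalar R) N (\<lambda>i. L (lE i)) (\<lambda>i. L (lF i)) (\<lambda>i. L (lH i)) (L (TT (1/2))) (L (TT (-1/2))) = L ` Rels"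
proof -
  interpret R: calgebra R by fact
  interpret T: calgebra_pair P R ..
  have rS: "ring S" using S ring_opp R.A.ring_axioms by (elim disjE) simp_all
  interpret LS: ring_hom_ring W.Sr S L by (rule ring_hom_ringI2[OF W.ring_Sr rS L(2)])
  show ?thesis
    unfolding Rels_def
  proof (rule LS.hom_relators)
    show "L (sc c x) = scalar R c \<otimes>\<^bsub>S\<^esub> L x" if "x \<in> carrier W.Sr" for c x
    proof -
      have "scalar R c \<otimes>\<^bsub>S\<^esub> L x = scalar R c \<otimes>\<^bsub>alg R\<^esub> L x"
        using S cembD(5)[OF R.cemb_scalar T.slinD(1)[OF L(1) that], of c] by (elim disjE) simp_all
      then show ?thesis using T.slinD(3)[OF L(1) that] unfolding smul_def by simp
    qed
    show "sc c x \<in> carrier W.Sr" if "x \<in> carrier W.Sr" for c x using that by (rule W.sc_closed)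
  qed (use letters_closed T_closed in blast)+
qed

lemma hom_Hs:
  assumes "ring S" "k \<in> ring_hom (alg P) S" shows "k gHs = finsum S (\<lambda>i. k (gH i)) {1..N-1}"
proof -
  interpret k: ring_hom_ring "alg P" S k by (rule ring_hom_ringI2[OF C.A.ring_axioms assms])
  show ?thesis unfolding gHs_def using gens_closed(3) by (subst k.hom_finsum) (auto simp: comp_def)
qed

sublocale PP: calgebra_tensor P P ..

abbreviation (input) "tn \<equiv> tens P P"

definition "gG i = gV \<otimes>\<^bsub>alg P\<^esub> \<lbrakk>gF i, gT\<rbrakk>\<^bsub>alg P\<^esub>"

lemma lie_fil: "i \<in> {1..N-1} \<Longrightarrow> \<lbrakk>gF i, gT\<rbrakk>\<^bsub>alg P\<^esub> \<in> fil P (-1)"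
  using C.fil_mult[OF fil_gens(2) fil_gens(4), of i] C.fil_mult[OF fil_gens(4) fil_gens(2), of i]
  unfolding lie_def by (intro C.fil_minus) simp_all

lemma gG_fil: "i \<in> {1..N-1} \<Longrightarrow> gG i \<in> fil P (-1)"
  using C.fil_mult[OF fil_gens(5) lie_fil, of i] by (simp add: gG_def)

definition "ED i = tn (gE i) \<one>\<^bsub>alg P\<^esub> \<oplus>\<^bsub>alg (P \<boxtimes> P)\<^esub> tn (gT [^]\<^bsub>alg P\<^esub> theta N i) (gE i)"
definition "FD i = tn (gF i) \<one>\<^bsub>alg P\<^esub> \<oplus>\<^bsub>alg (P \<boxtimes> P)\<^esub> tn (gV [^]\<^bsub>alg P\<^esub> theta N i) (gF i)
  \<oplus>\<^bsub>alg (P \<boxtimes> P)\<^esub> tn (gT \<otimes>\<^bsub>alg P\<^esub> gHs) (gG i)"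
definition "HD i = tn (gH i) \<one>\<^bsub>alg P\<^esub> \<oplus>\<^bsub>alg (P \<boxtimes> P)\<^esub> tn \<one>\<^bsub>alg P\<^esub> (gH i) \<ominus>\<^bsub>alg (P \<boxtimes> P)\<^esub>
  smul (P \<boxtimes> P) (of_nat (theta N i) / 2) (tn (\<one>\<^bsub>alg P\<^esub> \<ominus>\<^bsub>alg P\<^esub> gV [^]\<^bsub>alg P\<^esub> (2::nat)) gHs)"

text \<open>The values at T, T^-1, G_i and the sum of the H_i are recorded with those at the
  generators, since these elements occur inside the formulas and meet the coproduct again in
  coassociativity.\<close>

definition "is_Delta \<Delta> \<longleftrightarrow> filtered_linear P (P \<boxtimes> P) \<Delta> \<and> \<Delta> \<in> ring_hom (alg P) (alg (P \<boxtimes> P)) \<and>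
  (\<forall>i\<in>{1..N-1}. \<Delta> (gE i) = ED i \<and> \<Delta> (gF i) = FD i \<and> \<Delta> (gH i) = HD i \<and>
     \<Delta> (gG i) = tn (gG i) \<one>\<^bsub>alg P\<^esub> \<oplus>\<^bsub>alg (P \<boxtimes> P)\<^esub> tn gT (gG i)) \<and>
  \<Delta> gT = tn gT gT \<and> \<Delta> gV = tn gV gV \<and>
  \<Delta> gHs = tn gHs \<one>\<^bsub>alg P\<^esub> \<oplus>\<^bsub>alg (P \<boxtimes> P)\<^esub> tn (gV \<otimes>\<^bsub>alg P\<^esub> gV) gHs"

lemma fil_images: "i \<in> {1..N-1} \<Longrightarrow> ED i \<in> fil (P \<boxtimes> P) 1" "i \<in> {1..N-1} \<Longrightarrow> FD i \<in> fil (P \<boxtimes> P) (-1)"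
  "i \<in> {1..N-1} \<Longrightarrow> HD i \<in> fil (P \<boxtimes> P) 0"
proof -
  assume i: "i \<in> {1..N-1}"
  note t = PP.tens_fil and g = fil_gens(1-3)[OF i] fil_gens(4-6)
  have p: "gT [^]\<^bsub>alg P\<^esub> theta N i \<in> fil P 0" "gV [^]\<^bsub>alg P\<^esub> theta N i \<in> fil P 0" "gV [^]\<^bsub>alg P\<^esub> (2::nat) \<in> fil P 0"
    by (intro C.fil_pow g)+
  have "gT \<otimes>\<^bsub>alg P\<^esub> gHs \<in> fil P 0" using C.fil_mult[OF g(4) g(6)] by simp
  then have a: "tn (gT \<otimes>\<^bsub>alg P\<^esub> gHs) (gG i) \<in> fil (P \<boxtimes> P) (-1)" using t[OF _ gG_fil[OF i]] by fastforce
  have b: "tn (\<one>\<^bsub>alg P\<^esub> \<ominus>\<^bsub>alg P\<^esub> gV [^]\<^bsub>alg P\<^esub> (2::nat)) gHs \<in> fil (P \<boxtimes> P) 0"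
    using t[OF C.fil_minus[OF C.fil_one p(3)] g(6)] by simp
  show "ED i \<in> fil (P \<boxtimes> P) 1" unfolding ED_def
    using t[OF g(1) C.fil_one] t[OF p(1) g(1)] by (intro PP.PQ.fil_add) simp_all
  show "FD i \<in> fil (P \<boxtimes> P) (-1)" unfolding FD_def
    using t[OF g(2) C.fil_one] t[OF p(2) g(2)] a by (intro PP.PQ.fil_add) simp_all
  show "HD i \<in> fil (P \<boxtimes> P) 0" unfolding HD_def
    using t[OF g(3) C.fil_one] t[OF C.fil_one g(3)] b by (intro PP.PQ.fil_minus PP.PQ.fil_add PP.PQ.fil_smul) simp_all
qed

lemma Delta_exists: "\<exists>\<Delta>. is_Delta \<Delta>"
proof -
  let ?U = "alg P" and ?R = "alg (P \<boxtimes> P)" and ?\<iota> = "scalar (P \<boxtimes> P)"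
  let ?l = "\<lambda>x. tn x \<one>\<^bsub>alg P\<^esub>" and ?r = "\<lambda>y. tn \<one>\<^bsub>alg P\<^esub> y"
  note R = PP.PQ.calgebra_axioms
  interpret l: ring_hom_ring ?U ?R ?l by (rule ring_hom_ringI2[OF C.A.ring_axioms PP.PQ.A.ring_axioms PP.tens_hom(1)])
  interpret r: ring_hom_ring ?U ?R ?r by (rule ring_hom_ringI2[OF C.A.ring_axioms PP.PQ.A.ring_axioms PP.tens_hom(2)])
  note J1 = rep_hom[OF R PP.tens_filtered_linear(1) PP.tens_hom(1)]
  note J2 = rep_hom[OF R PP.tens_filtered_linear(2) PP.tens_hom(2)]
  define \<psi> where "\<psi> g = (case g of GE i \<Rightarrow> ED i | GF i \<Rightarrow> FD i | GH i \<Rightarrow> HD i)" for g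
  have "\<psi> g \<in> fil (P \<boxtimes> P) (letter_deg g)" if "g \<in> letters" for g
    using that fil_images by (auto simp: \<psi>_def letters_def)
  from word_ext[OF R disjI1[OF refl] this]
  obtain L where L: "slin P (P \<boxtimes> P) 0 L" "L \<in> ring_hom W.Sr ?R" and L\<psi>: "\<And>g. g \<in> letters \<Longrightarrow> L (letter_series g) = \<psi> g"
    by blast
  have LE: "L (lE i) = ED i" and LF: "L (lF i) = FD i" and LH: "L (lH i) = HD i" if "i \<in> {1..N-1}" for i
    using L\<psi> letters_mem[OF that] by (simp_all add: \<psi>_def)
  have lr: "?l x \<otimes>\<^bsub>?R\<^esub> ?r y = tn x y" if "x \<in> carrier ?U" "y \<in> carrier ?U" for x y
    using PP.tens_split(1)[OF that] .
  have gc: "x \<in> carrier ?U" if "x \<in> gE ` {1..N-1} \<union> gF ` {1..N-1} \<union> gH ` {1..N-1} \<union> {gT, gV}" for x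
    using that gens_closed by blast
  have lie: "?l (\<lbrakk>gF i, gT\<rbrakk>\<^bsub>?U\<^esub>) = \<lbrakk>?l (gF i), ?l gT\<rbrakk>\<^bsub>?R\<^esub>" "?r (\<lbrakk>gF i, gT\<rbrakk>\<^bsub>?U\<^esub>) = \<lbrakk>?r (gF i), ?r gT\<rbrakk>\<^bsub>?R\<^esub>" if "i \<in> {1..N-1}" for i
    using l.hom_lie[OF gens_closed(2)[OF that] gens_closed(4)] r.hom_lie[OF gens_closed(2)[OF that] gens_closed(4)] .
  have lc: "\<lbrakk>gF i, gT\<rbrakk>\<^bsub>?U\<^esub> \<in> carrier ?U" "gG i \<in> carrier ?U" if "i \<in> {1..N-1}" for i
    using C.fil_carrier[OF lie_fil[OF that]] C.fil_carrier[OF gG_fil[OF that]] .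
  have Hs: "finsum ?R (\<lambda>i. ?l (gH i)) {1..N-1} = ?l gHs" "finsum ?R (\<lambda>i. ?r (gH i)) {1..N-1} = ?r gHs"
    using hom_Hs[OF PP.PQ.A.ring_axioms PP.tens_hom(1)] hom_Hs[OF PP.PQ.A.ring_axioms PP.tens_hom(2)] by simp_all
  have cross: "x \<otimes>\<^bsub>?R\<^esub> y = y \<otimes>\<^bsub>?R\<^esub> x"
    if x: "x \<in> (\<lambda>i. ?l (gE i)) ` {1..N-1} \<union> (\<lambda>i. ?l (gF i)) ` {1..N-1} \<union> (\<lambda>i. ?l (gH i)) ` {1..N-1} \<union> {?l gT, ?l gV}"
      and y: "y \<in> (\<lambda>i. ?r (gE i)) ` {1..N-1} \<union> (\<lambda>i. ?r (gF i)) ` {1..N-1} \<union> (\<lambda>i. ?r (gH i)) ` {1..N-1} \<union> {?r gT, ?r gV}" for x y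
  proof -
    from x obtain x' where x': "x' \<in> carrier ?U" "x = ?l x'" using gens_closed by blast
    from y obtain y' where y': "y' \<in> carrier ?U" "y = ?r y'" using gens_closed by blast
    show ?thesis unfolding x'(2) y'(2) PP.tens_split[OF x'(1) y'(1)] ..
  qed
  \<comment> \<open>Brings the formulas into the multiplicative form x (x) y = (x (x) 1)(1 (x) y) in
    which the relations were computed.\<close>
  have hE: "L (lE i) = ?l (gE i) \<oplus>\<^bsub>?R\<^esub> ?l gT [^]\<^bsub>?R\<^esub> theta N i \<otimes>\<^bsub>?R\<^esub> ?r (gE i)" if i: "i \<in> {1..N-1}" for i
    unfolding LE[OF i] ED_def l.hom_nat_pow[OF gens_closed(4), symmetric] lr[OF C.A.nat_pow_closed[OF gens_closed(4)] gens_closed(1)[OF i]] ..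
  have hF: "L (lF i) = ?l (gF i) \<oplus>\<^bsub>?R\<^esub> ?l gV [^]\<^bsub>?R\<^esub> theta N i \<otimes>\<^bsub>?R\<^esub> ?r (gF i) \<oplus>\<^bsub>?R\<^esub>
      ?l gT \<otimes>\<^bsub>?R\<^esub> finsum ?R (\<lambda>i. ?l (gH i)) {1..N-1} \<otimes>\<^bsub>?R\<^esub> (?r gV \<otimes>\<^bsub>?R\<^esub> \<lbrakk>?r (gF i), ?r gT\<rbrakk>\<^bsub>?R\<^esub>)" if i: "i \<in> {1..N-1}" for i
    unfolding LF[OF i] FD_def Hs lie(2)[OF i, symmetric] l.hom_mult[OF gens_closed(4,6), symmetric]
      r.hom_mult[OF gens_closed(5) lc(1)[OF i], symmetric] gG_def[symmetric]
      l.hom_nat_pow[OF gens_closed(5), symmetric] lr[OF C.A.nat_pow_closed[OF gens_closed(5)] gens_closed(2)[OF i]]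
      lr[OF C.A.m_closed[OF gens_closed(4,6)] lc(2)[OF i]] ..
  have hH: "L (lH i) = ?l (gH i) \<oplus>\<^bsub>?R\<^esub> ?r (gH i) \<ominus>\<^bsub>?R\<^esub> ?\<iota> (of_nat (theta N i) / 2) \<otimes>\<^bsub>?R\<^esub>
      ((\<one>\<^bsub>?R\<^esub> \<ominus>\<^bsub>?R\<^esub> ?l gV [^]\<^bsub>?R\<^esub> (2::nat)) \<otimes>\<^bsub>?R\<^esub> finsum ?R (\<lambda>i. ?r (gH i)) {1..N-1})" if i: "i \<in> {1..N-1}" for i
    unfolding LH[OF i] HD_def Hs smul_def l.hom_one[symmetric] l.hom_nat_pow[OF gens_closed(5), symmetric]
      l.hom_minus[OF C.A.one_closed C.A.nat_pow_closed[OF gens_closed(5)], symmetric]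
      lr[OF C.A.minus_closed[OF C.A.one_closed C.A.nat_pow_closed[OF gens_closed(5)]] gens_closed(6)] ..
  have CR: "relators ?R ?\<iota> N (\<lambda>i. L (lE i)) (\<lambda>i. L (lF i)) (\<lambda>i. L (lH i)) (?l gT \<otimes>\<^bsub>?R\<^esub> ?r gT) (?l gV \<otimes>\<^bsub>?R\<^esub> ?r gV) \<subseteq> {\<zero>\<^bsub>?R\<^esub>}"
    "(?l gT \<otimes>\<^bsub>?R\<^esub> ?r gT) \<otimes>\<^bsub>?R\<^esub> (?l gT \<otimes>\<^bsub>?R\<^esub> ?r gT) = \<one>\<^bsub>?R\<^esub> \<oplus>\<^bsub>?R\<^esub> ?\<iota> (2 * h) \<otimes>\<^bsub>?R\<^esub> XR ?R N (\<lambda>i. L (lE i))"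
    "(?l gT \<otimes>\<^bsub>?R\<^esub> ?r gT) \<otimes>\<^bsub>?R\<^esub> XR ?R N (\<lambda>i. L (lE i)) = XR ?R N (\<lambda>i. L (lE i)) \<otimes>\<^bsub>?R\<^esub> (?l gT \<otimes>\<^bsub>?R\<^esub> ?r gT)"
    "finsum ?R (\<lambda>i. L (lH i)) {1..N-1} = finsum ?R (\<lambda>i. ?l (gH i)) {1..N-1} \<oplus>\<^bsub>?R\<^esub> ?l gV \<otimes>\<^bsub>?R\<^esub> ?l gV \<otimes>\<^bsub>?R\<^esub> finsum ?R (\<lambda>i. ?r (gH i)) {1..N-1}"
    "(?l gV \<otimes>\<^bsub>?R\<^esub> ?r gV) \<otimes>\<^bsub>?R\<^esub> (?l gT \<otimes>\<^bsub>?R\<^esub> ?r gT) = \<one>\<^bsub>?R\<^esub>"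
    by (rule coproduct_relations[OF J1(1) J2(1) cross hE hF hH]; assumption)+
  have CR5: "(?l gV \<otimes>\<^bsub>?R\<^esub> ?r gV) \<otimes>\<^bsub>?R\<^esub> \<lbrakk>L (lF i), ?l gT \<otimes>\<^bsub>?R\<^esub> ?r gT\<rbrakk>\<^bsub>?R\<^esub> =
      ?l gV \<otimes>\<^bsub>?R\<^esub> \<lbrakk>?l (gF i), ?l gT\<rbrakk>\<^bsub>?R\<^esub> \<oplus>\<^bsub>?R\<^esub> ?l gT \<otimes>\<^bsub>?R\<^esub> (?r gV \<otimes>\<^bsub>?R\<^esub> \<lbrakk>?r (gF i), ?r gT\<rbrakk>\<^bsub>?R\<^esub>)"
    if i: "i \<in> {1..N-1}" for i
    by (rule coproduct_relations(5)[OF J1(1) J2(1) cross hE hF hH]; (assumption | rule i))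
  have near: "?l gT \<otimes>\<^bsub>?R\<^esub> ?r gT \<ominus>\<^bsub>?R\<^esub> \<one>\<^bsub>?R\<^esub> \<in> fil (P \<boxtimes> P) 1"
    by (rule PP.PQ.near_one_mult[OF l.hom_closed[OF gens_closed(4)] J1(2) filtered_linearD(4)[OF PP.tens_filtered_linear(2) fil_gens(4)] J2(2)])
  have c4: "?l gT \<otimes>\<^bsub>?R\<^esub> ?r gT \<in> carrier ?R" "?l gV \<otimes>\<^bsub>?R\<^esub> ?r gV \<in> carrier ?R"
    by (intro PP.PQ.A.m_closed l.hom_closed r.hom_closed gens_closed)+
  note LT = T_image[OF R disjI1[OF refl] L c4(1) near CR(2) CR(3) c4(2) CR(5)]
  have "L ` Rels \<subseteq> {\<zero>\<^bsub>?R\<^esub>}"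
    unfolding Rels_image[OF R disjI1[OF refl] L, symmetric] LT by (rule CR(1))
  then have "L s = \<zero>\<^bsub>?R\<^esub>" if "s \<in> Rels" for s
    using that by (simp add: image_subset_iff)
  from hom_slin_descend[OF R disjI1[OF refl] L this] obtain \<Delta> where
    \<Delta>: "filtered_linear P (P \<boxtimes> P) \<Delta>" "\<Delta> \<in> ring_hom ?U ?R" and \<Delta>L: "\<And>f. f \<in> carrier W.Sr \<Longrightarrow> \<Delta> (cls P f) = L f"
    by blast
  interpret \<Delta>: ring_hom_ring ?U ?R \<Delta> by (rule ring_hom_ringI2[OF C.A.ring_axioms PP.PQ.A.ring_axioms \<Delta>(2)])
  have \<Delta>g: "\<Delta> (gE i) = L (lE i)" "\<Delta> (gF i) = L (lF i)" "\<Delta> (gH i) = L (lH i)" if "i \<in> {1..N-1}" for i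
    using letters_closed[OF that] \<Delta>L by (simp_all add: gE_def gF_def gH_def)
  have \<Delta>TV: "\<Delta> gT = ?l gT \<otimes>\<^bsub>?R\<^esub> ?r gT" "\<Delta> gV = ?l gV \<otimes>\<^bsub>?R\<^esub> ?r gV"
    using \<Delta>L[OF T_closed] LT by (simp_all add: gT_def gV_def)
  have "\<Delta> gHs = finsum ?R (\<lambda>i. L (lH i)) {1..N-1}"
    unfolding hom_Hs[OF PP.PQ.A.ring_axioms \<Delta>(2)] using \<Delta>g(3) \<Delta>.hom_closed[OF gens_closed(3)]
    by (intro PP.PQ.A.finsum_cong') auto
  then have \<Delta>Hs: "\<Delta> gHs = ?l gHs \<oplus>\<^bsub>?R\<^esub> tn (gV \<otimes>\<^bsub>?U\<^esub> gV) gHs"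
    unfolding CR(4) Hs l.hom_mult[OF gens_closed(5,5), symmetric] lr[OF C.A.m_closed[OF gens_closed(5,5)] gens_closed(6)] .
  have \<Delta>G: "\<Delta> (gG i) = ?l (gG i) \<oplus>\<^bsub>?R\<^esub> tn gT (gG i)" if i: "i \<in> {1..N-1}" for i
  proof -
    have "\<Delta> (gG i) = (?l gV \<otimes>\<^bsub>?R\<^esub> ?r gV) \<otimes>\<^bsub>?R\<^esub> \<lbrakk>L (lF i), ?l gT \<otimes>\<^bsub>?R\<^esub> ?r gT\<rbrakk>\<^bsub>?R\<^esub>"
      unfolding gG_def \<Delta>.hom_mult[OF gens_closed(5) lc(1)[OF i]] \<Delta>.hom_lie[OF gens_closed(2)[OF i] gens_closed(4)]
        \<Delta>TV \<Delta>g(2)[OF i] ..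
    also note CR5[OF i]
    also have "?l gV \<otimes>\<^bsub>?R\<^esub> \<lbrakk>?l (gF i), ?l gT\<rbrakk>\<^bsub>?R\<^esub> = ?l (gG i)"
      unfolding lie(1)[OF i, symmetric] l.hom_mult[OF gens_closed(5) lc(1)[OF i], symmetric] gG_def ..
    also have "?l gT \<otimes>\<^bsub>?R\<^esub> (?r gV \<otimes>\<^bsub>?R\<^esub> \<lbrakk>?r (gF i), ?r gT\<rbrakk>\<^bsub>?R\<^esub>) = tn gT (gG i)"
      unfolding lie(2)[OF i, symmetric] r.hom_mult[OF gens_closed(5) lc(1)[OF i], symmetric] gG_def[symmetric]
      by (rule lr[OF gens_closed(4) lc(2)[OF i]])
    finally show ?thesis .
  qed
  have "is_Delta \<Delta>"
    unfolding is_Delta_def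
  proof (intro conjI ballI)
    show "filtered_linear P (P \<boxtimes> P) \<Delta>" "\<Delta> \<in> ring_hom ?U ?R" by (fact \<Delta>)+
    show "\<Delta> gT = tn gT gT" "\<Delta> gV = tn gV gV"
      by (rule trans[OF \<Delta>TV(1) lr[OF gens_closed(4,4)]], rule trans[OF \<Delta>TV(2) lr[OF gens_closed(5,5)]])
    show "\<Delta> gHs = ?l gHs \<oplus>\<^bsub>?R\<^esub> tn (gV \<otimes>\<^bsub>?U\<^esub> gV) gHs" by (fact \<Delta>Hs)
    fix i assume i: "i \<in> {1..N-1}"
    show "\<Delta> (gE i) = ED i" "\<Delta> (gF i) = FD i" "\<Delta> (gH i) = HD i"
      by (rule trans[OF \<Delta>g(1)[OF i] LE[OF i]], rule trans[OF \<Delta>g(2)[OF i] LF[OF i]], rule trans[OF \<Delta>g(3)[OF i] LH[OF i]])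
    show "\<Delta> (gG i) = ?l (gG i) \<oplus>\<^bsub>?R\<^esub> tn gT (gG i)" by (rule \<Delta>G[OF i])
  qed
  then show ?thesis by blast
qed

definition "is_S S \<longleftrightarrow> filtered_linear P P S \<and> S \<in> ring_hom (alg P) (opp (alg P)) \<and>
  (\<forall>i\<in>{1..N-1}. S (gE i) = \<ominus>\<^bsub>alg P\<^esub> (gV [^]\<^bsub>alg P\<^esub> theta N i \<otimes>\<^bsub>alg P\<^esub> gE i) \<and>
     S (gF i) = \<ominus>\<^bsub>alg P\<^esub> (gT [^]\<^bsub>alg P\<^esub> theta N i \<otimes>\<^bsub>alg P\<^esub> gF i) \<oplus>\<^bsub>alg P\<^esub>
       gT [^]\<^bsub>alg P\<^esub> (2::nat) \<otimes>\<^bsub>alg P\<^esub> gHs \<otimes>\<^bsub>alg P\<^esub> gV [^]\<^bsub>alg P\<^esub> (2::nat) \<otimes>\<^bsub>alg P\<^esub> \<lbrakk>gF i, gT\<rbrakk>\<^bsub>alg P\<^esub> \<and>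
     S (gH i) = \<ominus>\<^bsub>alg P\<^esub> gH i \<oplus>\<^bsub>alg P\<^esub>
       smul P (of_nat (theta N i) / 2) ((\<one>\<^bsub>alg P\<^esub> \<ominus>\<^bsub>alg P\<^esub> gT [^]\<^bsub>alg P\<^esub> (2::nat)) \<otimes>\<^bsub>alg P\<^esub> gHs) \<and>
     \<lbrakk>gV, S (gF i)\<rbrakk>\<^bsub>alg P\<^esub> \<otimes>\<^bsub>alg P\<^esub> gT = \<ominus>\<^bsub>alg P\<^esub> (gV \<otimes>\<^bsub>alg P\<^esub> gV \<otimes>\<^bsub>alg P\<^esub> \<lbrakk>gF i, gT\<rbrakk>\<^bsub>alg P\<^esub>)) \<and>
  S gT = gV \<and> S gV = gT \<and> S gHs = \<ominus>\<^bsub>alg P\<^esub> (gT \<otimes>\<^bsub>alg P\<^esub> gT \<otimes>\<^bsub>alg P\<^esub> gHs)"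

lemma S_exists: "\<exists>S. is_S S"
proof -
  let ?U = "alg P"
  define ES where "ES i = \<ominus>\<^bsub>?U\<^esub> (gV [^]\<^bsub>?U\<^esub> theta N i \<otimes>\<^bsub>?U\<^esub> gE i)" for i
  define FS where "FS i = \<ominus>\<^bsub>?U\<^esub> (gT [^]\<^bsub>?U\<^esub> theta N i \<otimes>\<^bsub>?U\<^esub> gF i) \<oplus>\<^bsub>?U\<^esub>
       gT [^]\<^bsub>?U\<^esub> (2::nat) \<otimes>\<^bsub>?U\<^esub> gHs \<otimes>\<^bsub>?U\<^esub> gV [^]\<^bsub>?U\<^esub> (2::nat) \<otimes>\<^bsub>?U\<^esub> \<lbrakk>gF i, gT\<rbrakk>\<^bsub>?U\<^esub>" for i
  define HS where "HS i = \<ominus>\<^bsub>?U\<^esub> gH i \<oplus>\<^bsub>?U\<^esub>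
       smul P (of_nat (theta N i) / 2) ((\<one>\<^bsub>?U\<^esub> \<ominus>\<^bsub>?U\<^esub> gT [^]\<^bsub>?U\<^esub> (2::nat)) \<otimes>\<^bsub>?U\<^esub> gHs)" for i
  note P2 = disjI2[OF refl]
  define \<psi> where "\<psi> g = (case g of GE i \<Rightarrow> ES i | GF i \<Rightarrow> FS i | GH i \<Rightarrow> HS i)" for g
  have m0: "x \<otimes>\<^bsub>?U\<^esub> y \<in> fil P n" if "x \<in> fil P 0" "y \<in> fil P n" for x y n
    using C.fil_mult[OF that] by simp
  have fE: "ES i \<in> fil P 1" and fF: "FS i \<in> fil P (-1)" and fH: "HS i \<in> fil P 0" if i: "i \<in> {1..N-1}" for i
    unfolding ES_def FS_def HS_def
    by (intro C.fil_add C.fil_uminus C.fil_smul C.fil_minus C.fil_one m0 C.fil_pow fil_gens lie_fil i)+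
  have "\<psi> g \<in> fil P (letter_deg g)" if "g \<in> letters" for g
    using that fE fF fH by (auto simp: \<psi>_def letters_def)
  from word_ext[OF calgebra_P P2 this]
  obtain L where L: "slin P P 0 L" "L \<in> ring_hom W.Sr (opp ?U)" and L\<psi>: "\<And>g. g \<in> letters \<Longrightarrow> L (letter_series g) = \<psi> g"
    by blast
  have LE: "L (lE i) = ES i" and LF: "L (lF i) = FS i" and LH: "L (lH i) = HS i" if "i \<in> {1..N-1}" for i
    using L\<psi> letters_mem[OF that] by (simp_all add: \<psi>_def)
  have hE: "L (lE i) = \<ominus>\<^bsub>?U\<^esub> (gV [^]\<^bsub>?U\<^esub> theta N i \<otimes>\<^bsub>?U\<^esub> gE i)" if "i \<in> {1..N-1}" for i
    using LE[OF that] unfolding ES_def .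
  have hF: "L (lF i) = \<ominus>\<^bsub>?U\<^esub> (gT [^]\<^bsub>?U\<^esub> theta N i \<otimes>\<^bsub>?U\<^esub> gF i) \<oplus>\<^bsub>?U\<^esub>
       gT [^]\<^bsub>?U\<^esub> (2::nat) \<otimes>\<^bsub>?U\<^esub> finsum ?U gH {1..N-1} \<otimes>\<^bsub>?U\<^esub> gV [^]\<^bsub>?U\<^esub> (2::nat) \<otimes>\<^bsub>?U\<^esub> \<lbrakk>gF i, gT\<rbrakk>\<^bsub>?U\<^esub>" if "i \<in> {1..N-1}" for i
    using LF[OF that] unfolding FS_def gHs_def .
  have hH: "L (lH i) = \<ominus>\<^bsub>?U\<^esub> gH i \<oplus>\<^bsub>?U\<^esub>
       scalar P (of_nat (theta N i) / 2) \<otimes>\<^bsub>?U\<^esub> ((\<one>\<^bsub>?U\<^esub> \<ominus>\<^bsub>?U\<^esub> gT [^]\<^bsub>?U\<^esub> (2::nat)) \<otimes>\<^bsub>?U\<^esub> finsum ?U gH {1..N-1})" if "i \<in> {1..N-1}" for i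
    using LH[OF that] unfolding HS_def smul_def gHs_def .
  have AR: "relators (opp ?U) (scalar P) N (\<lambda>i. L (lE i)) (\<lambda>i. L (lF i)) (\<lambda>i. L (lH i)) gV gT \<subseteq> {\<zero>\<^bsub>?U\<^esub>}"
    "gV \<otimes>\<^bsub>?U\<^esub> gV = \<one>\<^bsub>?U\<^esub> \<oplus>\<^bsub>?U\<^esub> scalar P (2 * h) \<otimes>\<^bsub>?U\<^esub> XR (opp ?U) N (\<lambda>i. L (lE i))"
    "gV \<otimes>\<^bsub>?U\<^esub> XR (opp ?U) N (\<lambda>i. L (lE i)) = XR (opp ?U) N (\<lambda>i. L (lE i)) \<otimes>\<^bsub>?U\<^esub> gV"
    "finsum ?U (\<lambda>i. L (lH i)) {1..N-1} = \<ominus>\<^bsub>?U\<^esub> (gT \<otimes>\<^bsub>?U\<^esub> gT \<otimes>\<^bsub>?U\<^esub> finsum ?U gH {1..N-1})"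
    by (rule antipode_relations[OF gens_rep hE hF hH]; assumption)+
  have AR5: "\<lbrakk>gV, L (lF i)\<rbrakk>\<^bsub>?U\<^esub> \<otimes>\<^bsub>?U\<^esub> gT = \<ominus>\<^bsub>?U\<^esub> (gV \<otimes>\<^bsub>?U\<^esub> gV \<otimes>\<^bsub>?U\<^esub> \<lbrakk>gF i, gT\<rbrakk>\<^bsub>?U\<^esub>)" if i: "i \<in> {1..N-1}" for i
    by (rule antipode_relations(5)[OF gens_rep hE hF hH]; (assumption | rule i))
  \<comment> \<open>The prescribed square root is \<open>gV\<close>, with inverse \<open>gT\<close>,
    because the antipode inverts T.\<close>
  note LT = T_image[OF calgebra_P P2 L gens_closed(5) gT_near(2) AR(2) AR(3) gens_closed(4) TV(1)]
  have "L ` Rels \<subseteq> {\<zero>\<^bsub>?U\<^esub>}"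
    unfolding Rels_image[OF calgebra_P P2 L, symmetric] LT by (rule AR(1))
  then have "L s = \<zero>\<^bsub>?U\<^esub>" if "s \<in> Rels" for s
    using that by (simp add: image_subset_iff)
  from hom_slin_descend[OF calgebra_P P2 L this] obtain S where
    S: "filtered_linear P P S" "S \<in> ring_hom ?U (opp ?U)" and SL: "\<And>f. f \<in> carrier W.Sr \<Longrightarrow> S (cls P f) = L f"
    by blast
  have Sg: "S (gE i) = L (lE i)" "S (gF i) = L (lF i)" "S (gH i) = L (lH i)" if "i \<in> {1..N-1}" for i
    using letters_closed[OF that] SL by (simp_all add: gE_def gF_def gH_def)
  have STV: "S gT = gV" "S gV = gT"
    using SL[OF T_closed] LT by (simp_all add: gT_def gV_def)
  have "S gHs = finsum ?U (\<lambda>i. L (lH i)) {1..N-1}"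
    unfolding hom_Hs[OF ring_opp[OF C.A.ring_axioms] S(2)] opp_finsum
    using Sg(3) filtered_linearD(1)[OF S(1) gens_closed(3)] by (intro C.A.finsum_cong') auto
  then have SHs: "S gHs = \<ominus>\<^bsub>?U\<^esub> (gT \<otimes>\<^bsub>?U\<^esub> gT \<otimes>\<^bsub>?U\<^esub> gHs)"
    unfolding AR(4) gHs_def .
  have "is_S S"
    unfolding is_S_def ES_def[symmetric] FS_def[symmetric] HS_def[symmetric]
  proof (intro conjI ballI)
    show "filtered_linear P P S" "S \<in> ring_hom ?U (opp ?U)" by (fact S)+
    show "S gT = gV" "S gV = gT" by (fact STV)+
    show "S gHs = \<ominus>\<^bsub>?U\<^esub> (gT \<otimes>\<^bsub>?U\<^esub> gT \<otimes>\<^bsub>?U\<^esub> gHs)" by (fact SHs)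
    fix i assume i: "i \<in> {1..N-1}"
    show "S (gE i) = ES i" "S (gF i) = FS i" "S (gH i) = HS i"
      by (rule trans[OF Sg(1)[OF i] LE[OF i]], rule trans[OF Sg(2)[OF i] LF[OF i]], rule trans[OF Sg(3)[OF i] LH[OF i]])
    show "\<lbrakk>gV, S (gF i)\<rbrakk>\<^bsub>?U\<^esub> \<otimes>\<^bsub>?U\<^esub> gT = \<ominus>\<^bsub>?U\<^esub> (gV \<otimes>\<^bsub>?U\<^esub> gV \<otimes>\<^bsub>?U\<^esub> \<lbrakk>gF i, gT\<rbrakk>\<^bsub>?U\<^esub>)"
      unfolding Sg(2)[OF i] by (rule AR5[OF i])
  qed
  then show ?thesis by blast
qed

end

context jord
begin

definition "is_eps \<epsilon> \<longleftrightarrow> \<epsilon> \<in> ring_hom (alg P) (type_ring :: complex ring) \<and> (\<forall>c. \<epsilon> (scalar P c) = c) \<and>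
  (\<forall>x\<in>fil P 1. \<epsilon> x = 0) \<and> (\<forall>i\<in>{1..N-1}. \<epsilon> (gE i) = 0 \<and> \<epsilon> (gF i) = 0 \<and> \<epsilon> (gH i) = 0) \<and> \<epsilon> gT = 1 \<and> \<epsilon> gV = 1"

text \<open>The counit is the coefficient of the empty word, which is multiplicative because the
  empty word factors only trivially. Relators vanish under it since the generators go to the trivial
  representation.\<close>

lemma eps_exists: "\<exists>\<epsilon>. is_eps \<epsilon>"
proof -
  define e where "e f = f []" for f :: "letter list series"
  have e: "e \<in> ring_hom W.Sr (type_ring :: complex ring)"
  proof (rule ring_hom_memI)
    show "e (f \<otimes>\<^bsub>W.Sr\<^esub> g) = e f \<otimes>\<^bsub>type_ring\<^esub> e g" for f g
      unfolding e_def using W.mult_Sr_superset[of "{([], [])}" f g "[]"] by (auto simp: W.factors_def P_carrier)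
  qed (simp_all add: e_def W.one_Sr)
  interpret e: ring_hom_ring W.Sr "type_ring :: complex ring" e
    by (rule ring_hom_ringI2[OF W.ring_Sr ring_type_ring e])
  let ?J = "a_kernel W.Sr (type_ring :: complex ring) e"
  have J: "f \<in> ?J \<longleftrightarrow> f \<in> carrier W.Sr \<and> f [] = 0" for f by (simp add: a_kernel_def' e_def)
  have T1: "TT a [] = 1" for a
  proof -
    have "(TT a \<ominus>\<^bsub>W.Sr\<^esub> \<one>\<^bsub>W.Sr\<^esub>) [] = 0"
      using T_minus_one[of a] unfolding W.deg_ge_iff by fastforce
    then show ?thesis by (simp add: W.minus_Sr T_closed) (simp add: W.one_Sr)
  qed
  \<comment> \<open>The empty word has degree 0, so an approximation up to degree 1 already has the
    right coefficient there.\<close>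
  have "closed_set (mon P) (dgr P) ?J"
    unfolding closed_set_def
  proof (intro ballI impI)
    fix f assume f: "f \<in> carrier W.Sr" and "\<forall>n. \<exists>g\<in>?J. f \<ominus>\<^bsub>W.Sr\<^esub> g \<in> deg_ge (mon P) (dgr P) n"
    then obtain g where g: "g \<in> ?J" "f \<ominus>\<^bsub>W.Sr\<^esub> g \<in> deg_ge (mon P) (dgr P) 1" by blast
    then have "(f \<ominus>\<^bsub>W.Sr\<^esub> g) [] = 0" unfolding W.deg_ge_iff by fastforce
    then show "f \<in> ?J" using f g unfolding J by (simp add: W.minus_Sr)
  qed
  moreover have "Rels \<subseteq> ?J"
  proof
    fix s assume s: "s \<in> Rels"
    have "jordanian_data.relators (type_ring :: complex ring) (\<lambda>c x. id c \<otimes>\<^bsub>type_ring\<^esub> x) N (\<lambda>_. \<zero>\<^bsub>type_ring\<^esub>) (\<lambda>_. \<zero>\<^bsub>type_ring\<^esub>) (\<lambda>_. \<zero>\<^bsub>type_ring\<^esub>) \<one>\<^bsub>type_ring\<^esub> \<one>\<^bsub>type_ring\<^esub> = e ` Rels"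
      unfolding Rels_def
      by (rule e.hom_relators) (use letters_closed T_closed W.sc_closed in \<open>auto simp: e_def sc_def letter_series_def T1\<close>)
    moreover have "cemb (type_ring :: complex ring) id" by (simp add: cemb_def)
    ultimately have "e ` Rels \<subseteq> {0}"
      using trivial_relators[OF ring_type_ring, of id N] by simp
    then have "e s = 0" using s by blast
    then have "s [] = 0" by (simp only: e_def)
    then show "s \<in> ?J" using s Rels_closed unfolding J by blast
  qed
  ultimately have rel: "rel_ideal P \<subseteq> ?J"
    unfolding rel_ideal_P using W.closed_ideal_gen_props(4)[OF Rels_closed e.kernel_is_ideal] by blast
  define \<epsilon> where "\<epsilon> x = (SOME f. f \<in> carrier W.Sr \<and> x = cls P f) []" for x
  have \<epsilon>: "\<epsilon> (cls P f) = f []" if f: "f \<in> carrier W.Sr" for f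
  proof -
    define g where "g = (SOME g. g \<in> carrier W.Sr \<and> cls P f = cls P g)"
    have g: "g \<in> carrier W.Sr \<and> cls P f = cls P g"
      unfolding g_def by (rule someI[of _ f]) (use f in simp)
    then have "f \<ominus>\<^bsub>W.Sr\<^esub> g \<in> ?J" using C.cls_eq_iff[OF f] rel by blast
    then have "(f \<ominus>\<^bsub>W.Sr\<^esub> g) [] = 0" unfolding J by blast
    then have "g [] = f []" unfolding W.minus_Sr[OF f conjunct1[OF g]] by simp
    then show ?thesis unfolding \<epsilon>_def g_def .
  qed
  have "(\<lambda>f. \<epsilon> (cls P f)) \<in> ring_hom W.Sr (type_ring :: complex ring)"
  proof (rule ring_hom_memI)
    fix f g assume fg: "f \<in> carrier W.Sr" "g \<in> carrier W.Sr"
    show "\<epsilon> (cls P (f \<otimes>\<^bsub>W.Sr\<^esub> g)) = \<epsilon> (cls P f) \<otimes>\<^bsub>type_ring\<^esub> \<epsilon> (cls P g)"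
      unfolding \<epsilon>[OF fg(1)] \<epsilon>[OF fg(2)] \<epsilon>[OF W.Sr.m_closed[OF fg]] by (rule e.hom_mult[OF fg, unfolded e_def])
    show "\<epsilon> (cls P (f \<oplus>\<^bsub>W.Sr\<^esub> g)) = \<epsilon> (cls P f) \<oplus>\<^bsub>type_ring\<^esub> \<epsilon> (cls P g)"
      unfolding \<epsilon>[OF fg(1)] \<epsilon>[OF fg(2)] \<epsilon>[OF W.Sr.a_closed[OF fg]] by (rule e.hom_add[OF fg, unfolded e_def])
  next
    show "\<epsilon> (cls P \<one>\<^bsub>W.Sr\<^esub>) = \<one>\<^bsub>type_ring\<^esub>"
      unfolding \<epsilon>[OF W.Sr.one_closed] by (rule e.hom_one[unfolded e_def])
  qed simp
  then have "\<epsilon> \<in> ring_hom (alg P) (type_ring :: complex ring)" by (rule C.hom_descend)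
  moreover have "\<epsilon> (scalar P c) = c" for c
    unfolding C.scalar_eq \<epsilon>[OF C.sc_one_closed] by (simp add: sc_def W.one_Sr)
  moreover have "\<epsilon> x = 0" if x: "x \<in> fil P 1" for x
  proof -
    obtain f where f: "f \<in> deg_ge (mon P) (dgr P) 1" "x = cls P f" using x unfolding C.fil_iff by blast
    then have "f [] = 0" "f \<in> carrier W.Sr" unfolding W.deg_ge_iff by fastforce+
    then show ?thesis using f(2) \<epsilon> by simp
  qed
  moreover have "\<epsilon> (gE i) = 0 \<and> \<epsilon> (gF i) = 0 \<and> \<epsilon> (gH i) = 0" if "i \<in> {1..N-1}" for i
    using letters_closed[OF that] \<epsilon> by (simp add: gE_def gF_def gH_def) (simp add: letter_series_def)
  moreover have "\<epsilon> gT = 1" "\<epsilon> gV = 1"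
    using \<epsilon>[OF T_closed] T1 by (simp_all add: gT_def gV_def)
  ultimately have "is_eps \<epsilon>" unfolding is_eps_def by (intro conjI ballI allI) simp_all
  then show ?thesis by blast
qed

end

section \<open>Coassociativity\<close>

context ring
begin

lemma cancel_ab: "a \<in> carrier R \<Longrightarrow> b \<in> carrier R \<Longrightarrow> (\<ominus> a \<oplus> b) \<oplus> a \<oplus> \<ominus> b = \<zero>"
proof -
  assume c: "a \<in> carrier R" "b \<in> carrier R"
  have "(\<ominus> a \<oplus> b) \<oplus> a = \<ominus> a \<oplus> (a \<oplus> b)" using c by (simp only: a_assoc a_comm[of b a] a_inv_closed)
  also have "\<dots> = b" using c by (rule r_neg1)
  finally show ?thesis using c by (simp add: r_neg)
qed

text \<open>The digits name the tensor leg in which an element lives; on a generator,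
  coassociativity becomes an identity between ring elements.\<close>

lemma coassoc_E:
  assumes "{e1, t1, e2, t2, e3} \<subseteq> carrier R"
  shows "e1 \<oplus> t1 \<otimes> e2 \<oplus> (t1 \<otimes> t2) \<otimes> e3 = e1 \<oplus> t1 \<otimes> (e2 \<oplus> t2 \<otimes> e3)"
  using assms by (simp add: r_distr m_assoc a_assoc)

text \<open>Here k stands for T Hs, and k1 t2 + w1 k2 is its coproduct. w1 is V where v1 is V^theta;
  the hypothesis \<open>w\<close> lets them be exchanged in front of G in the third leg.\<close>

lemma coassoc_F:
  assumes c: "{f1, v1, f2, k1, g2, v2, f3, t2, w1, k2, g3} \<subseteq> carrier R" and w: "w1 \<otimes> (k2 \<otimes> g3) = v1 \<otimes> (k2 \<otimes> g3)"
  shows "(f1 \<oplus> v1 \<otimes> f2 \<oplus> k1 \<otimes> g2) \<oplus> (v1 \<otimes> v2) \<otimes> f3 \<oplus> (k1 \<otimes> t2 \<oplus> w1 \<otimes> k2) \<otimes> g3 =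
    f1 \<oplus> v1 \<otimes> (f2 \<oplus> v2 \<otimes> f3 \<oplus> k2 \<otimes> g3) \<oplus> k1 \<otimes> (g2 \<oplus> t2 \<otimes> g3)"
proof -
  have "(w1 \<otimes> k2) \<otimes> g3 = v1 \<otimes> (k2 \<otimes> g3)" using c w by (simp add: m_assoc)
  then show ?thesis using c by (simp add: r_distr l_distr m_assoc a_ac)
qed

text \<open>With v for V^2 this rests on 1 - v1 v2 = (1 - v2) + (1 - v1) v2.\<close>

lemma coassoc_H:
  assumes c: "{h1, h2, h3, c, v1, v2, s2, s3} \<subseteq> carrier R"
  shows "(h1 \<oplus> h2 \<ominus> c \<otimes> ((\<one> \<ominus> v1) \<otimes> s2)) \<oplus> h3 \<ominus> c \<otimes> ((\<one> \<ominus> v1 \<otimes> v2) \<otimes> s3) =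
    h1 \<oplus> (h2 \<oplus> h3 \<ominus> c \<otimes> ((\<one> \<ominus> v2) \<otimes> s3)) \<ominus> c \<otimes> ((\<one> \<ominus> v1) \<otimes> (s2 \<oplus> v2 \<otimes> s3))"
proof -
  define p where "p = (\<one> \<ominus> v1) \<otimes> s2"
  define q where "q = (\<one> \<ominus> v2) \<otimes> s3"
  define r where "r = (\<one> \<ominus> v1) \<otimes> (v2 \<otimes> s3)"
  have cl: "c \<otimes> p \<in> carrier R" "c \<otimes> q \<in> carrier R" "c \<otimes> r \<in> carrier R" "p \<in> carrier R" "q \<in> carrier R" "r \<in> carrier R"
    using c by (simp_all add: p_def q_def r_def)
  have "(\<one> \<ominus> v1 \<otimes> v2) \<otimes> s3 = q \<oplus> r"
    using c by (simp add: q_def r_def minus_eq l_distr l_minus m_assoc a_assoc r_neg1)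
  moreover have "(\<one> \<ominus> v1) \<otimes> (s2 \<oplus> v2 \<otimes> s3) = p \<oplus> r"
    using c by (simp add: p_def r_def r_distr)
  moreover have "(h1 \<oplus> h2 \<ominus> c \<otimes> p) \<oplus> h3 \<ominus> c \<otimes> (q \<oplus> r) = h1 \<oplus> (h2 \<oplus> h3 \<ominus> c \<otimes> q) \<ominus> c \<otimes> (p \<oplus> r)"
    using c cl by (simp add: r_distr minus_eq minus_add a_ac)
  ultimately show ?thesis by (simp add: p_def q_def)
qed

end

lemma ring_hom_funcset: "f \<in> ring_hom R S \<Longrightarrow> f \<in> carrier R \<rightarrow> carrier S"
  by (simp add: ring_hom_def)

lemma induced_cong:
  assumes "induced P Q R \<beta> k" "\<And>x y. x \<in> carrier (alg P) \<Longrightarrow> y \<in> carrier (alg Q) \<Longrightarrow> \<beta> x y = \<beta>' x y"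
  shows "induced P Q R \<beta>' k"
  using assms unfolding induced_def by simp

lemma inducedD:
  assumes "induced P Q R \<beta> k"
  shows "filtered_linear (P \<boxtimes> Q) R k"
    "x \<in> carrier (alg P) \<Longrightarrow> y \<in> carrier (alg Q) \<Longrightarrow> k (tens P Q x y) = \<beta> x y"
  using assms unfolding induced_def by simp_all

lemma (in calgebra_tensor) tens_pow:
  "x \<in> carrier (alg P) \<Longrightarrow> y \<in> carrier (alg Q) \<Longrightarrow>
    tens P Q x y [^]\<^bsub>alg (P \<boxtimes> Q)\<^esub> (n::nat) = tens P Q (x [^]\<^bsub>alg P\<^esub> n) (y [^]\<^bsub>alg Q\<^esub> n)"
  by (induction n) (simp_all add: tens_one tens_mult)

context jord
begin

lemma theta_cases: "i \<in> {1..N-1} \<Longrightarrow> theta N i = 1 \<or> theta N i = 0 \<and> \<lbrakk>gF i, gT\<rbrakk>\<^bsub>alg P\<^esub> = \<zero>\<^bsub>alg P\<^esub>"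
  using N3 jrep_interior[OF gens_rep, of i] by (cases "theta N i = 0") (auto simp: theta_def of_bool_def split: if_splits)

lemma V2: "gV [^]\<^bsub>alg P\<^esub> (2::nat) = gV \<otimes>\<^bsub>alg P\<^esub> gV" and T2: "gT [^]\<^bsub>alg P\<^esub> (2::nat) = gT \<otimes>\<^bsub>alg P\<^esub> gT"
  using nat_pow_2[OF C.A.ring_axioms] gens_closed by blast+

lemma TVV: "gT \<otimes>\<^bsub>alg P\<^esub> (gV \<otimes>\<^bsub>alg P\<^esub> gV) = gV" and VTT: "gV \<otimes>\<^bsub>alg P\<^esub> (gT \<otimes>\<^bsub>alg P\<^esub> gT) = gT"
  using TV gens_closed(4,5) by (simp_all add: C.A.m_assoc[symmetric])

lemma G_closed: "i \<in> {1..N-1} \<Longrightarrow> gG i \<in> carrier (alg P)" "i \<in> {1..N-1} \<Longrightarrow> \<lbrakk>gF i, gT\<rbrakk>\<^bsub>alg P\<^esub> \<in> carrier (alg P)"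
  using gG_fil lie_fil C.fil_carrier by blast+

lemma letters_unique_gens:
  assumes R: "calgebra R" and S: "S = alg R \<or> S = opp (alg R)"
    and k: "filtered_linear P R k1" "filtered_linear P R k2" "k1 \<in> ring_hom (alg P) S" "k2 \<in> ring_hom (alg P) S"
    and eq: "\<And>i. i \<in> {1..N-1} \<Longrightarrow> k1 (gE i) = k2 (gE i)" "\<And>i. i \<in> {1..N-1} \<Longrightarrow> k1 (gF i) = k2 (gF i)"
      "\<And>i. i \<in> {1..N-1} \<Longrightarrow> k1 (gH i) = k2 (gH i)"
    and x: "x \<in> carrier (alg P)"
  shows "k1 x = k2 x"
proof (rule letters_unique[OF R S k _ x])
  fix g assume "g \<in> letters"
  then obtain i where "i \<in> {1..N-1}" "g = GE i \<or> g = GF i \<or> g = GH i" by (auto simp: letters_def)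
  then show "k1 (cls P (letter_series g)) = k2 (cls P (letter_series g))"
    using eq unfolding gE_def gF_def gH_def by blast
qed

text \<open>Evaluates a map x (x) y to f(x) g(y) on the formulas for the coproduct. Only values at 1
  are prescribed for f and g, so the antipode, which reverses products, is covered as well.\<close>

context
  fixes R :: "'p calg" and k :: "(letter list \<times> letter list) series set \<Rightarrow> 'p series set"
    and f g :: "letter list series set \<Rightarrow> 'p series set"
  assumes R: "calgebra R" and k: "induced P P R (\<lambda>x y. f x \<otimes>\<^bsub>alg R\<^esub> g y) k"
    and one: "f \<one>\<^bsub>alg P\<^esub> = \<one>\<^bsub>alg R\<^esub>" "g \<one>\<^bsub>alg P\<^esub> = \<one>\<^bsub>alg R\<^esub>"
    and fg_maps: "f \<in> carrier (alg P) \<rightarrow> carrier (alg R)" "g \<in> carrier (alg P) \<rightarrow> carrier (alg R)"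
begin

interpretation R: calgebra R by (fact R)

lemma fg: "x \<in> carrier (alg P) \<Longrightarrow> f x \<in> carrier (alg R)" "x \<in> carrier (alg P) \<Longrightarrow> g x \<in> carrier (alg R)"
  using fg_maps by blast+

lemma induced_tens: "x \<in> carrier (alg P) \<Longrightarrow> y \<in> carrier (alg P) \<Longrightarrow> k (tn x y) = f x \<otimes>\<^bsub>alg R\<^esub> g y"
  "x \<in> carrier (alg P) \<Longrightarrow> k (tn x \<one>\<^bsub>alg P\<^esub>) = f x" "x \<in> carrier (alg P) \<Longrightarrow> k (tn \<one>\<^bsub>alg P\<^esub> x) = g x"
  using inducedD(2)[OF k] one fg by simp_all

lemma induced_add: "z \<in> carrier (alg (P \<boxtimes> P)) \<Longrightarrow> w \<in> carrier (alg (P \<boxtimes> P)) \<Longrightarrow>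
    k (z \<oplus>\<^bsub>alg (P \<boxtimes> P)\<^esub> w) = k z \<oplus>\<^bsub>alg R\<^esub> k w"
  by (rule filtered_linearD(2)[OF inducedD(1)[OF k]])

lemma induced_minus: "z \<in> carrier (alg (P \<boxtimes> P)) \<Longrightarrow> w \<in> carrier (alg (P \<boxtimes> P)) \<Longrightarrow>
    k (z \<ominus>\<^bsub>alg (P \<boxtimes> P)\<^esub> smul (P \<boxtimes> P) c w) = k z \<ominus>\<^bsub>alg R\<^esub> smul R c (k w)"
proof -
  assume z: "z \<in> carrier (alg (P \<boxtimes> P))" and w: "w \<in> carrier (alg (P \<boxtimes> P))"
  note F = filtered_linearD[OF inducedD(1)[OF k]]
  note sw = PP.PQ.smul_closed[OF w, of c]
  have "z \<ominus>\<^bsub>alg (P \<boxtimes> P)\<^esub> smul (P \<boxtimes> P) c w = z \<oplus>\<^bsub>alg (P \<boxtimes> P)\<^esub> smul (P \<boxtimes> P) (-1) (smul (P \<boxtimes> P) c w)"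
    unfolding PP.PQ.smul_neg[OF sw] by (rule PP.PQ.A.minus_eq)
  then have "k (z \<ominus>\<^bsub>alg (P \<boxtimes> P)\<^esub> smul (P \<boxtimes> P) c w) = k z \<oplus>\<^bsub>alg R\<^esub> smul R (-1) (smul R c (k w))"
    by (simp only: F(2)[OF z PP.PQ.smul_closed[OF sw]] F(3)[OF sw] F(3)[OF w])
  then show ?thesis
    unfolding R.smul_neg[OF R.smul_closed[OF F(1)[OF w]]] R.A.minus_eq .
qed

lemma induced_ED: "i \<in> {1..N-1} \<Longrightarrow> k (ED i) = f (gE i) \<oplus>\<^bsub>alg R\<^esub> f (gT [^]\<^bsub>alg P\<^esub> theta N i) \<otimes>\<^bsub>alg R\<^esub> g (gE i)"
  unfolding ED_def using gens_closed(1,4)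
  by (simp only: one fg R.A.r_one R.A.l_one induced_add induced_tens PP.tens_closed C.A.one_closed C.A.nat_pow_closed)

lemma induced_FD: "i \<in> {1..N-1} \<Longrightarrow> k (FD i) = f (gF i) \<oplus>\<^bsub>alg R\<^esub> f (gV [^]\<^bsub>alg P\<^esub> theta N i) \<otimes>\<^bsub>alg R\<^esub> g (gF i)
    \<oplus>\<^bsub>alg R\<^esub> f (gT \<otimes>\<^bsub>alg P\<^esub> gHs) \<otimes>\<^bsub>alg R\<^esub> g (gG i)"
  unfolding FD_def using gens_closed(2,4,5,6) G_closed(1)
  by (simp only: one fg R.A.r_one R.A.l_one induced_add induced_tens PP.tens_closed C.A.one_closed C.A.nat_pow_closed C.A.m_closed PP.PQ.A.a_closed)

lemma induced_HD: "i \<in> {1..N-1} \<Longrightarrow> k (HD i) = f (gH i) \<oplus>\<^bsub>alg R\<^esub> g (gH i) \<ominus>\<^bsub>alg R\<^esub>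
    smul R (of_nat (theta N i) / 2) (f (\<one>\<^bsub>alg P\<^esub> \<ominus>\<^bsub>alg P\<^esub> gV \<otimes>\<^bsub>alg P\<^esub> gV) \<otimes>\<^bsub>alg R\<^esub> g gHs)"
  unfolding HD_def V2 using gens_closed(3,5,6)
  by (simp only: one fg R.A.r_one R.A.l_one induced_minus induced_add induced_tens PP.tens_closed C.A.one_closed C.A.m_closed PP.PQ.A.a_closed C.A.minus_closed)

end

lemma is_DeltaD:
  assumes "is_Delta \<Delta>"
  shows "filtered_linear P (P \<boxtimes> P) \<Delta>" "\<Delta> \<in> ring_hom (alg P) (alg (P \<boxtimes> P))"
    "i \<in> {1..N-1} \<Longrightarrow> \<Delta> (gE i) = ED i" "i \<in> {1..N-1} \<Longrightarrow> \<Delta> (gF i) = FD i" "i \<in> {1..N-1} \<Longrightarrow> \<Delta> (gH i) = HD i"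
    "i \<in> {1..N-1} \<Longrightarrow> \<Delta> (gG i) = tn (gG i) \<one>\<^bsub>alg P\<^esub> \<oplus>\<^bsub>alg (P \<boxtimes> P)\<^esub> tn gT (gG i)"
    "\<Delta> gT = tn gT gT" "\<Delta> gV = tn gV gV"
    "\<Delta> gHs = tn gHs \<one>\<^bsub>alg P\<^esub> \<oplus>\<^bsub>alg (P \<boxtimes> P)\<^esub> tn (gV \<otimes>\<^bsub>alg P\<^esub> gV) gHs"
  using assms unfolding is_Delta_def by blast+

text \<open>Both sides are expressed through the embeddings \<open>p1\<close>, \<open>p2\<close>,
  \<open>p3\<close> of the algebra into the three legs of P \<boxtimes> (P \<boxtimes> P), where
  they can be compared as homomorphisms.\<close>

lemma coassoc: assumes D: "is_Delta \<Delta>" shows "coassociative P \<Delta>"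
proof -
  note \<Delta> = is_DeltaD[OF D]
  let ?U = "alg P" and ?UU = "alg (P \<boxtimes> P)" and ?R = "alg (P \<boxtimes> P \<boxtimes> P)"
  interpret Q1: calgebra_tensor P "P \<boxtimes> P" ..
  interpret Q2: calgebra_tensor "P \<boxtimes> P" P ..
  note R3 = Q1.PQ.calgebra_axioms
  define p1 where "p1 = (\<lambda>x. tens P (P \<boxtimes> P) x \<one>\<^bsub>?UU\<^esub>)"
  define q where "q = (\<lambda>w. tens P (P \<boxtimes> P) \<one>\<^bsub>?U\<^esub> w)"
  define p2 where "p2 = (\<lambda>y. q (tn y \<one>\<^bsub>?U\<^esub>))"
  define p3 where "p3 = (\<lambda>z. q (tn \<one>\<^bsub>?U\<^esub> z))"
  have fl: "filtered_linear P (P \<boxtimes> P \<boxtimes> P) p1" "filtered_linear (P \<boxtimes> P) (P \<boxtimes> P \<boxtimes> P) q"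
    unfolding p1_def q_def by (rule Q1.tens_filtered_linear)+
  have fl23: "filtered_linear P (P \<boxtimes> P \<boxtimes> P) p2" "filtered_linear P (P \<boxtimes> P \<boxtimes> P) p3"
    unfolding p2_def p3_def by (rule filtered_linear_comp[OF PP.tens_filtered_linear(1) fl(2)], rule filtered_linear_comp[OF PP.tens_filtered_linear(2) fl(2)])
  have hm: "p1 \<in> ring_hom ?U ?R" "q \<in> ring_hom ?UU ?R"
    unfolding p1_def q_def by (rule Q1.tens_hom)+
  have hm23: "p2 \<in> ring_hom ?U ?R" "p3 \<in> ring_hom ?U ?R"
    unfolding p2_def p3_def by (rule ring_hom_comp[OF PP.tens_hom(1) hm(2)], rule ring_hom_comp[OF PP.tens_hom(2) hm(2)])
  note cl = ring_hom_closed[OF hm(1)] ring_hom_closed[OF hm(2)] ring_hom_closed[OF hm23(1)] ring_hom_closed[OF hm23(2)]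
  have p1q: "p1 x \<otimes>\<^bsub>?R\<^esub> q w = tens P (P \<boxtimes> P) x w" "q w \<otimes>\<^bsub>?R\<^esub> p1 x = tens P (P \<boxtimes> P) x w"
    if "x \<in> carrier ?U" "w \<in> carrier ?UU" for x w
    unfolding p1_def q_def by (rule Q1.tens_split[OF that])+
  have qt: "q (tn y z) = p2 y \<otimes>\<^bsub>?R\<^esub> p3 z" "p3 z \<otimes>\<^bsub>?R\<^esub> p2 y = p2 y \<otimes>\<^bsub>?R\<^esub> p3 z"
    if "y \<in> carrier ?U" "z \<in> carrier ?U" for y z
  proof -
    note m = ring_hom_mult[OF hm(2), symmetric] and c = PP.tens_closed[OF that(1) C.A.one_closed] PP.tens_closed[OF C.A.one_closed that(2)]
    show e: "q (tn y z) = p2 y \<otimes>\<^bsub>?R\<^esub> p3 z" unfolding p2_def p3_def m[OF c] PP.tens_split(1)[OF that] ..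
    show "p3 z \<otimes>\<^bsub>?R\<^esub> p2 y = p2 y \<otimes>\<^bsub>?R\<^esub> p3 z" unfolding e[symmetric] unfolding p2_def p3_def m[OF c(2,1)] PP.tens_split(2)[OF that] ..
  qed
  have c12: "p1 x \<otimes>\<^bsub>?R\<^esub> p2 y = p2 y \<otimes>\<^bsub>?R\<^esub> p1 x" and c13: "p1 x \<otimes>\<^bsub>?R\<^esub> p3 y = p3 y \<otimes>\<^bsub>?R\<^esub> p1 x"
    if xy: "x \<in> carrier ?U" "y \<in> carrier ?U" for x y
    unfolding p2_def p3_def p1q[OF xy(1) PP.tens_closed[OF xy(2) C.A.one_closed]] p1q[OF xy(1) PP.tens_closed[OF C.A.one_closed xy(2)]]
    by (rule refl)+
  \<comment> \<open>\<open>a\<close> puts the two factors of a tensor into the legs 1 and 2;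
    combined with \<open>p3\<close> it gives the associator \<open>as\<close>.\<close>
  obtain a where a: "induced P P (P \<boxtimes> P \<boxtimes> P) (\<lambda>x y. p1 x \<otimes>\<^bsub>?R\<^esub> p2 y) a"
    using PP.induced_mult[OF R3 fl(1) fl23(1)] by blast
  have ah: "a \<in> ring_hom ?UU ?R" by (rule PP.induced_mult_hom[OF R3 a hm(1) hm23(1) c12])
  note al = inducedD(1)[OF a]
  have qi: "induced P P (P \<boxtimes> P \<boxtimes> P) (\<lambda>x y. p2 x \<otimes>\<^bsub>?R\<^esub> p3 y) q"
    unfolding induced_def using fl(2) qt(1) by blast
  obtain as where as: "induced (P \<boxtimes> P) P (P \<boxtimes> P \<boxtimes> P) (\<lambda>w z. a w \<otimes>\<^bsub>?R\<^esub> p3 z) as"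
    using Q2.induced_mult[OF R3 al fl23(2)] by blast
  have ac: "a w \<otimes>\<^bsub>?R\<^esub> p3 z = p3 z \<otimes>\<^bsub>?R\<^esub> a w" if w: "w \<in> carrier ?UU" and z: "z \<in> carrier ?U" for w z
  proof (rule PP.commute_dense[OF R3 al cl(4)[OF z] _ w])
    fix x y assume xy: "x \<in> carrier ?U" "y \<in> carrier ?U"
    show "a (tn x y) \<otimes>\<^bsub>?R\<^esub> p3 z = p3 z \<otimes>\<^bsub>?R\<^esub> a (tn x y)"
      unfolding inducedD(2)[OF a xy]
      by (rule Q1.PQ.A.commute_mult[OF c13[OF xy(1) z, symmetric] qt(2)[OF xy(2) z] cl(4)[OF z] cl(1)[OF xy(1)] cl(3)[OF xy(2)], symmetric])
  qed
  have ash: "as \<in> ring_hom (alg ((P \<boxtimes> P) \<boxtimes> P)) ?R" by (rule Q2.induced_mult_hom[OF R3 as ah hm23(2) ac])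
  note D1 = filtered_linear_comp[OF \<Delta>(1) Q2.tens_filtered_linear(1)] and D1h = ring_hom_comp[OF \<Delta>(2) Q2.tens_hom(1)]
  have \<Delta>c: "\<Delta> x \<in> carrier ?UU" if "x \<in> carrier ?U" for x by (rule ring_hom_closed[OF \<Delta>(2) that])
  \<comment> \<open>\<open>B\<close> applies the coproduct to the first tensor factor; its
    counterpart for the second factor is \<open>B2\<close>.\<close>
  obtain B where B: "induced P P ((P \<boxtimes> P) \<boxtimes> P) (\<lambda>x y. tens (P \<boxtimes> P) P (\<Delta> x) \<one>\<^bsub>?U\<^esub> \<otimes>\<^bsub>alg ((P \<boxtimes> P) \<boxtimes> P)\<^esub> tens (P \<boxtimes> P) P \<one>\<^bsub>?UU\<^esub> y) B"
    using PP.induced_mult[OF Q2.PQ.calgebra_axioms D1 Q2.tens_filtered_linear(2)] by blast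
  have Bh: "B \<in> ring_hom ?UU (alg ((P \<boxtimes> P) \<boxtimes> P))"
    by (rule PP.induced_mult_hom[OF Q2.PQ.calgebra_axioms B D1h Q2.tens_hom(2)]) (simp only: Q2.tens_split \<Delta>c)
  have B': "induced P P ((P \<boxtimes> P) \<boxtimes> P) (\<lambda>x y. tens (P \<boxtimes> P) P (\<Delta> x) y) B"
    by (rule induced_cong[OF B]) (simp only: Q2.tens_split \<Delta>c)
  note qD = filtered_linear_comp[OF \<Delta>(1) fl(2)] and qDh = ring_hom_comp[OF \<Delta>(2) hm(2)]
  obtain B2 where B2: "induced P P (P \<boxtimes> P \<boxtimes> P) (\<lambda>x y. p1 x \<otimes>\<^bsub>?R\<^esub> q (\<Delta> y)) B2"
    using PP.induced_mult[OF R3 fl(1) qD] by blast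
  have B2h: "B2 \<in> ring_hom ?UU ?R"
    by (rule PP.induced_mult_hom[OF R3 B2 hm(1) qDh]) (simp only: p1q \<Delta>c)
  have B2': "induced P P (P \<boxtimes> P \<boxtimes> P) (\<lambda>x y. tens P (P \<boxtimes> P) x (\<Delta> y)) B2"
    by (rule induced_cong[OF B2]) (simp only: p1q \<Delta>c)
  define B1 where "B1 = (\<lambda>w. as (B w))"
  have B1: "induced P P (P \<boxtimes> P \<boxtimes> P) (\<lambda>x y. a (\<Delta> x) \<otimes>\<^bsub>?R\<^esub> p3 y) B1"
    unfolding induced_def B1_def
  proof (intro conjI ballI)
    show "filtered_linear (P \<boxtimes> P) (P \<boxtimes> P \<boxtimes> P) (\<lambda>w. as (B w))"
      by (rule filtered_linear_comp[OF inducedD(1)[OF B] inducedD(1)[OF as]])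
    fix x y assume xy: "x \<in> carrier ?U" "y \<in> carrier ?U"
    show "as (B (tn x y)) = a (\<Delta> x) \<otimes>\<^bsub>?R\<^esub> p3 y"
      unfolding inducedD(2)[OF B' xy] by (rule inducedD(2)[OF as \<Delta>c[OF xy(1)] xy(2)])
  qed
  have B1h: "B1 \<in> ring_hom ?UU ?R" unfolding B1_def by (rule ring_hom_comp[OF Bh ash])
  have aDh: "(\<lambda>x. a (\<Delta> x)) \<in> ring_hom ?U ?R" by (rule ring_hom_comp[OF \<Delta>(2) ah])
  interpret \<Delta>: ring_hom_ring ?U ?UU \<Delta> by (rule ring_hom_ringI2[OF C.A.ring_axioms PP.PQ.A.ring_axioms \<Delta>(2)])
  interpret a: ring_hom_ring ?UU ?R a by (rule ring_hom_ringI2[OF PP.PQ.A.ring_axioms Q1.PQ.A.ring_axioms ah])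
  interpret p1: ring_hom_ring ?U ?R p1 by (rule ring_hom_ringI2[OF C.A.ring_axioms Q1.PQ.A.ring_axioms hm(1)])
  interpret p2: ring_hom_ring ?U ?R p2 by (rule ring_hom_ringI2[OF C.A.ring_axioms Q1.PQ.A.ring_axioms hm23(1)])
  interpret p3: ring_hom_ring ?U ?R p3 by (rule ring_hom_ringI2[OF C.A.ring_axioms Q1.PQ.A.ring_axioms hm23(2)])
  note g = gens_closed(4-6)
  have V2c: "gV \<otimes>\<^bsub>?U\<^esub> gV \<in> carrier ?U" "gT \<otimes>\<^bsub>?U\<^esub> gHs \<in> carrier ?U" using g by simp_all
  note a1 = induced_tens[OF R3 a ring_hom_one[OF hm(1)] ring_hom_one[OF hm23(1)] ring_hom_funcset[OF hm(1)] ring_hom_funcset[OF hm23(1)]]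
  note aD = induced_ED[OF R3 a ring_hom_one[OF hm(1)] ring_hom_one[OF hm23(1)] ring_hom_funcset[OF hm(1)] ring_hom_funcset[OF hm23(1)]]
    induced_FD[OF R3 a ring_hom_one[OF hm(1)] ring_hom_one[OF hm23(1)] ring_hom_funcset[OF hm(1)] ring_hom_funcset[OF hm23(1)]]
    induced_HD[OF R3 a ring_hom_one[OF hm(1)] ring_hom_one[OF hm23(1)] ring_hom_funcset[OF hm(1)] ring_hom_funcset[OF hm23(1)]]
  note q1 = induced_tens[OF R3 qi ring_hom_one[OF hm23(1)] ring_hom_one[OF hm23(2)] ring_hom_funcset[OF hm23(1)] ring_hom_funcset[OF hm23(2)]]
  note qD' = induced_ED[OF R3 qi ring_hom_one[OF hm23(1)] ring_hom_one[OF hm23(2)] ring_hom_funcset[OF hm23(1)] ring_hom_funcset[OF hm23(2)]]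
    induced_FD[OF R3 qi ring_hom_one[OF hm23(1)] ring_hom_one[OF hm23(2)] ring_hom_funcset[OF hm23(1)] ring_hom_funcset[OF hm23(2)]]
    induced_HD[OF R3 qi ring_hom_one[OF hm23(1)] ring_hom_one[OF hm23(2)] ring_hom_funcset[OF hm23(1)] ring_hom_funcset[OF hm23(2)]]
  note B1D = induced_ED[OF R3 B1 ring_hom_one[OF aDh] ring_hom_one[OF hm23(2)] ring_hom_funcset[OF aDh] ring_hom_funcset[OF hm23(2)]]
    induced_FD[OF R3 B1 ring_hom_one[OF aDh] ring_hom_one[OF hm23(2)] ring_hom_funcset[OF aDh] ring_hom_funcset[OF hm23(2)]]
    induced_HD[OF R3 B1 ring_hom_one[OF aDh] ring_hom_one[OF hm23(2)] ring_hom_funcset[OF aDh] ring_hom_funcset[OF hm23(2)]]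
  note B2D = induced_ED[OF R3 B2 ring_hom_one[OF hm(1)] ring_hom_one[OF qDh] ring_hom_funcset[OF hm(1)] ring_hom_funcset[OF qDh]]
    induced_FD[OF R3 B2 ring_hom_one[OF hm(1)] ring_hom_one[OF qDh] ring_hom_funcset[OF hm(1)] ring_hom_funcset[OF qDh]]
    induced_HD[OF R3 B2 ring_hom_one[OF hm(1)] ring_hom_one[OF qDh] ring_hom_funcset[OF hm(1)] ring_hom_funcset[OF qDh]]
  have pw: "a (\<Delta> (x [^]\<^bsub>?U\<^esub> n)) = p1 (x [^]\<^bsub>?U\<^esub> n) \<otimes>\<^bsub>?R\<^esub> p2 (x [^]\<^bsub>?U\<^esub> n)"
    if x: "x \<in> carrier ?U" "\<Delta> x = tn x x" for x and n :: nat
    unfolding \<Delta>.hom_nat_pow[OF x(1)] x(2) PP.tens_pow[OF x(1) x(1)]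
    by (rule a1(1)[OF C.A.nat_pow_closed[OF x(1)] C.A.nat_pow_closed[OF x(1)]])
  have VVc: "a (\<Delta> (\<one>\<^bsub>?U\<^esub> \<ominus>\<^bsub>?U\<^esub> gV \<otimes>\<^bsub>?U\<^esub> gV)) = \<one>\<^bsub>?R\<^esub> \<ominus>\<^bsub>?R\<^esub> p1 (gV \<otimes>\<^bsub>?U\<^esub> gV) \<otimes>\<^bsub>?R\<^esub> p2 (gV \<otimes>\<^bsub>?U\<^esub> gV)"
    unfolding \<Delta>.hom_minus[OF C.A.one_closed V2c(1)] \<Delta>.hom_mult[OF g(2,2)] \<Delta>(8) PP.tens_mult[OF g(2,2,2,2)]
      a.hom_minus[OF PP.PQ.A.one_closed PP.tens_closed[OF V2c(1,1)]] a1(1)[OF V2c(1,1)]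
      \<Delta>.hom_one a.hom_one ..
  \<comment> \<open>By T V^2 = V the coproduct of T Hs is T Hs (x) T + V (x) T Hs.\<close>
  have THs: "a (\<Delta> (gT \<otimes>\<^bsub>?U\<^esub> gHs)) = p1 (gT \<otimes>\<^bsub>?U\<^esub> gHs) \<otimes>\<^bsub>?R\<^esub> p2 gT \<oplus>\<^bsub>?R\<^esub> p1 gV \<otimes>\<^bsub>?R\<^esub> p2 (gT \<otimes>\<^bsub>?U\<^esub> gHs)"
  proof -
    have "\<Delta> (gT \<otimes>\<^bsub>?U\<^esub> gHs) = tn (gT \<otimes>\<^bsub>?U\<^esub> gHs) gT \<oplus>\<^bsub>?UU\<^esub> tn gV (gT \<otimes>\<^bsub>?U\<^esub> gHs)"
      unfolding \<Delta>.hom_mult[OF g(1,3)] \<Delta>(7,9)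
        PP.PQ.A.r_distr[OF PP.tens_closed[OF g(3) C.A.one_closed] PP.tens_closed[OF V2c(1) g(3)] PP.tens_closed[OF g(1,1)]]
        PP.tens_mult[OF g(1,3) g(1) C.A.one_closed] PP.tens_mult[OF g(1) V2c(1) g(1,3)] TVV C.A.r_one[OF g(1)] ..
    then show ?thesis
      by (simp only: a.hom_add[OF PP.tens_closed[OF V2c(2) g(1)] PP.tens_closed[OF g(2) V2c(2)]] a1(1)[OF V2c(2) g(1)] a1(1)[OF g(2) V2c(2)])
  qed
  have p1V: "p1 (\<one>\<^bsub>?U\<^esub> \<ominus>\<^bsub>?U\<^esub> gV \<otimes>\<^bsub>?U\<^esub> gV) = \<one>\<^bsub>?R\<^esub> \<ominus>\<^bsub>?R\<^esub> p1 (gV \<otimes>\<^bsub>?U\<^esub> gV)"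
    "p2 (\<one>\<^bsub>?U\<^esub> \<ominus>\<^bsub>?U\<^esub> gV \<otimes>\<^bsub>?U\<^esub> gV) = \<one>\<^bsub>?R\<^esub> \<ominus>\<^bsub>?R\<^esub> p2 (gV \<otimes>\<^bsub>?U\<^esub> gV)"
    by (simp_all only: p1.hom_minus[OF C.A.one_closed V2c(1)] p1.hom_one p2.hom_minus[OF C.A.one_closed V2c(1)] p2.hom_one)
  have qHs: "q (\<Delta> gHs) = p2 gHs \<oplus>\<^bsub>?R\<^esub> p2 (gV \<otimes>\<^bsub>?U\<^esub> gV) \<otimes>\<^bsub>?R\<^esub> p3 gHs"
    unfolding \<Delta>(9) filtered_linearD(2)[OF fl(2) PP.tens_closed[OF g(3) C.A.one_closed] PP.tens_closed[OF V2c(1) g(3)]]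
      q1(1)[OF V2c(1) g(3)] q1(2)[OF g(3)] ..
  have qG: "q (\<Delta> (gG i)) = p2 (gG i) \<oplus>\<^bsub>?R\<^esub> p2 gT \<otimes>\<^bsub>?R\<^esub> p3 (gG i)" if i: "i \<in> {1..N-1}" for i
    unfolding \<Delta>(6)[OF i] filtered_linearD(2)[OF fl(2) PP.tens_closed[OF G_closed(1)[OF i] C.A.one_closed] PP.tens_closed[OF g(1) G_closed(1)[OF i]]]
      q1(1)[OF g(1) G_closed(1)[OF i]] q1(2)[OF G_closed(1)[OF i]] ..
  have co: "as (B (\<Delta> x)) = B2 (\<Delta> x)" if x: "x \<in> carrier ?U" for x
    unfolding B1_def[symmetric, THEN fun_cong]
  proof (rule letters_unique_gens[OF R3 disjI1[OF refl] filtered_linear_comp[OF \<Delta>(1) inducedD(1)[OF B1]]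
        filtered_linear_comp[OF \<Delta>(1) inducedD(1)[OF B2]] ring_hom_comp[OF \<Delta>(2) B1h] ring_hom_comp[OF \<Delta>(2) B2h] _ _ _ x])
    fix i assume i: "i \<in> {1..N-1}"
    note gi = gens_closed(1-3)[OF i] G_closed(1)[OF i]
    have pc: "gT [^]\<^bsub>?U\<^esub> theta N i \<in> carrier ?U" "gV [^]\<^bsub>?U\<^esub> theta N i \<in> carrier ?U" using g by simp_all
    show "B1 (\<Delta> (gE i)) = B2 (\<Delta> (gE i))"
      unfolding \<Delta>(3)[OF i] B1D(1)[OF i] B2D(1)[OF i] unfolding \<Delta>(3)[OF i] aD(1)[OF i] qD'(1)[OF i] pw[OF g(1) \<Delta>(7)]
      by (rule Q1.PQ.A.coassoc_E) (use cl gi pc in simp)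
    \<comment> \<open>V and V^theta_i differ only at interior nodes, where G_i is zero.\<close>
    have w: "p1 gV \<otimes>\<^bsub>?R\<^esub> (p2 (gT \<otimes>\<^bsub>?U\<^esub> gHs) \<otimes>\<^bsub>?R\<^esub> p3 (gG i)) = p1 (gV [^]\<^bsub>?U\<^esub> theta N i) \<otimes>\<^bsub>?R\<^esub> (p2 (gT \<otimes>\<^bsub>?U\<^esub> gHs) \<otimes>\<^bsub>?R\<^esub> p3 (gG i))"
      using theta_cases[OF i]
    proof
      assume t: "theta N i = 1"
      show ?thesis unfolding t C.A.nat_pow_eone[OF g(2)] ..
    next
      assume t: "theta N i = 0 \<and> \<lbrakk>gF i, gT\<rbrakk>\<^bsub>?U\<^esub> = \<zero>\<^bsub>?U\<^esub>"
      then have "gG i = \<zero>\<^bsub>?U\<^esub>" unfolding gG_def using g(2) by simp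
      moreover have "p3 \<zero>\<^bsub>?U\<^esub> = \<zero>\<^bsub>?R\<^esub>"
        by (rule p3.hom_zero)
      ultimately show ?thesis using cl(1)[OF g(2)] cl(1)[OF pc(2)] cl(3)[OF V2c(2)] by (simp only: Q1.PQ.A.r_null)
    qed
    show "B1 (\<Delta> (gF i)) = B2 (\<Delta> (gF i))"
      unfolding \<Delta>(4)[OF i] B1D(2)[OF i] B2D(2)[OF i] unfolding \<Delta>(4)[OF i] aD(2)[OF i] qD'(2)[OF i] pw[OF g(2) \<Delta>(8)] THs qG[OF i]
      by (rule Q1.PQ.A.coassoc_F[OF _ w]) (use cl gi pc g V2c in simp)
    show "B1 (\<Delta> (gH i)) = B2 (\<Delta> (gH i))"
      unfolding \<Delta>(5)[OF i] B1D(3)[OF i] B2D(3)[OF i] unfolding \<Delta>(5)[OF i] aD(3)[OF i] qD'(3)[OF i] VVc p1V qHs smul_def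
      by (rule Q1.PQ.A.coassoc_H) (use cl gi pc g V2c cembD(1)[OF Q1.PQ.cemb_scalar] in simp)
  qed
  have asc: "as (tens (P \<boxtimes> P) P (tn x y) z) = tens P (P \<boxtimes> P) x (tn y z)"
    if c: "x \<in> carrier ?U" "y \<in> carrier ?U" "z \<in> carrier ?U" for x y z
    unfolding inducedD(2)[OF as PP.tens_closed[OF c(1,2)] c(3)] inducedD(2)[OF a c(1,2)]
      Q1.PQ.A.m_assoc[OF cl(1)[OF c(1)] cl(3)[OF c(2)] cl(4)[OF c(3)]] qt(1)[OF c(2,3), symmetric]
    by (rule p1q(1)[OF c(1) PP.tens_closed[OF c(2,3)]])
  show ?thesis
    unfolding coassociative_def
    by (rule exI[of _ B], rule exI[of _ B2], rule exI[of _ as])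
      (intro conjI ballI B' B2' inducedD(1)[OF as] asc co)
qed

end

section \<open>The counit and antipode axioms\<close>

lemma (in ring) antipode_F1:
  assumes "{a, A, V, L} \<subseteq> carrier R"
  shows "(\<ominus> a \<oplus> A \<otimes> (V \<otimes> V) \<otimes> L) \<oplus> a \<oplus> (\<ominus> A \<otimes> V) \<otimes> (V \<otimes> L) = \<zero>"
proof -
  have e: "(\<ominus> A \<otimes> V) \<otimes> (V \<otimes> L) = \<ominus> (A \<otimes> (V \<otimes> V) \<otimes> L)" using assms by (simp add: l_minus m_assoc)
  show ?thesis unfolding e by (rule cancel_ab) (use assms in simp_all)
qed

lemma (in ring) cancel_ba: "a \<in> carrier R \<Longrightarrow> b \<in> carrier R \<Longrightarrow> a \<oplus> (\<ominus> a \<oplus> b) \<oplus> \<ominus> b = \<zero>"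
  by (simp add: r_neg2 r_neg)

context jord
begin

lemma is_epsD:
  assumes "is_eps \<epsilon>"
  shows "\<epsilon> \<in> ring_hom (alg P) (type_ring :: complex ring)" "\<epsilon> (scalar P c) = c" "x \<in> fil P 1 \<Longrightarrow> \<epsilon> x = 0"
    "i \<in> {1..N-1} \<Longrightarrow> \<epsilon> (gE i) = 0" "i \<in> {1..N-1} \<Longrightarrow> \<epsilon> (gF i) = 0" "i \<in> {1..N-1} \<Longrightarrow> \<epsilon> (gH i) = 0"
    "\<epsilon> gT = 1" "\<epsilon> gV = 1"
  using assms unfolding is_eps_def by blast+

lemma scalar_0: "scalar P 0 = \<zero>\<^bsub>alg P\<^esub>"
proof -
  have "scalar P 0 = scalar P 0 \<oplus>\<^bsub>alg P\<^esub> scalar P 0"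
    using cembD(2)[OF C.cemb_scalar, of 0 0] by simp
  then show ?thesis
    using cembD(1)[OF C.cemb_scalar, of 0] by (metis C.A.add.r_cancel_one')
qed

lemma scalar_hom: "scalar P \<in> ring_hom (type_ring :: complex ring) (alg P)"
  by (rule ring_hom_memI) (simp_all add: cembD(1-4)[OF C.cemb_scalar])

context
  fixes \<epsilon> assumes eps: "is_eps \<epsilon>"
begin

text \<open>The unit of the convolution product: the counit followed by the inclusion of the
  scalars. With it the counit axiom concerns products of two homomorphisms of the algebra.\<close>

definition "phi = (\<lambda>x. scalar P (\<epsilon> x))"

lemma phi_hom: "phi \<in> ring_hom (alg P) (alg P)"
  unfolding phi_def by (rule ring_hom_comp[OF is_epsD(1)[OF eps] scalar_hom])

lemma phi_closed: "x \<in> carrier (alg P) \<Longrightarrow> phi x \<in> carrier (alg P)"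
  by (rule ring_hom_closed[OF phi_hom])

text \<open>Scalars lie in degree 0, so only positive n needs an argument, and there the counit
  vanishes.\<close>

lemma phi_linear: "filtered_linear P P phi"
  unfolding filtered_linear_def
proof (intro conjI allI ballI)
  note h = phi_hom
  show "phi \<in> carrier (alg P) \<rightarrow> carrier (alg P)" by (rule ring_hom_funcset[OF h])
  show "phi (x \<oplus>\<^bsub>alg P\<^esub> y) = phi x \<oplus>\<^bsub>alg P\<^esub> phi y" if "x \<in> carrier (alg P)" "y \<in> carrier (alg P)" for x y
    by (rule ring_hom_add[OF h that])
  show "phi (smul P c x) = smul P c (phi x)" if "x \<in> carrier (alg P)" for c x
    unfolding smul_def ring_hom_mult[OF h cembD(1)[OF C.cemb_scalar] that]
    by (simp add: phi_def is_epsD(2)[OF eps])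
  show "phi ` fil P n \<subseteq> fil P n" for n
  proof
    fix y assume "y \<in> phi ` fil P n"
    then obtain x where x: "x \<in> fil P n" "y = phi x" by blast
    show "y \<in> fil P n"
    proof (cases "n \<le> 0")
      case True
      then show ?thesis unfolding x(2) phi_def by (rule C.fil_mono[OF C.fil_scalar])
    next
      case False
      then have "x \<in> fil P 1" by (intro C.fil_mono[OF x(1)]) simp
      then show ?thesis unfolding x(2) phi_def by (simp add: is_epsD(3)[OF eps] scalar_0 C.fil_zero)
    qed
  qed
qed

lemma phi_gens: "i \<in> {1..N-1} \<Longrightarrow> phi (gE i) = \<zero>\<^bsub>alg P\<^esub>" "i \<in> {1..N-1} \<Longrightarrow> phi (gF i) = \<zero>\<^bsub>alg P\<^esub>"
  "i \<in> {1..N-1} \<Longrightarrow> phi (gH i) = \<zero>\<^bsub>alg P\<^esub>" "phi gT = \<one>\<^bsub>alg P\<^esub>" "phi gV = \<one>\<^bsub>alg P\<^esub>"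
  by (simp_all add: phi_def is_epsD[OF eps] scalar_0 cembD(4)[OF C.cemb_scalar])

lemma phi_derived: "phi (gT [^]\<^bsub>alg P\<^esub> (n::nat)) = \<one>\<^bsub>alg P\<^esub>" "phi (gV [^]\<^bsub>alg P\<^esub> n) = \<one>\<^bsub>alg P\<^esub>"
  "phi gHs = \<zero>\<^bsub>alg P\<^esub>" "i \<in> {1..N-1} \<Longrightarrow> phi (gG i) = \<zero>\<^bsub>alg P\<^esub>" "phi (gT \<otimes>\<^bsub>alg P\<^esub> gHs) = \<zero>\<^bsub>alg P\<^esub>"
  "phi (\<one>\<^bsub>alg P\<^esub> \<ominus>\<^bsub>alg P\<^esub> gV \<otimes>\<^bsub>alg P\<^esub> gV) = \<zero>\<^bsub>alg P\<^esub>"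
proof -
  interpret f: ring_hom_ring "alg P" "alg P" phi
    by (rule ring_hom_ringI2[OF C.A.ring_axioms C.A.ring_axioms phi_hom])
  note g = gens_closed(4-6)
  show "phi (gT [^]\<^bsub>alg P\<^esub> n) = \<one>\<^bsub>alg P\<^esub>" "phi (gV [^]\<^bsub>alg P\<^esub> n) = \<one>\<^bsub>alg P\<^esub>"
    unfolding f.hom_nat_pow[OF g(1)] f.hom_nat_pow[OF g(2)] phi_gens by (rule C.A.nat_pow_one)+
  have "finsum (alg P) (\<lambda>i. phi (gH i)) {1..N-1} = finsum (alg P) (\<lambda>i. \<zero>\<^bsub>alg P\<^esub>) {1..N-1}"
    by (rule C.A.finsum_cong') (simp_all add: phi_gens(3))
  then show Hs: "phi gHs = \<zero>\<^bsub>alg P\<^esub>"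
    unfolding hom_Hs[OF C.A.ring_axioms phi_hom] C.A.finsum_zero .
  show "phi (gT \<otimes>\<^bsub>alg P\<^esub> gHs) = \<zero>\<^bsub>alg P\<^esub>"
    unfolding f.hom_mult[OF g(1,3)] Hs by (rule C.A.r_null[OF phi_closed[OF g(1)]])
  have VV: "gV \<otimes>\<^bsub>alg P\<^esub> gV \<in> carrier (alg P)" using g by simp
  show "phi (\<one>\<^bsub>alg P\<^esub> \<ominus>\<^bsub>alg P\<^esub> gV \<otimes>\<^bsub>alg P\<^esub> gV) = \<zero>\<^bsub>alg P\<^esub>"
    unfolding f.hom_minus[OF C.A.one_closed VV] f.hom_mult[OF g(2,2)] phi_gens f.hom_one
    by (simp add: C.A.minus_eq C.A.r_neg)
  assume i: "i \<in> {1..N-1}"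
  have "phi (\<lbrakk>gF i, gT\<rbrakk>\<^bsub>alg P\<^esub>) = \<lbrakk>phi (gF i), phi gT\<rbrakk>\<^bsub>alg P\<^esub>"
    by (rule f.hom_lie[OF gens_closed(2)[OF i] g(1)])
  also have "\<dots> = \<zero>\<^bsub>alg P\<^esub>"
    unfolding phi_gens(2)[OF i] phi_gens(4) lie_def by (simp add: C.A.minus_eq)
  finally have "phi (\<lbrakk>gF i, gT\<rbrakk>\<^bsub>alg P\<^esub>) = \<zero>\<^bsub>alg P\<^esub>" .
  then show "phi (gG i) = \<zero>\<^bsub>alg P\<^esub>"
    unfolding gG_def f.hom_mult[OF g(2) G_closed(2)[OF i]] using phi_closed[OF g(2)] by simp
qed

lemma counit: assumes D: "is_Delta \<Delta>" shows "counital P \<Delta> \<epsilon>"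
proof -
  note \<Delta> = is_DeltaD[OF D]
  note fh = phi_hom and fi = id_hom
  have com: "phi x \<otimes>\<^bsub>alg P\<^esub> y = y \<otimes>\<^bsub>alg P\<^esub> phi x" if "y \<in> carrier (alg P)" for x y
    unfolding phi_def by (rule cembD(5)[OF C.cemb_scalar that])
  obtain k1 where k1: "induced P P P (\<lambda>x y. phi x \<otimes>\<^bsub>alg P\<^esub> y) k1"
    using PP.induced_mult[OF calgebra_P phi_linear filtered_linear_id] by blast
  obtain k2 where k2: "induced P P P (\<lambda>x y. x \<otimes>\<^bsub>alg P\<^esub> phi y) k2"
    using PP.induced_mult[OF calgebra_P filtered_linear_id phi_linear] by blast
  have h1: "k1 \<in> ring_hom (alg (P \<boxtimes> P)) (alg P)"
    by (rule PP.induced_mult_hom[OF calgebra_P k1 fh fi]) (rule com)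
  have h2: "k2 \<in> ring_hom (alg (P \<boxtimes> P)) (alg P)"
    by (rule PP.induced_mult_hom[OF calgebra_P k2 fi fh]) (rule com[symmetric])
  note d1 = induced_ED[OF calgebra_P k1 ring_hom_one[OF fh] refl ring_hom_funcset[OF fh] ring_hom_funcset[OF fi]]
    induced_FD[OF calgebra_P k1 ring_hom_one[OF fh] refl ring_hom_funcset[OF fh] ring_hom_funcset[OF fi]]
    induced_HD[OF calgebra_P k1 ring_hom_one[OF fh] refl ring_hom_funcset[OF fh] ring_hom_funcset[OF fi]]
  note d2 = induced_ED[OF calgebra_P k2 refl ring_hom_one[OF fh] ring_hom_funcset[OF fi] ring_hom_funcset[OF fh]]
    induced_FD[OF calgebra_P k2 refl ring_hom_one[OF fh] ring_hom_funcset[OF fi] ring_hom_funcset[OF fh]]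
    induced_HD[OF calgebra_P k2 refl ring_hom_one[OF fh] ring_hom_funcset[OF fi] ring_hom_funcset[OF fh]]
  note g = gens_closed(4-6)
  have c: "gT [^]\<^bsub>alg P\<^esub> (n::nat) \<in> carrier (alg P)" "gV [^]\<^bsub>alg P\<^esub> n \<in> carrier (alg P)"
    "gT \<otimes>\<^bsub>alg P\<^esub> gHs \<in> carrier (alg P)" "\<one>\<^bsub>alg P\<^esub> \<ominus>\<^bsub>alg P\<^esub> gV \<otimes>\<^bsub>alg P\<^esub> gV \<in> carrier (alg P)" for n
    using g by simp_all
  note z = C.A.l_null C.A.r_null C.A.l_zero C.A.r_zero C.A.l_one C.A.r_one C.smul_0 C.A.minus_eq C.A.minus_zero C.A.zero_closed
    phi_gens phi_derived gens_closed G_closed c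
  have 1: "k1 (\<Delta> x) = x" if x: "x \<in> carrier (alg P)" for x
  proof (rule letters_unique_gens[OF calgebra_P disjI1[OF refl] filtered_linear_comp[OF \<Delta>(1) inducedD(1)[OF k1]]
        filtered_linear_id ring_hom_comp[OF \<Delta>(2) h1] id_hom _ _ _ x])
    fix i assume i: "i \<in> {1..N-1}"
    show "k1 (\<Delta> (gE i)) = gE i" unfolding \<Delta>(3)[OF i] d1(1)[OF i] using i by (simp only: z)
    show "k1 (\<Delta> (gF i)) = gF i" unfolding \<Delta>(4)[OF i] d1(2)[OF i] using i by (simp only: z)
    have "phi (\<one>\<^bsub>alg P\<^esub> \<ominus>\<^bsub>alg P\<^esub> gV \<otimes>\<^bsub>alg P\<^esub> gV) \<otimes>\<^bsub>alg P\<^esub> gHs = \<zero>\<^bsub>alg P\<^esub>"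
      unfolding phi_derived(6) by (rule C.A.l_null[OF g(3)])
    then show "k1 (\<Delta> (gH i)) = gH i" unfolding \<Delta>(5)[OF i] d1(3)[OF i] using i
      by (simp only: z(7-) z(1-6))
  qed
  have 2: "k2 (\<Delta> x) = x" if x: "x \<in> carrier (alg P)" for x
  proof (rule letters_unique_gens[OF calgebra_P disjI1[OF refl] filtered_linear_comp[OF \<Delta>(1) inducedD(1)[OF k2]]
        filtered_linear_id ring_hom_comp[OF \<Delta>(2) h2] id_hom _ _ _ x])
    fix i assume i: "i \<in> {1..N-1}"
    show "k2 (\<Delta> (gE i)) = gE i" unfolding \<Delta>(3)[OF i] d2(1)[OF i] using i by (simp only: z)
    show "k2 (\<Delta> (gF i)) = gF i" unfolding \<Delta>(4)[OF i] d2(2)[OF i] using i by (simp only: z)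
    have "(\<one>\<^bsub>alg P\<^esub> \<ominus>\<^bsub>alg P\<^esub> gV \<otimes>\<^bsub>alg P\<^esub> gV) \<otimes>\<^bsub>alg P\<^esub> phi gHs = \<zero>\<^bsub>alg P\<^esub>"
      unfolding phi_derived(3) by (rule C.A.r_null[OF c(4)])
    then show "k2 (\<Delta> (gH i)) = gH i" unfolding \<Delta>(5)[OF i] d2(3)[OF i] using i
      by (simp only: z(7-) z(1-6))
  qed
  have i1: "induced P P P (\<lambda>x y. smul P (\<epsilon> x) y) k1"
    using k1 unfolding phi_def smul_def .
  have i2: "induced P P P (\<lambda>x y. smul P (\<epsilon> y) x) k2"
    by (rule induced_cong[OF k2]) (simp only: com[symmetric], simp only: phi_def smul_def)
  show ?thesis
    unfolding counital_def by (intro exI[of _ k1] exI[of _ k2] conjI ballI i1 i2 1 2)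
qed

text \<open>Here \<open>k\<close> is to be multiplication after S (x) id or id (x) S, which is not a
  homomorphism. The hypothesis \<open>mult\<close> replaces multiplicativity at elements with scalar
  value, and this carries the induction over words.\<close>

lemma scalar_eps_multiplicative:
  assumes D: "is_Delta \<Delta>" and k: "filtered_linear (P \<boxtimes> P) P k" and one: "k \<one>\<^bsub>alg (P \<boxtimes> P)\<^esub> = \<one>\<^bsub>alg P\<^esub>"
    and mult: "\<And>z w e e'. \<lbrakk>z \<in> carrier (alg (P \<boxtimes> P)); w \<in> carrier (alg (P \<boxtimes> P)); k z = scalar P e; k w = scalar P e'\<rbrakk>
      \<Longrightarrow> k (z \<otimes>\<^bsub>alg (P \<boxtimes> P)\<^esub> w) = scalar P (e * e')"
    and gens: "\<And>i. i \<in> {1..N-1} \<Longrightarrow> k (ED i) = \<zero>\<^bsub>alg P\<^esub>" "\<And>i. i \<in> {1..N-1} \<Longrightarrow> k (FD i) = \<zero>\<^bsub>alg P\<^esub>"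
      "\<And>i. i \<in> {1..N-1} \<Longrightarrow> k (HD i) = \<zero>\<^bsub>alg P\<^esub>"
    and x: "x \<in> carrier (alg P)"
  shows "k (\<Delta> x) = scalar P (\<epsilon> x)"
proof -
  note \<Delta> = is_DeltaD[OF D]
  interpret T: calgebra_pair P P ..
  have l: "k (\<Delta> (cls P (letter_series g))) = scalar P (\<epsilon> (cls P (letter_series g)))" if g: "g \<in> letters" for g
  proof -
    obtain i where i: "i \<in> {1..N-1}" "g = GE i \<or> g = GF i \<or> g = GH i" using g by (auto simp: letters_def)
    have "k (\<Delta> (gE i)) = scalar P (\<epsilon> (gE i))" "k (\<Delta> (gF i)) = scalar P (\<epsilon> (gF i))" "k (\<Delta> (gH i)) = scalar P (\<epsilon> (gH i))"
      by (simp_all only: \<Delta>(3-5)[OF i(1)] gens[OF i(1)] is_epsD(4-6)[OF eps i(1)] scalar_0)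
    then show ?thesis using i(2) unfolding gE_def gF_def gH_def by blast
  qed
  have w: "k (\<Delta> (cls P (W.delta w))) = scalar P (\<epsilon> (cls P (W.delta w)))" if "w \<in> lists letters" for w
    using that
  proof (induction w)
    case Nil
    have "cls P (W.delta []) = \<one>\<^bsub>alg P\<^esub>" using C.cls.hom_one by (simp add: W.one_delta)
    then show ?case
      by (simp only: ring_hom_one[OF \<Delta>(2)] ring_hom_one[OF is_epsD(1)[OF eps]] one type_ring_simps cembD(4)[OF C.cemb_scalar])
  next
    case (Cons g w)
    have gw: "W.delta [g] \<in> carrier W.Sr" "W.delta w \<in> carrier W.Sr" using Cons by (simp_all add: P_carrier)
    note gc = C.cls.hom_closed[OF gw(1)] C.cls.hom_closed[OF gw(2)]
    have "W.delta (g # w) = W.delta [g] \<otimes>\<^bsub>W.Sr\<^esub> W.delta w" using Cons by (simp add: W.delta_mult P_carrier)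
    then have e: "cls P (W.delta (g # w)) = cls P (W.delta [g]) \<otimes>\<^bsub>alg P\<^esub> cls P (W.delta w)" using gw by simp
    show ?case
      unfolding e ring_hom_mult[OF \<Delta>(2) gc] ring_hom_mult[OF is_epsD(1)[OF eps] gc] type_ring_simps
      by (rule mult[OF ring_hom_closed[OF \<Delta>(2) gc(1)] ring_hom_closed[OF \<Delta>(2) gc(2)]])
        (use l[of g] Cons letter_delta[of g] in auto)
  qed
  show ?thesis
    by (rule T.filtered_linear_unique[OF filtered_linear_comp[OF \<Delta>(1) k] phi_linear[unfolded phi_def] _ x])
      (rule w, simp only: P_carrier)
qed

end

lemma is_SD:
  assumes "is_S S"
  shows "filtered_linear P P S" "S \<in> ring_hom (alg P) (opp (alg P))"
    "i \<in> {1..N-1} \<Longrightarrow> S (gE i) = \<ominus>\<^bsub>alg P\<^esub> (gV [^]\<^bsub>alg P\<^esub> theta N i \<otimes>\<^bsub>alg P\<^esub> gE i)"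
    "i \<in> {1..N-1} \<Longrightarrow> S (gF i) = \<ominus>\<^bsub>alg P\<^esub> (gT [^]\<^bsub>alg P\<^esub> theta N i \<otimes>\<^bsub>alg P\<^esub> gF i) \<oplus>\<^bsub>alg P\<^esub>
       gT [^]\<^bsub>alg P\<^esub> (2::nat) \<otimes>\<^bsub>alg P\<^esub> gHs \<otimes>\<^bsub>alg P\<^esub> gV [^]\<^bsub>alg P\<^esub> (2::nat) \<otimes>\<^bsub>alg P\<^esub> \<lbrakk>gF i, gT\<rbrakk>\<^bsub>alg P\<^esub>"
    "i \<in> {1..N-1} \<Longrightarrow> S (gH i) = \<ominus>\<^bsub>alg P\<^esub> gH i \<oplus>\<^bsub>alg P\<^esub>
       smul P (of_nat (theta N i) / 2) ((\<one>\<^bsub>alg P\<^esub> \<ominus>\<^bsub>alg P\<^esub> gT [^]\<^bsub>alg P\<^esub> (2::nat)) \<otimes>\<^bsub>alg P\<^esub> gHs)"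
    "i \<in> {1..N-1} \<Longrightarrow> \<lbrakk>gV, S (gF i)\<rbrakk>\<^bsub>alg P\<^esub> \<otimes>\<^bsub>alg P\<^esub> gT = \<ominus>\<^bsub>alg P\<^esub> (gV \<otimes>\<^bsub>alg P\<^esub> gV \<otimes>\<^bsub>alg P\<^esub> \<lbrakk>gF i, gT\<rbrakk>\<^bsub>alg P\<^esub>)"
    "S gT = gV" "S gV = gT" "S gHs = \<ominus>\<^bsub>alg P\<^esub> (gT \<otimes>\<^bsub>alg P\<^esub> gT \<otimes>\<^bsub>alg P\<^esub> gHs)"
  using assms unfolding is_S_def by blast+

lemma S_mult: "is_S S \<Longrightarrow> x \<in> carrier (alg P) \<Longrightarrow> y \<in> carrier (alg P) \<Longrightarrow> S (x \<otimes>\<^bsub>alg P\<^esub> y) = S y \<otimes>\<^bsub>alg P\<^esub> S x"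
  and S_one: "is_S S \<Longrightarrow> S \<one>\<^bsub>alg P\<^esub> = \<one>\<^bsub>alg P\<^esub>"
  using ring_hom_mult[OF is_SD(2)] ring_hom_one[OF is_SD(2)] by simp_all

lemma pow_theta: "gT [^]\<^bsub>alg P\<^esub> (n::nat) \<otimes>\<^bsub>alg P\<^esub> gV [^]\<^bsub>alg P\<^esub> n = \<one>\<^bsub>alg P\<^esub>" "gV [^]\<^bsub>alg P\<^esub> n \<otimes>\<^bsub>alg P\<^esub> gT [^]\<^bsub>alg P\<^esub> n = \<one>\<^bsub>alg P\<^esub>"
proof -
  note g = gens_closed(4,5)
  have e: "gT \<otimes>\<^bsub>alg P\<^esub> gV = gV \<otimes>\<^bsub>alg P\<^esub> gT" using TV by simp
  show "gT [^]\<^bsub>alg P\<^esub> n \<otimes>\<^bsub>alg P\<^esub> gV [^]\<^bsub>alg P\<^esub> n = \<one>\<^bsub>alg P\<^esub>"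
    unfolding C.A.pow_mult_distrib[OF e g, symmetric] TV(1) by (rule C.A.nat_pow_one)
  show "gV [^]\<^bsub>alg P\<^esub> n \<otimes>\<^bsub>alg P\<^esub> gT [^]\<^bsub>alg P\<^esub> n = \<one>\<^bsub>alg P\<^esub>"
    unfolding C.A.pow_mult_distrib[OF e[symmetric] g(2,1), symmetric] TV(2) by (rule C.A.nat_pow_one)
qed

lemma antipode:
  assumes D: "is_Delta \<Delta>" and E: "is_eps \<epsilon>" and SS: "is_S S"
  shows "antipodal P \<Delta> \<epsilon> S"
proof -
  let ?U = "alg P" and ?UU = "alg (P \<boxtimes> P)"
  note S = is_SD[OF SS]
  note Sc = filtered_linearD(1)[OF S(1)] and Sm = S_mult[OF SS] and S1 = S_one[OF SS]
  have Sf: "S \<in> carrier ?U \<rightarrow> carrier ?U" using Sc by blast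
  interpret T: calgebra_pair "P \<boxtimes> P" P ..
  interpret S: ring_hom_ring ?U "opp ?U" S by (rule ring_hom_ringI2[OF C.A.ring_axioms ring_opp[OF C.A.ring_axioms] S(2)])
  note sc = cembD[OF C.cemb_scalar]
  note idf = ring_hom_funcset[OF id_hom]
  obtain k1 where k1: "induced P P P (\<lambda>x y. S x \<otimes>\<^bsub>?U\<^esub> y) k1"
    using PP.induced_mult[OF calgebra_P S(1) filtered_linear_id] by blast
  obtain k2 where k2: "induced P P P (\<lambda>x y. x \<otimes>\<^bsub>?U\<^esub> S y) k2"
    using PP.induced_mult[OF calgebra_P filtered_linear_id S(1)] by blast
  note fl1 = inducedD(1)[OF k1] and fl2 = inducedD(1)[OF k2]
  note L1 = T.filtered_linear_slin[OF fl1] and L2 = T.filtered_linear_slin[OF fl2]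
  have del: "\<exists>u v. u \<in> carrier ?U \<and> v \<in> carrier ?U \<and> cls (P \<boxtimes> P) (PP.PQ.delta p) = tn u v"
    if p: "p \<in> carrier (mon (P \<boxtimes> P))" for p
  proof -
    obtain u v where uv: "p = (u, v)" "u \<in> carrier (mon P)" "v \<in> carrier (mon P)" using p by (cases p) simp
    show ?thesis unfolding uv(1) PP.tens_delta[OF uv(2,3), symmetric]
      using C.cls.hom_closed[OF W.delta_closed[OF uv(2)]] C.cls.hom_closed[OF W.delta_closed[OF uv(3)]] by blast
  qed
  \<comment> \<open>On a pure tensor z this is the antimultiplicativity of S; both sides are
    continuous in z.\<close>
  have A1: "k1 (z \<otimes>\<^bsub>?UU\<^esub> tn c d) = S c \<otimes>\<^bsub>?U\<^esub> k1 z \<otimes>\<^bsub>?U\<^esub> d" if z: "z \<in> carrier ?UU" and c: "c \<in> carrier ?U" and d: "d \<in> carrier ?U" for z c d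
  proof -
    obtain f where f: "f \<in> carrier PP.PQ.Sr" "z = cls (P \<boxtimes> P) f" using z unfolding PP.PQ.cls_surj by blast
    obtain t where t: "t \<in> carrier PP.PQ.Sr" "tn c d = cls (P \<boxtimes> P) t" using PP.tens_closed[OF c d] unfolding PP.PQ.cls_surj by blast
    obtain m1 where m1: "slin (P \<boxtimes> P) P m1 (\<lambda>f. k1 (cls (P \<boxtimes> P) (f \<otimes>\<^bsub>PP.PQ.Sr\<^esub> t)))" using T.slin_rmult[OF L1 t(1)] by blast
    obtain m2 where m2: "slin (P \<boxtimes> P) P m2 (\<lambda>f. S c \<otimes>\<^bsub>?U\<^esub> k1 (cls (P \<boxtimes> P) f))" using T.slin_mult_left[OF L1 Sc[OF c]] by blast
    obtain m3 where m3: "slin (P \<boxtimes> P) P m3 (\<lambda>f. S c \<otimes>\<^bsub>?U\<^esub> k1 (cls (P \<boxtimes> P) f) \<otimes>\<^bsub>?U\<^esub> d)" using T.slin_mult_right[OF m2 d] by blast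
    have "k1 (cls (P \<boxtimes> P) (f \<otimes>\<^bsub>PP.PQ.Sr\<^esub> t)) = S c \<otimes>\<^bsub>?U\<^esub> k1 (cls (P \<boxtimes> P) f) \<otimes>\<^bsub>?U\<^esub> d"
    proof (rule T.slin_unique[OF m1 m3 _ f(1)])
      fix p assume p: "p \<in> carrier (mon (P \<boxtimes> P))"
      obtain u v where uv: "u \<in> carrier ?U" "v \<in> carrier ?U" "cls (P \<boxtimes> P) (PP.PQ.delta p) = tn u v" using del[OF p] by blast
      show "k1 (cls (P \<boxtimes> P) (PP.PQ.delta p \<otimes>\<^bsub>PP.PQ.Sr\<^esub> t)) = S c \<otimes>\<^bsub>?U\<^esub> k1 (cls (P \<boxtimes> P) (PP.PQ.delta p)) \<otimes>\<^bsub>?U\<^esub> d"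
        unfolding PP.PQ.cls.hom_mult[OF PP.PQ.delta_closed[OF p] t(1)] uv(3) t(2)[symmetric] PP.tens_mult[OF uv(1) c uv(2) d]
          inducedD(2)[OF k1 C.A.m_closed[OF uv(1) c] C.A.m_closed[OF uv(2) d]] inducedD(2)[OF k1 uv(1,2)] Sm[OF uv(1) c]
        using Sc[OF uv(1)] Sc[OF c] uv(2) d by (simp add: C.A.m_assoc)
    qed
    then show ?thesis unfolding f(2) t(2) PP.PQ.cls.hom_mult[OF f(1) t(1)] .
  qed
  have A2: "k2 (tn c d \<otimes>\<^bsub>?UU\<^esub> z) = c \<otimes>\<^bsub>?U\<^esub> k2 z \<otimes>\<^bsub>?U\<^esub> S d" if z: "z \<in> carrier ?UU" and c: "c \<in> carrier ?U" and d: "d \<in> carrier ?U" for z c d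
  proof -
    obtain f where f: "f \<in> carrier PP.PQ.Sr" "z = cls (P \<boxtimes> P) f" using z unfolding PP.PQ.cls_surj by blast
    obtain t where t: "t \<in> carrier PP.PQ.Sr" "tn c d = cls (P \<boxtimes> P) t" using PP.tens_closed[OF c d] unfolding PP.PQ.cls_surj by blast
    obtain m1 where m1: "slin (P \<boxtimes> P) P m1 (\<lambda>f. k2 (cls (P \<boxtimes> P) (t \<otimes>\<^bsub>PP.PQ.Sr\<^esub> f)))" using T.slin_lmult[OF L2 t(1)] by blast
    obtain m2 where m2: "slin (P \<boxtimes> P) P m2 (\<lambda>f. c \<otimes>\<^bsub>?U\<^esub> k2 (cls (P \<boxtimes> P) f))" using T.slin_mult_left[OF L2 c] by blast
    obtain m3 where m3: "slin (P \<boxtimes> P) P m3 (\<lambda>f. c \<otimes>\<^bsub>?U\<^esub> k2 (cls (P \<boxtimes> P) f) \<otimes>\<^bsub>?U\<^esub> S d)" using T.slin_mult_right[OF m2 Sc[OF d]] by blast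
    have "k2 (cls (P \<boxtimes> P) (t \<otimes>\<^bsub>PP.PQ.Sr\<^esub> f)) = c \<otimes>\<^bsub>?U\<^esub> k2 (cls (P \<boxtimes> P) f) \<otimes>\<^bsub>?U\<^esub> S d"
    proof (rule T.slin_unique[OF m1 m3 _ f(1)])
      fix p assume p: "p \<in> carrier (mon (P \<boxtimes> P))"
      obtain u v where uv: "u \<in> carrier ?U" "v \<in> carrier ?U" "cls (P \<boxtimes> P) (PP.PQ.delta p) = tn u v" using del[OF p] by blast
      show "k2 (cls (P \<boxtimes> P) (t \<otimes>\<^bsub>PP.PQ.Sr\<^esub> PP.PQ.delta p)) = c \<otimes>\<^bsub>?U\<^esub> k2 (cls (P \<boxtimes> P) (PP.PQ.delta p)) \<otimes>\<^bsub>?U\<^esub> S d"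
        unfolding PP.PQ.cls.hom_mult[OF t(1) PP.PQ.delta_closed[OF p]] uv(3) t(2)[symmetric] PP.tens_mult[OF c uv(1) d uv(2)]
          inducedD(2)[OF k2 C.A.m_closed[OF c uv(1)] C.A.m_closed[OF d uv(2)]] inducedD(2)[OF k2 uv(1,2)] Sm[OF d uv(2)]
        using Sc[OF uv(2)] Sc[OF d] uv(1) c by (simp add: C.A.m_assoc)
    qed
    then show ?thesis unfolding f(2) t(2) PP.PQ.cls.hom_mult[OF t(1) f(1)] .
  qed
  \<comment> \<open>On a pure tensor w = c (x) d the scalar k1 z can be pulled out of S(c) k1(z) d,
    which leaves k1 w; continuity in w extends this to all w.\<close>
  have M1: "k1 (z \<otimes>\<^bsub>?UU\<^esub> w) = scalar P (e * e')"
    if z: "z \<in> carrier ?UU" and w: "w \<in> carrier ?UU" and kz: "k1 z = scalar P e" and kw: "k1 w = scalar P e'" for z w e e'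
  proof -
    obtain f where f: "f \<in> carrier PP.PQ.Sr" "w = cls (P \<boxtimes> P) f" using w unfolding PP.PQ.cls_surj by blast
    obtain t where t: "t \<in> carrier PP.PQ.Sr" "z = cls (P \<boxtimes> P) t" using z unfolding PP.PQ.cls_surj by blast
    obtain m1 where m1: "slin (P \<boxtimes> P) P m1 (\<lambda>f. k1 (cls (P \<boxtimes> P) (t \<otimes>\<^bsub>PP.PQ.Sr\<^esub> f)))" using T.slin_lmult[OF L1 t(1)] by blast
    obtain m2 where m2: "slin (P \<boxtimes> P) P m2 (\<lambda>f. scalar P e \<otimes>\<^bsub>?U\<^esub> k1 (cls (P \<boxtimes> P) f))" using T.slin_mult_left[OF L1 sc(1)] by blast
    have "k1 (cls (P \<boxtimes> P) (t \<otimes>\<^bsub>PP.PQ.Sr\<^esub> f)) = scalar P e \<otimes>\<^bsub>?U\<^esub> k1 (cls (P \<boxtimes> P) f)"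
    proof (rule T.slin_unique[OF m1 m2 _ f(1)])
      fix p assume p: "p \<in> carrier (mon (P \<boxtimes> P))"
      obtain u v where uv: "u \<in> carrier ?U" "v \<in> carrier ?U" "cls (P \<boxtimes> P) (PP.PQ.delta p) = tn u v" using del[OF p] by blast
      show "k1 (cls (P \<boxtimes> P) (t \<otimes>\<^bsub>PP.PQ.Sr\<^esub> PP.PQ.delta p)) = scalar P e \<otimes>\<^bsub>?U\<^esub> k1 (cls (P \<boxtimes> P) (PP.PQ.delta p))"
        unfolding PP.PQ.cls.hom_mult[OF t(1) PP.PQ.delta_closed[OF p]] uv(3) t(2)[symmetric] A1[OF z uv(1,2)] kz
          inducedD(2)[OF k1 uv(1,2)] sc(5)[OF Sc[OF uv(1)], symmetric] by (rule C.A.m_assoc[OF sc(1) Sc[OF uv(1)] uv(2)])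
    qed
    then show ?thesis unfolding f(2) t(2) PP.PQ.cls.hom_mult[OF t(1) f(1)] using kw unfolding f(2) sc(3) by (simp only:)
  qed
  have M2: "k2 (w \<otimes>\<^bsub>?UU\<^esub> z) = scalar P (e' * e)"
    if w: "w \<in> carrier ?UU" and z: "z \<in> carrier ?UU" and kw: "k2 w = scalar P e'" and kz: "k2 z = scalar P e" for z w e e'
  proof -
    obtain f where f: "f \<in> carrier PP.PQ.Sr" "w = cls (P \<boxtimes> P) f" using w unfolding PP.PQ.cls_surj by blast
    obtain t where t: "t \<in> carrier PP.PQ.Sr" "z = cls (P \<boxtimes> P) t" using z unfolding PP.PQ.cls_surj by blast
    obtain m1 where m1: "slin (P \<boxtimes> P) P m1 (\<lambda>f. k2 (cls (P \<boxtimes> P) (f \<otimes>\<^bsub>PP.PQ.Sr\<^esub> t)))" using T.slin_rmult[OF L2 t(1)] by blast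
    obtain m2 where m2: "slin (P \<boxtimes> P) P m2 (\<lambda>f. k2 (cls (P \<boxtimes> P) f) \<otimes>\<^bsub>?U\<^esub> scalar P e)" using T.slin_mult_right[OF L2 sc(1)] by blast
    have "k2 (cls (P \<boxtimes> P) (f \<otimes>\<^bsub>PP.PQ.Sr\<^esub> t)) = k2 (cls (P \<boxtimes> P) f) \<otimes>\<^bsub>?U\<^esub> scalar P e"
    proof (rule T.slin_unique[OF m1 m2 _ f(1)])
      fix p assume p: "p \<in> carrier (mon (P \<boxtimes> P))"
      obtain u v where uv: "u \<in> carrier ?U" "v \<in> carrier ?U" "cls (P \<boxtimes> P) (PP.PQ.delta p) = tn u v" using del[OF p] by blast
      show "k2 (cls (P \<boxtimes> P) (PP.PQ.delta p \<otimes>\<^bsub>PP.PQ.Sr\<^esub> t)) = k2 (cls (P \<boxtimes> P) (PP.PQ.delta p)) \<otimes>\<^bsub>?U\<^esub> scalar P e"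
        unfolding PP.PQ.cls.hom_mult[OF PP.PQ.delta_closed[OF p] t(1)] uv(3) t(2)[symmetric] A2[OF z uv(1,2)] kz
          inducedD(2)[OF k2 uv(1,2)] C.A.m_assoc[OF uv(1) sc(1) Sc[OF uv(2)]] sc(5)[OF Sc[OF uv(2)]]
        by (rule C.A.m_assoc[OF uv(1) Sc[OF uv(2)] sc(1), symmetric])
    qed
    then show ?thesis unfolding f(2) t(2) PP.PQ.cls.hom_mult[OF f(1) t(1)] using kw unfolding f(2) sc(3) by (simp only:)
  qed
  have k1o: "k1 \<one>\<^bsub>?UU\<^esub> = \<one>\<^bsub>?U\<^esub>" and k2o: "k2 \<one>\<^bsub>?UU\<^esub> = \<one>\<^bsub>?U\<^esub>"
    unfolding PP.tens_one[symmetric] inducedD(2)[OF k1 C.A.one_closed C.A.one_closed] inducedD(2)[OF k2 C.A.one_closed C.A.one_closed] S1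
    by (rule C.A.l_one[OF C.A.one_closed])+
  note d1 = induced_ED[OF calgebra_P k1 S1 refl Sf idf] induced_FD[OF calgebra_P k1 S1 refl Sf idf] induced_HD[OF calgebra_P k1 S1 refl Sf idf]
  note d2 = induced_ED[OF calgebra_P k2 refl S1 idf Sf] induced_FD[OF calgebra_P k2 refl S1 idf Sf] induced_HD[OF calgebra_P k2 refl S1 idf Sf]
  note g = gens_closed(4-6)
  have cc: "gT \<otimes>\<^bsub>?U\<^esub> gT \<in> carrier ?U" "gV \<otimes>\<^bsub>?U\<^esub> gV \<in> carrier ?U" "gT \<otimes>\<^bsub>?U\<^esub> gT \<otimes>\<^bsub>?U\<^esub> gHs \<in> carrier ?U"
    "gT [^]\<^bsub>?U\<^esub> (n::nat) \<in> carrier ?U" "gV [^]\<^bsub>?U\<^esub> n \<in> carrier ?U" for n using g by simp_all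
  have Sp: "S (gT [^]\<^bsub>?U\<^esub> n) = gV [^]\<^bsub>?U\<^esub> n" "S (gV [^]\<^bsub>?U\<^esub> n) = gT [^]\<^bsub>?U\<^esub> n" for n :: nat
    unfolding S.hom_nat_pow[OF g(1)] S.hom_nat_pow[OF g(2)] S(7,8) by (rule opp_pow[OF C.A.ring_axioms g(2)], rule opp_pow[OF C.A.ring_axioms g(1)])
  have SVV: "S (\<one>\<^bsub>?U\<^esub> \<ominus>\<^bsub>?U\<^esub> gV \<otimes>\<^bsub>?U\<^esub> gV) = \<one>\<^bsub>?U\<^esub> \<ominus>\<^bsub>?U\<^esub> gT \<otimes>\<^bsub>?U\<^esub> gT"
    unfolding S.hom_minus[OF C.A.one_closed cc(2)] opp_minus Sm[OF g(2,2)] S(8) S1 ..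
  have G1: "k1 (ED i) = \<zero>\<^bsub>?U\<^esub>" if i: "i \<in> {1..N-1}" for i
    unfolding d1(1)[OF i] Sp S(3)[OF i] by (rule C.A.l_neg[OF C.A.m_closed[OF cc(5) gens_closed(1)[OF i]]])
  \<comment> \<open>T^theta F_i cancels against the leading term of S(F_i), and T^2 Hs V^2 [F_i, T]
    against S(T Hs) G_i.\<close>
  have G2: "k1 (FD i) = \<zero>\<^bsub>?U\<^esub>" if i: "i \<in> {1..N-1}" for i
    unfolding d1(2)[OF i] Sp S(4)[OF i] Sm[OF g(1,3)] S(7,9) gG_def V2 T2
    by (rule C.A.antipode_F1) (use g cc gens_closed(2)[OF i] G_closed(2)[OF i] in simp)
  have G3: "k1 (HD i) = \<zero>\<^bsub>?U\<^esub>" if i: "i \<in> {1..N-1}" for i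
    unfolding d1(3)[OF i] SVV S(5)[OF i] T2 C.A.minus_eq[of "_ \<oplus>\<^bsub>?U\<^esub> _"]
    by (rule C.A.cancel_ab[OF gens_closed(3)[OF i]], rule C.smul_closed) (use g in simp)
  have H1: "k2 (ED i) = \<zero>\<^bsub>?U\<^esub>" if i: "i \<in> {1..N-1}" for i
  proof -
    have "gT [^]\<^bsub>?U\<^esub> theta N i \<otimes>\<^bsub>?U\<^esub> (\<ominus>\<^bsub>?U\<^esub> (gV [^]\<^bsub>?U\<^esub> theta N i \<otimes>\<^bsub>?U\<^esub> gE i)) = \<ominus>\<^bsub>?U\<^esub> gE i"
      unfolding C.A.r_minus[OF cc(4) C.A.m_closed[OF cc(5) gens_closed(1)[OF i]]]
        C.A.m_assoc[OF cc(4) cc(5) gens_closed(1)[OF i], symmetric] pow_theta(1) C.A.l_one[OF gens_closed(1)[OF i]] ..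
    then show ?thesis
      unfolding d2(1)[OF i] S(3)[OF i] by (simp only: C.A.r_neg[OF gens_closed(1)[OF i]])
  qed
  have H2: "k2 (FD i) = \<zero>\<^bsub>?U\<^esub>" if i: "i \<in> {1..N-1}" for i
  proof -
    let ?L = "\<lbrakk>gF i, gT\<rbrakk>\<^bsub>?U\<^esub>"
    note F = gens_closed(2)[OF i] and Lc = G_closed(2)[OF i]
    define b where "b = gT \<otimes>\<^bsub>?U\<^esub> gHs \<otimes>\<^bsub>?U\<^esub> (gV \<otimes>\<^bsub>?U\<^esub> gV \<otimes>\<^bsub>?U\<^esub> ?L)"
    define B where "B = gT \<otimes>\<^bsub>?U\<^esub> gT \<otimes>\<^bsub>?U\<^esub> gHs \<otimes>\<^bsub>?U\<^esub> (gV \<otimes>\<^bsub>?U\<^esub> gV) \<otimes>\<^bsub>?U\<^esub> ?L"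
    have bc: "b \<in> carrier ?U" "B \<in> carrier ?U" using g Lc by (simp_all add: b_def B_def)
    have "S ?L = \<lbrakk>gV, S (gF i)\<rbrakk>\<^bsub>?U\<^esub>"
      unfolding S.hom_lie[OF F g(1)] lie_opp S(7) unfolding lie_def ..
    \<comment> \<open>S reverses products and sends T to V and V to T, so S(G_i) is [V, S(F_i)]
      T.\<close>
    then have SG: "S (gG i) = \<ominus>\<^bsub>?U\<^esub> (gV \<otimes>\<^bsub>?U\<^esub> gV \<otimes>\<^bsub>?U\<^esub> ?L)"
      unfolding gG_def Sm[OF g(2) Lc] S(8) using S(6)[OF i] by (simp only:)
    \<comment> \<open>At the end nodes V T^2 = T; at interior nodes both sides vanish with
      [F_i, T].\<close>
    have vB: "gV [^]\<^bsub>?U\<^esub> theta N i \<otimes>\<^bsub>?U\<^esub> B = b"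
      using theta_cases[OF i]
    proof
      assume t: "theta N i = 1"
      have "gV \<otimes>\<^bsub>?U\<^esub> B = (gV \<otimes>\<^bsub>?U\<^esub> (gT \<otimes>\<^bsub>?U\<^esub> gT)) \<otimes>\<^bsub>?U\<^esub> gHs \<otimes>\<^bsub>?U\<^esub> (gV \<otimes>\<^bsub>?U\<^esub> gV \<otimes>\<^bsub>?U\<^esub> ?L)"
        using g Lc by (simp add: B_def C.A.m_assoc)
      then show ?thesis unfolding t C.A.nat_pow_eone[OF g(2)] VTT b_def .
    next
      assume t: "theta N i = 0 \<and> ?L = \<zero>\<^bsub>?U\<^esub>"
      then have "?L = \<zero>\<^bsub>?U\<^esub>" ..
      then have "B = \<zero>\<^bsub>?U\<^esub>" "b = \<zero>\<^bsub>?U\<^esub>" using g unfolding B_def b_def by simp_all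
      then show ?thesis using cc(5) by simp
    qed
    have vF: "gV [^]\<^bsub>?U\<^esub> theta N i \<otimes>\<^bsub>?U\<^esub> (\<ominus>\<^bsub>?U\<^esub> (gT [^]\<^bsub>?U\<^esub> theta N i \<otimes>\<^bsub>?U\<^esub> gF i)) = \<ominus>\<^bsub>?U\<^esub> gF i"
      unfolding C.A.r_minus[OF cc(5) C.A.m_closed[OF cc(4) F]]
        C.A.m_assoc[OF cc(5) cc(4) F, symmetric] pow_theta(2) C.A.l_one[OF F] ..
    have "gV [^]\<^bsub>?U\<^esub> theta N i \<otimes>\<^bsub>?U\<^esub> S (gF i) = \<ominus>\<^bsub>?U\<^esub> gF i \<oplus>\<^bsub>?U\<^esub> b"
      unfolding S(4)[OF i] V2 T2 B_def[symmetric]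
        C.A.r_distr[OF C.A.a_inv_closed[OF C.A.m_closed[OF cc(4) F]] bc(2) cc(5)] vF vB ..
    moreover have "gT \<otimes>\<^bsub>?U\<^esub> gHs \<otimes>\<^bsub>?U\<^esub> S (gG i) = \<ominus>\<^bsub>?U\<^esub> b"
      unfolding SG b_def by (rule C.A.r_minus) (use g Lc in simp_all)
    ultimately show ?thesis
      unfolding d2(2)[OF i] by (simp only: C.A.cancel_ba[OF F bc(1)])
  qed
  have H3: "k2 (HD i) = \<zero>\<^bsub>?U\<^esub>" if i: "i \<in> {1..N-1}" for i
  proof -
    have "(\<one>\<^bsub>?U\<^esub> \<ominus>\<^bsub>?U\<^esub> gV \<otimes>\<^bsub>?U\<^esub> gV) \<otimes>\<^bsub>?U\<^esub> (\<ominus>\<^bsub>?U\<^esub> (gT \<otimes>\<^bsub>?U\<^esub> gT \<otimes>\<^bsub>?U\<^esub> gHs)) = (\<one>\<^bsub>?U\<^esub> \<ominus>\<^bsub>?U\<^esub> gT \<otimes>\<^bsub>?U\<^esub> gT) \<otimes>\<^bsub>?U\<^esub> gHs"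
    proof -
      have "gV \<otimes>\<^bsub>?U\<^esub> gV \<otimes>\<^bsub>?U\<^esub> (gT \<otimes>\<^bsub>?U\<^esub> gT \<otimes>\<^bsub>?U\<^esub> gHs) = gV \<otimes>\<^bsub>?U\<^esub> (gV \<otimes>\<^bsub>?U\<^esub> (gT \<otimes>\<^bsub>?U\<^esub> gT)) \<otimes>\<^bsub>?U\<^esub> gHs"
        using g by (simp add: C.A.m_assoc)
      also have "\<dots> = gHs" unfolding VTT TV using g by simp
      finally have e: "gV \<otimes>\<^bsub>?U\<^esub> gV \<otimes>\<^bsub>?U\<^esub> (gT \<otimes>\<^bsub>?U\<^esub> gT \<otimes>\<^bsub>?U\<^esub> gHs) = gHs" .
      show ?thesis
        unfolding C.A.minus_eq C.A.l_distr[OF C.A.one_closed C.A.a_inv_closed[OF cc(2)] C.A.a_inv_closed[OF cc(3)]]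
          C.A.l_distr[OF C.A.one_closed C.A.a_inv_closed[OF cc(1)] g(3)] C.A.l_minus[OF cc(1) g(3)]
          C.A.l_minus[OF cc(2) C.A.a_inv_closed[OF cc(3)]] C.A.r_minus[OF cc(2,3)] e
          C.A.minus_minus[OF g(3)] C.A.l_one[OF g(3)] C.A.l_one[OF C.A.a_inv_closed[OF cc(3)]]
        by (rule C.A.a_comm[OF C.A.a_inv_closed[OF cc(3)] g(3)])
    qed
    note e = this
    show ?thesis
      unfolding d2(3)[OF i] S(9) e S(5)[OF i] T2 C.A.minus_eq[of "_ \<oplus>\<^bsub>?U\<^esub> _"]
      by (rule C.A.cancel_ba[OF gens_closed(3)[OF i]], rule C.smul_closed) (use g in simp)
  qed
  have 1: "k1 (\<Delta> x) = scalar P (\<epsilon> x)" and 2: "k2 (\<Delta> x) = scalar P (\<epsilon> x)" if x: "x \<in> carrier ?U" for x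
    by (rule scalar_eps_multiplicative[OF E D fl1 k1o M1 G1 G2 G3 x]; assumption)
      (rule scalar_eps_multiplicative[OF E D fl2 k2o M2 H1 H2 H3 x]; assumption)
  show ?thesis
    unfolding antipodal_def by (intro exI[of _ k1] exI[of _ k2] conjI ballI k1 k2 1 2)
qed

end

theorem proposition9:
  fixes N :: nat and h :: complex
    and P :: "letter list calg"
    and U :: "letter list series set ring" (structure)
    and UU :: "(letter list \<times> letter list) series set ring"
    and E F H :: "nat \<Rightarrow> letter list series set"
    and T T' Hs :: "letter list series set"
    and tensor (infixr \<open>\<otimes>\<otimes>\<close> 72)
  assumes "N \<ge> 3"
  defines "P \<equiv> jordanian N h"
  defines "U \<equiv> alg P" and "UU \<equiv> alg (P \<boxtimes> P)"
  defines "tensor \<equiv> tens P P"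
  defines "E \<equiv> \<lambda>i. cls P (letter_series (GE i))"
    and "F \<equiv> \<lambda>i. cls P (letter_series (GF i))"
    and "H \<equiv> \<lambda>i. cls P (letter_series (GH i))"
    and "T \<equiv> cls P (T_series N h (1/2))"
    and "T' \<equiv> cls P (T_series N h (-1/2))"
  defines "Hs \<equiv> (\<Oplus>k\<in>{1..N - 1}. H k)"
  shows "\<exists>\<Delta> S \<epsilon>. hopf_structure P \<Delta> S \<epsilon> \<and>
    (\<forall>i\<in>{1..N - 1}.
       \<Delta> (E i) = E i \<otimes>\<otimes> \<one> \<oplus>\<^bsub>UU\<^esub> (T [^] theta N i) \<otimes>\<otimes> E i \<and>
       \<Delta> (F i) = F i \<otimes>\<otimes> \<one> \<oplus>\<^bsub>UU\<^esub> (T' [^] theta N i) \<otimes>\<otimes> F i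
                    \<oplus>\<^bsub>UU\<^esub> (T \<otimes> Hs) \<otimes>\<otimes> (T' \<otimes> \<lbrakk>F i, T\<rbrakk>) \<and>
       \<Delta> (H i) = H i \<otimes>\<otimes> \<one> \<oplus>\<^bsub>UU\<^esub> \<one> \<otimes>\<otimes> H i
                    \<ominus>\<^bsub>UU\<^esub> smul (P \<boxtimes> P) (of_nat (theta N i) / 2) ((\<one> \<ominus> T' [^] (2::nat)) \<otimes>\<otimes> Hs) \<and>
       S (E i) = \<ominus> (T' [^] theta N i \<otimes> E i) \<and>
       S (F i) = \<ominus> (T [^] theta N i \<otimes> F i)
                    \<oplus> T [^] (2::nat) \<otimes> Hs \<otimes> T' [^] (2::nat) \<otimes> \<lbrakk>F i, T\<rbrakk> \<and>
       S (H i) = \<ominus> H i \<oplus> smul P (of_nat (theta N i) / 2) ((\<one> \<ominus> T [^] (2::nat)) \<otimes> Hs) \<and>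
       \<epsilon> (E i) = 0 \<and> \<epsilon> (F i) = 0 \<and> \<epsilon> (H i) = 0)"
proof -
  interpret J: jord_base N h P
    using assms(1) by unfold_locales (simp_all add: P_def)
  interpret J: jord N h P
    by (intro jord.intro J.calgebra_P J.jord_base_axioms)
  obtain \<Delta> where D: "J.is_Delta \<Delta>" using J.Delta_exists by blast
  obtain S where S: "J.is_S S" using J.S_exists by blast
  obtain \<epsilon> where E: "J.is_eps \<epsilon>" using J.eps_exists by blast
  note \<Delta> = J.is_DeltaD[OF D] and S' = J.is_SD[OF S] and \<epsilon> = J.is_epsD[OF E]
  have hopf: "hopf_structure P \<Delta> S \<epsilon>"
    unfolding hopf_structure_def
    by (intro conjI ballI allI \<Delta>(1,2) \<epsilon>(1-3) S'(1) J.S_one[OF S] J.S_mult[OF S] J.coassoc[OF D] J.counit[OF E D] J.antipode[OF D E S])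
  have g: "E = J.gE" "F = J.gF" "H = J.gH" "T = J.gT" "T' = J.gV"
    by (simp_all add: E_def F_def H_def T_def T'_def fun_eq_iff J.gE_def J.gF_def J.gH_def J.gT_def J.gV_def)
  have Hs: "Hs = J.gHs" unfolding Hs_def J.gHs_def g U_def ..
  show ?thesis
    unfolding g Hs unfolding U_def UU_def tensor_def J.gG_def[symmetric]
    by (rule exI[of _ \<Delta>], rule exI[of _ S], rule exI[of _ \<epsilon>], intro conjI ballI hopf)
      (simp_all only: \<Delta> S' \<epsilon> J.ED_def J.FD_def J.HD_def)
qed

end
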